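(* Let $\{F_\ell\}_{\ell\in\mathbb N}$ be a nest, let $\mu_n$ ($n\in\mathbb N$) and $\mu$ be smooth measures belonging to $\mathcal S(\{F_\ell\})$, and let $\mathsf A^n$ and $\mathsf A$ be the PCAFs associated with $\mu_n$ and $\mu$ respectively. Assume the following two conditions. (A1) For every $\ell\in\mathbb N$, every $t>0$ and every compact set $K\subset E$, $$\lim_{n\to\infty}\ \sup_{0\le s\le t}\int_K\Big|\mathbb E_x\big[(1_{F_\ell}\mathsf A^n)_s\big]-\mathbb E_x\big[(1_{F_\ell}\mathsf A)_s\big]\Big|\,m(dx)=0 .$$ (A2) For every $\alpha>0$, every $\ell\in\mathbb N$ and every compact set $K\subset E$, $$\lim_{t\to\infty}\ \sup_{n\in\mathbb N}\int_K\Big(\mathbb E_x\Big[\int_t^\infty e^{-\alpha s}\,d(1_{F_\ell}\mathsf A^n)_s\Big]\vee\mathbb E_x\Big[\int_t^\infty e^{-\alpha s}\,d(1_{F_\ell}\mathsf A)_s\Big]\Big)m(dx)=0 .$$ Then $$\lim_{n\to\infty}\int_{F_\ell}R_\alpha f(x)\,\mu_n(dx)=\int_{F_\ell}R_\alpha f(x)\,\mu(dx)\qquad\text{for every }\alpha>0,\ \ell\in\mathbb N\text{ and } f\in\mathcal B_{b,0}(E),$$ where $\mathcal B_{b,0}(E)$ is the set of all bounded Borel functions $f$ on $E$ such that the support of the (signed) measure $f\,m$ is compact. Suppose, in addition, that for each $\ell\in\mathbb N$ $$M_\ell:=\sup_{x\in F_\ell}\Big(\sup_{n}\mathbb E_x\Big[\int_0^\infty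 e^{-t}\,d(1_{F_\ell}\mathsf A^n)_t\Big]\vee\mathbb E_x\Big[\int_0^\infty e^{-t}\,d(1_{F_\ell}\mathsf A)_t\Big]\Big)<\infty .$$ Then $\{\mu_n\}$ converges weakly to $\mu$ on the nest $\{F_\ell\}$.
   Context: Standing setting. $E$ is a locally compact separable metric space, $m$ a positive Radon measure on $E$ with full topological support, $E_\partial=E\cup\{\partial\}$ the one-point compactification; functions on $E$ are extended by $f(\partial)=0$. $\mathbb M=(X_t,\mathbb P_x)$ is an $m$-symmetric Hunt process on $E$ with lifetime $\zeta=\inf\{t\ge0:X_t=\partial\}$, transition semigroup $p_tf(x)=\mathbb E_x[f(X_t)]$ and resolvent $R_\alpha f(x)=\mathbb E_x[\int_0^\infty e^{-\alpha t}f(X_t)\,dt]$. Its Dirichlet form on $L^2(E;m)$ is $(\mathcal E,\mathcal F)$, assumed regular; $\mathcal E_\alpha(u,v)=\mathcal E(u,v)+\alpha\int_E uv\,dm$. $C_0(E)$ is the set of continuous functions on $E$ with compact support. Capacity: for open $O$, $\mathrm{Cap}(O)=\inf\{\mathcal E_1(u,u):u\in\mathcal F,\ u\ge1\ m\text{-a.e. on }O\}$ ($\inf\emptyset=\infty$), and $\mathrm{Cap}(A)=\inf\{\mathrm{Cap}(O):O\supset A \text{ open}\}$. "q.e." means outside a set of zero capacity. A positive Borel measure $\mu$ on $E$ is smooth if it charges no set of zero capacity and there is an increasing sequence of closed sets $\{G_\ell\}$ with $\mathrm{Cap}(K\setminus G_\ell)\to0$ for every compact $K$ and $\mu(G_\ell)<\infty$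 for each $\ell$. $\mathcal S$ is the class of smooth measures. $\mathcal S_0$ is the set of positive Radon measures $\mu$ for which there is $C>0$ with $\int_E|v|\,d\mu\le C\sqrt{\mathcal E_1(v,v)}$ for all $v\in\mathcal F\cap C_0(E)$. A nest is an increasing sequence $\{F_\ell\}$ of compact subsets of $E$ with $\mathrm{Cap}(K\setminus F_\ell)\to0$ as $\ell\to\infty$ for every compact $K\subset E$. For a nest, $\mathcal S(\{F_\ell\})$ is the set of smooth measures $\mu$ such that $1_{F_\ell}\mu\in\mathcal S_0$ for every $\ell$. PCAF: a function $\mathsf A:\Omega\times[0,\infty)\to[0,\infty]$, with $\mathsf A_t$ being $\mathcal F_t$-measurable (w.r.t. the minimal augmented filtration), such that there are an event $\Lambda$ in the terminal $\sigma$-field $\mathcal F_\infty$ of that filtration and an exceptional (zero capacity) set $N$ with $\mathbb P_x(\Lambda)=1$ for $x\in E\setminus N$, $\theta_t\Lambda\subset\Lambda$ for $t>0$, and for $\omega\in\Lambda$: $\mathsf A_0=0$, $\mathsf A_t<\infty$ for $t<\zeta$, $\mathsf A_t=\mathsf A_\zeta$ for $t\ge\zeta$, $\mathsf A_{t+s}(\omega)=\mathsf A_s(\omega)+\mathsf A_t(\theta_s\omega)$, and $t\mapsto\mathsf A_t(\omega)$ continuous. Two PCAFs are equivalent if for each $t>0$ they agree $\mathbb P_x$-a.s. for q.e. $x$. The Revuz correspondence is the one-to-one correspondence between $\mathcal S$ and equivalence classes of PCAFs given by $\mathbb E_{hm}[\int_0^tf(X_s)\,d\mathsf A_s]=\int_E(\int_0^tp_sh(x)\,ds)f(x)\,\mu(dx)$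 for all nonnegative Borel $f,h$ and $t\ge0$; $\mathsf A$ is then the PCAF associated with $\mu$. For a Borel set $B$, $(1_B\mathsf A)_t=\int_0^t1_B(X_s)\,d\mathsf A_s$. Weak convergence on a nest: a sequence $\{\mu_n\}$ of smooth measures converges to a measure $\mu$ weakly on the nest $\{F_\ell\}$ if $\{\mu_n\}\subset\mathcal S(\{F_\ell\})$ and $\lim_n\int_{F_\ell}f\,d\mu_n=\int_{F_\ell}f\,d\mu$ for every $\ell\in\mathbb N$ and every $f\in C(\{F_\ell\})$, where $C(\{F_\ell\})$ is the set of extended real-valued functions $f$ defined q.e. on $E$ whose restriction to $F_\ell$ is finite and continuous for each $\ell$. *)

theory Defs
  imports "HOL-Probability.Probability"
begin

text \<open>
  The state space \<open>E\<close> is the whole type \<open>'a\<close>, a separable (i.e. second countable) metric space;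
  local compactness is assumed in the statement.  Points of the one-point compactification are of
  type \<open>'a option\<close>, the cemetery being \<open>None\<close> (an isolated point when \<open>E\<close> is compact).
\<close>

section \<open>Measures on the state space\<close>

definition radon_measure :: "'a::{metric_space, second_countable_topology} measure \<Rightarrow> bool" where
  "radon_measure \<mu> \<longleftrightarrow> sets \<mu> = sets borel \<and> (\<forall>K. compact K \<longrightarrow> emeasure \<mu> K < \<infinity>)"

definition full_support :: "'a::{metric_space, second_countable_topology} measure \<Rightarrow> bool" where
  "full_support m \<longleftrightarrow> (\<forall>U. open U \<and> U \<noteq> {} \<longrightarrow> emeasure m U > 0)"

definition cpt_top :: "'a::{metric_space, second_countable_topology} option topology" where
  "cpt_top = Alexandroff_compactification euclidean"

definition borel_cpt :: "'a::{metric_space, second_countable_topology} option measure" where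
  "borel_cpt = sigma UNIV {U. openin cpt_top U}"

definition ext0 :: "('a \<Rightarrow> 'b::zero) \<Rightarrow> 'a option \<Rightarrow> 'b" where
  "ext0 f y = (case y of None \<Rightarrow> 0 | Some x \<Rightarrow> f x)"

definition C0 :: "('a::{metric_space, second_countable_topology} \<Rightarrow> real) set" where
  "C0 = {f. continuous_on UNIV f \<and> compact (closure {x. f x \<noteq> 0})}"

section \<open>Hunt processes\<close>

text \<open>
  The times \<open>t\<close> in \<open>coord M t\<close>, \<open>shift M t\<close> are meant to be nonnegative; negative ones are never
  used.  As usual \<open>X\<^sub>\<infinity> = \<partial>\<close> is left implicit.  The laws live on the sigma-field generated by all
  \<open>X\<^sub>t\<close>, no larger one is needed.
\<close>

record ('a, 'w) process =
  outcomes :: "'w set"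
  coord :: "real \<Rightarrow> 'w \<Rightarrow> 'a option"
  shift :: "real \<Rightarrow> 'w \<Rightarrow> 'w"
  law :: "'a option \<Rightarrow> 'w measure"

text \<open>
  Filtrations are indexed by \<open>t \<in> [0,\<infinity>]\<close>; \<open>t = \<infinity>\<close> gives the terminal sigma-field.
\<close>

definition natural_filt ::
  "('a::{metric_space, second_countable_topology}, 'w) process \<Rightarrow> ennreal \<Rightarrow> 'w measure" where
  "natural_filt M t = sigma (outcomes M)
     {coord M s -` B \<inter> outcomes M | s B. 0 \<le> s \<and> ennreal s \<le> t \<and> B \<in> sets borel_cpt}"

definition law_from ::
  "('a::{metric_space, second_countable_topology}, 'w) process \<Rightarrow> 'a option measure \<Rightarrow> 'w measure" where
  "law_from M \<nu> = bind \<nu> (law M)"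

text \<open>
  The minimal augmented filtration: the intersection, over all initial distributions \<open>\<nu>\<close>, of the
  natural filtration augmented by the null sets of the completion of \<open>\<P>\<^sub>\<nu>\<close>.
\<close>

definition filt ::
  "('a::{metric_space, second_countable_topology}, 'w) process \<Rightarrow> ennreal \<Rightarrow> 'w measure" where
  "filt M t = sigma (outcomes M)
     {A. A \<subseteq> outcomes M \<and>
         (\<forall>\<nu> \<in> space (prob_algebra borel_cpt). \<exists>B \<in> sets (natural_filt M t).
            (A - B) \<union> (B - A) \<in> null_sets (completion (law_from M \<nu>)))}"

definition lifetime ::
  "('a::{metric_space, second_countable_topology}, 'w) process \<Rightarrow> 'w \<Rightarrow> ennreal" where
  "lifetime M \<omega> = Inf {ennreal t | t. 0 \<le> t \<and> coord M t \<omega> = None}"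

definition markov_family ::
  "('a::{metric_space, second_countable_topology}, 'w) process \<Rightarrow> bool" where
  "markov_family M \<longleftrightarrow>
     law M \<in> borel_cpt \<rightarrow>\<^sub>M prob_algebra (natural_filt M \<infinity>) \<and>
     (\<forall>x. AE \<omega> in law M x. coord M 0 \<omega> = x) \<and>
     (\<forall>\<omega> \<in> outcomes M.
        (\<forall>s t. 0 \<le> s \<and> s \<le> t \<and> coord M s \<omega> = None \<longrightarrow> coord M t \<omega> = None) \<and>
        (\<forall>t\<ge>0. limitin cpt_top (\<lambda>s. coord M s \<omega>) (coord M t \<omega>) (at_right t)) \<and>
        (\<forall>t>0. \<exists>l. limitin cpt_top (\<lambda>s. coord M s \<omega>) l (at_left t)) \<and>
        (\<forall>t\<ge>0. shift M t \<omega> \<in> outcomes M \<and>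
           (\<forall>s\<ge>0. coord M s (shift M t \<omega>) = coord M (s + t) \<omega>)))"

text \<open>
  Strong Markov property:
  \<open>\<P>\<^sub>\<nu>(X\<^bsub>\<tau>+s\<^esub> \<in> B | \<F>\<^sub>\<tau>) = \<P>\<^bsub>X\<^sub>\<tau>\<^esub>(X\<^sub>s \<in> B)\<close>, with the conditional probability
  spelled out on the events \<open>A \<in> \<F>\<^sub>\<tau>\<close>, \<open>A \<subseteq> {\<tau> < \<infinity>}\<close>.  Deterministic \<open>\<tau>\<close> give the Markov property.
\<close>

definition strong_markov ::
  "('a::{metric_space, second_countable_topology}, 'w) process \<Rightarrow> bool" where
  "strong_markov M \<longleftrightarrow>
     (\<forall>t<\<infinity>. sets (filt M t) = (\<Inter>s\<in>{t<..}. sets (filt M s))) \<and>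
     (\<forall>\<nu> \<in> space (prob_algebra borel_cpt). \<forall>\<tau>. stopping_time (filt M) \<tau> \<longrightarrow>
        (\<forall>s\<ge>0. \<forall>B \<in> sets borel_cpt.
         \<forall>A \<in> sets (filtration.pre_sigma (outcomes M) (filt M) \<tau>). A \<subseteq> {\<omega>. \<tau> \<omega> < \<infinity>} \<longrightarrow>
           emeasure (completion (law_from M \<nu>)) {\<omega> \<in> A. coord M (enn2real (\<tau> \<omega>) + s) \<omega> \<in> B} =
           (\<integral>\<^sup>+\<omega>\<in>A. emeasure (law M (coord M (enn2real (\<tau> \<omega>)) \<omega>))
                          {\<omega>' \<in> outcomes M. coord M s \<omega>' \<in> B} \<partial>completion (law_from M \<nu>))))"

definition quasi_left_continuous ::
  "('a::{metric_space, second_countable_topology}, 'w) process \<Rightarrow> bool" where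
  "quasi_left_continuous M \<longleftrightarrow>
     (\<forall>\<nu> \<in> space (prob_algebra borel_cpt). \<forall>\<tau> :: nat \<Rightarrow> 'w \<Rightarrow> ennreal.
        (\<forall>n. stopping_time (filt M) (\<tau> n)) \<and> (\<forall>\<omega> \<in> outcomes M. incseq (\<lambda>n. \<tau> n \<omega>)) \<longrightarrow>
        (AE \<omega> in law_from M \<nu>. (SUP n. \<tau> n \<omega>) < \<infinity> \<longrightarrow>
           limitin cpt_top (\<lambda>n. coord M (enn2real (\<tau> n \<omega>)) \<omega>)
             (coord M (enn2real (SUP n. \<tau> n \<omega>)) \<omega>) sequentially))"

definition hunt_process ::
  "('a::{metric_space, second_countable_topology}, 'w) process \<Rightarrow> bool" where
  "hunt_process M \<longleftrightarrow> markov_family M \<and> strong_markov M \<and> quasi_left_continuous M"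

text \<open>
  Expectation \<open>\<E>\<^sub>x\<close> of a \<open>[0,\<infinity>]\<close>-valued functional.  Additive functionals are only measurable with
  respect to completions; this is harmless here and for the integrals with respect to \<open>m\<close> below,
  because \<open>nn_integral\<close> takes the same value for a measure and its completion
  (\<open>nn_integral_completion\<close>).
\<close>

definition expect ::
  "('a::{metric_space, second_countable_topology}, 'w) process \<Rightarrow> 'a \<Rightarrow> ('w \<Rightarrow> ennreal) \<Rightarrow> ennreal" where
  "expect M x Y = (\<integral>\<^sup>+\<omega>. Y \<omega> \<partial>law M (Some x))"

definition semigroup_nn ::
  "('a::{metric_space, second_countable_topology}, 'w) process \<Rightarrow> real \<Rightarrow> ('a \<Rightarrow> ennreal) \<Rightarrow> 'a \<Rightarrow> ennreal" where
  "semigroup_nn M t f x = expect M x (\<lambda>\<omega>. ext0 f (coord M t \<omega>))"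

definition transition ::
  "('a::{metric_space, second_countable_topology}, 'w) process \<Rightarrow> real \<Rightarrow> ('a \<Rightarrow> real) \<Rightarrow> 'a \<Rightarrow> real" where
  "transition M t f x = (\<integral>\<omega>. ext0 f (coord M t \<omega>) \<partial>law M (Some x))"

definition resolvent ::
  "('a::{metric_space, second_countable_topology}, 'w) process \<Rightarrow> real \<Rightarrow> ('a \<Rightarrow> real) \<Rightarrow> 'a \<Rightarrow> real" where
  "resolvent M \<alpha> f x =
     (\<integral>\<omega>. (LINT t:{0..}|lborel. exp (- \<alpha> * t) * ext0 f (coord M t \<omega>)) \<partial>law M (Some x))"

definition symmetric_process ::
  "('a::{metric_space, second_countable_topology}, 'w) process \<Rightarrow> 'a measure \<Rightarrow> bool" where
  "symmetric_process M m \<longleftrightarrow>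
     (\<forall>t\<ge>0. \<forall>f \<in> borel_measurable borel. \<forall>g \<in> borel_measurable borel.
        (\<integral>\<^sup>+x. semigroup_nn M t f x * g x \<partial>m) = (\<integral>\<^sup>+x. f x * semigroup_nn M t g x \<partial>m))"

section \<open>The Dirichlet form and its capacity\<close>

text \<open>
  \<open>\<E>(u,v) = lim\<^bsub>t\<rightarrow>0\<^esub> t\<inverse> (u - p\<^sub>t u, v)\<close>, and \<open>\<F>\<close> consists of the \<open>u \<in> L\<^sup>2(E;m)\<close> for which this limit
  exists (and is finite) with \<open>v = u\<close>.  Elements of \<open>L\<^sup>2\<close> are given by Borel representatives.
\<close>

definition approx_form ::
  "('a::{metric_space, second_countable_topology}, 'w) process \<Rightarrow> 'a measure \<Rightarrow> real \<Rightarrow>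
   ('a \<Rightarrow> real) \<Rightarrow> ('a \<Rightarrow> real) \<Rightarrow> real" where
  "approx_form M m t u v = (\<integral>x. (u x - transition M t u x) * v x \<partial>m) / t"

definition dirichlet_form ::
  "('a::{metric_space, second_countable_topology}, 'w) process \<Rightarrow> 'a measure \<Rightarrow>
   ('a \<Rightarrow> real) \<Rightarrow> ('a \<Rightarrow> real) \<Rightarrow> real" where
  "dirichlet_form M m u v = Lim (at_right 0) (\<lambda>t. approx_form M m t u v)"

definition form_domain ::
  "('a::{metric_space, second_countable_topology}, 'w) process \<Rightarrow> 'a measure \<Rightarrow> ('a \<Rightarrow> real) set" where
  "form_domain M m = {u \<in> borel_measurable borel. integrable m (\<lambda>x. (u x)\<^sup>2) \<and>
     (\<exists>c. ((\<lambda>t. approx_form M m t u u) \<longlongrightarrow> c) (at_right 0))}"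

definition dirichlet_form_alpha ::
  "('a::{metric_space, second_countable_topology}, 'w) process \<Rightarrow> 'a measure \<Rightarrow> real \<Rightarrow>
   ('a \<Rightarrow> real) \<Rightarrow> ('a \<Rightarrow> real) \<Rightarrow> real" where
  "dirichlet_form_alpha M m \<alpha> u v = dirichlet_form M m u v + \<alpha> * (\<integral>x. u x * v x \<partial>m)"

definition regular_form ::
  "('a::{metric_space, second_countable_topology}, 'w) process \<Rightarrow> 'a measure \<Rightarrow> bool" where
  "regular_form M m \<longleftrightarrow>
     (\<forall>u \<in> form_domain M m. \<forall>\<epsilon>>0. \<exists>v \<in> form_domain M m \<inter> C0.
        dirichlet_form_alpha M m 1 (\<lambda>x. u x - v x) (\<lambda>x. u x - v x) < \<epsilon>) \<and>
     (\<forall>f \<in> C0. \<forall>\<epsilon>>0. \<exists>v \<in> form_domain M m \<inter> C0. \<forall>x. \<bar>f x - v x\<bar> < \<epsilon>)"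

definition cap_open ::
  "('a::{metric_space, second_countable_topology}, 'w) process \<Rightarrow> 'a measure \<Rightarrow> 'a set \<Rightarrow> ennreal" where
  "cap_open M m U = (INF u \<in> {u \<in> form_domain M m. AE x in m. x \<in> U \<longrightarrow> 1 \<le> u x}.
                       ennreal (dirichlet_form_alpha M m 1 u u))"

definition cap ::
  "('a::{metric_space, second_countable_topology}, 'w) process \<Rightarrow> 'a measure \<Rightarrow> 'a set \<Rightarrow> ennreal" where
  "cap M m A = (INF U \<in> {U. open U \<and> A \<subseteq> U}. cap_open M m U)"

section \<open>Smooth measures and nests\<close>

definition smooth_measure ::
  "('a::{metric_space, second_countable_topology}, 'w) process \<Rightarrow> 'a measure \<Rightarrow> 'a measure \<Rightarrow> bool" where
  "smooth_measure M m \<mu> \<longleftrightarrow> sets \<mu> = sets borel \<and>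
     (\<forall>B \<in> sets borel. cap M m B = 0 \<longrightarrow> emeasure \<mu> B = 0) \<and>
     (\<exists>G :: nat \<Rightarrow> 'a set. (\<forall>l. closed (G l)) \<and> incseq G \<and>
        (\<forall>K. compact K \<longrightarrow> (\<lambda>l. cap M m (K - G l)) \<longlonglongrightarrow> 0) \<and>
        (\<forall>l. emeasure \<mu> (G l) < \<infinity>))"

definition S0_measures ::
  "('a::{metric_space, second_countable_topology}, 'w) process \<Rightarrow> 'a measure \<Rightarrow> 'a measure set" where
  "S0_measures M m = {\<mu>. radon_measure \<mu> \<and>
     (\<exists>C>0. \<forall>v \<in> form_domain M m \<inter> C0.
        (\<integral>\<^sup>+x. ennreal \<bar>v x\<bar> \<partial>\<mu>) \<le> ennreal (C * sqrt (dirichlet_form_alpha M m 1 v v)))}"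

definition nest ::
  "('a::{metric_space, second_countable_topology}, 'w) process \<Rightarrow> 'a measure \<Rightarrow> (nat \<Rightarrow> 'a set) \<Rightarrow> bool" where
  "nest M m F \<longleftrightarrow> (\<forall>l. compact (F l)) \<and> incseq F \<and>
     (\<forall>K. compact K \<longrightarrow> (\<lambda>l. cap M m (K - F l)) \<longlonglongrightarrow> 0)"

definition S_nest ::
  "('a::{metric_space, second_countable_topology}, 'w) process \<Rightarrow> 'a measure \<Rightarrow> (nat \<Rightarrow> 'a set) \<Rightarrow>
   'a measure set" where
  "S_nest M m F = {\<mu>. smooth_measure M m \<mu> \<and>
     (\<forall>l. density \<mu> (indicator (F l)) \<in> S0_measures M m)}"

section \<open>Positive continuous additive functionals\<close>

definition pcaf ::
  "('a::{metric_space, second_countable_topology}, 'w) process \<Rightarrow> 'a measure \<Rightarrow>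
   (real \<Rightarrow> 'w \<Rightarrow> ennreal) \<Rightarrow> bool" where
  "pcaf M m A \<longleftrightarrow>
     (\<forall>t\<ge>0. A t \<in> borel_measurable (filt M (ennreal t))) \<and>
     (\<exists>\<Lambda> \<in> sets (filt M \<infinity>). \<exists>N. cap M m N = 0 \<and>
        (\<forall>x. x \<notin> N \<longrightarrow> (AE \<omega> in law M (Some x). \<omega> \<in> \<Lambda>)) \<and>
        (\<forall>t>0. shift M t ` \<Lambda> \<subseteq> \<Lambda>) \<and>
        (\<forall>\<omega> \<in> \<Lambda>.
           A 0 \<omega> = 0 \<and>
           (\<forall>t\<ge>0. ennreal t < lifetime M \<omega> \<longrightarrow> A t \<omega> < \<infinity>) \<and>
           (\<forall>t\<ge>0. ennreal t \<ge> lifetime M \<omega> \<longrightarrow> A t \<omega> = A (enn2real (lifetime M \<omega>)) \<omega>) \<and>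
           (\<forall>s\<ge>0. \<forall>t\<ge>0. A (t + s) \<omega> = A s \<omega> + A t (shift M s \<omega>)) \<and>
           continuous_on {0..} (\<lambda>t. A t \<omega>)))"

text \<open>
  The Lebesgue-Stieltjes measure \<open>da\<close> on \<open>[0,\<infinity>)\<close> of a continuous nondecreasing path
  \<open>a : [0,\<infinity>) \<rightarrow> [0,\<infinity>]\<close> with \<open>a\<^sub>0 = 0\<close>.  As \<open>interval_measure\<close> needs a finite path and \<open>a\<close> may explode
  (at the lifetime), it is the limit of the measures of the paths \<open>a \<and> k\<close>, each of which is \<open>da\<close>
  restricted to \<open>{s. a\<^sub>s \<le> k}\<close>.  All other paths, which for a PCAF occur only outside the defining set
  \<open>\<Lambda>\<close>, get the zero measure.
\<close>

definition path_measure :: "(real \<Rightarrow> ennreal) \<Rightarrow> real measure" where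
  "path_measure a =
     (if a 0 = 0 \<and> mono_on {0..} a \<and> continuous_on {0..} a
      then measure_of UNIV (sets borel)
             (\<lambda>B. SUP k::nat. emeasure (interval_measure (\<lambda>s. enn2real (min (a (max 0 s)) (of_nat k)))) B)
      else null_measure borel)"

definition path_integral ::
  "(real \<Rightarrow> 'w \<Rightarrow> ennreal) \<Rightarrow> real set \<Rightarrow> (real \<Rightarrow> ennreal) \<Rightarrow> 'w \<Rightarrow> ennreal" where
  "path_integral A T f \<omega> = (\<integral>\<^sup>+s\<in>T. f s \<partial>path_measure (\<lambda>t. A t \<omega>))"

definition restrict_af ::
  "('a::{metric_space, second_countable_topology}, 'w) process \<Rightarrow> 'a set \<Rightarrow>
   (real \<Rightarrow> 'w \<Rightarrow> ennreal) \<Rightarrow> real \<Rightarrow> 'w \<Rightarrow> ennreal" where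
  "restrict_af M B A t \<omega> = path_integral A {0..t} (\<lambda>s. ext0 (indicator B) (coord M s \<omega>)) \<omega>"

text \<open>The relation ``\<open>A\<close> is (a version of) the PCAF associated with \<open>\<mu>\<close>''.\<close>

definition revuz ::
  "('a::{metric_space, second_countable_topology}, 'w) process \<Rightarrow> 'a measure \<Rightarrow> 'a measure \<Rightarrow>
   (real \<Rightarrow> 'w \<Rightarrow> ennreal) \<Rightarrow> bool" where
  "revuz M m \<mu> A \<longleftrightarrow> smooth_measure M m \<mu> \<and> pcaf M m A \<and>
     (\<forall>f \<in> borel_measurable borel. \<forall>h \<in> borel_measurable borel. \<forall>t\<ge>0.
        (\<integral>\<^sup>+x. h x * expect M x (\<lambda>\<omega>. path_integral A {0..t} (\<lambda>s. ext0 f (coord M s \<omega>)) \<omega>) \<partial>m) =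
        (\<integral>\<^sup>+x. (\<integral>\<^sup>+s\<in>{0..t}. semigroup_nn M s h x \<partial>lborel) * f x \<partial>\<mu>))"

section \<open>Convergence\<close>

text \<open>Here \<open>\<infinity> - \<infinity> = \<infinity>\<close>; for measures in \<open>S_nest M m F\<close> both arguments are finite \<open>m\<close>-a.e.\<close>

definition ennreal_absdiff :: "ennreal \<Rightarrow> ennreal \<Rightarrow> ennreal" where
  "ennreal_absdiff a b = e2ennreal \<bar>enn2ereal a - enn2ereal b\<bar>"

definition Bb0 :: "'a::{metric_space, second_countable_topology} measure \<Rightarrow> ('a \<Rightarrow> real) set" where
  "Bb0 m = {f \<in> borel_measurable borel. bounded (range f) \<and>
     compact {x. \<forall>U. open U \<and> x \<in> U \<longrightarrow> (\<integral>\<^sup>+y\<in>U. ennreal \<bar>f y\<bar> \<partial>m) > 0}}"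

text \<open>
  The complement of \<open>\<Union>l. F l\<close> has zero capacity when \<open>F\<close> is a nest, and only the values on the sets
  \<open>F l\<close> matter; functions defined quasi-everywhere are therefore represented by total functions.
\<close>

definition C_nest :: "(nat \<Rightarrow> 'a::{metric_space, second_countable_topology} set) \<Rightarrow> ('a \<Rightarrow> ereal) set" where
  "C_nest F = {f. \<forall>l. continuous_on (F l) f \<and> (\<forall>x \<in> F l. \<bar>f x\<bar> \<noteq> \<infinity>)}"

definition converges_weakly_on_nest ::
  "('a::{metric_space, second_countable_topology}, 'w) process \<Rightarrow> 'a measure \<Rightarrow> (nat \<Rightarrow> 'a set) \<Rightarrow>
   (nat \<Rightarrow> 'a measure) \<Rightarrow> 'a measure \<Rightarrow> bool" where
  "converges_weakly_on_nest M m F \<mu>s \<mu> \<longleftrightarrow>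
     (\<forall>n. \<mu>s n \<in> S_nest M m F) \<and>
     (\<forall>l. \<forall>f \<in> C_nest F.
        (\<lambda>n. LINT x:F l|\<mu>s n. real_of_ereal (f x)) \<longlonglongrightarrow> (LINT x:F l|\<mu>. real_of_ereal (f x)))"

end

theory Submission
  imports Defs
begin

text \<open>
  Put \<open>\<nu> = 1\<^sub>F \<mu>\<close> and \<open>u\<^sub>t(x) = E\<^sub>x[(1\<^sub>F A)\<^sub>t]\<close>.  By the Revuz formula and symmetry,
  \<open>\<integral> R\<^sub>\<alpha> f d\<nu> = \<integral> f(x) \<integral>\<^sub>0\<^sup>\<infinity> \<alpha> e\<^bsup>-\<alpha>t\<^esup> u\<^sub>t(x) dt m(dx)\<close>, so the first claim follows by comparing the
  functions \<open>u\<^sub>t\<close> on a bounded time interval through (A1) and their tails through (A2).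

  For the weak convergence, let \<open>K\<close> bound the 1-potentials on \<open>F\<close>.  The energy of \<open>\<nu>\<close> is at most
  \<open>K \<nu>(E)\<close>, whence Cauchy-Schwarz gives \<open>(\<integral> R\<^sub>1 f d\<nu>)\<^sup>2 \<le> K \<nu>(E) (R\<^sub>1 f, f)\<close> for bounded integrable \<open>f\<close>.  Taking
  for \<open>f\<close> the difference quotients \<open>(g - e\<^bsup>-t\<^esup> p\<^sub>t g)/t\<close>, whose 1-resolvents are the time averages
  \<open>t\<inverse> \<integral>\<^sub>0\<^sup>t e\<^bsup>-s\<^esup> p\<^sub>s g ds\<close>, and using that the energies of these averages converge for \<open>g\<close> in the form
  domain, one sees that \<open>\<integral> g d\<nu>\<close> is approximated by the integrals of the averages uniformly over all the
  measures involved, and that the total masses are bounded.  For fixed \<open>t\<close> the latter integrals are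
  close to \<open>t\<inverse> \<integral> g u\<^sub>t dm\<close>, which converge by (A1).  Regularity of the form extends the
  convergence to all continuous functions on \<open>F\<close>.
\<close>

section \<open>Stieltjes measures of paths\<close>

text \<open>The obstacle is that \<nu> may be singular to \<open>m\<close>: x \<mapsto>
  E_x[(1_F A)_t] is Borel only up to \<open>m\<close>-null sets, while the bound on the potentials
  is needed \<nu>-almost everywhere. The Revuz formula is the bridge. It shows that for \<nu>-almost
  every x and almost every r the path shifted by r avoids a given event that is null under P_y for
  \<open>m\<close>-almost every y. So the Borel version of the potential obeys the bound
  \<nu>-almost everywhere once it has been smoothed by p_r, at the price of a factor e^r that
  disappears as r tends to 0. Since g is continuous, its time averages converge at every point,
  which again is needed for a singular \<nu>.

  Spectral theory is replaced by convexity: the increments of s \<mapsto> e^{-s} (p_s g, g)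
  decrease, and minus the slope at 0 is E_1(g,g). The energy product of two difference quotients is
  an average of such slopes, so it lies within 2 \<epsilon> of E_1(g,g) once both times are small,
  and the difference of the quotients has energy at most 4 \<epsilon>. The mass bound comes from a g
  with g \<ge> 1 on F: with V = \<nu>(E), V^2 \<le> (\<integral> g d\<nu>)^2 \<le> K V
  E_1(g,g).\<close>

lemma continuous_at_right_UNIV:
  "continuous_on UNIV (F :: real \<Rightarrow> real) \<Longrightarrow> continuous (at_right a) F"
  by (metis continuous_on_eq_continuous_at continuous_at_imp_continuous_at_within open_UNIV UNIV_I)

lemma sets_borel_Ioc: "sets (borel :: real measure) = sigma_sets UNIV (range (\<lambda>(a, b). {a<..b}))"
  by (subst borel_sigma_sets_Ioc) simp

lemma interval_measure_Ioc:
  assumes "mono F" "continuous_on UNIV (F :: real \<Rightarrow> real)"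
  shows "emeasure (interval_measure F) {a<..b} = (if a \<le> b then F b - F a else 0)"
  by (rule emeasure_interval_measure_Ioc_eq) (use assms in \<open>auto intro: continuous_at_right_UNIV dest: monoD\<close>)

text \<open>Both sides agree on half-open intervals, an intersection-stable generator on which they
  are finite. The right-hand side has to be made a measure first, which is
  \<open>?N\<close>.\<close>

lemma interval_measure_add:
  fixes F G :: "real \<Rightarrow> real"
  assumes F: "mono F" "continuous_on UNIV F" and G: "mono G" "continuous_on UNIV G"
    and B: "B \<in> sets borel"
  shows "emeasure (interval_measure (\<lambda>s. F s + G s)) B =
    emeasure (interval_measure F) B + emeasure (interval_measure G) B"
proof -
  let ?N = "measure_of UNIV (sets borel) (\<lambda>B. emeasure (interval_measure F) B + emeasure (interval_measure G) B)"
  have em: "emeasure ?N B = emeasure (interval_measure F) B + emeasure (interval_measure G) B"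
    if "B \<in> sets borel" for B
  proof (rule emeasure_measure_of_sigma)
    show "sigma_algebra UNIV (sets borel :: real set set)"
      using sets.sigma_algebra_axioms[of borel] by simp
    show "positive (sets borel) (\<lambda>B. emeasure (interval_measure F) B + emeasure (interval_measure G) B)"
      by (simp add: positive_def)
    show "countably_additive (sets borel) (\<lambda>B. emeasure (interval_measure F) B + emeasure (interval_measure G) B)"
      by (auto simp: countably_additive_def suminf_add[symmetric] suminf_emeasure)
  qed fact
  have "interval_measure (\<lambda>s. F s + G s) = ?N"
  proof (rule measure_eqI_generator_eq)
    let ?E = "range (\<lambda>(a, b). {a<..b::real})"
    show "Int_stable ?E"
      by (auto simp: Int_stable_def)
    show "?E \<subseteq> Pow UNIV" by simp
    show "sets (interval_measure (\<lambda>s. F s + G s)) = sigma_sets UNIV ?E" "sets ?N = sigma_sets UNIV ?E"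
      by (simp_all add: sets_borel_Ioc sigma_sets_sigma_sets_eq)
    show "range (\<lambda>n. {- real n<..real n}) \<subseteq> ?E" by auto
    show "(\<Union>n. {- real n<..real n}) = UNIV"
    proof -
      have "\<exists>n. - real n < x \<and> x \<le> real n" for x :: real
        using reals_Archimedean2[of "\<bar>x\<bar>"] by (metis abs_less_iff less_imp_le minus_less_iff)
      then show ?thesis by auto
    qed
    have mono: "mono (\<lambda>s. F s + G s)" using F G by (auto simp: mono_def intro!: add_mono)
    have cont: "continuous_on UNIV (\<lambda>s. F s + G s)" using F G by (intro continuous_intros)
    note Ioc = interval_measure_Ioc
    show "emeasure (interval_measure (\<lambda>s. F s + G s)) X = emeasure ?N X" if "X \<in> ?E" for X
      using that F G by (auto simp: em Ioc[OF mono cont] Ioc[OF F] Ioc[OF G] mono_def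
          ennreal_plus[symmetric] algebra_simps simp del: ennreal_plus)
    show "emeasure (interval_measure (\<lambda>s. F s + G s)) {- real n<..real n} \<noteq> \<infinity>" for n
      by (simp add: Ioc[OF mono cont])
  qed
  then show ?thesis using em[OF B] by simp
qed

text \<open>A pointwise inequality between F and G would not do: what is needed is that G - F is
  again nondecreasing, because then its own Stieltjes measure is the surplus.\<close>

lemma interval_measure_mono:
  fixes F G :: "real \<Rightarrow> real"
  assumes F: "mono F" "continuous_on UNIV F" and G: "continuous_on UNIV G"
    and GF: "mono (\<lambda>s. G s - F s)" and B: "B \<in> sets borel"
  shows "emeasure (interval_measure F) B \<le> emeasure (interval_measure G) B"
  using interval_measure_add[OF F GF _ B] F(2) G by (simp add: continuous_on_diff)

lemma interval_measure_shift:
  fixes G :: "real \<Rightarrow> real"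
  assumes G: "mono G" "continuous_on UNIV G"
  shows "interval_measure (\<lambda>s. G (s + r)) = distr (interval_measure G) borel (\<lambda>s. s - r)"
proof (rule measure_eqI_generator_eq)
  let ?E = "range (\<lambda>(a, b). {a<..b::real})"
  show "Int_stable ?E"
    by (auto simp: Int_stable_def)
  show "?E \<subseteq> Pow UNIV" by simp
  show "sets (interval_measure (\<lambda>s. G (s + r))) = sigma_sets UNIV ?E"
      "sets (distr (interval_measure G) borel (\<lambda>s. s - r)) = sigma_sets UNIV ?E"
    by (simp_all add: sets_borel_Ioc)
  show "range (\<lambda>n. {- real n<..real n}) \<subseteq> ?E" by auto
  show "(\<Union>n. {- real n<..real n}) = UNIV"
  proof -
    have "\<exists>n. - real n < x \<and> x \<le> real n" for x :: real
      using reals_Archimedean2[of "\<bar>x\<bar>"] by (metis abs_less_iff less_imp_le minus_less_iff)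
    then show ?thesis by auto
  qed
  have mono: "mono (\<lambda>s. G (s + r))" using G by (auto simp: mono_def)
  have cont: "continuous_on UNIV (\<lambda>s. G (s + r))"
    by (rule continuous_on_compose2[OF G(2)]) (auto intro!: continuous_intros)
  note Ioc = interval_measure_Ioc
  have "(\<lambda>s. s - r) -` {a<..b} = {a + r<..b + r}" for a b by auto
  then show "emeasure (interval_measure (\<lambda>s. G (s + r))) X =
      emeasure (distr (interval_measure G) borel (\<lambda>s. s - r)) X" if "X \<in> ?E" for X
    using that by (auto simp: emeasure_distr Ioc[OF mono cont] Ioc[OF G])
  show "emeasure (interval_measure (\<lambda>s. G (s + r))) {- real n<..real n} \<noteq> \<infinity>" for n
    by (simp add: Ioc[OF mono cont])
qed

section \<open>Paths with values in [0,\<infinity>] and their truncations\<close>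

definition good_path :: "(real \<Rightarrow> ennreal) \<Rightarrow> bool" where
  "good_path a \<longleftrightarrow> a 0 = 0 \<and> mono_on {0..} a \<and> continuous_on {0..} a"

text \<open>The two ingredients of \<open>path_measure\<close> get names: \<open>good_path\<close>
  is the condition under which its first branch is taken, and \<open>trunc_path\<close> is the
  finite path fed to \<open>interval_measure\<close>, kept at its initial value on the negative
  axis.\<close>

definition trunc_path :: "(real \<Rightarrow> ennreal) \<Rightarrow> nat \<Rightarrow> real \<Rightarrow> real" where
  "trunc_path a k s = enn2real (min (a (max 0 s)) (of_nat k))"

lemma ennreal_trunc_path: "ennreal (trunc_path a k s) = min (a (max 0 s)) (of_nat k)"
  by (auto simp: trunc_path_def min_less_iff_disj of_nat_less_top less_top intro!: ennreal_enn2real)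

lemma trunc_path_nonneg [simp]: "0 \<le> trunc_path a k s"
  by (simp add: trunc_path_def)

lemma trunc_path_le: "trunc_path a k s \<le> real k"
proof -
  have "ennreal (trunc_path a k s) \<le> ennreal (real k)"
    by (simp add: ennreal_trunc_path ennreal_of_nat_eq_real_of_nat)
  then show ?thesis by simp
qed

lemma good_path_mono: "good_path a \<Longrightarrow> 0 \<le> s \<Longrightarrow> s \<le> t \<Longrightarrow> a s \<le> a t"
  by (auto simp: good_path_def intro: mono_onD)

lemma trunc_path_0: "good_path a \<Longrightarrow> s \<le> 0 \<Longrightarrow> trunc_path a k s = 0"
  by (simp add: trunc_path_def good_path_def max_def)

lemma mono_trunc_path: "good_path a \<Longrightarrow> mono (trunc_path a k)"
proof (rule monoI)
  fix s t :: real assume "good_path a" "s \<le> t"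
  then have "a (max 0 s) \<le> a (max 0 t)" by (intro good_path_mono) auto
  then have "ennreal (trunc_path a k s) \<le> ennreal (trunc_path a k t)"
    unfolding ennreal_trunc_path by (rule min.mono) simp
  then show "trunc_path a k s \<le> trunc_path a k t" by simp
qed

lemma continuous_trunc_path: "good_path a \<Longrightarrow> continuous_on UNIV (trunc_path a k)"
proof -
  assume a: "good_path a"
  have "continuous_on UNIV (\<lambda>s. a (max 0 s))"
    by (rule continuous_on_compose2[of "{0..}" a]) (use a in \<open>auto simp: good_path_def intro!: continuous_intros\<close>)
  then have "continuous_on UNIV (\<lambda>s. min (a (max 0 s)) (of_nat k))"
    by (intro continuous_intros)
  moreover have "min (a (max 0 s)) (of_nat k) \<noteq> \<infinity>" for s
    using min.cobounded2[of "a (max 0 s)" "of_nat k"] ennreal_of_nat_neq_top[of k]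
    by (metis infinity_ennreal_def top_unique)
  ultimately show ?thesis
    unfolding trunc_path_def[abs_def] continuous_on_def
    by (intro ballI tendsto_enn2real) (auto simp: ennreal_enn2real_if)
qed

lemma trunc_path_eq: "a (max 0 s) = ennreal c \<Longrightarrow> 0 \<le> c \<Longrightarrow> trunc_path a k s = min c (real k)"
  by (auto simp: trunc_path_def ennreal_of_nat_eq_real_of_nat min_def)

lemma trunc_path_top: "a (max 0 s) = \<infinity> \<Longrightarrow> trunc_path a k s = real k"
  by (simp add: trunc_path_def min_absorb2 enn2real_def)

text \<open>Raising the cap from j to k adds max 0 (min c k - j) at a path value c, a nondecreasing
  function of c; so the increments of the path, not just its values, grow with the cap.\<close>

lemma interval_measure_trunc_mono:
  assumes a: "good_path a" and B: "B \<in> sets borel" and "j \<le> k"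
  shows "emeasure (interval_measure (trunc_path a j)) B \<le> emeasure (interval_measure (trunc_path a k)) B"
proof (rule interval_measure_mono[OF mono_trunc_path continuous_trunc_path continuous_trunc_path _ B])
  show "mono (\<lambda>s. trunc_path a k s - trunc_path a j s)"
  proof (rule monoI)
    fix s t :: real assume "s \<le> t"
    have le: "a (max 0 s) \<le> a (max 0 t)" using \<open>s \<le> t\<close> by (intro good_path_mono[OF a]) auto
    have *: "trunc_path a k s - trunc_path a j s = max 0 (min c (real k) - real j)"
      if "a (max 0 s) = ennreal c" "0 \<le> c" for s c
      using that \<open>j \<le> k\<close> by (auto simp: trunc_path_eq)
    have **: "trunc_path a k s - trunc_path a j s = real k - real j"
      if "a (max 0 s) = top" for s
      using that by (simp add: trunc_path_top)
    show "trunc_path a k s - trunc_path a j s \<le> trunc_path a k t - trunc_path a j t"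
      using le \<open>j \<le> k\<close>
      by (cases "a (max 0 s)"; cases "a (max 0 t)") (auto simp: * ** max_def min_def top_unique)
  qed
qed fact+

lemma sets_path_measure [simp, measurable_cong]: "sets (path_measure a) = sets borel"
  by (simp add: path_measure_def sigma_sets_sigma_sets_eq sets.sigma_sets_eq[of borel, simplified])

lemma space_path_measure [simp]: "space (path_measure a) = UNIV"
  using sets_eq_imp_space_eq[OF sets_path_measure[of a]] by simp

text \<open>\<open>measure_of\<close> yields the prescribed values only if they form a measure. They
  do, because the truncated measures increase with k and the supremum of a chain of measures is
  computed setwise.\<close>

lemma emeasure_path_measure:
  assumes a: "good_path a" and B: "B \<in> sets borel"
  shows "emeasure (path_measure a) B = (SUP k. emeasure (interval_measure (trunc_path a k)) B)"
proof -
  let ?I = "\<lambda>k. interval_measure (trunc_path a k)"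
  have inc: "?I j \<le> ?I k" if "j \<le> k" for j k
    using interval_measure_trunc_mono[OF a _ that] by (subst le_measure) auto
  have chain: "Complete_Partial_Order.chain (\<le>) (range ?I)"
    unfolding chain_def using inc nat_le_linear by blast
  have SUP: "emeasure (SUP k. ?I k) B = (SUP k. emeasure (?I k) B)" if "B \<in> sets borel" for B
    using chain that by (intro emeasure_SUP_chain[where N=borel]) auto
  have sets: "sets (SUP k. ?I k) = sets borel"
    by (rule sets_SUP) auto
  have "path_measure a = measure_of UNIV (sets borel) (\<lambda>B. SUP k. emeasure (?I k) B)"
    using a by (simp add: path_measure_def good_path_def trunc_path_def[abs_def])
  also have "\<dots> = measure_of UNIV (sets borel) (emeasure (SUP k. ?I k))"
    by (rule measure_of_eq) (auto simp: SUP sets.sigma_sets_eq[of borel, simplified])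
  also have "\<dots> = (SUP k. ?I k)"
    using measure_of_of_measure[of "SUP k. ?I k"] sets sets_eq_imp_space_eq[OF sets] by simp
  finally show ?thesis using SUP[OF B] by simp
qed

text \<open>Induction over the integrand; for an increasing sequence of functions the step is an
  interchange of two suprema, one over the sequence and one over the truncation level.\<close>

lemma nn_integral_path_measure:
  assumes a: "good_path a" and f: "f \<in> borel_measurable borel"
  shows "(\<integral>\<^sup>+s. f s \<partial>path_measure a) = (SUP k. \<integral>\<^sup>+s. f s \<partial>interval_measure (trunc_path a k))"
proof -
  let ?I = "\<lambda>k. interval_measure (trunc_path a k)"
  have inc: "incseq (\<lambda>k. \<integral>\<^sup>+s. f s \<partial>?I k)" for f
    using interval_measure_trunc_mono[OF a]
    by (intro incseq_SucI nn_integral_mono_measure) (auto simp: le_measure)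
  show ?thesis
    using f
  proof (induction rule: borel_measurable_induct)
    case (cong f g)
    then show ?case by simp
  next
    case (set A)
    then show ?case by (simp add: emeasure_path_measure[OF a])
  next
    case (mult u v)
    then show ?case by (simp add: nn_integral_cmult SUP_mult_left_ennreal)
  next
    case (add u v)
    then show ?case by (simp add: nn_integral_add ennreal_SUP_add[OF inc inc])
  next
    case (seq U)
    have U[measurable]: "U i \<in> borel_measurable borel" and inc: "incseq U" for i by fact+
    have Up: "U i \<in> borel_measurable (path_measure a)" "U i \<in> borel_measurable (?I k)" for i k
      by measurable
    have "(\<integral>\<^sup>+s. (SUP i. U i s) \<partial>path_measure a) = (SUP i. \<integral>\<^sup>+s. U i s \<partial>path_measure a)"
      by (rule nn_integral_monotone_convergence_SUP) (simp_all add: Up inc)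
    also have "\<dots> = (SUP i. SUP k. \<integral>\<^sup>+s. U i s \<partial>?I k)" by (simp only: seq.IH)
    also have "\<dots> = (SUP k. SUP i. \<integral>\<^sup>+s. U i s \<partial>?I k)" by (rule SUP_commute)
    also have "\<dots> = (SUP k. \<integral>\<^sup>+s. (SUP i. U i s) \<partial>?I k)"
      by (intro SUP_cong refl nn_integral_monotone_convergence_SUP[symmetric]) (simp_all add: Up inc)
    finally show ?case by (simp only: Sup_apply image_comp comp_def)
  qed
qed

lemma emeasure_interval_trunc_Icc:
  "good_path a \<Longrightarrow> s \<le> t \<Longrightarrow>
    emeasure (interval_measure (trunc_path a k)) {s..t} = ennreal (trunc_path a k t - trunc_path a k s)"
  by (rule emeasure_interval_measure_Icc) (auto simp: continuous_trunc_path intro: monoD[OF mono_trunc_path])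

lemma emeasure_path_Icc0:
  assumes a: "good_path a" and t: "0 \<le> t"
  shows "emeasure (path_measure a) {0..t} = a t"
proof -
  have "emeasure (path_measure a) {0..t} = (SUP k. min (a t) (of_nat k))"
    using t by (simp add: emeasure_path_measure[OF a] emeasure_interval_trunc_Icc[OF a] trunc_path_0[OF a]
        ennreal_trunc_path)
  also have "\<dots> = a t"
  proof (rule LIMSEQ_unique)
    show "(\<lambda>k. min (a t) (of_nat k)) \<longlonglongrightarrow> (SUP k. min (a t) (of_nat k))"
      by (intro LIMSEQ_SUP incseq_SucI min.mono order_refl) (simp add: add_increasing)
    show "(\<lambda>k. min (a t) (of_nat k)) \<longlonglongrightarrow> a t"
      using tendsto_min[OF tendsto_const of_nat_tendsto_top_ennreal, of "a t"] by (simp add: min_absorb1)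
  qed
  finally show ?thesis .
qed

lemma emeasure_path_singleton:
  assumes a: "good_path a" shows "emeasure (path_measure a) {s} = 0"
  using emeasure_interval_trunc_Icc[OF a, of s s] by (simp add: emeasure_path_measure[OF a])

text \<open>From the explosion on, every truncation is constant, so all mass sits strictly before t;
  continuity excludes an atom at t itself.\<close>

lemma emeasure_path_top:
  assumes a: "good_path a" and t: "0 \<le> t" "a t = \<infinity>"
  shows "emeasure (path_measure a) {t..} = 0"
proof -
  have "emeasure (path_measure a) {t..t + real n} = 0" for n
  proof -
    have "a (t + real n) = \<infinity>"
      using good_path_mono[OF a t(1), of "t + real n"] t(2) by (simp add: top_unique)
    then show ?thesis using t
      by (simp add: emeasure_path_measure[OF a] emeasure_interval_trunc_Icc[OF a] trunc_path_top)
  qed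
  then have "emeasure (path_measure a) (\<Union>n. {t..t + real n}) = 0"
    by (intro emeasure_UN_eq_0) auto
  also have "(\<Union>n. {t..t + real n}) = {t..}"
  proof -
    have "\<exists>n. x \<le> t + real n" for x
      using real_arch_simple[of "x - t"] by (auto simp: algebra_simps)
    then show ?thesis by auto
  qed
  finally show ?thesis .
qed

text \<open>Continuity holds because da has no atoms. Where a is finite it follows by dominated
  convergence on a slightly longer interval. At an explosion no dominating mass is finite, but da
  then lives before t, so no value exceeds the one at t, and Fatou's lemma gives the lower
  bound.\<close>

lemma good_path_restrict:
  assumes a: "good_path a" and f[measurable]: "f \<in> borel_measurable borel" and f1: "\<And>s. f s \<le> (1::ennreal)"
  shows "good_path (\<lambda>t. \<integral>\<^sup>+s\<in>{0..t}. f s \<partial>path_measure a)"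
proof -
  let ?\<mu> = "path_measure a"
  let ?b = "\<lambda>t. \<integral>\<^sup>+s\<in>{0..t}. f s \<partial>?\<mu>"
  have mono: "?b s \<le> ?b t" if "s \<le> t" for s t
    using that by (intro nn_integral_mono) (auto split: split_indicator)
  have "?b 0 = 0"
    by (rule nn_integral_null_set) (simp add: null_sets_def emeasure_path_singleton[OF a])
  moreover have "continuous_on {0..} ?b"
    unfolding continuous_on_sequentially
  proof (intro allI ballI impI, elim conjE)
    fix x t assume t: "t \<in> {0..}" and x: "\<forall>n. x n \<in> {0..}" "x \<longlonglongrightarrow> (t::real)"
    have ae: "AE s in ?\<mu>. s \<noteq> t"
      by (rule AE_I[of _ _ "{t}"]) (auto simp: emeasure_path_singleton[OF a])
    have ind: "(\<lambda>n. f s * indicator {0..x n} s) \<longlonglongrightarrow> f s * indicator {0..t} s" if "s \<noteq> t" for s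
    proof -
      have "\<forall>\<^sub>F n in sequentially. f s * indicator {0..x n} s = f s * indicator {0..t} s"
      proof (cases "s < t")
        case True
        then have "\<forall>\<^sub>F n in sequentially. s < x n" using x(2) by (intro order_tendstoD)
        then show ?thesis by eventually_elim (use True in \<open>auto split: split_indicator\<close>)
      next
        case False
        then have "\<forall>\<^sub>F n in sequentially. x n < s" using x(2) that by (intro order_tendstoD) auto
        then show ?thesis by eventually_elim (use False that in \<open>auto split: split_indicator\<close>)
      qed
      then show ?thesis by (rule tendsto_eventually)
    qed
    show "(?b \<circ> x) \<longlonglongrightarrow> ?b t"
    proof (cases "a t = \<infinity>")
      case False
      \<comment> \<open>Continuity into [0,\<infinity>] keeps a finite for a little while after t,
        which yields a dominating interval of finite mass.\<close>
      obtain u where u: "t < u" "a u \<noteq> \<infinity>"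
      proof -
        have "(a \<longlongrightarrow> a t) (at t within {0..})"
          using a t by (auto simp: good_path_def continuous_on_def)
        then have "\<forall>\<^sub>F y in at t within {0..}. a y < \<infinity>"
          using False by (intro order_tendstoD) (auto simp: less_top)
        then have "\<forall>\<^sub>F y in at_right t. a y < \<infinity>"
          by (rule filter_leD[OF at_le, rotated]) (use t in auto)
        then obtain b where "t < b" "\<And>y. t < y \<Longrightarrow> y < b \<Longrightarrow> a y < \<infinity>"
          unfolding eventually_at_right_field by auto
        then have "t < (t + b) / 2" "a ((t + b) / 2) < \<infinity>" by auto
        then show ?thesis using that[of "(t + b) / 2"] by simp
      qed
      have ev: "\<forall>\<^sub>F n in sequentially. x n \<le> u"
        using order_tendstoD(2)[OF x(2) u(1)] by eventually_elim simp
      then obtain n0 where n0: "\<And>n. n \<ge> n0 \<Longrightarrow> x n \<le> u"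
        by (auto simp: eventually_sequentially)
      have "(\<lambda>n. ?b (x (n + n0))) \<longlonglongrightarrow> ?b t"
      proof (rule nn_integral_dominated_convergence[where w="indicator {0..u}"])
        show "AE s in ?\<mu>. f s * indicator {0..x (j + n0)} s \<le> indicator {0..u} s" for j
          using n0[of "j + n0"] f1 by (auto split: split_indicator)
        show "(\<integral>\<^sup>+ s. indicator {0..u} s \<partial>?\<mu>) < \<infinity>"
          using u t by (simp add: emeasure_path_Icc0[OF a] less_top)
        show "AE s in ?\<mu>. (\<lambda>i. f s * indicator {0..x (i + n0)} s) \<longlonglongrightarrow> f s * indicator {0..t} s"
          using ae by eventually_elim (use ind LIMSEQ_ignore_initial_segment in blast)
      qed auto
      then show ?thesis by (subst LIMSEQ_offset[where k=n0]) (simp_all add: comp_def)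
    next
      case True
      have "emeasure ?\<mu> {t..} = 0" using emeasure_path_top[OF a _ True] t by simp
      then have ae': "AE s in ?\<mu>. s < t"
        by (intro AE_I[of _ _ "{t..}"]) auto
      have "?b y \<le> ?b t" for y
        by (rule nn_integral_mono_AE) (use ae' in eventually_elim, auto split: split_indicator)
      then have "limsup (?b \<circ> x) \<le> ?b t"
        by (intro Limsup_bounded) auto
      moreover have "?b t \<le> liminf (?b \<circ> x)"
      proof -
        have "?b t = (\<integral>\<^sup>+s. liminf (\<lambda>n. f s * indicator {0..x n} s) \<partial>?\<mu>)"
        proof (rule nn_integral_cong_AE, use ae in eventually_elim)
          fix s assume "s \<noteq> t"
          from lim_imp_Liminf[OF _ ind[OF this]]
          show "f s * indicator {0..t} s = liminf (\<lambda>n. f s * indicator {0..x n} s)" by simp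
        qed
        also have "\<dots> \<le> liminf (\<lambda>n. \<integral>\<^sup>+s. f s * indicator {0..x n} s \<partial>?\<mu>)"
          by (rule nn_integral_liminf) auto
        finally show ?thesis by (simp add: comp_def)
      qed
      moreover have "liminf (?b \<circ> x) \<le> limsup (?b \<circ> x)"
        by (rule Liminf_le_Limsup) simp
      ultimately have "liminf (?b \<circ> x) = ?b t" "limsup (?b \<circ> x) = ?b t" by auto
      then show ?thesis by (simp add: tendsto_iff_Liminf_eq_Limsup)
    qed
  qed
  ultimately show ?thesis using mono by (auto simp: good_path_def intro: mono_onI)
qed

section \<open>Exponential weights, time shifts and measurability of path integrals\<close>

lemma nn_integral_exp_tail:
  assumes "\<alpha> > 0"
  shows "(\<integral>\<^sup>+s\<in>{r..}. ennreal (\<alpha> * exp (- \<alpha> * s)) \<partial>lborel) = ennreal (exp (- \<alpha> * r))"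
proof -
  have "(\<integral>\<^sup>+s\<in>{r..}. ennreal (\<alpha> * exp (- \<alpha> * s)) \<partial>lborel) = ennreal (0 - (- exp (- \<alpha> * r)))"
  proof (rule nn_integral_FTC_atLeast[where F="\<lambda>s. - exp (- \<alpha> * s)"])
    have "((\<lambda>s. - exp (- (\<alpha> * s))) \<longlongrightarrow> - 0) at_top"
      using assms by (intro tendsto_minus filterlim_compose[OF exp_at_bot])
        (auto intro!: filterlim_tendsto_pos_mult_at_top filterlim_ident simp: filterlim_uminus_at_top[symmetric])
    then show "((\<lambda>s. - exp (- \<alpha> * s)) \<longlongrightarrow> 0) at_top" by simp
  qed (use assms in \<open>auto intro!: derivative_eq_intros\<close>)
  then show ?thesis by simp
qed

text \<open>Integration by parts: a_s = a_t + da([t,s]) is inserted under the exponential weight and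
  the order of integration is exchanged. Fubini's theorem is applied to the truncations, whose
  Stieltjes measures are sigma-finite, before the level tends to infinity.\<close>

lemma path_measure_exp_tail:
  assumes a: "good_path a" and \<alpha>: "\<alpha> > 0" and t: "0 \<le> t"
  shows "(\<integral>\<^sup>+s\<in>{t..}. ennreal (\<alpha> * exp (- \<alpha> * s)) * a s \<partial>lborel) \<le>
    ennreal (exp (- \<alpha> * t)) * a t + (\<integral>\<^sup>+s\<in>{t..}. ennreal (exp (- \<alpha> * s)) \<partial>path_measure a)"
proof -
  let ?I = "\<lambda>k. interval_measure (trunc_path a k)"
  have [measurable]: "trunc_path a k \<in> borel_measurable borel" for k
    using continuous_trunc_path[OF a] by (rule borel_measurable_continuous_onI)
  have step: "(\<integral>\<^sup>+s. ennreal (\<alpha> * exp (- \<alpha> * s)) * trunc_path a k s * indicator {t..} s \<partial>lborel) \<le>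
      ennreal (exp (- \<alpha> * t)) * a t + (\<integral>\<^sup>+s\<in>{t..}. ennreal (exp (- \<alpha> * s)) \<partial>path_measure a)" for k
  proof -
    interpret I: sigma_finite_measure "?I k"
      by (rule sigma_finite_interval_measure)
         (auto intro: monoD[OF mono_trunc_path[OF a]] continuous_at_right_UNIV continuous_trunc_path[OF a])
    interpret P: pair_sigma_finite lborel "?I k" ..
    have jm: "(\<lambda>(s, r). ennreal (\<alpha> * exp (- \<alpha> * s)) * indicator {t..} s * indicator {t..s} r)
        \<in> borel_measurable (lborel \<Otimes>\<^sub>M ?I k)"
      unfolding indicator_def of_bool_def atLeastAtMost_iff atLeast_iff by measurable
    have eq: "ennreal (trunc_path a k s) = ennreal (trunc_path a k t) + (\<integral>\<^sup>+r. indicator {t..s} r \<partial>?I k)"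
      if "t \<le> s" for s
      using that monoD[OF mono_trunc_path[OF a] that, of k]
      by (simp add: emeasure_interval_trunc_Icc[OF a] ennreal_plus[symmetric] del: ennreal_plus)
    have "(\<integral>\<^sup>+s. ennreal (\<alpha> * exp (- \<alpha> * s)) * trunc_path a k s * indicator {t..} s \<partial>lborel) =
       (\<integral>\<^sup>+s. ennreal (trunc_path a k t) * (ennreal (\<alpha> * exp (- \<alpha> * s)) * indicator {t..} s) +
          (\<integral>\<^sup>+r. ennreal (\<alpha> * exp (- \<alpha> * s)) * indicator {t..} s * indicator {t..s} r \<partial>?I k) \<partial>lborel)"
    proof (intro nn_integral_cong)
      fix s
      have c: "(\<integral>\<^sup>+r. ennreal (\<alpha> * exp (- \<alpha> * s)) * indicator {t..} s * indicator {t..s} r \<partial>?I k) =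
        ennreal (\<alpha> * exp (- \<alpha> * s)) * indicator {t..} s * (\<integral>\<^sup>+r. indicator {t..s} r \<partial>?I k)"
        by (rule nn_integral_cmult) simp
      show "ennreal (\<alpha> * exp (- \<alpha> * s)) * trunc_path a k s * indicator {t..} s =
        ennreal (trunc_path a k t) * (ennreal (\<alpha> * exp (- \<alpha> * s)) * indicator {t..} s) +
        (\<integral>\<^sup>+r. ennreal (\<alpha> * exp (- \<alpha> * s)) * indicator {t..} s * indicator {t..s} r \<partial>?I k)"
      proof (cases "t \<le> s")
        case True
        have alg: "E * (T + J) = T * E + E * J" for E T J :: ennreal
          by (simp add: distrib_left mult.commute)
        show ?thesis unfolding c eq[OF True] alg using True by simp
      qed (simp add: c)
    qed
    also have "\<dots> = ennreal (trunc_path a k t) * ennreal (exp (- \<alpha> * t)) +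
       (\<integral>\<^sup>+s. (\<integral>\<^sup>+r. ennreal (\<alpha> * exp (- \<alpha> * s)) * indicator {t..} s * indicator {t..s} r \<partial>?I k) \<partial>lborel)"
    proof (subst nn_integral_add)
      show "(\<lambda>s. \<integral>\<^sup>+r. ennreal (\<alpha> * exp (- \<alpha> * s)) * indicator {t..} s * indicator {t..s} r \<partial>?I k)
        \<in> borel_measurable lborel"
        using I.borel_measurable_nn_integral[OF jm] by simp
    qed (simp, subst nn_integral_cmult, simp, simp only: nn_integral_exp_tail[OF \<alpha>])
    also have "(\<integral>\<^sup>+s. (\<integral>\<^sup>+r. ennreal (\<alpha> * exp (- \<alpha> * s)) * indicator {t..} s * indicator {t..s} r \<partial>?I k) \<partial>lborel) =
       (\<integral>\<^sup>+r. (\<integral>\<^sup>+s. ennreal (\<alpha> * exp (- \<alpha> * s)) * indicator {t..} s * indicator {t..s} r \<partial>lborel) \<partial>?I k)"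
      by (rule P.Fubini'[symmetric, OF jm])
    also have "\<dots> = (\<integral>\<^sup>+r. indicator {t..} r * (\<integral>\<^sup>+s\<in>{r..}. ennreal (\<alpha> * exp (- \<alpha> * s)) \<partial>lborel) \<partial>?I k)"
    proof (intro nn_integral_cong)
      fix r
      have "ennreal (\<alpha> * exp (- \<alpha> * s)) * indicator {t..} s * indicator {t..s} r =
        indicator {t..} r * (ennreal (\<alpha> * exp (- \<alpha> * s)) * indicator {r..} s)" for s
        by (auto split: split_indicator)
      then show "(\<integral>\<^sup>+s. ennreal (\<alpha> * exp (- \<alpha> * s)) * indicator {t..} s * indicator {t..s} r \<partial>lborel) =
        indicator {t..} r * (\<integral>\<^sup>+s\<in>{r..}. ennreal (\<alpha> * exp (- \<alpha> * s)) \<partial>lborel)"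
        by (simp only:) (rule nn_integral_cmult, simp)
    qed
    also have "\<dots> = (\<integral>\<^sup>+r\<in>{t..}. ennreal (exp (- \<alpha> * r)) \<partial>?I k)"
      unfolding nn_integral_exp_tail[OF \<alpha>] by (simp only: mult.commute)
    also have "\<dots> \<le> (\<integral>\<^sup>+r\<in>{t..}. ennreal (exp (- \<alpha> * r)) \<partial>path_measure a)"
      by (subst nn_integral_path_measure[OF a]) (auto intro: SUP_upper2)
    finally have fin: "(\<integral>\<^sup>+s. ennreal (\<alpha> * exp (- \<alpha> * s)) * trunc_path a k s * indicator {t..} s \<partial>lborel) \<le>
      ennreal (trunc_path a k t) * ennreal (exp (- \<alpha> * t)) +
      (\<integral>\<^sup>+r\<in>{t..}. ennreal (exp (- \<alpha> * r)) \<partial>path_measure a)"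
      by (simp add: add_left_mono)
    have "ennreal (trunc_path a k t) \<le> a t"
      using t by (simp add: ennreal_trunc_path)
    then show ?thesis
      by (intro order_trans[OF fin] add_right_mono, subst mult.commute) (rule mult_left_mono, simp_all)
  qed
  have "(\<integral>\<^sup>+s\<in>{t..}. ennreal (\<alpha> * exp (- \<alpha> * s)) * a s \<partial>lborel) =
     (\<integral>\<^sup>+s. (SUP k. ennreal (\<alpha> * exp (- \<alpha> * s)) * trunc_path a k s * indicator {t..} s) \<partial>lborel)"
  proof (intro nn_integral_cong)
    fix s
    show "ennreal (\<alpha> * exp (- \<alpha> * s)) * a s * indicator {t..} s =
      (SUP k. ennreal (\<alpha> * exp (- \<alpha> * s)) * trunc_path a k s * indicator {t..} s)"
    proof (cases "t \<le> s")
      case True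
      then have "a s = (SUP k. ennreal (trunc_path a k s))"
        using emeasure_path_Icc0[OF a, of s] t
        by (simp add: emeasure_path_measure[OF a] emeasure_interval_trunc_Icc[OF a] trunc_path_0[OF a])
      then show ?thesis using True by (simp add: SUP_mult_left_ennreal)
    qed simp
  qed
  also have "\<dots> = (SUP k. \<integral>\<^sup>+s. ennreal (\<alpha> * exp (- \<alpha> * s)) * trunc_path a k s * indicator {t..} s \<partial>lborel)"
  proof (rule nn_integral_monotone_convergence_SUP)
    show "incseq (\<lambda>k s. ennreal (\<alpha> * exp (- \<alpha> * s)) * ennreal (trunc_path a k s) * indicator {t..} s)"
      by (auto simp: incseq_def le_fun_def ennreal_trunc_path intro!: mult_right_mono mult_left_mono min.mono)
  qed measurable
  finally show ?thesis using step by (simp add: SUP_least)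
qed

text \<open>By additivity the part of a after r is a' raised by the constant a r, so da' is da seen
  from time r. The inequality is the direction that bounds functionals of the shifted path by those
  of the original one. If a r were infinite, the equation would say nothing about a'.\<close>

lemma path_measure_shift_le:
  assumes a: "good_path a" and a': "good_path a'" and r: "0 \<le> r" "a r \<noteq> \<infinity>"
    and eq: "\<And>t. 0 \<le> t \<Longrightarrow> a (t + r) = a r + a' t" and B: "B \<in> sets borel"
  shows "emeasure (path_measure a') B \<le> emeasure (distr (path_measure a) borel (\<lambda>s. s - r)) B"
proof -
  obtain c where c: "a r = ennreal c" "0 \<le> c" using r by (cases "a r") auto
  have "emeasure (interval_measure (trunc_path a' k)) B \<le> emeasure (distr (path_measure a) borel (\<lambda>s. s - r)) B" for k
  proof -
    \<comment> \<open>The level k of a' is the level k + c of a; rounding c up keeps the level a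
      natural number.\<close>
    define j where "j = k + nat \<lceil>c\<rceil>"
    have j: "real k + c \<le> real j" unfolding j_def using c by linarith
    have "emeasure (interval_measure (trunc_path a' k)) B \<le>
      emeasure (interval_measure (\<lambda>s. trunc_path a j (s + r))) B"
    proof (rule interval_measure_mono[OF mono_trunc_path[OF a'] continuous_trunc_path[OF a'] _ _ B])
      show "continuous_on UNIV (\<lambda>s. trunc_path a j (s + r))"
        by (rule continuous_on_compose2[OF continuous_trunc_path[OF a]]) (auto intro!: continuous_intros)
      show "mono (\<lambda>s. trunc_path a j (s + r) - trunc_path a' k s)"
      proof (rule monoI)
        fix s t :: real assume st: "s \<le> t"
        have le: "trunc_path a j (s + r) \<le> trunc_path a j (t + r)"
          using st by (intro monoD[OF mono_trunc_path[OF a]]) simp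
        \<comment> \<open>In terms of the value d of a', the difference of the capped paths is c
          until d exceeds k and never decreases afterwards; this is the monotonicity that the
          comparison of the Stieltjes measures asks for.\<close>
        have val: "trunc_path a j (s + r) - trunc_path a' k s = c + max 0 (min (d + c) (real j) - (real k + c))"
          if "0 \<le> s" "a' s = ennreal d" "0 \<le> d" for s d
          using that r c j eq[of s]
          by (auto simp: trunc_path_eq max_def add.commute ennreal_plus[symmetric] simp del: ennreal_plus)
        have valtop: "trunc_path a j (s + r) - trunc_path a' k s = real j - real k"
          if "0 \<le> s" "a' s = top" for s
          using that r eq[of s] by (simp add: trunc_path_top)
        have pos: "trunc_path a j (s + r) - trunc_path a' k s \<le> trunc_path a j (t + r) - trunc_path a' k t"
          if "0 \<le> s" "s \<le> t" for s t
          using good_path_mono[OF a' that] that j c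
          by (cases "a' s"; cases "a' t") (auto simp: val valtop max_def min_def top_unique)
        show "trunc_path a j (s + r) - trunc_path a' k s \<le> trunc_path a j (t + r) - trunc_path a' k t"
        proof (cases "0 \<le> s")
          case True then show ?thesis using pos st by simp
        next
          case False
          then have s: "trunc_path a' k s = 0" "trunc_path a j (s + r) \<le> trunc_path a j (0 + r)"
            using trunc_path_0[OF a'] by (auto intro!: monoD[OF mono_trunc_path[OF a]])
          show ?thesis
          proof (cases "0 \<le> t")
            case True
            then show ?thesis using s pos[of 0 t] trunc_path_0[OF a', of 0] by simp
          next
            case False
            then show ?thesis using s le trunc_path_0[OF a'] by simp
          qed
        qed
      qed
    qed
    also have "\<dots> = emeasure (interval_measure (trunc_path a j)) ((\<lambda>s. s - r) -` B)"
      using B by (simp add: interval_measure_shift[OF mono_trunc_path[OF a] continuous_trunc_path[OF a]] emeasure_distr)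
    also have "\<dots> \<le> emeasure (path_measure a) ((\<lambda>s. s - r) -` B)"
    proof -
      have "(\<lambda>s. s - r) -` B \<in> sets borel"
        using measurable_sets[OF _ B, of "\<lambda>s. s - r" borel] by simp
      then show ?thesis by (subst emeasure_path_measure[OF a]) (auto intro: SUP_upper2)
    qed
    finally show ?thesis using B by (simp add: emeasure_distr)
  qed
  then show ?thesis using B by (simp add: emeasure_path_measure[OF a'] SUP_least)
qed

lemma path_integral_shift_le:
  assumes a: "good_path a" and a': "good_path a'" and r: "0 \<le> r" "a r \<noteq> \<infinity>"
    and eq: "\<And>t. 0 \<le> t \<Longrightarrow> a (t + r) = a r + a' t" and [measurable]: "f \<in> borel_measurable borel"
  shows "(\<integral>\<^sup>+s\<in>{0..t}. f (s + r) \<partial>path_measure a') \<le> (\<integral>\<^sup>+s\<in>{0..t + r}. f s \<partial>path_measure a)"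
proof -
  have "(\<integral>\<^sup>+s\<in>{0..t}. f (s + r) \<partial>path_measure a') \<le>
      (\<integral>\<^sup>+s\<in>{0..t}. f (s + r) \<partial>distr (path_measure a) borel (\<lambda>s. s - r))"
    by (rule nn_integral_mono_measure) (auto simp: le_measure intro!: path_measure_shift_le[OF a a' r eq])
  also have "\<dots> = (\<integral>\<^sup>+s. f s * indicator {0..t} (s - r) \<partial>path_measure a)"
    by (simp add: nn_integral_distr)
  also have "\<dots> \<le> (\<integral>\<^sup>+s\<in>{0..t + r}. f s \<partial>path_measure a)"
    using r by (intro nn_integral_mono) (auto split: split_indicator)
  finally show ?thesis .
qed

text \<open>A truncated path has total mass at most k, so the factor 1/(k+1) turns its measure into
  a subprobability kernel, for which measurability need only be tested on half-open intervals and on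
  the whole line.\<close>

lemma measurable_interval_measure_kernel:
  assumes good: "\<And>\<omega>. \<omega> \<in> space N \<Longrightarrow> good_path (\<lambda>t. A t \<omega>)"
    and A: "\<And>t. 0 \<le> t \<Longrightarrow> A t \<in> borel_measurable N"
  shows "(\<lambda>\<omega>. scale_measure (inverse (of_nat (Suc k))) (interval_measure (trunc_path (\<lambda>t. A t \<omega>) k)))
    \<in> N \<rightarrow>\<^sub>M subprob_algebra borel"
proof -
  let ?I = "\<lambda>\<omega>. interval_measure (trunc_path (\<lambda>t. A t \<omega>) k)"
  have tm: "(\<lambda>\<omega>. trunc_path (\<lambda>t. A t \<omega>) k s) \<in> borel_measurable N" for s
    unfolding trunc_path_def using A[of "max 0 s"] by measurable
  have Ioc: "emeasure (?I \<omega>) {a<..b} =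
      ennreal (if a \<le> b then trunc_path (\<lambda>t. A t \<omega>) k b - trunc_path (\<lambda>t. A t \<omega>) k a else 0)"
    if "\<omega> \<in> space N" for \<omega> a b
    by (rule interval_measure_Ioc[OF mono_trunc_path[OF good[OF that]] continuous_trunc_path[OF good[OF that]]])
  have un: "(\<Union>n. {- real n<..real n}) = UNIV"
  proof -
    have "\<exists>n. - real n < x \<and> x \<le> real n" for x :: real
      using reals_Archimedean2[of "\<bar>x\<bar>"] by (metis abs_less_iff less_imp_le minus_less_iff)
    then show ?thesis by auto
  qed
  have univ: "emeasure (?I \<omega>) UNIV = (SUP n. emeasure (?I \<omega>) {- real n<..real n})" for \<omega>
    by (subst SUP_emeasure_incseq) (auto simp: un incseq_def)
  have le: "emeasure (?I \<omega>) UNIV \<le> of_nat k" if "\<omega> \<in> space N" for \<omega>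
  proof -
    have "trunc_path (\<lambda>t. A t \<omega>) k y - trunc_path (\<lambda>t. A t \<omega>) k x \<le> real k" for x y
      using trunc_path_le[of "\<lambda>t. A t \<omega>" k y] trunc_path_nonneg[of "\<lambda>t. A t \<omega>" k x] by linarith
    then show ?thesis
      unfolding univ using that
      by (intro SUP_least) (simp add: Ioc ennreal_of_nat_eq_real_of_nat)
  qed
  show ?thesis
  proof (rule measurable_subprob_algebra_generated[OF sets_borel_Ioc])
    show "Int_stable (range (\<lambda>(a, b). {a<..b::real}))" by (auto simp: Int_stable_def)
    show "(\<lambda>\<omega>. emeasure (scale_measure (inverse (of_nat (Suc k))) (?I \<omega>)) A) \<in> borel_measurable N"
      if "A \<in> range (\<lambda>(a, b). {a<..b})" for A
      using that tm by (auto simp: Ioc cong: measurable_cong)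
    have "(\<lambda>\<omega>. SUP n. emeasure (?I \<omega>) {- real n<..real n}) \<in> borel_measurable N"
      using tm by (intro borel_measurable_SUP) (auto simp: Ioc cong: measurable_cong)
    then show "(\<lambda>\<omega>. emeasure (scale_measure (inverse (of_nat (Suc k))) (?I \<omega>)) UNIV) \<in> borel_measurable N"
      by (simp add: univ)
    show "subprob_space (scale_measure (inverse (of_nat (Suc k))) (?I \<omega>))" if "\<omega> \<in> space N" for \<omega>
    proof
      have "inverse (of_nat (Suc k)) * emeasure (?I \<omega>) UNIV \<le> inverse (of_nat (Suc k)) * of_nat (Suc k)"
        using le[OF that] by (intro mult_left_mono) (auto intro: order_trans)
      also have "\<dots> = (1::ennreal)"
        by (simp add: ennreal_of_nat_eq_real_of_nat inverse_ennreal ennreal_mult[symmetric] del: of_nat_Suc)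
      finally show "emeasure (scale_measure (inverse (of_nat (Suc k))) (?I \<omega>))
          (space (scale_measure (inverse (of_nat (Suc k))) (?I \<omega>))) \<le> 1"
        by (simp add: space_scale_measure)
    qed (simp add: space_scale_measure)
  qed auto
qed

text \<open>Paths outside G are replaced by the zero path, so that the truncated kernels are defined
  everywhere; on G the integral is the supremum of the measurable integrals against them.\<close>

lemma measurable_nn_integral_path_measure:
  assumes G[measurable]: "G \<in> sets N" and good: "\<And>\<omega>. \<omega> \<in> G \<Longrightarrow> good_path (\<lambda>t. A t \<omega>)"
    and A: "\<And>t. 0 \<le> t \<Longrightarrow> A t \<in> borel_measurable N"
    and f[measurable]: "(\<lambda>(\<omega>, s). f \<omega> s) \<in> borel_measurable (N \<Otimes>\<^sub>M borel)"
  shows "(\<lambda>\<omega>. if \<omega> \<in> G then \<integral>\<^sup>+s. f \<omega> s \<partial>path_measure (\<lambda>t. A t \<omega>) else 0) \<in> borel_measurable N"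
proof -
  define A' where "A' t \<omega> = (if \<omega> \<in> G then A t \<omega> else 0)" for t \<omega>
  have good': "good_path (\<lambda>t. A' t \<omega>)" for \<omega>
    using good by (cases "\<omega> \<in> G") (auto simp: A'_def good_path_def monotone_on_def)
  have A': "A' t \<in> borel_measurable N" if "0 \<le> t" for t
    unfolding A'_def[abs_def] using A[OF that] by measurable
  let ?I = "\<lambda>k \<omega>. interval_measure (trunc_path (\<lambda>t. A' t \<omega>) k)"
  have "(\<lambda>\<omega>. of_nat (Suc k) * (\<integral>\<^sup>+s. f \<omega> s \<partial>scale_measure (inverse (of_nat (Suc k))) (?I k \<omega>))) \<in> borel_measurable N" for k
    using nn_integral_measurable_subprob_algebra2[OF f measurable_interval_measure_kernel[of N A' k, OF good' A']]
    by measurable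
  moreover have "of_nat (Suc k) * (\<integral>\<^sup>+s. f \<omega> s \<partial>scale_measure (inverse (of_nat (Suc k))) (?I k \<omega>)) = (\<integral>\<^sup>+s. f \<omega> s \<partial>?I k \<omega>)"
    if "\<omega> \<in> space N" for k \<omega>
  proof -
    have [measurable]: "f \<omega> \<in> borel_measurable borel" using that by measurable
    have "of_nat (Suc k) * inverse (of_nat (Suc k)) = (1::ennreal)"
      by (simp add: ennreal_of_nat_eq_real_of_nat inverse_ennreal ennreal_mult[symmetric] del: of_nat_Suc)
    then show ?thesis by (simp add: nn_integral_scale_measure mult.assoc[symmetric] del: of_nat_Suc)
  qed
  ultimately have [measurable]: "(\<lambda>\<omega>. \<integral>\<^sup>+s. f \<omega> s \<partial>?I k \<omega>) \<in> borel_measurable N" for k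
    by (rule measurable_cong[THEN iffD1, rotated])
  have "(\<lambda>\<omega>. SUP k. \<integral>\<^sup>+s. f \<omega> s \<partial>?I k \<omega>) \<in> borel_measurable N"
    by measurable
  then have "(\<lambda>\<omega>. if \<omega> \<in> G then SUP k. \<integral>\<^sup>+s. f \<omega> s \<partial>?I k \<omega> else 0) \<in> borel_measurable N"
    by measurable
  then show ?thesis
  proof (rule measurable_cong[THEN iffD1, rotated])
    fix \<omega> assume \<omega>: "\<omega> \<in> space N"
    have [measurable]: "f \<omega> \<in> borel_measurable borel" using \<omega> by measurable
    show "(if \<omega> \<in> G then SUP k. \<integral>\<^sup>+s. f \<omega> s \<partial>?I k \<omega> else 0) =
      (if \<omega> \<in> G then \<integral>\<^sup>+s. f \<omega> s \<partial>path_measure (\<lambda>t. A t \<omega>) else 0)"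
      using nn_integral_path_measure[OF good, of \<omega> "f \<omega>"] by (auto simp: A'_def)
  qed
qed

section \<open>Measurability of the process\<close>

lemma space_borel_cpt [simp]: "space borel_cpt = UNIV"
  by (simp add: borel_cpt_def)

lemma sets_borel_cpt: "sets borel_cpt = sigma_sets UNIV {U. openin cpt_top U}"
  by (simp add: borel_cpt_def)

lemma openin_cpt_top_Some: "openin cpt_top (Some ` U) \<longleftrightarrow> open U"
  by (simp add: cpt_top_def)

lemma closedin_cpt_top_Some: "compact K \<Longrightarrow> closedin cpt_top (Some ` K)"
  by (simp add: cpt_top_def compact_imp_closed)

lemma topspace_cpt_top [simp]: "topspace cpt_top = UNIV"
  by (simp add: cpt_top_def UNIV_option_conv)

lemma sets_borel_cpt_Some:
  assumes "B \<in> sets borel" shows "Some ` B \<in> sets borel_cpt"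
proof -
  have "B \<in> sigma_sets UNIV {S. open S}" using assms by (simp add: borel_def)
  then show ?thesis
  proof induction
    case (Basic a)
    then show ?case by (auto simp: sets_borel_cpt openin_cpt_top_Some intro: sigma_sets.Basic)
  next
    case Empty
    then show ?case by simp
  next
    case (Compl a)
    have "Some ` UNIV \<in> sets borel_cpt"
      by (auto simp: sets_borel_cpt openin_cpt_top_Some intro: sigma_sets.Basic)
    moreover have "Some ` (UNIV - a) = Some ` UNIV - Some ` a" by auto
    ultimately show ?case using Compl.IH by (metis sets.Diff)
  next
    case (Union a)
    then show ?case by (simp add: image_UN)
  qed
qed

lemma sets_borel_cpt_None: "{None} \<in> sets borel_cpt"
proof -
  have "{None} = space borel_cpt - Some ` UNIV" by (auto simp: notin_range_Some)
  then show ?thesis using sets_borel_cpt_Some[of UNIV] by (metis sets.compl_sets sets.top space_borel)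
qed


text \<open>The other open sets contain the cemetery and are complements of images of closed subsets
  of E, so images of open sets are enough.\<close>

lemma measurable_into_cpt:
  assumes "\<And>U. open U \<Longrightarrow> f -` (Some ` U) \<inter> space N \<in> sets N"
  shows "f \<in> N \<rightarrow>\<^sub>M borel_cpt"
  unfolding borel_cpt_def
proof (rule measurable_measure_of)
  fix V :: "'a option set" assume "V \<in> {U. openin cpt_top U}"
  then have "(\<exists>U. V = Some ` U \<and> open U) \<or> (\<exists>C. V = insert None (Some ` (UNIV - C)) \<and> closed C)"
    by (auto simp: cpt_top_def openin_Alexandroff_compactification)
  moreover have "insert None (Some ` (UNIV - C)) = UNIV - Some ` C" for C :: "'a set"
    by (auto simp: UNIV_option_conv)
  ultimately consider U where "V = Some ` U" "open U" | C where "V = UNIV - Some ` C" "closed C"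
    by metis
  then show "f -` V \<inter> space N \<in> sets N"
  proof cases
    case 1 then show ?thesis using assms by simp
  next
    case 2
    have "f -` V \<inter> space N = space N - (f -` (Some ` UNIV) \<inter> space N - f -` (Some ` (- C)) \<inter> space N)"
      unfolding 2 by auto
    moreover have "f -` (Some ` UNIV) \<inter> space N \<in> sets N" "f -` (Some ` (- C)) \<inter> space N \<in> sets N"
      using 2 by (intro assms; simp add: open_Compl)+
    ultimately show ?thesis by (metis sets.Diff sets.top)
  qed
qed auto

lemma measurable_Some [measurable]: "Some \<in> borel \<rightarrow>\<^sub>M borel_cpt"
  by (rule measurable_into_cpt) (simp add: inj_vimage_image_eq)

lemma measurable_ext0 [measurable]:
  assumes f: "f \<in> borel_measurable borel"
  shows "ext0 f \<in> borel_measurable borel_cpt"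
proof (rule measurableI)
  fix B :: "'b set" assume "B \<in> sets borel"
  then have "Some ` (f -` B) \<in> sets borel_cpt"
    using measurable_sets[OF f] by (intro sets_borel_cpt_Some) simp
  moreover have "ext0 f -` B \<inter> space borel_cpt = Some ` (f -` B) \<union> (if 0 \<in> B then {None} else {})"
    by (auto simp: ext0_def split: option.splits)
  ultimately show "ext0 f -` B \<inter> space borel_cpt \<in> sets borel_cpt"
    using sets_borel_cpt_None by (cases "0 \<in> B") (auto simp del: Un_insert_right)
qed simp

lemma ext0_simps [simp]: "ext0 f None = 0" "ext0 f (Some x) = f x"
  by (simp_all add: ext0_def)

section \<open>Coordinates and shifts of a Hunt process\<close>

locale hunt =
  fixes M :: "('a::{metric_space, second_countable_topology}, 'w) process"
  assumes lc: "locally_compact_space (euclidean :: 'a topology)" and hunt: "hunt_process M"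
begin

abbreviation "\<F> \<equiv> natural_filt M top"

lemma family: "markov_family M" and strong: "strong_markov M"
  using hunt by (auto simp: hunt_process_def)

lemma law_kernel [measurable]: "law M \<in> borel_cpt \<rightarrow>\<^sub>M prob_algebra \<F>"
  using family by (simp add: markov_family_def)

lemma law_kernel_sub: "law M \<in> borel_cpt \<rightarrow>\<^sub>M subprob_algebra \<F>"
  by (rule measurable_prob_algebraD[OF law_kernel])

lemma prob_law: "prob_space (law M y)" and sets_law [measurable_cong, simp]: "sets (law M y) = sets \<F>"
  using measurable_space[OF law_kernel, of y] by (auto simp: space_prob_algebra)

lemma law_Some_kernel [measurable]: "(\<lambda>x. law M (Some x)) \<in> borel \<rightarrow>\<^sub>M subprob_algebra \<F>"
  using measurable_compose[OF measurable_Some law_kernel_sub] .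

lemma space_filt_nat [simp]: "space (natural_filt M t) = outcomes M"
  unfolding natural_filt_def by (rule space_measure_of) auto

lemma space_law [simp]: "space (law M y) = outcomes M"
  using sets_eq_imp_space_eq[OF sets_law] by simp

lemma sets_natural_filt:
  "sets (natural_filt M t) = sigma_sets (outcomes M)
     {coord M s -` B \<inter> outcomes M | s B. 0 \<le> s \<and> ennreal s \<le> t \<and> B \<in> sets borel_cpt}"
  unfolding natural_filt_def by (rule sets_measure_of) auto

lemma sets_natural_filt_mono: "s \<le> t \<Longrightarrow> sets (natural_filt M s) \<subseteq> sets (natural_filt M t)"
  unfolding sets_natural_filt by (rule sigma_sets_mono') (auto intro: order_trans)

lemma sets_natural_filt_top: "A \<in> sets (natural_filt M t) \<Longrightarrow> A \<in> sets \<F>"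
  using sets_natural_filt_mono[of t top] by auto

lemma coord_measurable_filt: "0 \<le> s \<Longrightarrow> ennreal s \<le> t \<Longrightarrow> coord M s \<in> natural_filt M t \<rightarrow>\<^sub>M borel_cpt"
  by (rule measurableI) (auto simp: sets_natural_filt intro!: sigma_sets.Basic)

lemma coord_measurable: "0 \<le> s \<Longrightarrow> coord M s \<in> \<F> \<rightarrow>\<^sub>M borel_cpt"
  by (rule coord_measurable_filt) auto

lemma start: "AE \<omega> in law M y. coord M 0 \<omega> = y"
  using family by (auto simp: markov_family_def)

lemma dead: "\<omega> \<in> outcomes M \<Longrightarrow> 0 \<le> s \<Longrightarrow> s \<le> t \<Longrightarrow> coord M s \<omega> = None \<Longrightarrow> coord M t \<omega> = None"
  using family by (auto simp: markov_family_def)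

lemma right_cont: "\<omega> \<in> outcomes M \<Longrightarrow> 0 \<le> t \<Longrightarrow> limitin cpt_top (\<lambda>s. coord M s \<omega>) (coord M t \<omega>) (at_right t)"
  using family by (auto simp: markov_family_def)

lemma shift_outcomes: "\<omega> \<in> outcomes M \<Longrightarrow> 0 \<le> t \<Longrightarrow> shift M t \<omega> \<in> outcomes M"
  and coord_shift: "\<omega> \<in> outcomes M \<Longrightarrow> 0 \<le> t \<Longrightarrow> 0 \<le> s \<Longrightarrow> coord M s (shift M t \<omega>) = coord M (s + t) \<omega>"
  using family by (auto simp: markov_family_def)

lemma compact_nbhd:
  fixes U :: "'a set"
  assumes "open U" "x \<in> U"
  obtains e where "e > 0" "compact (cball x e)" "cball x e \<subseteq> U"
proof -
  have "\<exists>V K. open V \<and> compact K \<and> x \<in> V \<and> V \<subseteq> K"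
    using lc unfolding locally_compact_space_def by auto
  then obtain V K where V: "open V" "compact K" "x \<in> V" "V \<subseteq> K"
    by blast
  then obtain e where e: "e > 0" "cball x e \<subseteq> V \<inter> U"
    using assms open_contains_cball[of "V \<inter> U"] by (meson IntI open_Int)
  then have "compact (cball x e)"
    using compact_Int_closed[OF V(2), of "cball x e"] V(4) by (metis Int_absorb1 closed_cball le_inf_iff order_trans inf_commute)
  then show ?thesis using that e by auto
qed

text \<open>The event that X_t lies in U is rewritten through countably many conditions on a
  sequence of later times. Passing from U to compact closures of basic sets inside U makes the
  converse work: such a set is closed in the compactification, so the limit cannot leave it.\<close>

lemma coord_in_open_iff:
  fixes U :: "'a set"
  assumes B: "topological_basis \<B>" and U: "open U" and \<omega>: "\<omega> \<in> outcomes M" and t: "0 \<le> t"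
    and s: "\<And>n. t < s n" "s \<longlonglongrightarrow> t"
  shows "coord M t \<omega> \<in> Some ` U \<longleftrightarrow>
    (\<exists>b \<in> {b \<in> \<B>. compact (closure b) \<and> closure b \<subseteq> U}. \<forall>\<^sub>F n in sequentially. coord M (s n) \<omega> \<in> Some ` closure b)"
proof -
  have "filterlim s (at_right t) sequentially"
    using s by (simp add: filterlim_at less_imp_neq[THEN not_sym])
  then have lim: "limitin cpt_top (\<lambda>n. coord M (s n) \<omega>) (coord M t \<omega>) sequentially"
    using right_cont[OF \<omega> t] by (auto simp: limitin_def intro: eventually_compose_filterlim)
  show ?thesis
  proof
    assume "coord M t \<omega> \<in> Some ` U"
    then obtain x where x: "x \<in> U" "coord M t \<omega> = Some x" by auto
    obtain e where e: "e > 0" "compact (cball x e)" "cball x e \<subseteq> U" using compact_nbhd[OF U x(1)] .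
    obtain b where b: "b \<in> \<B>" "x \<in> b" "b \<subseteq> ball x e"
      using topological_basisE[OF B open_ball[of x e], of x] e by auto
    have cl: "closure b \<subseteq> cball x e"
      using b by (meson ball_subset_cball closed_cball closure_minimal order_trans)
    then have "compact (closure b)" using compact_Int_closed[OF e(2) closed_closure, of b] by (simp add: inf_absorb2)
    moreover have "\<forall>\<^sub>F n in sequentially. coord M (s n) \<omega> \<in> Some ` b"
      using lim x b openin_cpt_top_Some[of b] topological_basis_open[OF B] unfolding limitin_def by auto
    then have "\<forall>\<^sub>F n in sequentially. coord M (s n) \<omega> \<in> Some ` closure b"
      by eventually_elim (use closure_subset in blast)
    ultimately show "\<exists>b \<in> {b \<in> \<B>. compact (closure b) \<and> closure b \<subseteq> U}.
        \<forall>\<^sub>F n in sequentially. coord M (s n) \<omega> \<in> Some ` closure b"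
      using b cl e by auto
  next
    assume "\<exists>b \<in> {b \<in> \<B>. compact (closure b) \<and> closure b \<subseteq> U}.
        \<forall>\<^sub>F n in sequentially. coord M (s n) \<omega> \<in> Some ` closure b"
    then obtain b where b: "compact (closure b)" "closure b \<subseteq> U"
      "\<forall>\<^sub>F n in sequentially. coord M (s n) \<omega> \<in> Some ` closure b" by auto
    have "coord M t \<omega> \<in> Some ` closure b"
    proof (rule ccontr)
      assume "coord M t \<omega> \<notin> Some ` closure b"
      moreover have "openin cpt_top (UNIV - Some ` closure b)"
        using closedin_cpt_top_Some[OF b(1)] by (simp add: closedin_def)
      ultimately have "\<forall>\<^sub>F n in sequentially. coord M (s n) \<omega> \<in> UNIV - Some ` closure b"
        using lim unfolding limitin_def by auto
      with b(3) have "\<forall>\<^sub>F n in sequentially. False" by eventually_elim auto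
      then show False by simp
    qed
    then show "coord M t \<omega> \<in> Some ` U" using b by auto
  qed
qed

lemma joint_coord_measurable:
  "(\<lambda>(s, \<omega>). coord M (max 0 s) \<omega>) \<in> borel \<Otimes>\<^sub>M \<F> \<rightarrow>\<^sub>M borel_cpt"
proof (rule measurable_into_cpt)
  fix U :: "'a set" assume U: "open U"
  obtain \<B> :: "'a set set" where \<B>: "countable \<B>" "topological_basis \<B>"
    using ex_countable_basis by auto
  \<comment> \<open>Dyadic times, countably many for each n. The added 1 keeps \<open>q n s\<close>
    strictly to the right of s even when s is dyadic, as the approximation from the right
    requires.\<close>
  define q :: "nat \<Rightarrow> real \<Rightarrow> real" where "q n s = (of_int \<lfloor>2 ^ n * max 0 s\<rfloor> + 1) / 2 ^ n" for n s
  have q: "max 0 s < q n s" "q n s \<le> max 0 s + (1/2) ^ n" for n s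
  proof -
    have "z < (of_int \<lfloor>2 ^ n * z\<rfloor> + 1) / 2 ^ n" "(of_int \<lfloor>2 ^ n * z\<rfloor> + 1) / 2 ^ n \<le> z + (1/2) ^ n" for z :: real
      using floor_correct[of "2 ^ n * z"] by (simp_all add: field_simps power_divide)
    then show "max 0 s < q n s" "q n s \<le> max 0 s + (1/2) ^ n"
      unfolding q_def by blast+
  qed
  have lim: "(\<lambda>n. q n s) \<longlonglongrightarrow> max 0 s" for s
  proof (rule tendsto_sandwich[of "\<lambda>n. max 0 s" _ _ "\<lambda>n. max 0 s + (1/2) ^ n"])
    show "(\<lambda>n. max 0 s + (1/2) ^ n) \<longlonglongrightarrow> max 0 s"
      using tendsto_add[OF tendsto_const LIMSEQ_realpow_zero[of "1/2::real"], of "max 0 s"] by simp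
  qed (use q in \<open>simp_all add: less_imp_le\<close>)
  have qm: "(\<lambda>(s, \<omega>). coord M (q n s) \<omega>) \<in> borel \<Otimes>\<^sub>M \<F> \<rightarrow>\<^sub>M borel_cpt" for n
  proof -
    have "(\<lambda>z. coord M (max 0 ((of_int \<lfloor>2 ^ n * max 0 (fst z :: real)\<rfloor> + 1) / 2 ^ n)) (snd z)) \<in> borel \<Otimes>\<^sub>M \<F> \<rightarrow>\<^sub>M borel_cpt"
    proof (rule measurable_compose_countable[where f="\<lambda>i z. coord M (max 0 ((of_int i + 1) / 2 ^ n)) (snd z)"])
      show "(\<lambda>z. coord M (max 0 ((of_int i + 1) / 2 ^ n)) (snd z)) \<in> borel \<Otimes>\<^sub>M \<F> \<rightarrow>\<^sub>M borel_cpt" for i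
        by (rule measurable_compose[OF measurable_snd coord_measurable]) simp
      show "(\<lambda>z. \<lfloor>2 ^ n * max 0 (fst z :: real)\<rfloor>) \<in> borel \<Otimes>\<^sub>M \<F> \<rightarrow>\<^sub>M count_space UNIV"
        by measurable
    qed
    moreover have "max 0 ((of_int \<lfloor>2 ^ n * max 0 s\<rfloor> + 1) / 2 ^ n) = q n s" for s :: real
    proof -
      have "0 \<le> q n s" using q(1)[of s n] by (rule order_trans[OF max.cobounded1 less_imp_le])
      then show ?thesis by (simp add: q_def)
    qed
    ultimately show ?thesis by (simp add: case_prod_beta)
  qed
  have "(\<lambda>(s, \<omega>). coord M (max 0 s) \<omega>) -` (Some ` U) \<inter> space (borel \<Otimes>\<^sub>M \<F>) =
    (\<Union>b \<in> {b \<in> \<B>. compact (closure b) \<and> closure b \<subseteq> U}. \<Union>n0. \<Inter>n\<in>{n0..}.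
       (\<lambda>(s, \<omega>). coord M (q n s) \<omega>) -` (Some ` closure b) \<inter> space (borel \<Otimes>\<^sub>M \<F>))"
  proof (intro set_eqI)
    fix z :: "real \<times> 'w"
    obtain s \<omega> where z: "z = (s, \<omega>)" by (cases z)
    show "z \<in> (\<lambda>(s, \<omega>). coord M (max 0 s) \<omega>) -` (Some ` U) \<inter> space (borel \<Otimes>\<^sub>M \<F>) \<longleftrightarrow>
      z \<in> (\<Union>b \<in> {b \<in> \<B>. compact (closure b) \<and> closure b \<subseteq> U}. \<Union>n0. \<Inter>n\<in>{n0..}.
       (\<lambda>(s, \<omega>). coord M (q n s) \<omega>) -` (Some ` closure b) \<inter> space (borel \<Otimes>\<^sub>M \<F>))"
    proof (cases "\<omega> \<in> outcomes M")
      case True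
      show ?thesis
        using coord_in_open_iff[OF \<B>(2) U True max.cobounded1 q(1) lim, of s] True
        by (simp add: z space_pair_measure eventually_sequentially) (simp add: Ball_def)
    next
      case False then show ?thesis by (auto simp: z space_pair_measure)
    qed
  qed
  also have "\<dots> \<in> sets (borel \<Otimes>\<^sub>M \<F>)"
  proof -
    have "(\<lambda>(s, \<omega>). coord M (q n s) \<omega>) -` (Some ` closure b) \<inter> space (borel \<Otimes>\<^sub>M \<F>) \<in> sets (borel \<Otimes>\<^sub>M \<F>)" for b n
      by (rule measurable_sets[OF qm sets_borel_cpt_Some]) simp
    then have *: "(\<Union>n0. \<Inter>n\<in>{n0..}. (\<lambda>(s, \<omega>). coord M (q n s) \<omega>) -` (Some ` closure b) \<inter> space (borel \<Otimes>\<^sub>M \<F>)) \<in> sets (borel \<Otimes>\<^sub>M \<F>)" for b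
      by (intro sets.countable_UN image_subsetI sets.countable_INT') auto
    show ?thesis using \<B>(1) by (intro sets.countable_UN''[OF _ *]) simp
  qed
  finally show "(\<lambda>(s, \<omega>). coord M (max 0 s) \<omega>) -` (Some ` U) \<inter> space (borel \<Otimes>\<^sub>M \<F>) \<in> sets (borel \<Otimes>\<^sub>M \<F>)" .
qed

lemma coord_compose_measurable [measurable (raw)]:
  assumes "f \<in> borel_measurable L" "g \<in> L \<rightarrow>\<^sub>M \<F>"
  shows "(\<lambda>x. coord M (max 0 (f x)) (g x)) \<in> L \<rightarrow>\<^sub>M borel_cpt"
  using measurable_compose[OF measurable_Pair[OF assms] joint_coord_measurable] by simp

lemma shift_measurable:
  assumes r: "0 \<le> r" shows "shift M r \<in> \<F> \<rightarrow>\<^sub>M \<F>"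
proof -
  have "shift M r \<in> \<F> \<rightarrow>\<^sub>M sigma (outcomes M)
     {coord M s -` B \<inter> outcomes M | s B. 0 \<le> s \<and> ennreal s \<le> top \<and> B \<in> sets borel_cpt}"
  proof (rule measurable_measure_of)
    fix C assume "C \<in> {coord M s -` B \<inter> outcomes M | s B. 0 \<le> s \<and> ennreal s \<le> top \<and> B \<in> sets borel_cpt}"
    then obtain s B where sB: "C = coord M s -` B \<inter> outcomes M" "0 \<le> s" "B \<in> sets borel_cpt" by auto
    have "shift M r -` C \<inter> space \<F> = coord M (s + r) -` B \<inter> space \<F>"
      using sB r by (auto simp: coord_shift shift_outcomes)
    also have "\<dots> \<in> sets \<F>"
      using sB r by (intro measurable_sets[OF coord_measurable]) auto
    finally show "shift M r -` C \<inter> space \<F> \<in> sets \<F>" .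
  qed (auto simp: r shift_outcomes)
  then show ?thesis by (simp add: natural_filt_def)
qed

section \<open>The Markov property\<close>

lemma sets_natural_filt_subset_filt: "A \<in> sets (natural_filt M t) \<Longrightarrow> A \<in> sets (filt M t)"
proof -
  assume A: "A \<in> sets (natural_filt M t)"
  then have "A \<subseteq> outcomes M" using sets.sets_into_space by fastforce
  then show ?thesis
    unfolding filt_def using A by (subst sets_measure_of) (auto intro!: sigma_sets.Basic bexI[of _ A])
qed

lemma filtration_filt: "filtration (outcomes M) (filt M)"
proof
  show "space (filt M t) = outcomes M" for t
    unfolding filt_def by (rule space_measure_of) auto
  fix s t :: ennreal assume "s \<le> t"
  then show "sets (filt M s) \<subseteq> sets (filt M t)"
  proof -
    let ?G = "\<lambda>t. {A. A \<subseteq> outcomes M \<and>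
         (\<forall>\<nu> \<in> space (prob_algebra borel_cpt). \<exists>B \<in> sets (natural_filt M t).
            (A - B) \<union> (B - A) \<in> null_sets (completion (law_from M \<nu>)))}"
    have "?G s \<subseteq> ?G t"
    proof safe
      fix A and \<nu> :: "'a option measure" assume "\<forall>\<nu> \<in> space (prob_algebra borel_cpt). \<exists>B \<in> sets (natural_filt M s).
            (A - B) \<union> (B - A) \<in> null_sets (completion (law_from M \<nu>))" "\<nu> \<in> space (prob_algebra borel_cpt)"
      then obtain B where "B \<in> sets (natural_filt M s)" "(A - B) \<union> (B - A) \<in> null_sets (completion (law_from M \<nu>))"
        by blast
      then show "\<exists>B \<in> sets (natural_filt M t). (A - B) \<union> (B - A) \<in> null_sets (completion (law_from M \<nu>))"
        using sets_natural_filt_mono[OF \<open>s \<le> t\<close>] by blast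
    qed
    moreover have "sets (filt M t) = sigma_sets (outcomes M) (?G t)" for t
      unfolding filt_def by (rule sets_measure_of) auto
    ultimately show ?thesis by (simp add: sigma_sets_mono')
  qed
qed

lemma return_space: "return borel_cpt y \<in> space (prob_algebra borel_cpt)"
  by (simp add: space_prob_algebra prob_space_return)

lemma law_from_return: "law_from M (return borel_cpt y) = law M y"
  unfolding law_from_def by (rule bind_return[OF law_kernel_sub]) simp

text \<open>The strong Markov property at the constant time r, started from a point mass. The
  completion disappears because the event is measurable for the natural sigma-field and
  \<open>nn_integral\<close> does not see completions.\<close>

lemma markov_set:
  assumes r: "0 \<le> r" and s: "0 \<le> s" and A: "A \<in> sets (natural_filt M (ennreal r))" and B: "B \<in> sets borel_cpt"
  shows "emeasure (law M y) {\<omega> \<in> A. coord M (r + s) \<omega> \<in> B} =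
    (\<integral>\<^sup>+\<omega>\<in>A. emeasure (law M (coord M r \<omega>)) {\<omega>' \<in> outcomes M. coord M s \<omega>' \<in> B} \<partial>law M y)"
proof -
  interpret filtration "outcomes M" "filt M" by (rule filtration_filt)
  have "A \<in> sets (pre_sigma (\<lambda>_. ennreal r))"
  proof (rule sets_pre_sigmaI)
    show "{\<omega> \<in> A. ennreal r \<le> t} \<in> sets (filt M t)" for t
    proof (cases "ennreal r \<le> t")
      case True
      then have "A \<in> sets (natural_filt M t)" using A sets_natural_filt_mono by blast
      then show ?thesis using True sets_natural_filt_subset_filt by simp
    qed simp
  qed (rule stopping_time_const)
  then have "emeasure (completion (law M y)) {\<omega> \<in> A. coord M (enn2real (ennreal r) + s) \<omega> \<in> B} =
    (\<integral>\<^sup>+\<omega>\<in>A. emeasure (law M (coord M (enn2real (ennreal r)) \<omega>)) {\<omega>' \<in> outcomes M. coord M s \<omega>' \<in> B} \<partial>completion (law M y))"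
    using strong[unfolded strong_markov_def, THEN conjunct2, rule_format,
        OF return_space stopping_time_const s B, of A "ennreal r" y]
    by (simp add: law_from_return)
  moreover have "{\<omega> \<in> A. coord M (r + s) \<omega> \<in> B} \<in> sets (law M y)"
  proof -
    have "{\<omega> \<in> A. coord M (r + s) \<omega> \<in> B} = A \<inter> (coord M (r + s) -` B \<inter> space \<F>)"
      using sets.sets_into_space[OF A] by auto
    then show ?thesis
      using sets_natural_filt_top[OF A] measurable_sets[OF coord_measurable B, of "r + s"] r s by simp
  qed
  ultimately show ?thesis using r by (simp add: nn_integral_completion)
qed

lemma markov_fun:
  assumes r: "0 \<le> r" and s: "0 \<le> s" and A: "A \<in> sets (natural_filt M (ennreal r))"
    and g: "g \<in> borel_measurable borel_cpt"
  shows "(\<integral>\<^sup>+\<omega>\<in>A. g (coord M (r + s) \<omega>) \<partial>law M y) =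
    (\<integral>\<^sup>+\<omega>\<in>A. (\<integral>\<^sup>+\<omega>'. g (coord M s \<omega>') \<partial>law M (coord M r \<omega>)) \<partial>law M y)"
proof -
  note [measurable] = coord_measurable[OF r] coord_measurable[OF s] coord_measurable[of "r + s"] sets_natural_filt_top[OF A]
  have rs: "0 \<le> r + s" using r s by simp
  note [measurable] = coord_measurable[OF rs]
  note law_kernel_sub[measurable]
  have inner[measurable]: "(\<lambda>z. \<integral>\<^sup>+\<omega>'. g (coord M s \<omega>') \<partial>law M z) \<in> borel_measurable borel_cpt"
    if [measurable]: "g \<in> borel_measurable borel_cpt" for g :: "_ \<Rightarrow> ennreal"
    by (rule measurable_compose[OF law_kernel_sub nn_integral_measurable_subprob_algebra]) measurable
  show ?thesis using g
  proof (induction rule: borel_measurable_induct)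
    case (cong f g)
    then show ?case by simp
  next
    case (set B)
    have [measurable]: "B \<in> sets borel_cpt" by fact
    have "(\<integral>\<^sup>+\<omega>\<in>A. indicator B (coord M (r + s) \<omega>) \<partial>law M y) =
        (\<integral>\<^sup>+\<omega>. indicator {\<omega> \<in> A. coord M (r + s) \<omega> \<in> B} \<omega> \<partial>law M y)"
      by (intro nn_integral_cong) (auto split: split_indicator)
    also have "\<dots> = emeasure (law M y) {\<omega> \<in> A. coord M (r + s) \<omega> \<in> B}"
    proof (rule nn_integral_indicator)
      have "{\<omega> \<in> A. coord M (r + s) \<omega> \<in> B} = A \<inter> (coord M (r + s) -` B \<inter> space \<F>)"
        using sets.sets_into_space[OF A] by auto
      then show "{\<omega> \<in> A. coord M (r + s) \<omega> \<in> B} \<in> sets (law M y)"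
        using sets_natural_filt_top[OF A] measurable_sets[OF coord_measurable[OF rs] set] by simp
    qed
    also have "\<dots> = (\<integral>\<^sup>+\<omega>\<in>A. emeasure (law M (coord M r \<omega>)) {\<omega>' \<in> outcomes M. coord M s \<omega>' \<in> B} \<partial>law M y)"
      by (rule markov_set[OF r s A set])
    also have "(\<lambda>z. emeasure (law M z) {\<omega>' \<in> outcomes M. coord M s \<omega>' \<in> B}) = (\<lambda>z. \<integral>\<^sup>+\<omega>'. indicator B (coord M s \<omega>') \<partial>law M z)"
    proof
      fix z
      have "{\<omega>' \<in> outcomes M. coord M s \<omega>' \<in> B} \<in> sets (law M z)"
        using measurable_sets[OF coord_measurable[OF s] set] by (simp add: vimage_def Int_def conj_commute)
      then have "emeasure (law M z) {\<omega>' \<in> outcomes M. coord M s \<omega>' \<in> B} = (\<integral>\<^sup>+\<omega>'. indicator {\<omega>' \<in> outcomes M. coord M s \<omega>' \<in> B} \<omega>' \<partial>law M z)"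
        by (simp add: nn_integral_indicator)
      also have "\<dots> = (\<integral>\<^sup>+\<omega>'. indicator B (coord M s \<omega>') \<partial>law M z)"
        by (intro nn_integral_cong) (auto split: split_indicator)
      finally show "emeasure (law M z) {\<omega>' \<in> outcomes M. coord M s \<omega>' \<in> B} = (\<integral>\<^sup>+\<omega>'. indicator B (coord M s \<omega>') \<partial>law M z)" .
    qed
    finally show ?case .
  next
    case (mult u v)
    have [measurable]: "u \<in> borel_measurable borel_cpt" by fact
    show ?case
      using mult.IH by (simp add: nn_integral_cmult mult.assoc)
  next
    case (add u v)
    have [measurable]: "u \<in> borel_measurable borel_cpt" "v \<in> borel_measurable borel_cpt" by fact+
    show ?case
      using add.IH by (simp add: nn_integral_add distrib_right)
  next
    case (seq U)
    have [measurable]: "U i \<in> borel_measurable borel_cpt" for i by fact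
    have inc: "incseq U" by fact
    have "(\<integral>\<^sup>+\<omega>\<in>A. (SUP i. U i (coord M (r + s) \<omega>)) \<partial>law M y) = (SUP i. \<integral>\<^sup>+\<omega>\<in>A. U i (coord M (r + s) \<omega>) \<partial>law M y)"
      unfolding SUP_mult_right_ennreal
      by (rule nn_integral_monotone_convergence_SUP)
         (use inc in \<open>auto simp: incseq_def le_fun_def intro!: mult_right_mono\<close>)
    also have "\<dots> = (SUP i. \<integral>\<^sup>+\<omega>\<in>A. (\<integral>\<^sup>+\<omega>'. U i (coord M s \<omega>') \<partial>law M (coord M r \<omega>)) \<partial>law M y)"
      by (simp only: seq.IH)
    also have "\<dots> = (\<integral>\<^sup>+\<omega>\<in>A. (SUP i. \<integral>\<^sup>+\<omega>'. U i (coord M s \<omega>') \<partial>law M (coord M r \<omega>)) \<partial>law M y)"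
      unfolding SUP_mult_right_ennreal
      by (rule nn_integral_monotone_convergence_SUP[symmetric])
         (use inc in \<open>auto simp: incseq_def le_fun_def intro!: mult_right_mono nn_integral_mono\<close>)
    also have "\<dots> = (\<integral>\<^sup>+\<omega>\<in>A. (\<integral>\<^sup>+\<omega>'. (SUP i. U i (coord M s \<omega>')) \<partial>law M (coord M r \<omega>)) \<partial>law M y)"
      by (subst nn_integral_monotone_convergence_SUP)
         (use inc in \<open>auto simp: incseq_def le_fun_def\<close>)
    finally show ?case by (simp only: Sup_apply image_comp comp_def)
  qed
qed

lemma cyl_sets:
  assumes "finite J" "\<And>t. t \<in> J \<Longrightarrow> 0 \<le> t" "\<And>t. t \<in> J \<Longrightarrow> B t \<in> sets borel_cpt"
  shows "{\<omega> \<in> outcomes M. \<forall>t\<in>J. coord M t \<omega> \<in> B t} \<in> sets \<F>"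
proof -
  have "{\<omega> \<in> outcomes M. \<forall>t\<in>J. coord M t \<omega> \<in> B t} = outcomes M \<inter> (\<Inter>t\<in>J. coord M t -` B t \<inter> space \<F>)"
    by auto
  also have "\<dots> \<in> sets \<F>"
  proof (cases "J = {}")
    case True
    then show ?thesis using sets.top[of \<F>] by simp
  next
    case False
    have "outcomes M \<in> sets \<F>" using sets.top[of \<F>] by simp
    then show ?thesis using False assms
      by (intro sets.Int sets.finite_INT measurable_sets[OF coord_measurable]) auto
  qed
  finally show ?thesis .
qed

text \<open>The conditioning event \<open>A\<close> makes the induction on the number of time points go through.\<close>

lemma markov_cyl:
  assumes "finite J" "\<And>t. t \<in> J \<Longrightarrow> 0 \<le> t" "\<And>t. t \<in> J \<Longrightarrow> B t \<in> sets borel_cpt"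
    and "0 \<le> r" "A \<in> sets (natural_filt M (ennreal r))"
  shows "emeasure (law M y) {\<omega> \<in> A. \<forall>t\<in>J. coord M (r + t) \<omega> \<in> B t} =
    (\<integral>\<^sup>+\<omega>\<in>A. emeasure (law M (coord M r \<omega>)) {\<omega>' \<in> outcomes M. \<forall>t\<in>J. coord M t \<omega>' \<in> B t} \<partial>law M y)"
  using assms
proof (induction "card J" arbitrary: J B r A y)
  case 0
  then have "J = {}" by simp
  have A: "A \<in> sets (law M y)" using sets_natural_filt_top[OF 0(6)] by simp
  have "emeasure (law M z) (outcomes M) = 1" for z
    using prob_space.emeasure_space_1[OF prob_law, of z] by simp
  then show ?case using \<open>J = {}\<close> A by simp
next
  case (Suc n)
  \<comment> \<open>The earliest time is split off: conditioning at r + t0 leaves the times J',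
    counted from t0, to the induction hypothesis, with the condition at t0 absorbed into the
    event.\<close>
  define t0 where "t0 = Min J"
  define J' where "J' = (\<lambda>t. t - t0) ` (J - {t0})"
  define B' where "B' t = B (t + t0)" for t
  have ne: "J \<noteq> {}" using Suc.hyps(2) by auto
  have t0: "t0 \<in> J" "0 \<le> t0" using ne Suc.prems by (auto simp: t0_def)
  have t0_le: "t0 \<le> t" if "t \<in> J" for t using that Suc.prems(1) by (simp add: t0_def)
  have "card J' = n"
    unfolding J'_def using Suc.hyps(2) t0 Suc.prems(1) by (subst card_image) (auto simp: inj_on_def)
  have J': "finite J'" "\<And>t. t \<in> J' \<Longrightarrow> 0 \<le> t" "\<And>t. t \<in> J' \<Longrightarrow> B' t \<in> sets borel_cpt"
    using Suc.prems t0_le by (auto simp: J'_def B'_def)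
  have all_iff: "(\<forall>t\<in>J. P t) \<longleftrightarrow> P t0 \<and> (\<forall>t\<in>J'. P (t0 + t))" for P
    using t0 by (auto simp: J'_def)
  have IH: "emeasure (law M y) {\<omega> \<in> A. \<forall>t\<in>J'. coord M (r + t) \<omega> \<in> B' t} =
    (\<integral>\<^sup>+\<omega>\<in>A. emeasure (law M (coord M r \<omega>)) {\<omega>' \<in> outcomes M. \<forall>t\<in>J'. coord M t \<omega>' \<in> B' t} \<partial>law M y)"
    if "0 \<le> r" "A \<in> sets (natural_filt M (ennreal r))" for r A y
    using Suc.hyps(1)[of J' B' r A y] \<open>card J' = n\<close> J' that by blast
  define Q where "Q z = emeasure (law M z) {\<omega>' \<in> outcomes M. \<forall>t\<in>J'. coord M t \<omega>' \<in> B' t}" for z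
  have Q: "Q \<in> borel_measurable borel_cpt"
    unfolding Q_def using cyl_sets[OF J'] by (intro measurable_emeasure_kernel[OF law_kernel_sub])
  have Bt0: "B t0 \<in> sets borel_cpt" using Suc.prems t0 by simp
  have QB: "(\<lambda>z. Q z * indicator (B t0) z) \<in> borel_measurable borel_cpt"
    using Q Bt0 by measurable
  have step: "emeasure (law M y) {\<omega> \<in> A. \<forall>t\<in>J. coord M (r + t) \<omega> \<in> B t} =
      (\<integral>\<^sup>+\<omega>\<in>A. (Q (coord M (r + t0) \<omega>) * indicator (B t0) (coord M (r + t0) \<omega>)) \<partial>law M y)"
    if r: "0 \<le> r" and A: "A \<in> sets (natural_filt M (ennreal r))" for r A y
  proof -
    have A': "{\<omega> \<in> A. coord M (r + t0) \<omega> \<in> B t0} \<in> sets (natural_filt M (ennreal (r + t0)))"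
    proof -
      have "{\<omega> \<in> A. coord M (r + t0) \<omega> \<in> B t0} = A \<inter> (coord M (r + t0) -` B t0 \<inter> space (natural_filt M (ennreal (r + t0))))"
        using sets.sets_into_space[OF A] by auto
      moreover have "A \<in> sets (natural_filt M (ennreal (r + t0)))"
        using A sets_natural_filt_mono[of "ennreal r" "ennreal (r + t0)"] t0 by (auto simp: ennreal_leI)
      ultimately show ?thesis
        using measurable_sets[OF coord_measurable_filt Bt0, of "r + t0"] r t0 by auto
    qed
    have "{\<omega> \<in> A. \<forall>t\<in>J. coord M (r + t) \<omega> \<in> B t} =
      {\<omega> \<in> {\<omega> \<in> A. coord M (r + t0) \<omega> \<in> B t0}. \<forall>t\<in>J'. coord M (r + t0 + t) \<omega> \<in> B' t}"
      by (auto simp: all_iff B'_def add_ac)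
    then have "emeasure (law M y) {\<omega> \<in> A. \<forall>t\<in>J. coord M (r + t) \<omega> \<in> B t} =
      (\<integral>\<^sup>+\<omega>\<in>{\<omega> \<in> A. coord M (r + t0) \<omega> \<in> B t0}. Q (coord M (r + t0) \<omega>) \<partial>law M y)"
      using IH[OF _ A', of y] r t0 by (simp add: Q_def)
    also have "\<dots> = (\<integral>\<^sup>+\<omega>\<in>A. (Q (coord M (r + t0) \<omega>) * indicator (B t0) (coord M (r + t0) \<omega>)) \<partial>law M y)"
      by (intro nn_integral_cong) (auto split: split_indicator)
    finally show ?thesis .
  qed
  have inner: "emeasure (law M z) {\<omega>' \<in> outcomes M. \<forall>t\<in>J. coord M t \<omega>' \<in> B t} =
      (\<integral>\<^sup>+\<omega>'. (Q (coord M t0 \<omega>') * indicator (B t0) (coord M t0 \<omega>')) \<partial>law M z)" for z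
  proof -
    have "outcomes M \<in> sets (natural_filt M (ennreal 0))"
      using sets.top[of "natural_filt M (ennreal 0)"] by simp
    from step[OF order_refl this, of z] show ?thesis
      by (simp cong: nn_integral_cong_simp)
  qed
  show ?case
    unfolding step[OF Suc.prems(4,5)] inner
    by (rule markov_fun[OF Suc.prems(4) t0(2) Suc.prems(5) QB])
qed

text \<open>Finite-dimensional cylinder events are stable under intersection and generate the
  sigma-field, and on them the claim is the Markov property. This is the form needed for functionals
  of whole paths, such as additive functionals.\<close>

lemma law_shift:
  assumes r: "0 \<le> r"
  shows "distr (law M y) \<F> (shift M r) = law_from M (distr (law M y) borel_cpt (coord M r))"
proof -
  let ?\<nu> = "distr (law M y) borel_cpt (coord M r)"
  let ?E = "{{\<omega> \<in> outcomes M. \<forall>t\<in>J. coord M t \<omega> \<in> B t} | J B. finite J \<and> (\<forall>t\<in>J. 0 \<le> t \<and> B t \<in> sets borel_cpt)}"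
  have cr: "coord M r \<in> law M y \<rightarrow>\<^sub>M borel_cpt"
    using coord_measurable[OF r] by (simp cong: measurable_cong_sets)
  have sets_lf: "sets (law_from M ?\<nu>) = sets \<F>"
    unfolding law_from_def by (rule sets_bind) auto
  have gen: "sets \<F> = sigma_sets (outcomes M) ?E"
  proof
    show "sets \<F> \<subseteq> sigma_sets (outcomes M) ?E"
      unfolding sets_natural_filt
    proof (rule sigma_sets_mono)
      show "{coord M s -` B \<inter> outcomes M | s B. 0 \<le> s \<and> ennreal s \<le> top \<and> B \<in> sets borel_cpt} \<subseteq> sigma_sets (outcomes M) ?E"
      proof safe
        fix s and B :: "'a option set" assume "0 \<le> (s::real)" "B \<in> sets borel_cpt"
        then show "coord M s -` B \<inter> outcomes M \<in> sigma_sets (outcomes M) ?E"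
          by (intro sigma_sets.Basic CollectI exI[of _ "{s}"] exI[of _ "\<lambda>_. B"]) auto
      qed
    qed
    have "?E \<subseteq> sets \<F>" using cyl_sets by auto
    then show "sigma_sets (outcomes M) ?E \<subseteq> sets \<F>"
      using sets.sigma_sets_subset[of ?E \<F>] by simp
  qed
  show ?thesis
  proof (rule measure_eqI_generator_eq[where E="?E" and \<Omega>="outcomes M" and A="\<lambda>_. outcomes M"])
    show "Int_stable ?E"
    proof (rule Int_stableI, clarsimp)
      fix J J' :: "real set" and B B' :: "real \<Rightarrow> 'a option set"
      assume J: "finite J" "\<forall>t\<in>J. 0 \<le> t \<and> B t \<in> sets borel_cpt" "finite J'" "\<forall>t\<in>J'. 0 \<le> t \<and> B' t \<in> sets borel_cpt"
      let ?B = "\<lambda>t. (if t \<in> J then B t else UNIV) \<inter> (if t \<in> J' then B' t else UNIV)"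
      have "UNIV \<in> sets (borel_cpt :: 'a option measure)" using sets.top[of borel_cpt] by simp
      then show "\<exists>J'' B''. {\<omega> \<in> outcomes M. \<forall>t\<in>J. coord M t \<omega> \<in> B t} \<inter> {\<omega> \<in> outcomes M. \<forall>t\<in>J'. coord M t \<omega> \<in> B' t} =
          {\<omega> \<in> outcomes M. \<forall>t\<in>J''. coord M t \<omega> \<in> B'' t} \<and> finite J'' \<and> (\<forall>t\<in>J''. 0 \<le> t \<and> B'' t \<in> sets borel_cpt)"
        using J by (intro exI[of _ "J \<union> J'"] exI[of _ ?B]) auto
    qed
    show "range (\<lambda>_. outcomes M) \<subseteq> ?E"
      by (auto intro!: exI[of _ "{}"])
    show "emeasure (distr (law M y) \<F> (shift M r)) (outcomes M) \<noteq> \<infinity>" for i :: nat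
    proof -
      have "prob_space (distr (law M y) \<F> (shift M r))"
        by (rule prob_space.prob_space_distr[OF prob_law], subst measurable_cong_sets[OF sets_law refl])
           (rule shift_measurable[OF r])
      then show ?thesis using prob_space.emeasure_space_1 by fastforce
    qed
    fix X assume "X \<in> ?E"
    then obtain J B where X: "X = {\<omega> \<in> outcomes M. \<forall>t\<in>J. coord M t \<omega> \<in> B t}"
      and J: "finite J" "\<And>t. t \<in> J \<Longrightarrow> 0 \<le> t" "\<And>t. t \<in> J \<Longrightarrow> B t \<in> sets borel_cpt" by auto
    have XF: "X \<in> sets \<F>" unfolding X by (rule cyl_sets[OF J])
    have "emeasure (distr (law M y) \<F> (shift M r)) X = emeasure (law M y) (shift M r -` X \<inter> space (law M y))"
      using XF shift_measurable[OF r] by (intro emeasure_distr) (auto cong: measurable_cong_sets)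
    also have "shift M r -` X \<inter> space (law M y) = {\<omega> \<in> outcomes M. \<forall>t\<in>J. coord M (r + t) \<omega> \<in> B t}"
      using J(2) r by (auto simp: X coord_shift shift_outcomes add.commute)
    also have "emeasure (law M y) \<dots> = (\<integral>\<^sup>+\<omega>\<in>outcomes M. emeasure (law M (coord M r \<omega>)) X \<partial>law M y)"
      unfolding X using sets.top[of "natural_filt M (ennreal r)"] by (intro markov_cyl[OF J r]) simp_all
    also have "\<dots> = (\<integral>\<^sup>+\<omega>. emeasure (law M (coord M r \<omega>)) X \<partial>law M y)"
      by (intro nn_integral_cong) simp
    also have "\<dots> = (\<integral>\<^sup>+z. emeasure (law M z) X \<partial>?\<nu>)"
      using measurable_emeasure_kernel[OF law_kernel_sub XF] cr by (subst nn_integral_distr) auto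
    also have "\<dots> = emeasure (law_from M ?\<nu>) X"
      unfolding law_from_def using law_kernel_sub XF by (intro emeasure_bind[symmetric]) auto
    finally show "emeasure (distr (law M y) \<F> (shift M r)) X = emeasure (law_from M ?\<nu>) X" .
  qed (use gen sets_lf in auto)
qed

end

section \<open>The semigroup and its resolvent\<close>

text \<open>For these functions the integrals behind the semigroup and the resolvent converge at
  every starting point, so no null sets have to be tracked.\<close>

definition bdd_fun :: "('a::topological_space \<Rightarrow> real) \<Rightarrow> bool" where
  "bdd_fun f \<longleftrightarrow> f \<in> borel_measurable borel \<and> (\<exists>C. \<forall>x. \<bar>f x\<bar> \<le> C)"

lemma bdd_fun_measurable [measurable_dest]: "bdd_fun f \<Longrightarrow> f \<in> borel_measurable borel"
  by (simp add: bdd_fun_def)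

lemma bdd_funE: assumes "bdd_fun f" obtains C where "0 \<le> C" "\<And>x. \<bar>f x\<bar> \<le> C"
  using assms unfolding bdd_fun_def by (meson abs_ge_zero order_trans)

lemma bdd_funI: "f \<in> borel_measurable borel \<Longrightarrow> (\<And>x. \<bar>f x\<bar> \<le> C) \<Longrightarrow> bdd_fun f"
  by (auto simp: bdd_fun_def)

lemma bdd_fun_lincomb:
  assumes f: "bdd_fun f" and g: "bdd_fun g" shows "bdd_fun (\<lambda>x. a * f x + b * g x)"
proof -
  obtain C D where C: "\<And>x. \<bar>f x\<bar> \<le> C" and D: "\<And>x. \<bar>g x\<bar> \<le> D"
    using f g by (meson bdd_funE)
  note [measurable] = bdd_fun_measurable[OF f] bdd_fun_measurable[OF g]
  show ?thesis
  proof (rule bdd_funI[where C="\<bar>a\<bar> * C + \<bar>b\<bar> * D"])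
    fix x
    have "\<bar>a * f x + b * g x\<bar> \<le> \<bar>a\<bar> * \<bar>f x\<bar> + \<bar>b\<bar> * \<bar>g x\<bar>"
      by (metis abs_mult abs_triangle_ineq)
    also have "\<dots> \<le> \<bar>a\<bar> * C + \<bar>b\<bar> * D"
      by (intro add_mono mult_left_mono C D) auto
    finally show "\<bar>a * f x + b * g x\<bar> \<le> \<bar>a\<bar> * C + \<bar>b\<bar> * D" .
  qed simp
qed

lemma bdd_fun_parts: "bdd_fun f \<Longrightarrow> bdd_fun (\<lambda>x. max 0 (f x))" "bdd_fun f \<Longrightarrow> bdd_fun (\<lambda>x. max 0 (- f x))"
  unfolding bdd_fun_def by (auto simp: max_def abs_le_iff intro: order_trans) (meson abs_ge_zero abs_le_iff order_trans)+

lemma bdd_fun_abs: "bdd_fun f \<Longrightarrow> bdd_fun (\<lambda>x. \<bar>f x\<bar>)"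
  by (auto simp: bdd_fun_def)

text \<open>Under an exponential law \<alpha> R_\<alpha> f is the average of p_s f over a random
  time, and finiteness of the law settles the integrability of bounded functions.\<close>

abbreviation Exp_meas :: "real \<Rightarrow> real measure" where
  "Exp_meas \<alpha> \<equiv> density lborel (\<lambda>s. ennreal (exponential_density \<alpha> s))"

text \<open>The exponential law has no memory: moving the time by r cuts off the interval before r
  and renormalises by e^r.\<close>

lemma integral_Exp_shift:
  fixes f :: "real \<Rightarrow> real"
  assumes [measurable]: "f \<in> borel_measurable borel" and r: "0 \<le> r"
  shows "(\<integral>s. f (s + r) \<partial>Exp_meas 1) = exp r * (\<integral>s. indicator {r..} s * f s \<partial>Exp_meas 1)"
proof -
  have "(\<integral>s. f (s + r) \<partial>Exp_meas 1) = (\<integral>s. exponential_density 1 s * f (s + r) \<partial>lborel)"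
    by (subst integral_density) (auto simp: exponential_density_nonneg)
  also have "\<dots> = (\<integral>s. exponential_density 1 (s - r) * f s \<partial>lborel)"
    using lborel_integral_real_affine[of 1 "\<lambda>s. exponential_density 1 (s - r) * f s" r] by (simp add: add.commute)
  also have "\<dots> = (\<integral>s. exp r * (exponential_density 1 s * (indicator {r..} s * f s)) \<partial>lborel)"
    using r by (intro Bochner_Integration.integral_cong) (auto simp: exponential_density_def exp_diff exp_minus field_simps split: split_indicator)
  also have "\<dots> = exp r * (\<integral>s. exponential_density 1 s * (indicator {r..} s * f s) \<partial>lborel)"
    by simp
  also have "(\<integral>s. exponential_density 1 s * (indicator {r..} s * f s) \<partial>lborel) = (\<integral>s. indicator {r..} s * f s \<partial>Exp_meas 1)"
    by (subst integral_density) (auto simp: exponential_density_nonneg)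
  finally show ?thesis .
qed

lemma measure_Exp_atLeast:
  assumes "0 \<le> r" shows "measure (Exp_meas 1) {r..} = exp (- r)"
proof -
  have "emeasure (Exp_meas 1) {r..} = (\<integral>\<^sup>+s\<in>{r..}. ennreal (1 * exp (- 1 * s)) \<partial>lborel)"
    using assms by (subst emeasure_density) (auto intro!: nn_integral_cong simp: exponential_density_def split: split_indicator)
  also have "\<dots> = ennreal (exp (- 1 * r))" by (rule nn_integral_exp_tail) simp
  finally show ?thesis by (simp add: measure_def)
qed

text \<open>Carrying x along turns K into a kernel on the product space, where one fixed integrand
  replaces the family of functions f x.\<close>

lemma integral_kernel_measurable:
  fixes f :: "'x \<Rightarrow> 'y \<Rightarrow> real"
  assumes f[measurable]: "(\<lambda>(x, y). f x y) \<in> borel_measurable (L \<Otimes>\<^sub>M N)"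
  assumes K[measurable]: "K \<in> L \<rightarrow>\<^sub>M subprob_algebra N"
  shows "(\<lambda>x. \<integral>y. f x y \<partial>K x) \<in> borel_measurable L"
proof -
  note integral_measurable_subprob_algebra[measurable]
  note measurable_distr2[measurable]
  have "(\<lambda>x. \<integral>z. (\<lambda>(x, y). f x y) z \<partial>distr (K x) (L \<Otimes>\<^sub>M N) (\<lambda>y. (x, y))) \<in> borel_measurable L"
    by measurable
  then show ?thesis
    by (rule measurable_cong[THEN iffD1, rotated]) (simp add: integral_distr)
qed

context hunt begin

text \<open>Nothing is known about the process at negative times; clamping the time at 0 makes joint
  measurability hold without a sign condition, and it changes nothing under a law carried by
  [0,\<infinity>).\<close>

lemma semigroup_nn_measurable [measurable (raw)]:
  assumes [measurable]: "f \<in> borel_measurable borel" "t \<in> borel_measurable L" "g \<in> L \<rightarrow>\<^sub>M borel"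
  shows "(\<lambda>z. semigroup_nn M (max 0 (t z)) f (g z)) \<in> borel_measurable L"
  unfolding semigroup_nn_def expect_def
proof (rule nn_integral_measurable_subprob_algebra2)
  show "(\<lambda>z. law M (Some (g z))) \<in> L \<rightarrow>\<^sub>M subprob_algebra \<F>"
    by (rule measurable_compose[OF _ law_Some_kernel]) simp
qed measurable

lemma semigroup_nn_measurable' [measurable]:
  assumes "f \<in> borel_measurable borel" "0 \<le> t"
  shows "semigroup_nn M t f \<in> borel_measurable borel"
  using semigroup_nn_measurable[OF assms(1), of "\<lambda>_. t" borel "\<lambda>x. x"] assms(2) by (simp add: max_def)

lemma AE_law_None: "0 \<le> t \<Longrightarrow> AE \<omega> in law M None. coord M t \<omega> = None"
  using start[of None] AE_space[of "law M None"] by eventually_elim (auto intro: dead[of _ 0])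

lemma ext0_semigroup_nn: "0 \<le> t \<Longrightarrow> ext0 (semigroup_nn M t f) y = (\<integral>\<^sup>+\<omega>. ext0 f (coord M t \<omega>) \<partial>law M y)"
proof (cases y)
  case None
  assume "0 \<le> t"
  then have "(\<integral>\<^sup>+\<omega>. ext0 f (coord M t \<omega>) \<partial>law M None) = (\<integral>\<^sup>+\<omega>. 0 \<partial>law M None)"
    using AE_law_None[of t] by (intro nn_integral_cong_AE) (auto elim!: eventually_mono)
  then show ?thesis by (simp add: None)
qed (simp add: semigroup_nn_def expect_def)

text \<open>The Chapman-Kolmogorov equation: the Markov property with the whole space as event, the
  semigroup being extended by 0 to the cemetery.\<close>

lemma semigroup_nn_add:
  assumes r: "0 \<le> r" and s: "0 \<le> s" and [measurable]: "f \<in> borel_measurable borel"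
  shows "semigroup_nn M (r + s) f x = semigroup_nn M r (semigroup_nn M s f) x"
proof -
  have "semigroup_nn M (r + s) f x = (\<integral>\<^sup>+\<omega>\<in>outcomes M. ext0 f (coord M (r + s) \<omega>) \<partial>law M (Some x))"
    unfolding semigroup_nn_def expect_def by (intro nn_integral_cong) simp
  also have "\<dots> = (\<integral>\<^sup>+\<omega>\<in>outcomes M. (\<integral>\<^sup>+\<omega>'. ext0 f (coord M s \<omega>') \<partial>law M (coord M r \<omega>)) \<partial>law M (Some x))"
    using sets.top[of "natural_filt M (ennreal r)"] by (intro markov_fun r s) simp_all
  also have "\<dots> = semigroup_nn M r (semigroup_nn M s f) x"
    unfolding semigroup_nn_def[of M r] expect_def ext0_semigroup_nn[OF s] by (intro nn_integral_cong) simp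
  finally show ?thesis .
qed


lemma semigroup_nn_mono: "(\<And>x. f x \<le> g x) \<Longrightarrow> semigroup_nn M t f x \<le> semigroup_nn M t g x"
  unfolding semigroup_nn_def expect_def by (intro nn_integral_mono) (simp add: ext0_def split: option.split)

lemma semigroup_nn_const_le: "semigroup_nn M t (\<lambda>_. c) x \<le> c"
proof -
  have "semigroup_nn M t (\<lambda>_. c) x \<le> (\<integral>\<^sup>+\<omega>. c \<partial>law M (Some x))"
    unfolding semigroup_nn_def expect_def by (intro nn_integral_mono) (simp add: ext0_def split: option.split)
  also have "\<dots> = c" using prob_space.emeasure_space_1[OF prob_law[of "Some x"]] by simp
  finally show ?thesis .
qed

definition resolvent_nn :: "('a \<Rightarrow> ennreal) \<Rightarrow> 'a \<Rightarrow> ennreal" where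
  "resolvent_nn f x = (\<integral>\<^sup>+s. semigroup_nn M (max 0 s) f x \<partial>Exp_meas 1)"

lemma sigma_finite_Exp: "sigma_finite_measure (Exp_meas 1)"
  using prob_space_exponential_density[of 1] prob_space_imp_sigma_finite by auto

lemma resolvent_nn_measurable [measurable]:
  assumes [measurable]: "f \<in> borel_measurable borel"
  shows "resolvent_nn f \<in> borel_measurable borel"
proof -
  interpret E: sigma_finite_measure "Exp_meas 1" by (rule sigma_finite_Exp)
  show ?thesis unfolding resolvent_nn_def[abs_def] by measurable
qed

lemma nn_integral_Exp:
  "f \<in> borel_measurable borel \<Longrightarrow> (\<integral>\<^sup>+s. f s \<partial>Exp_meas 1) = (\<integral>\<^sup>+s\<in>{0..}. ennreal (exp (- s)) * f s \<partial>lborel)"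
  by (subst nn_integral_density) (auto intro!: nn_integral_cong simp: exponential_density_def split: split_indicator)

lemma nn_integral_Exp_shift_le:
  assumes [measurable]: "f \<in> borel_measurable borel" and r: "0 \<le> r"
  shows "(\<integral>\<^sup>+s. f (max 0 s + r) \<partial>Exp_meas 1) \<le> ennreal (exp r) * (\<integral>\<^sup>+s. f (max 0 s) \<partial>Exp_meas 1)"
proof -
  have "(\<integral>\<^sup>+s. f (max 0 s + r) \<partial>Exp_meas 1) = (\<integral>\<^sup>+s. ennreal (exp (- s)) * f (max 0 s + r) * indicator {0..} s \<partial>lborel)"
    by (rule nn_integral_Exp) simp
  also have "\<dots> = (\<integral>\<^sup>+s. ennreal (exp (- (s - r))) * f (max 0 (s - r) + r) * indicator {0..} (s - r) \<partial>lborel)"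
    by (subst nn_integral_real_affine[where c=1 and t="-r"]) (auto simp: algebra_simps)
  also have "\<dots> \<le> (\<integral>\<^sup>+s. ennreal (exp r) * (ennreal (exp (- s)) * f (max 0 s) * indicator {0..} s) \<partial>lborel)"
  proof (intro nn_integral_mono)
    fix s
    have "ennreal (exp (- (s - r))) = ennreal (exp r) * ennreal (exp (- s))"
      by (simp add: ennreal_mult[symmetric] exp_add[symmetric])
    then show "ennreal (exp (- (s - r))) * f (max 0 (s - r) + r) * indicator {0..} (s - r) \<le>
        ennreal (exp r) * (ennreal (exp (- s)) * f (max 0 s) * indicator {0..} s)"
      using r by (auto simp: mult.assoc max_def split: split_indicator)
  qed
  also have "\<dots> = ennreal (exp r) * (\<integral>\<^sup>+s. f (max 0 s) \<partial>Exp_meas 1)"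
    by (subst nn_integral_cmult) (auto simp: nn_integral_Exp)
  finally show ?thesis .
qed

text \<open>A 1-potential is 1-excessive: e^{-r} p_r R_1 f is the part of R_1 f that comes from
  times after r.\<close>

lemma semigroup_resolvent_nn_le:
  assumes [measurable]: "f \<in> borel_measurable borel" and r: "0 \<le> r"
  shows "semigroup_nn M r (resolvent_nn f) x \<le> ennreal (exp r) * resolvent_nn f x"
proof -
  interpret E: sigma_finite_measure "Exp_meas 1" by (rule sigma_finite_Exp)
  interpret L: prob_space "law M (Some x)" by (rule prob_law)
  interpret P: pair_sigma_finite "law M (Some x)" "Exp_meas 1" ..
  note [measurable] = coord_measurable[OF r]
  have jm: "(\<lambda>(\<omega>, s). ext0 (semigroup_nn M (max 0 s) f) (coord M r \<omega>)) \<in> borel_measurable (law M (Some x) \<Otimes>\<^sub>M Exp_meas 1)"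
  proof -
    have "(\<lambda>(y, s). ext0 (semigroup_nn M (max 0 s) f) y) = (\<lambda>(y, s). \<integral>\<^sup>+\<omega>. ext0 f (coord M (max 0 s) \<omega>) \<partial>law M y)"
      by (auto simp: ext0_semigroup_nn)
    moreover have "(\<lambda>z. \<integral>\<^sup>+\<omega>. ext0 f (coord M (max 0 (snd z)) \<omega>) \<partial>law M (fst z)) \<in> borel_measurable (borel_cpt \<Otimes>\<^sub>M borel)"
    proof (rule nn_integral_measurable_subprob_algebra2[where N=\<F>])
      show "(\<lambda>z. law M (fst z)) \<in> borel_cpt \<Otimes>\<^sub>M borel \<rightarrow>\<^sub>M subprob_algebra \<F>"
        by (rule measurable_compose[OF measurable_fst law_kernel_sub])
    qed measurable
    ultimately have [measurable]: "(\<lambda>(y, s). ext0 (semigroup_nn M (max 0 s) f) y) \<in> borel_measurable (borel_cpt \<Otimes>\<^sub>M borel)"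
      by (simp add: case_prod_beta')
    have "(\<lambda>z. (\<lambda>(y, s). ext0 (semigroup_nn M (max 0 s) f) y) (coord M r (fst z), snd z)) \<in> borel_measurable (law M (Some x) \<Otimes>\<^sub>M Exp_meas 1)"
      by measurable
    then show ?thesis by (simp add: case_prod_beta')
  qed
  have "semigroup_nn M r (resolvent_nn f) x = (\<integral>\<^sup>+\<omega>. (\<integral>\<^sup>+s. ext0 (semigroup_nn M (max 0 s) f) (coord M r \<omega>) \<partial>Exp_meas 1) \<partial>law M (Some x))"
    unfolding semigroup_nn_def[of M r] expect_def
    by (intro nn_integral_cong) (simp add: ext0_def resolvent_nn_def split: option.split)
  also have "\<dots> = (\<integral>\<^sup>+s. (\<integral>\<^sup>+\<omega>. ext0 (semigroup_nn M (max 0 s) f) (coord M r \<omega>) \<partial>law M (Some x)) \<partial>Exp_meas 1)"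
    by (rule P.Fubini'[symmetric, OF jm])
  also have "\<dots> = (\<integral>\<^sup>+s. semigroup_nn M (max 0 s + r) f x \<partial>Exp_meas 1)"
    using r by (intro nn_integral_cong) (simp add: semigroup_nn_add add.commute[of _ r] semigroup_nn_def[of M r] expect_def)
  also have "\<dots> = (\<integral>\<^sup>+s. semigroup_nn M (max 0 (max 0 s + r)) f x \<partial>Exp_meas 1)"
    using r by (intro nn_integral_cong) (simp add: max_def)
  also have "\<dots> \<le> ennreal (exp r) * (\<integral>\<^sup>+s. semigroup_nn M (max 0 (max 0 s)) f x \<partial>Exp_meas 1)"
    by (rule nn_integral_Exp_shift_le[OF _ r]) measurable
  finally show ?thesis by (simp add: resolvent_nn_def)
qed

lemma ext0_bdd: "(\<And>x. \<bar>f x :: real\<bar> \<le> C) \<Longrightarrow> 0 \<le> C \<Longrightarrow> \<bar>ext0 f y\<bar> \<le> C"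
  by (simp add: ext0_def split: option.split)

lemma integrable_law:
  assumes f: "bdd_fun f" and t: "0 \<le> t"
  shows "integrable (law M y) (\<lambda>\<omega>. ext0 f (coord M t \<omega>))"
proof -
  interpret L: prob_space "law M y" by (rule prob_law)
  obtain C where C: "0 \<le> C" "\<And>x. \<bar>f x\<bar> \<le> C" using bdd_funE[OF f] by blast
  note [measurable] = coord_measurable[OF t] bdd_fun_measurable[OF f]
  show ?thesis
    by (rule L.integrable_const_bound[where B=C]) (auto simp: ext0_bdd C)
qed

lemma transition_measurable [measurable (raw)]:
  assumes [measurable]: "f \<in> borel_measurable borel" "t \<in> borel_measurable L" "g \<in> L \<rightarrow>\<^sub>M borel"
  shows "(\<lambda>z. transition M (max 0 (t z)) f (g z)) \<in> borel_measurable L"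
  unfolding transition_def
proof (rule integral_kernel_measurable)
  show "(\<lambda>z. law M (Some (g z))) \<in> L \<rightarrow>\<^sub>M subprob_algebra \<F>"
    by (rule measurable_compose[OF _ law_Some_kernel]) simp
qed measurable

lemma transition_measurable' [measurable]:
  assumes "f \<in> borel_measurable borel" "0 \<le> t"
  shows "transition M t f \<in> borel_measurable borel"
  using transition_measurable[OF assms(1), of "\<lambda>_. t" borel "\<lambda>x. x"] assms(2) by (simp add: max_def)

lemma transition_bound:
  assumes f: "bdd_fun f" and C: "\<And>x. \<bar>f x\<bar> \<le> C" and t: "0 \<le> t"
  shows "\<bar>transition M t f x\<bar> \<le> C"
proof -
  interpret L: prob_space "law M (Some x)" by (rule prob_law)
  have C0: "0 \<le> C" using C[of x] by linarith
  have "\<bar>transition M t f x\<bar> \<le> (\<integral>\<omega>. \<bar>ext0 f (coord M t \<omega>)\<bar> \<partial>law M (Some x))"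
    unfolding transition_def using integral_norm_bound[of "law M (Some x)" "\<lambda>\<omega>. ext0 f (coord M t \<omega>)"] by simp
  also have "\<dots> \<le> (\<integral>\<omega>. C \<partial>law M (Some x))"
    using integrable_law[OF f t] by (intro integral_mono) (auto simp: ext0_bdd C C0)
  finally show ?thesis using L.prob_space by simp
qed

lemma bdd_fun_transition: "bdd_fun f \<Longrightarrow> 0 \<le> t \<Longrightarrow> bdd_fun (transition M t f)"
  by (metis bdd_funE bdd_funI transition_bound transition_measurable' bdd_fun_measurable)

lemma transition_lincomb:
  assumes f: "bdd_fun f" and g: "bdd_fun g" and t: "0 \<le> t"
  shows "transition M t (\<lambda>x. a * f x + b * g x) x = a * transition M t f x + b * transition M t g x"
proof -
  have "transition M t (\<lambda>x. a * f x + b * g x) x =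
      (\<integral>\<omega>. a * ext0 f (coord M t \<omega>) + b * ext0 g (coord M t \<omega>) \<partial>law M (Some x))"
    unfolding transition_def by (intro Bochner_Integration.integral_cong) (auto simp: ext0_def split: option.split)
  also have "\<dots> = a * transition M t f x + b * transition M t g x"
    unfolding transition_def
    using integrable_law[OF f t, of "Some x"] integrable_law[OF g t, of "Some x"] by simp
  finally show ?thesis .
qed

lemma ennreal_transition:
  assumes f: "bdd_fun f" "\<And>x. 0 \<le> f x" and t: "0 \<le> t"
  shows "ennreal (transition M t f x) = semigroup_nn M t (\<lambda>x. ennreal (f x)) x" "0 \<le> transition M t f x"
proof -
  have nn: "0 \<le> ext0 f y" for y using f(2) by (simp add: ext0_def split: option.split)
  have "ennreal (transition M t f x) = (\<integral>\<^sup>+\<omega>. ennreal (ext0 f (coord M t \<omega>)) \<partial>law M (Some x))"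
    unfolding transition_def using integrable_law[OF f(1) t, of "Some x"] nn
    by (intro nn_integral_eq_integral[symmetric]) auto
  then show "ennreal (transition M t f x) = semigroup_nn M t (\<lambda>x. ennreal (f x)) x"
    unfolding semigroup_nn_def expect_def
    by (simp add: ext0_def option.case_distrib[of ennreal] cong: option.case_cong)
  show "0 \<le> transition M t f x" unfolding transition_def using nn by simp
qed

lemma transition_parts:
  assumes f: "bdd_fun f" and t: "0 \<le> t"
  shows "transition M t f x = transition M t (\<lambda>x. max 0 (f x)) x - transition M t (\<lambda>x. max 0 (- f x)) x"
  using transition_lincomb[OF bdd_fun_parts[OF f] t, of 1 "-1" x]
  by (simp add: max_def if_distrib cong: if_cong)

lemma transition_add:
  assumes r: "0 \<le> r" and s: "0 \<le> s" and f: "bdd_fun f"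
  shows "transition M (r + s) f x = transition M r (transition M s f) x"
proof -
  have pos: "transition M (r + s) f x = transition M r (transition M s f) x"
    if f: "bdd_fun f" "\<And>x. 0 \<le> f x" for f
  proof -
    note [measurable] = bdd_fun_measurable[OF f(1)]
    have "ennreal (transition M (r + s) f x) = semigroup_nn M r (semigroup_nn M s (\<lambda>x. ennreal (f x))) x"
      using r s by (simp add: ennreal_transition f semigroup_nn_add)
    also have "\<dots> = semigroup_nn M r (\<lambda>x. ennreal (transition M s f x)) x"
      using ennreal_transition(1)[OF f s] by presburger
    also have "\<dots> = ennreal (transition M r (transition M s f) x)"
      by (intro ennreal_transition(1)[symmetric] bdd_fun_transition ennreal_transition(2) f r s)
    finally show ?thesis
      using r s by (subst (asm) ennreal_inj) (auto intro!: ennreal_transition(2) bdd_fun_transition f)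
  qed
  let ?p = "\<lambda>x. max 0 (f x)" and ?n = "\<lambda>x. max 0 (- f x)"
  note b = bdd_fun_parts[OF f]
  have "transition M (r + s) f x = transition M r (transition M s ?p) x - transition M r (transition M s ?n) x"
    using r s transition_parts[OF f, of "r + s" x] by (simp add: pos b)
  also have "\<dots> = transition M r (\<lambda>y. 1 * transition M s ?p y + (-1) * transition M s ?n y) x"
    by (subst transition_lincomb) (use r s b bdd_fun_transition in auto)
  also have "(\<lambda>y. 1 * transition M s ?p y + (-1) * transition M s ?n y) = transition M s f"
    using transition_parts[OF f s] by auto
  finally show ?thesis .
qed


lemma ext0_transition:
  assumes t: "0 \<le> t"
  shows "ext0 (transition M t f) y = (\<integral>\<omega>. ext0 f (coord M t \<omega>) \<partial>law M y)"
proof (cases y)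
  case None
  have "(\<integral>\<omega>. ext0 f (coord M t \<omega>) \<partial>law M None) = 0"
  proof (rule integral_eq_zero_AE)
    show "AE \<omega> in law M None. ext0 f (coord M t \<omega>) = 0"
      using AE_law_None[OF t] by eventually_elim simp
  qed
  then show ?thesis by (simp add: None)
qed (simp add: transition_def)

text \<open>Time averages of the semigroup with weight \<open>w\<close> against the exponential law; the weight \<open>1\<close>
  gives the \<open>1\<close>-resolvent.\<close>

definition avg :: "(real \<Rightarrow> real) \<Rightarrow> ('a \<Rightarrow> real) \<Rightarrow> 'a \<Rightarrow> real" where
  "avg w f x = (\<integral>s. w s * transition M (max 0 s) f x \<partial>Exp_meas 1)"

lemma prob_Exp: "prob_space (Exp_meas 1)"
  using prob_space_exponential_density[of 1] by simp

lemma avg_measurable [measurable]: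
  assumes [measurable]: "w \<in> borel_measurable borel" "f \<in> borel_measurable borel"
  shows "avg w f \<in> borel_measurable borel"
proof -
  interpret E: sigma_finite_measure "Exp_meas 1" by (rule sigma_finite_Exp)
  show ?thesis unfolding avg_def[abs_def] by measurable
qed

lemma integrable_avg:
  assumes f: "bdd_fun f" and w: "bdd_fun w"
  shows "integrable (Exp_meas 1) (\<lambda>s. w s * transition M (max 0 s) f x)"
proof -
  interpret E: prob_space "Exp_meas 1" by (rule prob_Exp)
  obtain C where C: "0 \<le> C" "\<And>x. \<bar>f x\<bar> \<le> C" using bdd_funE[OF f] by blast
  obtain W where W: "0 \<le> W" "\<And>x. \<bar>w x\<bar> \<le> W" using bdd_funE[OF w] by blast
  note [measurable] = bdd_fun_measurable[OF f] bdd_fun_measurable[OF w]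
  show ?thesis
    by (rule E.integrable_const_bound[where B="W * C"])
       (auto simp: abs_mult intro!: mult_mono W transition_bound f C)
qed

lemma avg_bound:
  assumes f: "bdd_fun f" and w: "bdd_fun w" and C: "\<And>x. \<bar>f x\<bar> \<le> C" and W: "\<And>s. \<bar>w s\<bar> \<le> W"
  shows "\<bar>avg w f x\<bar> \<le> W * C"
proof -
  interpret E: prob_space "Exp_meas 1" by (rule prob_Exp)
  have "0 \<le> W" using W[of 0] by linarith
  have "\<bar>avg w f x\<bar> \<le> (\<integral>s. \<bar>w s * transition M (max 0 s) f x\<bar> \<partial>Exp_meas 1)"
    unfolding avg_def using integral_norm_bound[of "Exp_meas 1" "\<lambda>s. w s * transition M (max 0 s) f x"] by simp
  also have "\<dots> \<le> (\<integral>s. W * C \<partial>Exp_meas 1)"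
    by (rule integral_mono[OF integrable_abs[OF integrable_avg[OF f w, of x]]])
       (use \<open>0 \<le> W\<close> in \<open>auto simp: abs_mult intro!: mult_mono W transition_bound f C\<close>)
  finally show ?thesis using E.prob_space by simp
qed

lemma bdd_fun_avg: "bdd_fun f \<Longrightarrow> bdd_fun w \<Longrightarrow> bdd_fun (avg w f)"
  by (metis bdd_funE bdd_funI avg_bound avg_measurable bdd_fun_measurable)

lemma avg_lincomb:
  assumes "bdd_fun f" "bdd_fun g" "bdd_fun w"
  shows "avg w (\<lambda>x. a * f x + b * g x) x = a * avg w f x + b * avg w g x"
proof -
  have "avg w (\<lambda>x. a * f x + b * g x) x =
    (\<integral>s. a * (w s * transition M (max 0 s) f x) + b * (w s * transition M (max 0 s) g x) \<partial>Exp_meas 1)"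
    unfolding avg_def by (intro Bochner_Integration.integral_cong) (simp_all add: transition_lincomb assms algebra_simps)
  also have "\<dots> = a * avg w f x + b * avg w g x"
    using integrable_avg[OF assms(1,3), of x] integrable_avg[OF assms(2,3), of x] by (simp add: avg_def)
  finally show ?thesis .
qed

lemma AE_Exp: "AE s in Exp_meas 1. 0 \<le> s"
  by (subst AE_density) (auto simp: exponential_density_def)

lemma avg1_transition:
  assumes f: "bdd_fun f" and r: "0 \<le> r"
  shows "avg (\<lambda>_. 1) (transition M r f) x = exp r * avg (indicator {r..}) f x"
proof -
  note [measurable] = bdd_fun_measurable[OF f]
  have "avg (\<lambda>_. 1) (transition M r f) x = (\<integral>s. transition M (max 0 (s + r)) f x \<partial>Exp_meas 1)"
    unfolding avg_def
  proof (rule integral_cong_AE)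
    show "AE s in Exp_meas 1. 1 * transition M (max 0 s) (transition M r f) x = transition M (max 0 (s + r)) f x"
      using AE_Exp by eventually_elim (use r f in \<open>simp add: transition_add[symmetric] max_def\<close>)
  qed (use r in measurable)
  also have "\<dots> = exp r * avg (indicator {r..}) f x"
    unfolding avg_def by (rule integral_Exp_shift[OF _ r]) measurable
  finally show ?thesis .
qed

lemma transition_avg1:
  assumes f: "bdd_fun f" and r: "0 \<le> r"
  shows "transition M r (avg (\<lambda>_. 1) f) x = avg (\<lambda>_. 1) (transition M r f) x"
proof -
  interpret E: prob_space "Exp_meas 1" by (rule prob_Exp)
  interpret L: prob_space "law M (Some x)" by (rule prob_law)
  interpret P: pair_prob_space "law M (Some x)" "Exp_meas 1" ..
  obtain C where C: "0 \<le> C" "\<And>x. \<bar>f x\<bar> \<le> C" using bdd_funE[OF f] by blast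
  note [measurable] = coord_measurable[OF r] bdd_fun_measurable[OF f]
  have jm: "(\<lambda>(\<omega>, s). ext0 (transition M (max 0 s) f) (coord M r \<omega>)) \<in> borel_measurable (law M (Some x) \<Otimes>\<^sub>M Exp_meas 1)"
  proof -
    have "(\<lambda>(y, s). ext0 (transition M (max 0 s) f) y) = (\<lambda>(y, s). \<integral>\<omega>. ext0 f (coord M (max 0 s) \<omega>) \<partial>law M y)"
      by (auto simp: ext0_transition)
    moreover have "(\<lambda>z. \<integral>\<omega>. ext0 f (coord M (max 0 (snd z)) \<omega>) \<partial>law M (fst z)) \<in> borel_measurable (borel_cpt \<Otimes>\<^sub>M borel)"
    proof (rule integral_kernel_measurable[where N=\<F>])
      show "(\<lambda>z. law M (fst z)) \<in> borel_cpt \<Otimes>\<^sub>M borel \<rightarrow>\<^sub>M subprob_algebra \<F>"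
        by (rule measurable_compose[OF measurable_fst law_kernel_sub])
    qed measurable
    ultimately have [measurable]: "(\<lambda>(y, s). ext0 (transition M (max 0 s) f) y) \<in> borel_measurable (borel_cpt \<Otimes>\<^sub>M borel)"
      by (simp add: case_prod_beta')
    have "(\<lambda>z. (\<lambda>(y, s). ext0 (transition M (max 0 s) f) y) (coord M r (fst z), snd z)) \<in> borel_measurable (law M (Some x) \<Otimes>\<^sub>M Exp_meas 1)"
      by measurable
    then show ?thesis by (simp add: case_prod_beta')
  qed
  have "transition M r (avg (\<lambda>_. 1) f) x = (\<integral>\<omega>. (\<integral>s. ext0 (transition M (max 0 s) f) (coord M r \<omega>) \<partial>Exp_meas 1) \<partial>law M (Some x))"
    unfolding transition_def[of M r]
    by (intro Bochner_Integration.integral_cong) (auto simp: ext0_def avg_def split: option.split)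
  also have "\<dots> = (\<integral>s. (\<integral>\<omega>. ext0 (transition M (max 0 s) f) (coord M r \<omega>) \<partial>law M (Some x)) \<partial>Exp_meas 1)"
  proof (rule P.Fubini_integral[symmetric])
    show "integrable (law M (Some x) \<Otimes>\<^sub>M Exp_meas 1) (\<lambda>(\<omega>, s). ext0 (transition M (max 0 s) f) (coord M r \<omega>))"
      by (rule P.integrable_const_bound[where B=C, OF _ jm])
         (auto intro!: ext0_bdd transition_bound f C)
  qed
  also have "\<dots> = avg (\<lambda>_. 1) (transition M r f) x"
    unfolding avg_def
    using r f by (intro Bochner_Integration.integral_cong)
      (auto simp: transition_def[of M r _ x, symmetric] transition_add[symmetric] add.commute)
  finally show ?thesis .
qed

text \<open>The difference integrates p_s f against the weight e^r 1_{[r,\<infinity>)} - 1, whose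
  absolute mass under the exponential law is (e^r - 1) e^{-r} + (1 - e^{-r}) = 2 (1 - e^{-r}) \<le>
  2 r.\<close>

lemma transition_avg1_close:
  assumes f: "bdd_fun f" and C: "\<And>x. \<bar>f x\<bar> \<le> C" and r: "0 \<le> r"
  shows "\<bar>transition M r (avg (\<lambda>_. 1) f) x - avg (\<lambda>_. 1) f x\<bar> \<le> 2 * C * r"
proof -
  interpret E: prob_space "Exp_meas 1" by (rule prob_Exp)
  have bd: "bdd_fun (\<lambda>_::real. c::real)" "bdd_fun (indicator {r..} :: real \<Rightarrow> real)" for c
    by (rule bdd_funI[where C="\<bar>c\<bar>"], auto) (rule bdd_funI[where C=1], auto split: split_indicator)
  have C0: "0 \<le> C" using C[of x] by linarith
  note i1 = integrable_avg[OF f bd(1)[of 1], of x] and i2 = integrable_avg[OF f bd(2), of x]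
  have iI: "integrable (Exp_meas 1) (indicator {r..} :: real \<Rightarrow> real)"
    by (rule integrable_real_indicator) (simp_all add: E.emeasure_eq_measure)
  have eq: "transition M r (avg (\<lambda>_. 1) f) x - avg (\<lambda>_. 1) f x =
    (\<integral>s. exp r * (indicator {r..} s * transition M (max 0 s) f x) - 1 * transition M (max 0 s) f x \<partial>Exp_meas 1)"
    unfolding transition_avg1[OF f r] avg1_transition[OF f r]
    using integrable_avg[OF f bd(1)[of 1], of x] integrable_avg[OF f bd(2), of x] by (simp add: avg_def)
  have "\<bar>transition M r (avg (\<lambda>_. 1) f) x - avg (\<lambda>_. 1) f x\<bar> \<le>
    (\<integral>s. \<bar>exp r * (indicator {r..} s * transition M (max 0 s) f x) - 1 * transition M (max 0 s) f x\<bar> \<partial>Exp_meas 1)"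
    unfolding eq using integral_norm_bound[of "Exp_meas 1" "\<lambda>s. exp r * (indicator {r..} s * transition M (max 0 s) f x) - 1 * transition M (max 0 s) f x"] by simp
  also have "\<dots> \<le> (\<integral>s. C * ((exp r - 2) * indicator {r..} s + 1) \<partial>Exp_meas 1)"
  proof (rule integral_mono)
    show "integrable (Exp_meas 1) (\<lambda>s. \<bar>exp r * (indicator {r..} s * transition M (max 0 s) f x) - 1 * transition M (max 0 s) f x\<bar>)"
      by (rule integrable_abs, rule Bochner_Integration.integrable_diff, rule integrable_mult_right, rule i2, rule i1)
    show "integrable (Exp_meas 1) (\<lambda>s. C * ((exp r - 2) * indicator {r..} s + 1))"
      by (rule integrable_mult_right, rule Bochner_Integration.integrable_add, rule integrable_mult_right, rule iI, rule E.integrable_const)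
    fix s
    have b: "\<bar>transition M (max 0 s) f x\<bar> \<le> C" by (intro transition_bound f C) simp
    have e: "1 \<le> exp r" using r by simp
    show "\<bar>exp r * (indicator {r..} s * transition M (max 0 s) f x) - 1 * transition M (max 0 s) f x\<bar> \<le> C * ((exp r - 2) * indicator {r..} s + 1)"
    proof (cases "r \<le> s")
      case True
      have "\<bar>(exp r - 1) * transition M (max 0 s) f x\<bar> \<le> (exp r - 1) * C"
        unfolding abs_mult using e b by (intro mult_mono) auto
      then show ?thesis using True by (simp add: algebra_simps)
    next
      case False then show ?thesis using b by simp
    qed
  qed
  also have "\<dots> = C * ((exp r - 2) * exp (- r) + 1)"
  proof -
    have "(\<integral>s. (exp r - 2) * indicator {r..} s + 1 \<partial>Exp_meas 1) = (exp r - 2) * (\<integral>s. indicator {r..} s \<partial>Exp_meas 1) + (\<integral>s. 1 \<partial>Exp_meas 1)"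
      by (subst Bochner_Integration.integral_add[OF integrable_mult_right[OF iI] E.integrable_const]) (simp only: integral_mult_right_zero)
    also have "(\<integral>s. indicator {r..} s \<partial>Exp_meas 1) = exp (- r)"
      using measure_Exp_atLeast[OF r] by simp
    finally show ?thesis using E.prob_space by (simp only: integral_mult_right_zero) simp
  qed
  also have "\<dots> = C * (2 * (1 - exp (- r)))"
    by (simp add: algebra_simps exp_minus)
  also have "\<dots> \<le> C * (2 * r)"
    using exp_ge_add_one_self[of "-r"] C0 by (intro mult_left_mono) auto
  finally show ?thesis by simp
qed

text \<open>By the lack of memory R_1 (e^{-t} p_t g) is the part of R_1 g after time t, so the
  difference leaves the part before t. This exhibits time averages as 1-potentials, to which the
  energy inequality applies.\<close>

lemma avg1_difference_quotient:
  assumes g: "bdd_fun g" and t: "0 < t"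
  shows "avg (\<lambda>_. 1) (\<lambda>x. (g x - exp (- t) * transition M t g x) / t) x = avg (\<lambda>s. indicator {..<t} s / t) g x"
proof -
  have bd: "bdd_fun (\<lambda>_::real. c::real)" "bdd_fun (indicator {t..} :: real \<Rightarrow> real)" for c
    by (rule bdd_funI[where C="\<bar>c\<bar>"], auto) (rule bdd_funI[where C=1], auto split: split_indicator)
  have "avg (\<lambda>_. 1) (\<lambda>x. (g x - exp (- t) * transition M t g x) / t) x =
     (1 / t) * avg (\<lambda>_. 1) g x + (- exp (- t) / t) * avg (\<lambda>_. 1) (transition M t g) x"
    using avg_lincomb[of g "transition M t g" "\<lambda>_. 1" "1 / t" "- exp (- t) / t" x] g t bd
    by (simp add: bdd_fun_transition diff_divide_distrib)
  also have "\<dots> = (1 / t) * avg (\<lambda>_. 1) g x + (- 1 / t) * avg (indicator {t..}) g x"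
    using t by (simp add: avg1_transition[OF g] exp_minus)
  also have "\<dots> = (\<integral>s. (1 / t) * (1 * transition M (max 0 s) g x) + (- 1 / t) * (indicator {t..} s * transition M (max 0 s) g x) \<partial>Exp_meas 1)"
    using integrable_avg[OF g bd(1)[of 1], of x] integrable_avg[OF g bd(2), of x] by (simp add: avg_def)
  also have "\<dots> = avg (\<lambda>s. indicator {..<t} s / t) g x"
    unfolding avg_def by (intro Bochner_Integration.integral_cong) (auto split: split_indicator)
  finally show ?thesis .
qed

end

section \<open>Symmetry: contraction in L^1 and self-adjointness\<close>

locale symmetric_hunt = hunt M for M :: "('a::{metric_space, second_countable_topology}, 'w) process" +
  fixes m :: "'a measure"
  assumes radon: "radon_measure m" and supp: "full_support m" and sym: "symmetric_process M m"
begin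

lemma sets_m [measurable_cong, simp]: "sets m = sets borel"
  using radon by (simp add: radon_measure_def)

lemma space_m [simp]: "space m = UNIV"
  using sets_eq_imp_space_eq[OF sets_m] by simp

lemma sigma_finite_m: "sigma_finite_measure m"
proof
  obtain \<B> :: "'a set set" where \<B>: "countable \<B>" "topological_basis \<B>"
    using ex_countable_basis by auto
  let ?A = "closure ` {b \<in> \<B>. compact (closure b)}"
  have "\<exists>b\<in>\<B>. x \<in> b \<and> compact (closure b)" for x
  proof -
    obtain e where e: "e > 0" "compact (cball x e)" using compact_nbhd[of UNIV x] by auto
    obtain b where b: "b \<in> \<B>" "x \<in> b" "b \<subseteq> ball x e"
      using topological_basisE[OF \<B>(2) open_ball[of x e], of x] e by auto
    have "closure b \<subseteq> cball x e"
      using b by (meson ball_subset_cball closed_cball closure_minimal order_trans)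
    then have "compact (closure b)" using compact_Int_closed[OF e(2) closed_closure, of b] by (simp add: inf_absorb2)
    then show ?thesis using b by auto
  qed
  then have "\<Union>?A = space m" using closure_subset by (fastforce simp: subset_eq)
  moreover have "\<forall>a\<in>?A. emeasure m a \<noteq> \<infinity>"
    using radon by (auto simp: radon_measure_def)
  ultimately show "\<exists>A. countable A \<and> A \<subseteq> sets m \<and> \<Union>A = space m \<and> (\<forall>a\<in>A. emeasure m a \<noteq> \<infinity>)"
    using \<B>(1) by (intro exI[of _ ?A]) auto
qed

lemma sym_nn:
  "0 \<le> t \<Longrightarrow> f \<in> borel_measurable borel \<Longrightarrow> g \<in> borel_measurable borel \<Longrightarrow>
    (\<integral>\<^sup>+x. semigroup_nn M t f x * g x \<partial>m) = (\<integral>\<^sup>+x. f x * semigroup_nn M t g x \<partial>m)"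
  using sym by (simp add: symmetric_process_def)

text \<open>Symmetry moves p_t onto the constant 1, where p_t 1 \<le> 1.\<close>

lemma semigroup_nn_contract:
  assumes t: "0 \<le> t" and [measurable]: "f \<in> borel_measurable borel"
  shows "(\<integral>\<^sup>+x. semigroup_nn M t f x \<partial>m) \<le> (\<integral>\<^sup>+x. f x \<partial>m)"
proof -
  have "(\<integral>\<^sup>+x. semigroup_nn M t f x \<partial>m) = (\<integral>\<^sup>+x. f x * semigroup_nn M t (\<lambda>_. 1) x \<partial>m)"
    using sym_nn[OF t, of f "\<lambda>_. 1"] by simp
  also have "\<dots> \<le> (\<integral>\<^sup>+x. f x * 1 \<partial>m)"
    by (intro nn_integral_mono mult_left_mono semigroup_nn_const_le) simp
  finally show ?thesis by simp
qed

text \<open>A class stable under the semigroup and its averages, on which all products are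
  integrable; bilinear identities can be used on it without discussing L^2.\<close>

definition L1b :: "('a \<Rightarrow> real) \<Rightarrow> bool" where
  "L1b f \<longleftrightarrow> bdd_fun f \<and> integrable m f"

lemma L1b_lincomb: "L1b f \<Longrightarrow> L1b g \<Longrightarrow> L1b (\<lambda>x. a * f x + b * g x)"
  by (auto simp: L1b_def intro: bdd_fun_lincomb)

lemma L1b_mult: "L1b f \<Longrightarrow> bdd_fun g \<Longrightarrow> integrable m (\<lambda>x. f x * g x)"
proof -
  assume f: "L1b f" and g: "bdd_fun g"
  obtain C where C: "0 \<le> C" "\<And>x. \<bar>g x\<bar> \<le> C" using bdd_funE[OF g] by blast
  have "bdd_fun f" "integrable m f" using f by (auto simp: L1b_def)
  note [measurable] = bdd_fun_measurable[OF g] bdd_fun_measurable[OF \<open>bdd_fun f\<close>]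
  show ?thesis
  proof (rule Bochner_Integration.integrable_bound)
    show "integrable m (\<lambda>x. C * f x)" using \<open>integrable m f\<close> by simp
    show "AE x in m. norm (f x * g x) \<le> norm (C * f x)"
    proof (rule AE_I2)
      fix x
      have "\<bar>f x\<bar> * \<bar>g x\<bar> \<le> \<bar>f x\<bar> * C" by (intro mult_left_mono C) auto
      then show "norm (f x * g x) \<le> norm (C * f x)" using C(1) by (simp add: abs_mult mult.commute)
    qed
  qed simp
qed

lemma nn_integral_abs_transition:
  assumes f: "bdd_fun f" and t: "0 \<le> t"
  shows "(\<integral>\<^sup>+x. ennreal \<bar>transition M t f x\<bar> \<partial>m) \<le> (\<integral>\<^sup>+x. ennreal \<bar>f x\<bar> \<partial>m)"
proof -
  note [measurable] = bdd_fun_measurable[OF f]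
  have "ennreal \<bar>transition M t f x\<bar> \<le> semigroup_nn M t (\<lambda>x. ennreal \<bar>f x\<bar>) x" for x
  proof -
    have "\<bar>transition M t f x\<bar> \<le> (\<integral>\<omega>. \<bar>ext0 f (coord M t \<omega>)\<bar> \<partial>law M (Some x))"
      unfolding transition_def using integral_norm_bound[of "law M (Some x)" "\<lambda>\<omega>. ext0 f (coord M t \<omega>)"] by simp
    also have "\<dots> = transition M t (\<lambda>x. \<bar>f x\<bar>) x"
      unfolding transition_def by (intro Bochner_Integration.integral_cong) (auto simp: ext0_def split: option.split)
    finally show ?thesis
      using ennreal_transition(1)[OF bdd_fun_abs[OF f] _ t, of x] by (metis abs_ge_zero ennreal_leI)
  qed
  then have "(\<integral>\<^sup>+x. ennreal \<bar>transition M t f x\<bar> \<partial>m) \<le> (\<integral>\<^sup>+x. semigroup_nn M t (\<lambda>x. ennreal \<bar>f x\<bar>) x \<partial>m)"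
    by (intro nn_integral_mono)
  also have "\<dots> \<le> (\<integral>\<^sup>+x. ennreal \<bar>f x\<bar> \<partial>m)"
    by (rule semigroup_nn_contract[OF t]) simp
  finally show ?thesis .
qed

lemma L1b_transition: "L1b f \<Longrightarrow> 0 \<le> t \<Longrightarrow> L1b (transition M t f)"
proof -
  assume f: "L1b f" and t: "0 \<le> t"
  then have b: "bdd_fun f" and i: "integrable m f" by (auto simp: L1b_def)
  note [measurable] = bdd_fun_measurable[OF b]
  have "(\<integral>\<^sup>+x. ennreal \<bar>f x\<bar> \<partial>m) < \<infinity>" using i by (simp add: integrable_iff_bounded)
  then have "integrable m (transition M t f)"
    using nn_integral_abs_transition[OF b t] t by (auto simp: integrable_iff_bounded)
  then show ?thesis using b t by (simp add: L1b_def bdd_fun_transition)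
qed

lemma transition_sym:
  assumes f: "L1b f" and g: "L1b g" and t: "0 \<le> t"
  shows "(\<integral>x. transition M t f x * g x \<partial>m) = (\<integral>x. f x * transition M t g x \<partial>m)"
proof -
  have pos: "(\<integral>x. transition M t f x * g x \<partial>m) = (\<integral>x. f x * transition M t g x \<partial>m)"
    if f: "L1b f" "\<And>x. 0 \<le> f x" and g: "L1b g" "\<And>x. 0 \<le> g x" for f g
  proof -
    have b: "bdd_fun f" "bdd_fun g" using f g by (auto simp: L1b_def)
    note [measurable] = b[THEN bdd_fun_measurable]
    have "(\<integral>\<^sup>+x. ennreal (transition M t f x * g x) \<partial>m) = (\<integral>\<^sup>+x. ennreal (f x * transition M t g x) \<partial>m)"
      using sym_nn[OF t, of "\<lambda>x. ennreal (f x)" "\<lambda>x. ennreal (g x)"] f g b t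
      by (simp add: ennreal_mult ennreal_transition)
    then show ?thesis
      using f g b t by (subst (1 2) integral_eq_nn_integral) (auto simp: ennreal_transition(2))
  qed
  let ?fp = "\<lambda>x. max 0 (f x)" and ?fn = "\<lambda>x. max 0 (- f x)" and ?gp = "\<lambda>x. max 0 (g x)" and ?gn = "\<lambda>x. max 0 (- g x)"
  have L: "L1b ?fp" "L1b ?fn" "L1b ?gp" "L1b ?gn"
    using f g by (auto simp: L1b_def bdd_fun_parts)
  have i: "integrable m (\<lambda>x. transition M t u x * v x)" "integrable m (\<lambda>x. v x * transition M t u x)"
    if "L1b u" "L1b v" for u v
    using L1b_mult[OF L1b_transition[OF that(1) t], of v] that by (auto simp: L1b_def mult.commute)
  have fd: "f x = ?fp x - ?fn x" and gd: "g x = ?gp x - ?gn x" for x by auto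
  have bf: "bdd_fun f" "bdd_fun g" using f g by (auto simp: L1b_def)
  have "(\<integral>x. transition M t f x * g x \<partial>m) =
    (\<integral>x. (transition M t ?fp x * ?gp x - transition M t ?fp x * ?gn x) - (transition M t ?fn x * ?gp x - transition M t ?fn x * ?gn x) \<partial>m)"
    by (intro Bochner_Integration.integral_cong refl, subst transition_parts[OF bf(1) t], subst gd) (simp only: algebra_simps)
  also have "\<dots> = (\<integral>x. transition M t ?fp x * ?gp x \<partial>m) - (\<integral>x. transition M t ?fp x * ?gn x \<partial>m) -
      ((\<integral>x. transition M t ?fn x * ?gp x \<partial>m) - (\<integral>x. transition M t ?fn x * ?gn x \<partial>m))"
    using L i by simp
  also have "\<dots> = (\<integral>x. ?fp x * transition M t ?gp x \<partial>m) - (\<integral>x. ?fp x * transition M t ?gn x \<partial>m) -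
      ((\<integral>x. ?fn x * transition M t ?gp x \<partial>m) - (\<integral>x. ?fn x * transition M t ?gn x \<partial>m))"
    using L by (simp add: pos)
  also have "\<dots> = (\<integral>x. (?fp x * transition M t ?gp x - ?fp x * transition M t ?gn x) - (?fn x * transition M t ?gp x - ?fn x * transition M t ?gn x) \<partial>m)"
    using L i by simp
  also have "\<dots> = (\<integral>x. f x * transition M t g x \<partial>m)"
  proof (intro Bochner_Integration.integral_cong refl)
    fix x
    have alg: "(a * c - a * d) - (b * c - b * d) = (a - b) * (c - d)" for a b c d :: real
      by (simp add: algebra_simps)
    show "(?fp x * transition M t ?gp x - ?fp x * transition M t ?gn x) - (?fn x * transition M t ?gp x - ?fn x * transition M t ?gn x) =
      f x * transition M t g x"
      unfolding alg using fd[of x] transition_parts[OF bf(2) t, of x] by presburger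
  qed
  finally show ?thesis .
qed

text \<open>Fubini's theorem needs one bound: the semigroup contracts L^1 at every time, the other
  factors are bounded, and the exponential law is finite.\<close>

lemma integrable_pair_avg:
  assumes f: "L1b f" and g: "bdd_fun g" and w: "bdd_fun w"
  shows "integrable (m \<Otimes>\<^sub>M Exp_meas 1) (\<lambda>(x, s). w s * transition M (max 0 s) f x * g x)"
proof -
  interpret m: sigma_finite_measure m by (rule sigma_finite_m)
  interpret E: prob_space "Exp_meas 1" by (rule prob_Exp)
  interpret P: pair_sigma_finite m "Exp_meas 1" ..
  have b: "bdd_fun f" and i: "integrable m f" using f by (auto simp: L1b_def)
  obtain G where G: "0 \<le> G" "\<And>x. \<bar>g x\<bar> \<le> G" using bdd_funE[OF g] by blast
  obtain W where W: "0 \<le> W" "\<And>x. \<bar>w x\<bar> \<le> W" using bdd_funE[OF w] by blast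
  note [measurable] = b[THEN bdd_fun_measurable] g[THEN bdd_fun_measurable] w[THEN bdd_fun_measurable]
  have "(\<integral>\<^sup>+z. ennreal (norm (case z of (x, s) \<Rightarrow> w s * transition M (max 0 s) f x * g x)) \<partial>(m \<Otimes>\<^sub>M Exp_meas 1)) =
    (\<integral>\<^sup>+s. (\<integral>\<^sup>+x. ennreal (norm (w s * transition M (max 0 s) f x * g x)) \<partial>m) \<partial>Exp_meas 1)"
    by (subst P.nn_integral_snd[symmetric]) auto
  also have "\<dots> \<le> (\<integral>\<^sup>+s. ennreal (W * G) * (\<integral>\<^sup>+x. ennreal \<bar>f x\<bar> \<partial>m) \<partial>Exp_meas 1)"
  proof (rule nn_integral_mono)
    fix s
    have "(\<integral>\<^sup>+x. ennreal (norm (w s * transition M (max 0 s) f x * g x)) \<partial>m) \<le>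
      (\<integral>\<^sup>+x. ennreal (W * G) * ennreal \<bar>transition M (max 0 s) f x\<bar> \<partial>m)"
    proof (rule nn_integral_mono)
      fix x
      have "\<bar>w s\<bar> * \<bar>g x\<bar> \<le> W * G" using W G by (intro mult_mono) auto
      then have "\<bar>w s\<bar> * \<bar>g x\<bar> * \<bar>transition M (max 0 s) f x\<bar> \<le> W * G * \<bar>transition M (max 0 s) f x\<bar>"
        by (intro mult_right_mono) auto
      then show "ennreal (norm (w s * transition M (max 0 s) f x * g x)) \<le> ennreal (W * G) * ennreal \<bar>transition M (max 0 s) f x\<bar>"
        using W G by (subst ennreal_mult[symmetric]) (auto simp: abs_mult mult_ac intro!: ennreal_leI)
    qed
    also have "\<dots> = ennreal (W * G) * (\<integral>\<^sup>+x. ennreal \<bar>transition M (max 0 s) f x\<bar> \<partial>m)"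
      by (rule nn_integral_cmult) measurable
    also have "\<dots> \<le> ennreal (W * G) * (\<integral>\<^sup>+x. ennreal \<bar>f x\<bar> \<partial>m)"
      by (intro mult_left_mono nn_integral_abs_transition b) auto
    finally show "(\<integral>\<^sup>+x. ennreal (norm (w s * transition M (max 0 s) f x * g x)) \<partial>m) \<le> ennreal (W * G) * (\<integral>\<^sup>+x. ennreal \<bar>f x\<bar> \<partial>m)" .
  qed
  also have "\<dots> = ennreal (W * G) * (\<integral>\<^sup>+x. ennreal \<bar>f x\<bar> \<partial>m)"
    using E.emeasure_space_1 by simp
  also have "\<dots> < \<infinity>"
    using i by (simp add: integrable_iff_bounded ennreal_mult_less_top)
  finally show ?thesis
    by (simp add: integrable_iff_bounded)
qed

lemma L1b_avg:
  assumes f: "L1b f" and w: "bdd_fun w"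
  shows "L1b (avg w f)"
proof -
  interpret m: sigma_finite_measure m by (rule sigma_finite_m)
  interpret E: prob_space "Exp_meas 1" by (rule prob_Exp)
  interpret P: pair_sigma_finite m "Exp_meas 1" ..
  have "bdd_fun (\<lambda>_::'a. 1::real)" by (rule bdd_funI[where C=1]) auto
  from P.integrable_fst'[OF integrable_pair_avg[OF f this w]]
  have "integrable m (avg w f)" by (simp add: avg_def[abs_def])
  then show ?thesis using f w by (simp add: L1b_def bdd_fun_avg)
qed

lemma avg_inner:
  assumes f: "L1b f" and g: "bdd_fun g" and w: "bdd_fun w"
  shows "(\<integral>x. avg w f x * g x \<partial>m) = (\<integral>s. w s * (\<integral>x. transition M (max 0 s) f x * g x \<partial>m) \<partial>Exp_meas 1)"
    "integrable (Exp_meas 1) (\<lambda>s. w s * (\<integral>x. transition M (max 0 s) f x * g x \<partial>m))"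
proof -
  interpret m: sigma_finite_measure m by (rule sigma_finite_m)
  interpret E: prob_space "Exp_meas 1" by (rule prob_Exp)
  interpret P: pair_sigma_finite m "Exp_meas 1" ..
  interpret Q: pair_sigma_finite "Exp_meas 1" m ..
  note I = integrable_pair_avg[OF f g w]
  have b: "bdd_fun f" using f by (auto simp: L1b_def)
  have "(\<integral>x. avg w f x * g x \<partial>m) = (\<integral>x. (\<integral>s. w s * transition M (max 0 s) f x * g x \<partial>Exp_meas 1) \<partial>m)"
    unfolding avg_def by simp
  also have "\<dots> = (\<integral>s. (\<integral>x. w s * transition M (max 0 s) f x * g x \<partial>m) \<partial>Exp_meas 1)"
    by (rule P.Fubini_integral[symmetric, OF I])
  also have "\<dots> = (\<integral>s. w s * (\<integral>x. transition M (max 0 s) f x * g x \<partial>m) \<partial>Exp_meas 1)"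
    by (simp add: mult.assoc)
  finally show "(\<integral>x. avg w f x * g x \<partial>m) = (\<integral>s. w s * (\<integral>x. transition M (max 0 s) f x * g x \<partial>m) \<partial>Exp_meas 1)" .
  show "integrable (Exp_meas 1) (\<lambda>s. w s * (\<integral>x. transition M (max 0 s) f x * g x \<partial>m))"
    using Q.integrable_fst'[OF P.integrable_product_swap[OF I]] by (simp add: mult.assoc)
qed

end

section \<open>Sets of zero capacity\<close>

context symmetric_hunt begin

text \<open>Jensen's inequality, in the form that a variance is nonnegative. If the square is not
  integrable the right-hand side is infinite, so u may be any Borel function.\<close>

lemma transition_power2_le:
  assumes [measurable]: "u \<in> borel_measurable borel" and t: "0 \<le> t"
  shows "ennreal ((transition M t u x)\<^sup>2) \<le> semigroup_nn M t (\<lambda>x. ennreal ((u x)\<^sup>2)) x"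
proof -
  interpret L: prob_space "law M (Some x)" by (rule prob_law)
  note [measurable] = coord_measurable[OF t]
  let ?X = "\<lambda>\<omega>. ext0 u (coord M t \<omega>)"
  have eq: "semigroup_nn M t (\<lambda>x. ennreal ((u x)\<^sup>2)) x = (\<integral>\<^sup>+\<omega>. ennreal ((?X \<omega>)\<^sup>2) \<partial>law M (Some x))"
    unfolding semigroup_nn_def expect_def by (intro nn_integral_cong) (simp add: ext0_def split: option.split)
  show ?thesis
  proof (cases "integrable (law M (Some x)) (\<lambda>\<omega>. (?X \<omega>)\<^sup>2)")
    case True
    have "?X \<in> borel_measurable (law M (Some x))" by measurable
    then have i: "integrable (law M (Some x)) ?X"
      using True by (rule L.square_integrable_imp_integrable)
    have "(transition M t u x)\<^sup>2 \<le> (\<integral>\<omega>. (?X \<omega>)\<^sup>2 \<partial>law M (Some x))"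
      using L.variance_eq[OF i True] L.variance_positive[of ?X] by (simp add: transition_def)
    then have "ennreal ((transition M t u x)\<^sup>2) \<le> ennreal (\<integral>\<omega>. (?X \<omega>)\<^sup>2 \<partial>law M (Some x))"
      by (rule ennreal_leI)
    also have "\<dots> = semigroup_nn M t (\<lambda>x. ennreal ((u x)\<^sup>2)) x"
      unfolding eq by (rule nn_integral_eq_integral[OF True, symmetric]) simp
    finally show ?thesis .
  next
    case False
    then have "(\<integral>\<^sup>+\<omega>. ennreal ((?X \<omega>)\<^sup>2) \<partial>law M (Some x)) = \<infinity>"
      by (simp add: integrable_iff_bounded) (metis top.not_eq_extremum)
    then show ?thesis unfolding eq by simp
  qed
qed

text \<open>Jensen's inequality and the L^1 contraction give \<integral> (p_t u)^2 dm \<le>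
  \<integral> u^2 dm, and 2 a b \<le> a^2 + b^2 turns this into (p_t u, u) \<le> (u, u).\<close>

lemma approx_form_nonneg:
  assumes u[measurable]: "u \<in> borel_measurable borel" and i: "integrable m (\<lambda>x. (u x)\<^sup>2)" and t: "0 < t"
  shows "0 \<le> approx_form M m t u u"
proof -
  note [measurable] = transition_measurable'[OF u less_imp_le[OF t]]
  let ?T = "transition M t u"
  have "0 \<le> (\<integral>x. (u x - ?T x) * u x \<partial>m)"
  proof -
    have le: "(\<integral>\<^sup>+x. ennreal ((?T x)\<^sup>2) \<partial>m) \<le> (\<integral>\<^sup>+x. ennreal ((u x)\<^sup>2) \<partial>m)"
      using t by (intro order_trans[OF nn_integral_mono[OF transition_power2_le] semigroup_nn_contract]) auto
    have "(\<integral>\<^sup>+x. ennreal ((u x)\<^sup>2) \<partial>m) < \<infinity>" using i by (simp add: integrable_iff_bounded)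
    then have iT: "integrable m (\<lambda>x. (?T x)\<^sup>2)"
      using le by (auto simp: integrable_iff_bounded)
    have "(\<integral>x. (?T x)\<^sup>2 \<partial>m) \<le> (\<integral>x. (u x)\<^sup>2 \<partial>m)"
      using le i iT by (simp add: nn_integral_eq_integral)
    have iTu: "integrable m (\<lambda>x. ?T x * u x)"
    proof (rule Bochner_Integration.integrable_bound[OF Bochner_Integration.integrable_add[OF i iT]])
      have "\<bar>a * b\<bar> \<le> \<bar>b\<^sup>2 + a\<^sup>2\<bar>" for a b :: real
      proof -
        have "2 * (\<bar>a\<bar> * \<bar>b\<bar>) \<le> a\<^sup>2 + b\<^sup>2"
          using sum_squares_bound[of "\<bar>a\<bar>" "\<bar>b\<bar>"] by simp
        then have "\<bar>a * b\<bar> \<le> a\<^sup>2 + b\<^sup>2"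
          by (simp add: abs_mult) (smt (verit) mult_nonneg_nonneg abs_ge_zero)
        then show ?thesis by simp
      qed
      then show "AE x in m. norm (?T x * u x) \<le> norm ((u x)\<^sup>2 + (?T x)\<^sup>2)" by simp
    qed measurable
    have "(\<integral>x. ?T x * u x \<partial>m) \<le> (\<integral>x. ((?T x)\<^sup>2 + (u x)\<^sup>2) / 2 \<partial>m)"
    proof (rule integral_mono[OF iTu])
      show "?T x * u x \<le> ((?T x)\<^sup>2 + (u x)\<^sup>2) / 2" for x
        using sum_squares_bound[of "?T x" "u x"] by simp
    qed (use i iT in auto)
    also have "\<dots> = ((\<integral>x. (?T x)\<^sup>2 \<partial>m) + (\<integral>x. (u x)\<^sup>2 \<partial>m)) / 2"
      using i iT by simp
    also have "\<dots> \<le> (\<integral>x. (u x)\<^sup>2 \<partial>m)"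
      using \<open>(\<integral>x. (?T x)\<^sup>2 \<partial>m) \<le> (\<integral>x. (u x)\<^sup>2 \<partial>m)\<close> by simp
    finally have "0 \<le> (\<integral>x. (u x)\<^sup>2 \<partial>m) - (\<integral>x. ?T x * u x \<partial>m)" by simp
    also have "\<dots> = (\<integral>x. (u x)\<^sup>2 - ?T x * u x \<partial>m)" using i iTu by simp
    finally show ?thesis by (simp add: power2_eq_square left_diff_distrib)
  qed
  then show ?thesis using t by (simp add: approx_form_def)
qed

lemma form_domain_limit:
  assumes "u \<in> form_domain M m"
  shows "((\<lambda>t. approx_form M m t u u) \<longlongrightarrow> dirichlet_form M m u u) (at_right 0)" "0 \<le> dirichlet_form M m u u"
proof -
  obtain c where c: "((\<lambda>t. approx_form M m t u u) \<longlongrightarrow> c) (at_right 0)"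
    using assms by (auto simp: form_domain_def)
  then have "dirichlet_form M m u u = c"
    unfolding dirichlet_form_def by (intro tendsto_Lim) simp_all
  moreover have "0 \<le> c"
  proof (rule tendsto_lowerbound[OF c])
    have "\<forall>\<^sub>F t in at_right 0. (0::real) < t" by (simp add: eventually_at_right_less)
    then show "\<forall>\<^sub>F t in at_right 0. 0 \<le> approx_form M m t u u"
      by eventually_elim (use assms in \<open>auto simp: form_domain_def intro: approx_form_nonneg\<close>)
  qed simp
  ultimately show "((\<lambda>t. approx_form M m t u u) \<longlongrightarrow> dirichlet_form M m u u) (at_right 0)" "0 \<le> dirichlet_form M m u u"
    using c by auto
qed

text \<open>The form is nonnegative, so E_1(u,u) \<ge> \<integral> u^2 dm \<ge> m(U). Hence sets of
  zero capacity are \<open>m\<close>-null.\<close>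

lemma emeasure_le_cap_open:
  assumes "open U" shows "emeasure m U \<le> cap_open M m U"
  unfolding cap_open_def
proof (rule INF_greatest)
  fix u assume u: "u \<in> {u \<in> form_domain M m. AE x in m. x \<in> U \<longrightarrow> 1 \<le> u x}"
  then have [measurable]: "u \<in> borel_measurable borel" and i: "integrable m (\<lambda>x. (u x)\<^sup>2)"
    by (auto simp: form_domain_def)
  have "emeasure m U = (\<integral>\<^sup>+x. indicator U x \<partial>m)" using assms by simp
  also have "\<dots> \<le> (\<integral>\<^sup>+x. ennreal ((u x)\<^sup>2) \<partial>m)"
  proof (rule nn_integral_mono_AE)
    have "AE x in m. x \<in> U \<longrightarrow> 1 \<le> u x" using u by simp
    then show "AE x in m. indicator U x \<le> ennreal ((u x)\<^sup>2)"
    proof eventually_elim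
      case (elim x)
      then show ?case by (auto simp: ennreal_1[symmetric] one_le_power split: split_indicator simp del: ennreal_1)
    qed
  qed
  also have "\<dots> = ennreal (\<integral>x. (u x)\<^sup>2 \<partial>m)"
    using i by (intro nn_integral_eq_integral) auto
  also have "\<dots> \<le> ennreal (dirichlet_form_alpha M m 1 u u)"
    using form_domain_limit(2)[of u] u
    by (intro ennreal_leI) (simp add: dirichlet_form_alpha_def power2_eq_square)
  finally show "emeasure m U \<le> ennreal (dirichlet_form_alpha M m 1 u u)" .
qed

text \<open>An exceptional set need not be Borel. Open supersets of capacity tending to 0 intersect
  in a Borel set that is null for \<open>m\<close> and, having zero capacity, for every smooth
  measure.\<close>

lemma cap_zero_borel_cover:
  assumes "cap M m N = 0"
  obtains B where "B \<in> sets borel" "N \<subseteq> B" "cap M m B = 0" "emeasure m B = 0"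
proof -
  have "\<exists>U. open U \<and> N \<subseteq> U \<and> cap_open M m U < ennreal (1 / real (Suc n))" for n
  proof -
    have "cap M m N < ennreal (1 / real (Suc n))" using assms by (simp add: ennreal_zero_less_divide)
    then show ?thesis unfolding cap_def INF_less_iff by auto
  qed
  then obtain U where U: "\<And>n. open (U n)" "\<And>n. N \<subseteq> U n" "\<And>n. cap_open M m (U n) < ennreal (1 / real (Suc n))"
    by metis
  let ?B = "\<Inter>n. U n"
  have small: "c = 0" if "\<And>n. c \<le> ennreal (1 / real (Suc n))" for c :: ennreal
  proof -
    have "(\<lambda>n. ennreal (1 / real (Suc n))) \<longlonglongrightarrow> ennreal 0"
      using LIMSEQ_inverse_real_of_nat by (intro tendsto_ennrealI) (simp add: inverse_eq_divide)
    then have "c \<le> ennreal 0" by (rule LIMSEQ_le_const) (use that in auto)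
    then show ?thesis by simp
  qed
  have "cap M m ?B = 0"
  proof (rule small)
    fix n
    have "cap M m ?B \<le> cap_open M m (U n)"
      unfolding cap_def by (rule INF_lower) (use U in auto)
    then show "cap M m ?B \<le> ennreal (1 / real (Suc n))" using U(3)[of n] by simp
  qed
  moreover have "?B \<in> sets borel" using U by (intro sets.countable_INT) auto
  moreover have "emeasure m ?B = 0"
  proof (rule small)
    fix n
    have "emeasure m ?B \<le> emeasure m (U n)" using U by (intro emeasure_mono) auto
    also have "\<dots> \<le> cap_open M m (U n)" by (rule emeasure_le_cap_open[OF U(1)])
    finally show "emeasure m ?B \<le> ennreal (1 / real (Suc n))" using U(3)[of n] by simp
  qed
  ultimately show ?thesis using that U by blast
qed

end

section \<open>Measurable versions of additive functionals\<close>

context hunt begin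

text \<open>Each generator differs from an event of the natural sigma-field by a null set of the law
  started from \<nu>, so adapted functionals are measurable under each single completion.\<close>

lemma filt_subset_completion:
  assumes \<nu>: "\<nu> \<in> space (prob_algebra borel_cpt)" and X: "X \<in> sets (filt M t)"
  shows "X \<in> sets (completion (law_from M \<nu>))"
proof -
  let ?P = "law_from M \<nu>"
  let ?G = "{A. A \<subseteq> outcomes M \<and>
         (\<forall>\<nu> \<in> space (prob_algebra borel_cpt). \<exists>B \<in> sets (natural_filt M t).
            (A - B) \<union> (B - A) \<in> null_sets (completion (law_from M \<nu>)))}"
  have sets_P: "sets ?P = sets \<F>"
    unfolding law_from_def by (rule sets_bind'[OF \<nu> law_kernel])
  have space_P: "space ?P = outcomes M" using sets_eq_imp_space_eq[OF sets_P] by simp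
  have "?G \<subseteq> sets (completion ?P)"
  proof safe
    fix A assume "\<forall>\<nu> \<in> space (prob_algebra borel_cpt). \<exists>B \<in> sets (natural_filt M t).
            (A - B) \<union> (B - A) \<in> null_sets (completion (law_from M \<nu>))"
    then obtain B where B: "B \<in> sets (natural_filt M t)" "(A - B) \<union> (B - A) \<in> null_sets (completion ?P)"
      using \<nu> by blast
    have BA: "A - B \<in> sets (completion ?P)" "B - A \<in> sets (completion ?P)"
      using null_sets_completion_subset[OF _ B(2)] by auto
    have "B \<in> sets (completion ?P)" using sets_natural_filt_top[OF B(1)] by (simp add: sets_P)
    then have "(B - (B - A)) \<union> (A - B) \<in> sets (completion ?P)" using BA by blast
    moreover have "(B - (B - A)) \<union> (A - B) = A" by blast
    ultimately show "A \<in> sets (completion ?P)" by simp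
  qed
  moreover have "sets (filt M t) = sigma_sets (outcomes M) ?G"
    unfolding filt_def by (rule sets_measure_of) auto
  ultimately show ?thesis
    using X sets.sigma_sets_subset[of ?G "completion ?P"] by (auto simp: space_P)
qed

text \<open>Pathwise content of \<open>pcaf\<close> with the defining set as a parameter. The
  exceptional set of starting points is kept apart, since pathwise estimates do not involve
  it.\<close>

definition af_good :: "(real \<Rightarrow> 'w \<Rightarrow> ennreal) \<Rightarrow> 'w set \<Rightarrow> bool" where
  "af_good A \<Lambda> \<longleftrightarrow> \<Lambda> \<in> sets (filt M top) \<and> (\<forall>t\<ge>0. A t \<in> borel_measurable (filt M (ennreal t))) \<and>
    (\<forall>t>0. shift M t ` \<Lambda> \<subseteq> \<Lambda>) \<and>
    (\<forall>\<omega>\<in>\<Lambda>. A 0 \<omega> = 0 \<and> (\<forall>t\<ge>0. ennreal t < lifetime M \<omega> \<longrightarrow> A t \<omega> < \<infinity>) \<and>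
      (\<forall>s\<ge>0. \<forall>t\<ge>0. A (t + s) \<omega> = A s \<omega> + A t (shift M s \<omega>)) \<and> continuous_on {0..} (\<lambda>t. A t \<omega>))"

text \<open>Increments are values along the shifted path, hence nonnegative.\<close>

lemma af_good_path:
  assumes "af_good A \<Lambda>" "\<omega> \<in> \<Lambda>" shows "good_path (\<lambda>t. A t \<omega>)"
proof -
  have add: "A (t + s) \<omega> = A s \<omega> + A t (shift M s \<omega>)" if "0 \<le> s" "0 \<le> t" for s t
    using assms that by (auto simp: af_good_def)
  have "A s \<omega> \<le> A t \<omega>" if "0 \<le> s" "s \<le> t" for s t
    using add[of s "t - s"] that by simp
  then show ?thesis using assms by (auto simp: good_path_def af_good_def intro!: mono_onI)
qed

lemma af_good_outcomes: "af_good A \<Lambda> \<Longrightarrow> \<omega> \<in> \<Lambda> \<Longrightarrow> \<omega> \<in> outcomes M"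
  using sets.sets_into_space[of \<Lambda> "filt M top"] filtration.space_F[OF filtration_filt, of top]
  by (auto simp: af_good_def)

lemma coord_path_measurable [measurable]:
  "\<omega> \<in> outcomes M \<Longrightarrow> (\<lambda>s. coord M (max 0 s) \<omega>) \<in> borel \<rightarrow>\<^sub>M borel_cpt"
  using measurable_compose[OF measurable_Pair2'[of \<omega> \<F> borel] joint_coord_measurable] by simp

lemma restrict_af_eq:
  "restrict_af M F A t \<omega> = (\<integral>\<^sup>+s\<in>{0..t}. ext0 (indicator F) (coord M (max 0 s) \<omega>) \<partial>path_measure (\<lambda>t. A t \<omega>))"
  unfolding restrict_af_def path_integral_def
  by (intro nn_integral_cong) (auto simp: max_def split: split_indicator)

lemma ext0_indicator_le_1: "ext0 (indicator F) y \<le> (1::ennreal)"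
  by (auto simp: ext0_def split: option.split split_indicator)

lemma restrict_af_good_path:
  assumes A: "af_good A \<Lambda>" "\<omega> \<in> \<Lambda>" and F[measurable]: "F \<in> sets borel"
  shows "good_path (\<lambda>t. restrict_af M F A t \<omega>)"
proof -
  have [measurable]: "(\<lambda>s. coord M (max 0 s) \<omega>) \<in> borel \<rightarrow>\<^sub>M borel_cpt"
    by (rule coord_path_measurable[OF af_good_outcomes[OF A]])
  show ?thesis
    unfolding restrict_af_eq
    by (rule good_path_restrict[OF af_good_path[OF A] _ ext0_indicator_le_1]) measurable
qed

text \<open>If the path is alive at r, right continuity keeps it in E shortly afterwards, so the
  lifetime exceeds r and A_r is finite, as the comparison of the shifted path measures requires. A
  path dead at r could have A_r = \<infinity>.\<close>

lemma restrict_af_shift_le: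
  assumes A: "af_good A \<Lambda>" "\<omega> \<in> \<Lambda>" and F[measurable]: "F \<in> sets borel" and r: "0 < r"
    and alive: "coord M r \<omega> \<noteq> None" and t: "0 \<le> t"
  shows "restrict_af M F A t (shift M r \<omega>) \<le> restrict_af M F A (t + r) \<omega>"
proof -
  have \<omega>: "\<omega> \<in> outcomes M" by (rule af_good_outcomes[OF A])
  have sh: "shift M r \<omega> \<in> \<Lambda>" using A r by (auto simp: af_good_def)
  obtain x where x: "coord M r \<omega> = Some x" using alive by auto
  have "limitin cpt_top (\<lambda>s. coord M s \<omega>) (coord M r \<omega>) (at_right r)"
    using right_cont[OF \<omega>] r by simp
  then have "\<forall>\<^sub>F s in at_right r. coord M s \<omega> \<in> Some ` UNIV"
    unfolding limitin_def using openin_cpt_top_Some[of UNIV] x by auto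
  then obtain b where b: "r < b" "\<And>s. r < s \<Longrightarrow> s < b \<Longrightarrow> coord M s \<omega> \<in> Some ` UNIV"
    unfolding eventually_at_right_field by auto
  have "ennreal b \<le> lifetime M \<omega>"
    unfolding lifetime_def
  proof (rule Inf_greatest)
    fix z assume "z \<in> {ennreal t |t. 0 \<le> t \<and> coord M t \<omega> = None}"
    then obtain s where z: "z = ennreal s" and s: "0 \<le> s" "coord M s \<omega> = None" by auto
    have "b \<le> s"
    proof (rule ccontr)
      assume "\<not> b \<le> s"
      then show False
        using b(2)[of s] dead[OF \<omega> s(1) _ s(2), of r] alive s by (cases "r < s") auto
    qed
    then show "ennreal b \<le> z" unfolding z by (rule ennreal_leI)
  qed
  moreover have "ennreal r < ennreal b" using b(1) r by (simp add: ennreal_less_iff)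
  ultimately have "ennreal r < lifetime M \<omega>" by (rule less_le_trans[rotated])
  then have "A r \<omega> < \<infinity>" using A r unfolding af_good_def by (meson less_imp_le)
  then have fin: "A r \<omega> \<noteq> \<infinity>" by simp
  have [measurable]: "(\<lambda>s. coord M (max 0 s) \<omega>) \<in> borel \<rightarrow>\<^sub>M borel_cpt"
    by (rule coord_path_measurable[OF \<omega>])
  have "restrict_af M F A t (shift M r \<omega>) =
    (\<integral>\<^sup>+s\<in>{0..t}. ext0 (indicator F) (coord M (max 0 (s + r)) \<omega>) \<partial>path_measure (\<lambda>t. A t (shift M r \<omega>)))"
    unfolding restrict_af_eq using r \<omega>
    by (intro nn_integral_cong) (auto simp: coord_shift max_def split: split_indicator)
  also have "\<dots> \<le> restrict_af M F A (t + r) \<omega>"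
    unfolding restrict_af_eq
  proof (rule path_integral_shift_le[OF af_good_path[OF A] af_good_path[OF A(1) sh],
        where f="\<lambda>s. ext0 (indicator F) (coord M (max 0 s) \<omega>)"])
    show "A (t + r) \<omega> = A r \<omega> + A t (shift M r \<omega>)" if "0 \<le> t" for t
      using A r that by (auto simp: af_good_def)
  qed (use r fin in auto)
  finally show ?thesis .
qed

end

context symmetric_hunt begin

text \<open>The exceptional set of starting points is enlarged to a Borel set, so that statements
  outside it hold almost everywhere for \<open>m\<close> and for every smooth measure.\<close>

lemma pcaf_obtain:
  assumes "pcaf M m A"
  obtains \<Lambda> B where "af_good A \<Lambda>" "B \<in> sets borel" "cap M m B = 0" "emeasure m B = 0"
    "\<And>x. x \<notin> B \<Longrightarrow> AE \<omega> in law M (Some x). \<omega> \<in> \<Lambda>"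
proof -
  obtain \<Lambda> N where *: "\<Lambda> \<in> sets (filt M \<infinity>)" "cap M m N = 0"
        "\<forall>x. x \<notin> N \<longrightarrow> (AE \<omega> in law M (Some x). \<omega> \<in> \<Lambda>)"
        "\<forall>t>0. shift M t ` \<Lambda> \<subseteq> \<Lambda>"
        "\<forall>\<omega> \<in> \<Lambda>.
           A 0 \<omega> = 0 \<and>
           (\<forall>t\<ge>0. ennreal t < lifetime M \<omega> \<longrightarrow> A t \<omega> < \<infinity>) \<and>
           (\<forall>t\<ge>0. ennreal t \<ge> lifetime M \<omega> \<longrightarrow> A t \<omega> = A (enn2real (lifetime M \<omega>)) \<omega>) \<and>
           (\<forall>s\<ge>0. \<forall>t\<ge>0. A (t + s) \<omega> = A s \<omega> + A t (shift M s \<omega>)) \<and>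
           continuous_on {0..} (\<lambda>t. A t \<omega>)"
    using assms[unfolded pcaf_def, THEN conjunct2] by (elim bexE exE conjE) (rule that, assumption+)
  have At: "\<forall>t\<ge>0. A t \<in> borel_measurable (filt M (ennreal t))"
    using assms unfolding pcaf_def by (rule conjunct1)
  have "A 0 \<omega> = 0 \<and> (\<forall>t\<ge>0. ennreal t < lifetime M \<omega> \<longrightarrow> A t \<omega> < \<infinity>) \<and>
      (\<forall>s\<ge>0. \<forall>t\<ge>0. A (t + s) \<omega> = A s \<omega> + A t (shift M s \<omega>)) \<and> continuous_on {0..} (\<lambda>t. A t \<omega>)"
    if "\<omega> \<in> \<Lambda>" for \<omega>
    using *(5)[rule_format, OF that] by (elim conjE) (intro conjI, assumption+)
  then have "af_good A \<Lambda>" using *(1,4) At unfolding af_good_def infinity_ennreal_def by blast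
  moreover obtain B where "B \<in> sets borel" "N \<subseteq> B" "cap M m B = 0" "emeasure m B = 0"
    using cap_zero_borel_cover[OF *(2)] .
  ultimately show ?thesis using that *(3) by blast
qed

text \<open>Augmented events are completed under probability initial laws, whereas \<open>m\<close>
  may be infinite. A positive \<open>m\<close>-integrable density, normalised, gives a probability
  with the same null sets; full support makes the normalising constant positive.\<close>

lemma equivalent_initial_law:
  obtains \<nu> where "\<nu> \<in> space (prob_algebra borel_cpt)"
    "\<And>Q. (AE \<omega> in law_from M \<nu>. Q \<omega>) \<Longrightarrow> AE x in m. AE \<omega> in law M (Some x). Q \<omega>"
proof -
  interpret m: sigma_finite_measure m by (rule sigma_finite_m)
  obtain f :: "'a \<Rightarrow> real" where f: "f \<in> borel_measurable m" "\<And>x. f x > 0" "integrable m f"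
    using m.obtain_positive_integrable_function by metis
  have [measurable]: "f \<in> borel_measurable borel" using f(1) by simp
  have I: "(\<integral>\<^sup>+x. ennreal (f x) \<partial>m) = ennreal (\<integral>x. f x \<partial>m)"
    using f by (intro nn_integral_eq_integral) (auto simp: less_imp_le)
  have "(\<integral>\<^sup>+x. ennreal (f x) \<partial>m) \<noteq> 0"
  proof
    assume "(\<integral>\<^sup>+x. ennreal (f x) \<partial>m) = 0"
    then have "AE x in m. ennreal (f x) = 0" by (subst (asm) nn_integral_0_iff_AE) auto
    then have "AE x in m. False" by eventually_elim (use f(2) in \<open>metis ennreal_eq_0_iff not_less\<close>)
    then have "emeasure m (space m) = 0" by (simp add: AE_iff_measurable[OF _ refl])
    then show False using supp by (auto simp: full_support_def)
  qed
  then have pos: "(\<integral>x. f x \<partial>m) > 0" unfolding I by (metis ennreal_neg not_le)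
  let ?d = "density m (\<lambda>x. ennreal (f x / (\<integral>x. f x \<partial>m)))"
  have "prob_space ?d"
  proof
    have "emeasure ?d (space ?d) = (\<integral>\<^sup>+x. ennreal (f x / (\<integral>x. f x \<partial>m)) \<partial>m)"
      by (subst emeasure_density) auto
    also have "\<dots> = ennreal (\<integral>x. f x / (\<integral>x. f x \<partial>m) \<partial>m)"
      using f pos by (intro nn_integral_eq_integral) (auto simp: less_imp_le)
    also have "\<dots> = 1" using pos by simp
    finally show "emeasure ?d (space ?d) = 1" .
  qed
  then have \<nu>: "distr ?d borel_cpt Some \<in> space (prob_algebra borel_cpt)"
    by (auto simp: space_prob_algebra intro!: prob_space.prob_space_distr)
  show ?thesis
  proof (rule that[OF \<nu>])
    fix Q assume Q: "AE \<omega> in law_from M (distr ?d borel_cpt Some). Q \<omega>"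
    have sets_P: "sets (law_from M (distr ?d borel_cpt Some)) = sets \<F>"
      unfolding law_from_def by (rule sets_bind'[OF \<nu> law_kernel])
    obtain Z where Z: "Z \<in> null_sets (law_from M (distr ?d borel_cpt Some))"
      "{\<omega> \<in> space (law_from M (distr ?d borel_cpt Some)). \<not> Q \<omega>} \<subseteq> Z"
      using Q unfolding eventually_ae_filter by auto
    have ZF: "Z \<in> sets \<F>" using Z(1) sets_P by auto
    have "AE \<omega> in law_from M (distr ?d borel_cpt Some). \<omega> \<notin> Z" using Z(1) by (rule AE_not_in)
    then have "AE y in distr ?d borel_cpt Some. AE \<omega> in law M y. \<omega> \<notin> Z"
      unfolding law_from_def
    proof (subst (asm) AE_bind)
      show "law M \<in> distr ?d borel_cpt Some \<rightarrow>\<^sub>M subprob_algebra \<F>"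
        using law_kernel_sub by simp
    qed (use ZF in auto)
    then have "AE x in ?d. AE \<omega> in law M (Some x). \<omega> \<notin> Z"
      by (rule AE_distrD[rotated]) simp
    then have "AE x in m. AE \<omega> in law M (Some x). \<omega> \<notin> Z"
      by (subst (asm) AE_density) (use f(2) pos in auto)
    then show "AE x in m. AE \<omega> in law M (Some x). Q \<omega>"
    proof eventually_elim
      case (elim x)
      have "AE \<omega> in law M (Some x). \<omega> \<in> outcomes M" using AE_space[of "law M (Some x)"] by simp
      with elim show ?case
        by eventually_elim (use Z(2) sets_eq_imp_space_eq[OF sets_P] in auto)
    qed
  qed
qed

text \<open>Under one initial law equivalent to \<open>m\<close>, each time has a version measurable
  for the uncompleted sigma-field, and the exceptional events of the rational times fit into one set
  Z. Continuity of the paths recovers all times from the rational ones, jointly measurably.\<close>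

lemma af_version:
  assumes A: "af_good A \<Lambda>" and F[measurable]: "F \<in> sets borel"
  obtains a Z where "(\<lambda>(s, \<omega>). a s \<omega>) \<in> borel_measurable (borel \<Otimes>\<^sub>M \<F>)" "Z \<in> sets \<F>"
    "AE x in m. emeasure (law M (Some x)) Z = 0"
    "\<And>\<omega> s. \<omega> \<in> \<Lambda> - Z \<Longrightarrow> 0 \<le> s \<Longrightarrow> a s \<omega> = restrict_af M F A s \<omega>"
proof -
  obtain \<nu> where \<nu>: "\<nu> \<in> space (prob_algebra borel_cpt)"
    "\<And>Q. (AE \<omega> in law_from M \<nu>. Q \<omega>) \<Longrightarrow> AE x in m. AE \<omega> in law M (Some x). Q \<omega>"
    using equivalent_initial_law by metis
  let ?P = "law_from M \<nu>" and ?C = "completion (law_from M \<nu>)"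
  have sets_P: "sets ?P = sets \<F>"
    unfolding law_from_def by (rule sets_bind'[OF \<nu>(1) law_kernel])
  have space_P: "space ?P = outcomes M" using sets_eq_imp_space_eq[OF sets_P] by simp
  have idm[measurable]: "(\<lambda>\<omega>. \<omega>) \<in> ?C \<rightarrow>\<^sub>M \<F>"
    by (rule measurable_completion) (simp add: sets_P cong: measurable_cong_sets)
  have AC: "A t \<in> borel_measurable ?C" if "0 \<le> t" for t
  proof (rule measurableI)
    fix X :: "ennreal set" assume "X \<in> sets borel"
    moreover have "A t \<in> borel_measurable (filt M (ennreal t))" using A that by (auto simp: af_good_def)
    ultimately have "A t -` X \<inter> space (filt M (ennreal t)) \<in> sets (filt M (ennreal t))" by (rule measurable_sets[rotated])
    then have "A t -` X \<inter> space (filt M (ennreal t)) \<in> sets ?C" by (rule filt_subset_completion[OF \<nu>(1)])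
    then show "A t -` X \<inter> space ?C \<in> sets ?C"
      by (simp add: filtration.space_F[OF filtration_filt] space_P)
  qed simp
  have \<Lambda>: "\<Lambda> \<in> sets ?C" using A by (intro filt_subset_completion[OF \<nu>(1)]) (auto simp: af_good_def)
  have "\<exists>Y. Y \<in> borel_measurable \<F> \<and> (AE \<omega> in ?P. \<omega> \<in> \<Lambda> \<longrightarrow> restrict_af M F A q \<omega> = Y \<omega>)" for q
  proof -
    have "(\<lambda>\<omega>. if \<omega> \<in> \<Lambda> then \<integral>\<^sup>+s. ext0 (indicator F) (coord M (max 0 s) \<omega>) * indicator {0..q} s \<partial>path_measure (\<lambda>t. A t \<omega>) else 0)
      \<in> borel_measurable ?C"
    proof (rule measurable_nn_integral_path_measure[OF \<Lambda> af_good_path[OF A] AC])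
      have "(\<lambda>z. fst z) \<in> ?C \<Otimes>\<^sub>M borel \<rightarrow>\<^sub>M \<F>"
        by (rule measurable_compose[OF measurable_fst idm])
      then have "(\<lambda>z. coord M (max 0 (snd z)) (fst z)) \<in> ?C \<Otimes>\<^sub>M borel \<rightarrow>\<^sub>M borel_cpt"
        by (intro coord_compose_measurable) auto
      from measurable_compose[OF this measurable_ext0[of "indicator F :: 'a \<Rightarrow> ennreal"]]
      have [measurable]: "(\<lambda>z. ext0 (indicator F) (coord M (max 0 (snd z)) (fst z)) :: ennreal) \<in> borel_measurable (?C \<Otimes>\<^sub>M borel)"
        by simp
      show "(\<lambda>(\<omega>, s). ext0 (indicator F) (coord M (max 0 s) \<omega>) * indicator {0..q} s :: ennreal) \<in> borel_measurable (?C \<Otimes>\<^sub>M borel)"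
        unfolding case_prod_beta by (rule borel_measurable_times_ennreal) measurable
    qed
    from completion_ex_borel_measurable[OF this]
    obtain Y where Y: "Y \<in> borel_measurable ?P"
      "AE \<omega> in ?P. (if \<omega> \<in> \<Lambda> then \<integral>\<^sup>+s. ext0 (indicator F) (coord M (max 0 s) \<omega>) * indicator {0..q} s \<partial>path_measure (\<lambda>t. A t \<omega>) else 0) = Y \<omega>"
      by auto
    have "AE \<omega> in ?P. \<omega> \<in> \<Lambda> \<longrightarrow> restrict_af M F A q \<omega> = Y \<omega>"
      using Y(2) by eventually_elim (simp add: restrict_af_eq split: if_splits)
    then show ?thesis using Y(1) by (auto simp: sets_P cong: measurable_cong_sets)
  qed
  then obtain Y where Ym: "\<And>q. Y q \<in> borel_measurable \<F>"
    and Y: "\<And>q. AE \<omega> in ?P. \<omega> \<in> \<Lambda> \<longrightarrow> restrict_af M F A q \<omega> = Y q \<omega>"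
    by metis
  have "AE \<omega> in ?P. \<forall>q\<in>\<rat>. \<omega> \<in> \<Lambda> \<longrightarrow> restrict_af M F A q \<omega> = Y q \<omega>"
    using Y by (subst AE_ball_countable[OF countable_rat]) auto
  then obtain Z where Z: "Z \<in> null_sets ?P" "{\<omega> \<in> space ?P. \<not> (\<forall>q\<in>\<rat>. \<omega> \<in> \<Lambda> \<longrightarrow> restrict_af M F A q \<omega> = Y q \<omega>)} \<subseteq> Z"
    unfolding eventually_ae_filter by auto
  have ZF: "Z \<in> sets \<F>" using Z(1) sets_P by auto
  \<comment> \<open>The supremum over rational times strictly below s is the left limit of a
    nondecreasing path; negative q contribute 0, so the value at s = 0 is 0.\<close>
  define a where "a s \<omega> = (SUP q\<in>\<rat>. indicator {q<..} s * indicator {0..} q * Y q \<omega>)" for s \<omega>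
  show ?thesis
  proof (rule that[of a Z])
    have "(\<lambda>z. SUP q\<in>\<rat>. indicator {q<..} (fst z) * indicator {0..} q * Y q (snd z)) \<in> borel_measurable (borel \<Otimes>\<^sub>M \<F>)"
    proof (rule borel_measurable_SUP[OF countable_rat])
      fix q :: real
      note [measurable] = Ym[of q]
      show "(\<lambda>z. indicator {q<..} (fst z) * indicator {0..} q * Y q (snd z)) \<in> borel_measurable (borel \<Otimes>\<^sub>M \<F>)"
        by measurable
    qed
    then show "(\<lambda>(s, \<omega>). a s \<omega>) \<in> borel_measurable (borel \<Otimes>\<^sub>M \<F>)"
      by (simp add: a_def case_prod_beta)
    show "Z \<in> sets \<F>" by fact
    have "AE x in m. AE \<omega> in law M (Some x). \<omega> \<notin> Z"
      by (rule \<nu>(2)[OF AE_not_in[OF Z(1)]])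
    then show "AE x in m. emeasure (law M (Some x)) Z = 0"
      by eventually_elim (simp add: AE_iff_null_sets ZF null_setsD1)
    fix \<omega> s assume \<omega>: "\<omega> \<in> \<Lambda> - Z" and s: "(0::real) \<le> s"
    let ?a = "\<lambda>s. restrict_af M F A s \<omega>"
    have g: "good_path ?a" using \<omega> by (intro restrict_af_good_path[OF A _ F]) simp
    have Yq: "Y q \<omega> = ?a q" if "q \<in> \<rat>" for q
      using Z(2) \<omega> that af_good_outcomes[OF A, of \<omega>] by (force simp: space_P)
    show "a s \<omega> = ?a s"
    proof (rule antisym)
      show "a s \<omega> \<le> ?a s"
        unfolding a_def using good_path_mono[OF g] by (intro SUP_least) (auto simp: Yq split: split_indicator)
      show "?a s \<le> a s \<omega>"
      proof (cases "s = 0")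
        case True
        then show ?thesis using g by (simp add: good_path_def)
      next
        case False
        then have "0 < s" using s by simp
        have "(?a \<longlongrightarrow> ?a s) (at s within {0..})"
          using g s by (auto simp: good_path_def continuous_on_def)
        then have lim: "(?a \<longlongrightarrow> ?a s) (at s within {0..<s})"
          by (rule tendsto_within_subset) auto
        show ?thesis
        proof (rule ccontr)
          assume "\<not> ?a s \<le> a s \<omega>"
          then have "\<forall>\<^sub>F q in at s within {0..<s}. a s \<omega> < ?a q"
            using order_tendstoD(1)[OF lim] by simp
          then obtain d where d: "d > 0" "\<And>q. q \<in> {0..<s} \<Longrightarrow> q \<noteq> s \<Longrightarrow> dist q s < d \<Longrightarrow> a s \<omega> < ?a q"
            unfolding eventually_at by auto
          obtain q where q: "q \<in> \<rat>" "max 0 (s - d) < q" "q < s"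
            using Rats_dense_in_real[of "max 0 (s - d)" s] \<open>0 < s\<close> d(1) by auto
          have "a s \<omega> < ?a q" using q by (intro d(2)) (auto simp: dist_real_def)
          also have "\<dots> = indicator {q<..} s * indicator {0..} q * Y q \<omega>" using q by (simp add: Yq)
          also have "\<dots> \<le> a s \<omega>" unfolding a_def using q(1) by (rule SUP_upper)
          finally show False by simp
        qed
      qed
    qed
  qed
qed

end

section \<open>Potentials of additive functionals\<close>

text \<open>Only \<open>X\<close> and \<open>c\<close> need to be measurable: \<^const>\<open>nn_integral\<close> is a lower integral otherwise.\<close>

lemma nn_integral_le_add_lower:
  assumes X[measurable]: "X \<in> borel_measurable L" and c[measurable]: "c \<in> borel_measurable L"
    and le: "AE \<omega> in L. X \<omega> \<le> c \<omega> + g \<omega>"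
  shows "(\<integral>\<^sup>+\<omega>. X \<omega> \<partial>L) \<le> (\<integral>\<^sup>+\<omega>. c \<omega> \<partial>L) + (\<integral>\<^sup>+\<omega>. g \<omega> \<partial>L)"
proof -
  define D where "D \<omega> = (if c \<omega> = top then 0 else X \<omega> - c \<omega>)" for \<omega>
  have [measurable]: "D \<in> borel_measurable L" unfolding D_def[abs_def] by measurable
  have "X \<omega> \<le> c \<omega> + D \<omega>" for \<omega>
    using ennreal_minus_le_iff[of "X \<omega>" "c \<omega>" "X \<omega> - c \<omega>"] by (auto simp: D_def)
  then have "(\<integral>\<^sup>+\<omega>. X \<omega> \<partial>L) \<le> (\<integral>\<^sup>+\<omega>. c \<omega> + D \<omega> \<partial>L)"
    by (rule nn_integral_mono)
  also have "\<dots> = (\<integral>\<^sup>+\<omega>. c \<omega> \<partial>L) + (\<integral>\<^sup>+\<omega>. D \<omega> \<partial>L)" by (rule nn_integral_add) measurable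
  also have "(\<integral>\<^sup>+\<omega>. D \<omega> \<partial>L) \<le> (\<integral>\<^sup>+\<omega>. g \<omega> \<partial>L)"
  proof (rule nn_integral_mono_AE)
    show "AE \<omega> in L. D \<omega> \<le> g \<omega>"
      using le by eventually_elim (auto simp: D_def ennreal_minus_le_iff add.commute)
  qed
  finally show ?thesis by (simp add: add_left_mono)
qed

context hunt begin

lemma nn_integral_shift:
  assumes r: "0 \<le> r" and \<Phi>[measurable]: "\<Phi> \<in> borel_measurable \<F>"
  shows "(\<integral>\<^sup>+\<omega>. \<Phi> (shift M r \<omega>) \<partial>law M y) = (\<integral>\<^sup>+\<omega>. (\<integral>\<^sup>+\<omega>'. \<Phi> \<omega>' \<partial>law M (coord M r \<omega>)) \<partial>law M y)"
proof -
  have sm: "shift M r \<in> law M y \<rightarrow>\<^sub>M \<F>" using shift_measurable[OF r] by (simp cong: measurable_cong_sets)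
  have cm: "coord M r \<in> law M y \<rightarrow>\<^sub>M borel_cpt" using coord_measurable[OF r] by (simp cong: measurable_cong_sets)
  have "(\<integral>\<^sup>+\<omega>. \<Phi> (shift M r \<omega>) \<partial>law M y) = (\<integral>\<^sup>+\<omega>. \<Phi> \<omega> \<partial>distr (law M y) \<F> (shift M r))"
    using sm by (subst nn_integral_distr) auto
  also have "\<dots> = (\<integral>\<^sup>+z. (\<integral>\<^sup>+\<omega>. \<Phi> \<omega> \<partial>law M z) \<partial>distr (law M y) borel_cpt (coord M r))"
    unfolding law_shift[OF r] law_from_def
    by (rule nn_integral_bind[OF \<Phi>]) (use law_kernel_sub in simp)
  also have "\<dots> = (\<integral>\<^sup>+\<omega>. (\<integral>\<^sup>+\<omega>'. \<Phi> \<omega>' \<partial>law M (coord M r \<omega>)) \<partial>law M y)"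
    using cm measurable_compose[OF law_kernel_sub nn_integral_measurable_subprob_algebra[OF \<Phi>]]
    by (intro nn_integral_distr) simp_all
  finally show ?thesis .
qed

lemma nn_integral_law_alive:
  assumes \<Phi>[measurable]: "\<Phi> \<in> borel_measurable \<F>"
  shows "(\<integral>\<^sup>+\<omega>. (if coord M 0 \<omega> = None then 0 else \<Phi> \<omega>) \<partial>law M y) = ext0 (\<lambda>x. \<integral>\<^sup>+\<omega>. \<Phi> \<omega> \<partial>law M (Some x)) y"
proof -
  have "(\<integral>\<^sup>+\<omega>. (if coord M 0 \<omega> = None then 0 else \<Phi> \<omega>) \<partial>law M y) = (\<integral>\<^sup>+\<omega>. (if y = None then 0 else \<Phi> \<omega>) \<partial>law M y)"
    by (rule nn_integral_cong_AE) (use start[of y] in eventually_elim, simp)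
  then show ?thesis by (cases y) auto
qed

text \<open>The semigroup assigns 0 to the cemetery, so the shifted functional has to be switched
  off on paths that are dead at time r.\<close>

lemma semigroup_nn_path:
  assumes r: "0 \<le> r" and \<Phi>[measurable]: "\<Phi> \<in> borel_measurable \<F>"
  shows "semigroup_nn M r (\<lambda>x. \<integral>\<^sup>+\<omega>. \<Phi> \<omega> \<partial>law M (Some x)) x =
    (\<integral>\<^sup>+\<omega>. (if coord M r \<omega> = None then 0 else \<Phi> (shift M r \<omega>)) \<partial>law M (Some x))"
proof -
  have c0: "coord M 0 \<in> \<F> \<rightarrow>\<^sub>M borel_cpt" by (rule coord_measurable) simp
  have "{\<omega> \<in> space \<F>. coord M 0 \<omega> = None} \<in> sets \<F>"
    using measurable_sets[OF c0 sets_borel_cpt_None] by (simp add: vimage_def Int_def conj_commute)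
  then have m: "(\<lambda>\<omega>. if coord M 0 \<omega> = None then 0 else \<Phi> \<omega>) \<in> borel_measurable \<F>"
    by (intro measurable_If) auto
  have "(\<integral>\<^sup>+\<omega>. (if coord M r \<omega> = None then 0 else \<Phi> (shift M r \<omega>)) \<partial>law M (Some x)) =
    (\<integral>\<^sup>+\<omega>. (\<lambda>\<omega>. if coord M 0 \<omega> = None then 0 else \<Phi> \<omega>) (shift M r \<omega>) \<partial>law M (Some x))"
    using r by (intro nn_integral_cong) (simp add: coord_shift)
  also have "\<dots> = semigroup_nn M r (\<lambda>x. \<integral>\<^sup>+\<omega>. \<Phi> \<omega> \<partial>law M (Some x)) x"
    unfolding nn_integral_shift[OF r m] nn_integral_law_alive[OF \<Phi>] semigroup_nn_def expect_def by simp
  finally show ?thesis by simp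
qed

end

context symmetric_hunt begin

text \<open>The map \<open>x \<mapsto> E\<^sub>x[(1\<^sub>F A)\<^sub>s]\<close> is only measurable up to null sets; \<open>u\<close> is a jointly Borel version.
  The last clause holds \<open>\<nu>\<close>-almost everywhere, not just \<open>m\<close>-almost everywhere: this is what makes
  the energy of \<open>\<nu>\<close> bounded.\<close>

definition potential :: "'a measure \<Rightarrow> 'a set \<Rightarrow> (real \<Rightarrow> 'w \<Rightarrow> ennreal) \<Rightarrow> (real \<Rightarrow> 'a \<Rightarrow> ennreal) \<Rightarrow> bool" where
  "potential \<nu> F A u \<longleftrightarrow>
    (\<lambda>(s, x). u s x) \<in> borel_measurable (borel \<Otimes>\<^sub>M borel) \<and>
    (AE x in m. \<forall>s\<ge>0. expect M x (restrict_af M F A s) = u s x) \<and>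
    (\<forall>h\<in>borel_measurable borel. \<forall>t\<ge>0.
      (\<integral>\<^sup>+x. h x * u t x \<partial>m) = (\<integral>\<^sup>+x. (\<integral>\<^sup>+s\<in>{0..t}. semigroup_nn M (max 0 s) h x \<partial>lborel) \<partial>\<nu>)) \<and>
    (\<forall>\<alpha>>0. \<forall>t\<ge>0. AE x in m. (\<integral>\<^sup>+s\<in>{t..}. ennreal (\<alpha> * exp (- \<alpha> * s)) * u s x \<partial>lborel) \<le>
      ennreal (exp (- \<alpha> * t)) * u t x +
      expect M x (path_integral (restrict_af M F A) {t..} (\<lambda>s. ennreal (exp (- \<alpha> * s))))) \<and>
    (\<forall>t\<ge>0. AE x in \<nu>. AE r in lborel. r \<in> {0<..t} \<longrightarrow>
      semigroup_nn M r (\<lambda>y. \<integral>\<^sup>+s. u (max 0 s) y \<partial>Exp_meas 1) x \<le>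
      ennreal (exp r) * expect M x (path_integral (restrict_af M F A) {0..} (\<lambda>s. ennreal (exp (- s)))))"

text \<open>u s x is the expectation of the Borel version a of the restricted functional. All
  clauses but the last concern \<open>m\<close> and follow from agreement outside Z. For the last
  one Z may be charged from \<nu>-typical starting points; it is avoided by waiting a time r, since
  for \<nu>-almost every x and almost every r the shifted path avoids Z.\<close>

lemma potential_exists:
  assumes rev: "revuz M m \<mu> A" and F[measurable]: "F \<in> sets borel"
  obtains u where "potential (density \<mu> (indicator F)) F A u"
proof -
  let ?\<nu> = "density \<mu> (indicator F)"
  have smooth: "smooth_measure M m \<mu>" and af: "pcaf M m A" using rev by (auto simp: revuz_def)
  have sets_\<mu>[measurable_cong, simp]: "sets \<mu> = sets borel" using smooth by (simp add: smooth_measure_def)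
  obtain \<Lambda> B where good: "af_good A \<Lambda>" and B: "B \<in> sets borel" "cap M m B = 0" "emeasure m B = 0"
    and \<Lambda>: "\<And>x. x \<notin> B \<Longrightarrow> AE \<omega> in law M (Some x). \<omega> \<in> \<Lambda>"
    using pcaf_obtain[OF af] by metis
  have \<mu>B: "emeasure \<mu> B = 0" using smooth B by (auto simp: smooth_measure_def)
  obtain a Z where a[measurable]: "(\<lambda>(s, \<omega>). a s \<omega>) \<in> borel_measurable (borel \<Otimes>\<^sub>M \<F>)" and Z[measurable]: "Z \<in> sets \<F>"
    and Z0: "AE x in m. emeasure (law M (Some x)) Z = 0"
    and a_eq: "\<And>\<omega> s. \<omega> \<in> \<Lambda> - Z \<Longrightarrow> 0 \<le> s \<Longrightarrow> a s \<omega> = restrict_af M F A s \<omega>"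
    using af_version[OF good F] by metis
  have a_comp[measurable (raw)]: "(\<lambda>z. a (f z) (g z)) \<in> borel_measurable L"
    if "f \<in> borel_measurable L" "g \<in> L \<rightarrow>\<^sub>M \<F>" for f g and L :: "'z measure"
    using measurable_compose[OF measurable_Pair[OF that] a] by simp
  define u where "u s x = (\<integral>\<^sup>+\<omega>. a s \<omega> \<partial>law M (Some x))" for s x
  have u_joint: "(\<lambda>(s, x). u s x) \<in> borel_measurable (borel \<Otimes>\<^sub>M borel)"
  proof -
    have "(\<lambda>z. \<integral>\<^sup>+\<omega>. a (fst z) \<omega> \<partial>law M (Some (snd z))) \<in> borel_measurable (borel \<Otimes>\<^sub>M borel)"
    proof (rule nn_integral_measurable_subprob_algebra2[where N=\<F>])
      have "(\<lambda>p. a (fst (fst p)) (snd p)) \<in> borel_measurable ((borel \<Otimes>\<^sub>M borel) \<Otimes>\<^sub>M \<F>)"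
        using measurable_compose[OF measurable_Pair[OF measurable_compose[OF measurable_fst measurable_fst] measurable_snd] a] by simp
      then show "(\<lambda>(z, \<omega>). a (fst z) \<omega>) \<in> borel_measurable ((borel \<Otimes>\<^sub>M borel) \<Otimes>\<^sub>M \<F>)"
        by (simp add: case_prod_beta)
      show "(\<lambda>z. law M (Some (snd z))) \<in> borel \<Otimes>\<^sub>M borel \<rightarrow>\<^sub>M subprob_algebra \<F>"
        by (rule measurable_compose[OF measurable_snd law_Some_kernel])
    qed
    then show ?thesis by (simp add: u_def case_prod_beta)
  qed
  have mB: "AE x in m. x \<notin> B" using B by (intro AE_not_in) (simp add: null_sets_def)
  have ae\<omega>: "AE x in m. AE \<omega> in law M (Some x). \<omega> \<in> \<Lambda> - Z"
    using Z0 mB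
  proof eventually_elim
    case (elim x)
    have "AE \<omega> in law M (Some x). \<omega> \<notin> Z" using elim(1) by (intro AE_not_in) (simp add: null_sets_def)
    then show ?case using \<Lambda>[OF elim(2)] by eventually_elim simp
  qed
  have u_expect: "AE x in m. \<forall>s\<ge>0. expect M x (restrict_af M F A s) = u s x"
    using ae\<omega>
  proof eventually_elim
    case (elim x)
    show ?case
    proof (intro allI impI)
      fix s :: real assume "0 \<le> s"
      show "expect M x (restrict_af M F A s) = u s x"
        unfolding expect_def u_def
      proof (rule nn_integral_cong_AE)
        show "AE \<omega> in law M (Some x). restrict_af M F A s \<omega> = a s \<omega>"
          using elim by eventually_elim (simp add: a_eq \<open>0 \<le> s\<close>)
      qed
    qed
  qed
  have revuz_u: "(\<integral>\<^sup>+x. h x * u t x \<partial>m) = (\<integral>\<^sup>+x. (\<integral>\<^sup>+s\<in>{0..t}. semigroup_nn M (max 0 s) h x \<partial>lborel) \<partial>?\<nu>)"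
    if h[measurable]: "h \<in> borel_measurable borel" and t: "0 \<le> t" for h t
  proof -
    have "(\<integral>\<^sup>+x. h x * u t x \<partial>m) = (\<integral>\<^sup>+x. h x * expect M x (restrict_af M F A t) \<partial>m)"
      using u_expect t by (intro nn_integral_cong_AE) (auto elim!: eventually_mono)
    also have "\<dots> = (\<integral>\<^sup>+x. (\<integral>\<^sup>+s\<in>{0..t}. semigroup_nn M s h x \<partial>lborel) * indicator F x \<partial>\<mu>)"
      using rev h t unfolding revuz_def restrict_af_def[abs_def] by simp
    also have "\<dots> = (\<integral>\<^sup>+x. (\<integral>\<^sup>+s\<in>{0..t}. semigroup_nn M (max 0 s) h x \<partial>lborel) * indicator F x \<partial>\<mu>)"
      by (rule nn_integral_cong, rule arg_cong2[where f="(*)", OF nn_integral_cong refl]) (auto simp: max_def split: split_indicator)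
    also have "\<dots> = (\<integral>\<^sup>+x. (\<integral>\<^sup>+s\<in>{0..t}. semigroup_nn M (max 0 s) h x \<partial>lborel) \<partial>?\<nu>)"
      by (subst nn_integral_density) (auto simp: mult.commute)
    finally show ?thesis .
  qed
  have tail: "AE x in m. (\<integral>\<^sup>+s\<in>{t..}. ennreal (\<alpha> * exp (- \<alpha> * s)) * u s x \<partial>lborel) \<le>
      ennreal (exp (- \<alpha> * t)) * u t x +
      expect M x (path_integral (restrict_af M F A) {t..} (\<lambda>s. ennreal (exp (- \<alpha> * s))))"
    if \<alpha>: "0 < \<alpha>" and t: "0 \<le> t" for \<alpha> t
    using ae\<omega>
  proof eventually_elim
    case (elim x)
    interpret L: prob_space "law M (Some x)" by (rule prob_law)
    interpret P: pair_sigma_finite lborel "law M (Some x)" ..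
    let ?X = "\<lambda>\<omega>. \<integral>\<^sup>+s\<in>{t..}. ennreal (\<alpha> * exp (- \<alpha> * s)) * a s \<omega> \<partial>lborel"
    have jm: "(\<lambda>z. ennreal (\<alpha> * exp (- \<alpha> * fst z)) * a (fst z) (snd z) * indicator {t..} (fst z)) \<in> borel_measurable (lborel \<Otimes>\<^sub>M law M (Some x))"
    proof -
      have "(\<lambda>z. a (fst z) (snd z)) \<in> borel_measurable (lborel \<Otimes>\<^sub>M law M (Some x))"
        using a by (simp add: case_prod_beta cong: measurable_cong_sets)
      then show ?thesis by measurable
    qed
    have jm': "(\<lambda>z. ennreal (\<alpha> * exp (- \<alpha> * snd z)) * a (snd z) (fst z) * indicator {t..} (snd z)) \<in> borel_measurable (law M (Some x) \<Otimes>\<^sub>M lborel)"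
      using measurable_compose[OF measurable_pair_swap' jm] by (simp add: case_prod_beta)
    have "(\<integral>\<^sup>+s\<in>{t..}. ennreal (\<alpha> * exp (- \<alpha> * s)) * u s x \<partial>lborel) =
      (\<integral>\<^sup>+s. (\<integral>\<^sup>+\<omega>. ennreal (\<alpha> * exp (- \<alpha> * s)) * a s \<omega> * indicator {t..} s \<partial>law M (Some x)) \<partial>lborel)"
    proof (rule nn_integral_cong)
      fix s
      have [measurable]: "a s \<in> borel_measurable (law M (Some x))"
        using a_comp[of "\<lambda>_. s" \<F> "\<lambda>\<omega>. \<omega>"] by (simp cong: measurable_cong_sets)
      show "ennreal (\<alpha> * exp (- \<alpha> * s)) * u s x * indicator {t..} s =
        (\<integral>\<^sup>+\<omega>. ennreal (\<alpha> * exp (- \<alpha> * s)) * a s \<omega> * indicator {t..} s \<partial>law M (Some x))"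
        unfolding u_def by (simp add: nn_integral_cmult nn_integral_multc)
    qed
    also have "\<dots> = (\<integral>\<^sup>+\<omega>. ?X \<omega> \<partial>law M (Some x))"
      by (rule P.Fubini'[symmetric]) (use jm in \<open>simp add: case_prod_beta\<close>)
    also have "\<dots> \<le> (\<integral>\<^sup>+\<omega>. ennreal (exp (- \<alpha> * t)) * a t \<omega> \<partial>law M (Some x)) +
      (\<integral>\<^sup>+\<omega>. path_integral (restrict_af M F A) {t..} (\<lambda>s. ennreal (exp (- \<alpha> * s))) \<omega> \<partial>law M (Some x))"
    proof (rule nn_integral_le_add_lower)
      show "?X \<in> borel_measurable (law M (Some x))"
        by (rule lborel.borel_measurable_nn_integral) (use jm' in \<open>simp add: case_prod_beta\<close>)
      show "(\<lambda>\<omega>. ennreal (exp (- \<alpha> * t)) * a t \<omega>) \<in> borel_measurable (law M (Some x))"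
        using a_comp[of "\<lambda>_. t" \<F> "\<lambda>\<omega>. \<omega>"] by (simp cong: measurable_cong_sets)
      show "AE \<omega> in law M (Some x). ?X \<omega> \<le> ennreal (exp (- \<alpha> * t)) * a t \<omega> +
          path_integral (restrict_af M F A) {t..} (\<lambda>s. ennreal (exp (- \<alpha> * s))) \<omega>"
        using elim
      proof eventually_elim
        case (elim \<omega>)
        then have g: "good_path (\<lambda>t. restrict_af M F A t \<omega>)"
          by (intro restrict_af_good_path[OF good _ F]) simp
        have "?X \<omega> = (\<integral>\<^sup>+s\<in>{t..}. ennreal (\<alpha> * exp (- \<alpha> * s)) * restrict_af M F A s \<omega> \<partial>lborel)"
          using t elim by (intro nn_integral_cong) (auto simp: a_eq split: split_indicator)
        also have "\<dots> \<le> ennreal (exp (- \<alpha> * t)) * restrict_af M F A t \<omega> +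
           (\<integral>\<^sup>+s\<in>{t..}. ennreal (exp (- \<alpha> * s)) \<partial>path_measure (\<lambda>t. restrict_af M F A t \<omega>))"
          by (rule path_measure_exp_tail[OF g \<alpha> t])
        finally show ?case using t elim by (simp add: path_integral_def a_eq)
      qed
    qed
    also have "(\<integral>\<^sup>+\<omega>. ennreal (exp (- \<alpha> * t)) * a t \<omega> \<partial>law M (Some x)) = ennreal (exp (- \<alpha> * t)) * u t x"
      unfolding u_def using a_comp[of "\<lambda>_. t" \<F> "\<lambda>\<omega>. \<omega>"]
      by (intro nn_integral_cmult) (simp cong: measurable_cong_sets)
    finally show ?case by (simp add: expect_def)
  qed
  \<comment> \<open>The 1-potential along a path after integration by parts, in the measurable
    version.\<close>
  define Y where "Y \<omega> = (\<integral>\<^sup>+s. a (max 0 s) \<omega> \<partial>Exp_meas 1)" for \<omega>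
  interpret E: prob_space "Exp_meas 1" by (rule prob_Exp)
  have am: "(\<lambda>z. a (max 0 (snd z)) (fst z)) \<in> borel_measurable (\<F> \<Otimes>\<^sub>M Exp_meas 1)"
  proof -
    have "(\<lambda>z. a (max 0 (snd z)) (fst z)) \<in> borel_measurable (\<F> \<Otimes>\<^sub>M borel)"
      by (rule measurable_compose[OF measurable_Pair[OF _ measurable_fst] a, simplified]) measurable
    then show ?thesis by (simp cong: measurable_cong_sets)
  qed
  have Ym[measurable]: "Y \<in> borel_measurable \<F>"
    unfolding Y_def[abs_def] by (rule E.borel_measurable_nn_integral) (use am in \<open>simp add: case_prod_beta\<close>)
  have W_eq: "(\<integral>\<^sup>+s. u (max 0 s) y \<partial>Exp_meas 1) = (\<integral>\<^sup>+\<omega>. Y \<omega> \<partial>law M (Some y))" for y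
  proof -
    interpret L: prob_space "law M (Some y)" by (rule prob_law)
    interpret P: pair_sigma_finite "law M (Some y)" "Exp_meas 1" ..
    show ?thesis unfolding u_def Y_def
      by (rule P.Fubini') (use am in \<open>simp add: case_prod_beta cong: measurable_cong_sets\<close>)
  qed
  \<comment> \<open>The probability of Z as a function of the start. It vanishes
    \<open>m\<close>-almost everywhere, which says nothing about \<nu>; what is used below is p_r
    z.\<close>
  define z where "z y = (\<integral>\<^sup>+\<omega>. indicator Z \<omega> \<partial>law M (Some y))" for y
  have zm: "z \<in> borel_measurable borel"
    unfolding z_def[abs_def] using measurable_compose[OF law_Some_kernel nn_integral_measurable_subprob_algebra[of "indicator Z" \<F>]] by simp
  have excess: "semigroup_nn M r (\<lambda>y. \<integral>\<^sup>+s. u (max 0 s) y \<partial>Exp_meas 1) x \<le>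
      ennreal (exp r) * expect M x (path_integral (restrict_af M F A) {0..} (\<lambda>s. ennreal (exp (- s))))"
    if x: "x \<notin> B" and r: "0 < r" and z0: "semigroup_nn M r z x = 0" for x r
  proof -
    let ?T = "path_integral (restrict_af M F A) {0..} (\<lambda>s. ennreal (exp (- s)))"
    have r0: "0 \<le> r" using r by simp
    have sm: "shift M r \<in> law M (Some x) \<rightarrow>\<^sub>M \<F>" using shift_measurable[OF r0] by (simp cong: measurable_cong_sets)
    have cm: "coord M r \<in> law M (Some x) \<rightarrow>\<^sub>M borel_cpt" using coord_measurable[OF r0] by (simp cong: measurable_cong_sets)
    have none: "{\<omega> \<in> space (law M (Some x)). coord M r \<omega> = None} \<in> sets (law M (Some x))"
      using measurable_sets[OF cm sets_borel_cpt_None] by (simp add: vimage_def Int_def conj_commute)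
    have ifm: "(\<lambda>\<omega>. if coord M r \<omega> = None then 0 else \<Phi> (shift M r \<omega>)) \<in> borel_measurable (law M (Some x))"
      if "\<Phi> \<in> borel_measurable \<F>" for \<Phi> :: "'w \<Rightarrow> ennreal"
      using none measurable_compose[OF sm that] by (intro measurable_If) auto
    have "(\<integral>\<^sup>+\<omega>. (if coord M r \<omega> = None then 0 else indicator Z (shift M r \<omega>)) \<partial>law M (Some x)) = 0"
      using z0 unfolding z_def[abs_def] by (subst (asm) semigroup_nn_path[OF r0]) auto
    \<comment> \<open>p_r z (x) = 0 means that the path started at x and shifted by r almost surely
      avoids Z whenever it is alive at r.\<close>
    then have noZ: "AE \<omega> in law M (Some x). (if coord M r \<omega> = None then 0 else indicator Z (shift M r \<omega>)) = (0::ennreal)"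
      by (subst (asm) nn_integral_0_iff_AE) (use ifm[of "indicator Z"] in auto)
    have "ennreal (exp (- r)) * semigroup_nn M r (\<lambda>y. \<integral>\<^sup>+s. u (max 0 s) y \<partial>Exp_meas 1) x =
      (\<integral>\<^sup>+\<omega>. ennreal (exp (- r)) * (if coord M r \<omega> = None then 0 else Y (shift M r \<omega>)) \<partial>law M (Some x))"
      unfolding W_eq semigroup_nn_path[OF r0 Ym] by (rule nn_integral_cmult[symmetric, OF ifm[OF Ym]])
    also have "\<dots> \<le> (\<integral>\<^sup>+\<omega>. ?T \<omega> \<partial>law M (Some x))"
    proof (rule nn_integral_mono_AE)
      show "AE \<omega> in law M (Some x). ennreal (exp (- r)) * (if coord M r \<omega> = None then 0 else Y (shift M r \<omega>)) \<le> ?T \<omega>"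
        using noZ \<Lambda>[OF x]
      proof eventually_elim
        case (elim \<omega>)
        show ?case
        proof (cases "coord M r \<omega> = None")
          case False
          have \<omega>: "\<omega> \<in> \<Lambda>" by fact
          have sh: "shift M r \<omega> \<in> \<Lambda> - Z"
            using False elim(1) good \<omega> r by (auto simp: af_good_def split: split_indicator_asm)
          let ?b = "\<lambda>s. restrict_af M F A s \<omega>"
          have g: "good_path ?b" by (rule restrict_af_good_path[OF good \<omega> F])
          have "continuous_on UNIV (\<lambda>s. ?b (max 0 s))"
            by (rule continuous_on_compose2[of "{0..}" ?b]) (use g in \<open>auto simp: good_path_def intro!: continuous_intros\<close>)
          then have [measurable]: "(\<lambda>s. ?b (max 0 s)) \<in> borel_measurable borel"
            by (rule borel_measurable_continuous_onI)
          have "Y (shift M r \<omega>) \<le> (\<integral>\<^sup>+s. ?b (max 0 (max 0 s + r)) \<partial>Exp_meas 1)"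
            unfolding Y_def
          proof (rule nn_integral_mono)
            fix s :: real
            have "a (max 0 s) (shift M r \<omega>) = restrict_af M F A (max 0 s) (shift M r \<omega>)"
              by (rule a_eq[OF sh]) simp
            also have "\<dots> \<le> ?b (max 0 s + r)"
              by (rule restrict_af_shift_le[OF good \<omega> F r False]) simp
            also have "max 0 s + r = max 0 (max 0 s + r)" using r by simp
            finally show "a (max 0 s) (shift M r \<omega>) \<le> ?b (max 0 (max 0 s + r))" .
          qed
          also have "\<dots> \<le> ennreal (exp r) * (\<integral>\<^sup>+s. ?b (max 0 (max 0 s)) \<partial>Exp_meas 1)"
            by (rule nn_integral_Exp_shift_le[OF _ r0]) measurable
          also have "(\<integral>\<^sup>+s. ?b (max 0 (max 0 s)) \<partial>Exp_meas 1) = (\<integral>\<^sup>+s\<in>{0..}. ennreal (1 * exp (- 1 * s)) * ?b s \<partial>lborel)"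
          proof -
            have "(\<lambda>s. ?b (max 0 (max 0 s))) \<in> borel_measurable borel" by simp
            then show ?thesis
              by (subst nn_integral_Exp) (auto intro!: nn_integral_cong simp: max_def split: split_indicator)
          qed
          also have "\<dots> \<le> ennreal (exp (- 1 * 0)) * ?b 0 + (\<integral>\<^sup>+s\<in>{0..}. ennreal (exp (- 1 * s)) \<partial>path_measure ?b)"
            by (rule path_measure_exp_tail[OF g]) auto
          also have "\<dots> = ?T \<omega>"
            using g by (simp add: good_path_def path_integral_def)
          finally have "Y (shift M r \<omega>) \<le> ennreal (exp r) * ?T \<omega>" by (simp add: mult_left_mono)
          then have "ennreal (exp (- r)) * Y (shift M r \<omega>) \<le> ennreal (exp (- r)) * (ennreal (exp r) * ?T \<omega>)"
            by (rule mult_left_mono) simp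
          also have "\<dots> = ?T \<omega>" by (simp add: mult.assoc[symmetric] ennreal_mult[symmetric] exp_minus)
          finally show ?thesis using False by simp
        qed simp
      qed
    qed
    finally have "ennreal (exp r) * (ennreal (exp (- r)) * semigroup_nn M r (\<lambda>y. \<integral>\<^sup>+s. u (max 0 s) y \<partial>Exp_meas 1) x) \<le>
        ennreal (exp r) * expect M x ?T"
      unfolding expect_def by (rule mult_left_mono) simp
    then show ?thesis by (simp add: mult.assoc[symmetric] ennreal_mult[symmetric] exp_minus)
  qed
  have excess_ae: "AE x in ?\<nu>. AE r in lborel. r \<in> {0<..t} \<longrightarrow>
      semigroup_nn M r (\<lambda>y. \<integral>\<^sup>+s. u (max 0 s) y \<partial>Exp_meas 1) x \<le>
      ennreal (exp r) * expect M x (path_integral (restrict_af M F A) {0..} (\<lambda>s. ennreal (exp (- s))))"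
    if t: "0 \<le> t" for t
  proof -
    note [measurable] = zm
    \<comment> \<open>The Revuz formula with h = z: its \<open>m\<close>-side vanishes, hence so
      does the \<nu>-integral of p_s z over s in [0,t].\<close>
    have "AE y in m. z y = 0" using Z0 by eventually_elim (simp add: z_def)
    then have "(\<integral>\<^sup>+x. z x * u t x \<partial>m) = 0"
      by (subst nn_integral_cong_AE[where v="\<lambda>_. 0"]) (auto elim!: eventually_mono)
    then have "(\<integral>\<^sup>+x. (\<integral>\<^sup>+s\<in>{0..t}. semigroup_nn M (max 0 s) z x \<partial>lborel) \<partial>?\<nu>) = 0"
      using revuz_u[OF zm t] by simp
    then have "AE x in ?\<nu>. (\<integral>\<^sup>+s\<in>{0..t}. semigroup_nn M (max 0 s) z x \<partial>lborel) = 0"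
      by (subst (asm) nn_integral_0_iff_AE) measurable
    moreover have "AE x in ?\<nu>. x \<notin> B"
    proof -
      have "AE x in \<mu>. x \<notin> B" using \<mu>B B by (intro AE_not_in) (simp add: null_sets_def)
      then show ?thesis by (subst AE_density) (auto elim!: eventually_mono)
    qed
    ultimately show ?thesis
    proof eventually_elim
      case (elim x)
      have "AE s in lborel. semigroup_nn M (max 0 s) z x * indicator {0..t} s = 0"
        using elim(1) by (subst (asm) nn_integral_0_iff_AE) measurable
      then show ?case
      proof eventually_elim
        case (elim r)
        then show ?case using excess[OF \<open>x \<notin> B\<close>, of r] by (auto simp: max_def)
      qed
    qed
  qed
  show ?thesis
    by (rule that[of u]) (use u_joint u_expect revuz_u tail excess_ae in \<open>auto simp: potential_def\<close>)
qed

end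

section \<open>Convergence of the resolvent integrals\<close>

lemma le_add_ennreal_absdiff: "a \<le> b + ennreal_absdiff a b"
proof (cases "b = top")
  case False
  show ?thesis
  proof (cases "a = top")
    case True
    then show ?thesis using False
      by (cases b) (simp_all add: ennreal_absdiff_def)
  next
    case False
    then obtain r s where "a = ennreal r" "b = ennreal s" "0 \<le> r" "0 \<le> s"
      using \<open>b \<noteq> top\<close> by (cases a; cases b) auto
    then show ?thesis
      by (simp add: ennreal_absdiff_def e2ennreal_ereal ennreal_plus[symmetric] del: ennreal_plus)
  qed
qed simp

lemma ennreal_absdiff_commute: "ennreal_absdiff a b = ennreal_absdiff b a"
  unfolding ennreal_absdiff_def
  by (cases "enn2ereal a"; cases "enn2ereal b") (auto simp: abs_minus_commute)

lemma ennreal_absdiff_measurable [measurable]: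
  "f \<in> borel_measurable L \<Longrightarrow> g \<in> borel_measurable L \<Longrightarrow> (\<lambda>x. ennreal_absdiff (f x) (g x)) \<in> borel_measurable L"
  unfolding ennreal_absdiff_def
  by (rule measurable_compose[OF _ measurable_e2ennreal], rule borel_measurable_ereal_abs, rule borel_measurable_ereal_diff)
     (rule measurable_compose[OF _ measurable_enn2ereal], assumption)+

text \<open>Two one-sided inequalities stand in for an absolute difference, so that each can come
  from its own comparison in [0,\<infinity>].\<close>

lemma tendsto_enn2real_squeeze:
  assumes fin: "L < \<infinity>"
    and ev: "\<And>\<eta>. \<eta> > 0 \<Longrightarrow> \<forall>\<^sub>F n in sequentially. Ls n \<le> L + ennreal \<eta> \<and> L \<le> Ls n + ennreal \<eta>"
  shows "(\<lambda>n. enn2real (Ls n)) \<longlonglongrightarrow> enn2real L"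
proof (rule LIMSEQ_I)
  fix e :: real assume "0 < e"
  obtain l where l: "L = ennreal l" "0 \<le> l" using fin by (cases L) auto
  have "\<forall>\<^sub>F n in sequentially. \<bar>enn2real (Ls n) - enn2real L\<bar> < e"
    using ev[OF half_gt_zero[OF \<open>0 < e\<close>]]
  proof eventually_elim
    case (elim n)
    then obtain k where k: "Ls n = ennreal k" "0 \<le> k" using l \<open>0 < e\<close> by (cases "Ls n") (auto simp: top_unique)
    from elim have "k \<le> l + e / 2" "l \<le> k + e / 2"
      using \<open>0 < e\<close> by (simp_all add: k l ennreal_plus[symmetric] del: ennreal_plus)
    then show ?case using \<open>0 < e\<close> by (simp add: k l)
  qed
  then show "\<exists>N. \<forall>n\<ge>N. norm (enn2real (Ls n) - enn2real L) < e"
    by (simp add: eventually_sequentially)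
qed

context symmetric_hunt begin

lemma potential_joint: "potential \<nu> F A u \<Longrightarrow> (\<lambda>(s, x). u s x) \<in> borel_measurable (borel \<Otimes>\<^sub>M borel)"
  by (simp add: potential_def)

lemma potential_compose:
  assumes "potential \<nu> F A u" "f \<in> borel_measurable L" "g \<in> L \<rightarrow>\<^sub>M borel"
  shows "(\<lambda>z. u (f z) (g z)) \<in> borel_measurable L"
  using measurable_compose[OF measurable_Pair[OF assms(2,3)] potential_joint[OF assms(1)]] by simp

lemma potential_expect: "potential \<nu> F A u \<Longrightarrow> AE x in m. \<forall>s\<ge>0. expect M x (restrict_af M F A s) = u s x"
  by (simp add: potential_def)

lemma potential_revuz:
  "potential \<nu> F A u \<Longrightarrow> h \<in> borel_measurable borel \<Longrightarrow> 0 \<le> t \<Longrightarrow>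
    (\<integral>\<^sup>+x. h x * u t x \<partial>m) = (\<integral>\<^sup>+x. (\<integral>\<^sup>+s\<in>{0..t}. semigroup_nn M (max 0 s) h x \<partial>lborel) \<partial>\<nu>)"
  by (simp add: potential_def)

lemma potential_tail:
  "potential \<nu> F A u \<Longrightarrow> 0 < \<alpha> \<Longrightarrow> 0 \<le> t \<Longrightarrow>
    AE x in m. (\<integral>\<^sup>+s\<in>{t..}. ennreal (\<alpha> * exp (- \<alpha> * s)) * u s x \<partial>lborel) \<le>
      ennreal (exp (- \<alpha> * t)) * u t x +
      expect M x (path_integral (restrict_af M F A) {t..} (\<lambda>s. ennreal (exp (- \<alpha> * s))))"
  by (simp add: potential_def)

text \<open>p_s h \<le> C at every time, and the Revuz formula integrates this over [0,t] and
  \<nu>.\<close>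

lemma potential_revuz_le:
  assumes pot: "potential \<nu> F A u" and h: "h \<in> borel_measurable borel" "\<And>x. h x \<le> C" and t: "0 \<le> t"
  shows "(\<integral>\<^sup>+x. h x * u t x \<partial>m) \<le> ennreal t * C * emeasure \<nu> (space \<nu>)"
proof -
  have "(\<integral>\<^sup>+s\<in>{0..t}. semigroup_nn M (max 0 s) h x \<partial>lborel) \<le> ennreal t * C" for x
  proof -
    have "(\<integral>\<^sup>+s\<in>{0..t}. semigroup_nn M (max 0 s) h x \<partial>lborel) \<le> (\<integral>\<^sup>+s. C * indicator {0..t} s \<partial>lborel)"
      by (intro nn_integral_mono mult_right_mono order_trans[OF semigroup_nn_mono semigroup_nn_const_le]) (auto simp: h(2))
    also have "\<dots> = C * ennreal t" using t by (subst nn_integral_cmult_indicator) auto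
    finally show ?thesis by (simp add: mult.commute)
  qed
  then have "(\<integral>\<^sup>+x. (\<integral>\<^sup>+s\<in>{0..t}. semigroup_nn M (max 0 s) h x \<partial>lborel) \<partial>\<nu>) \<le> (\<integral>\<^sup>+x. ennreal t * C \<partial>\<nu>)"
    by (rule nn_integral_mono)
  then show ?thesis using potential_revuz[OF pot h(1) t] by simp
qed

lemma potential_swap:
  assumes pot: "potential \<nu> F A u" and [measurable]: "h \<in> borel_measurable borel" "c \<in> borel_measurable borel"
  shows "(\<integral>\<^sup>+x. h x * (\<integral>\<^sup>+s. c s * u s x \<partial>lborel) \<partial>m) = (\<integral>\<^sup>+s. c s * (\<integral>\<^sup>+x. h x * u s x \<partial>m) \<partial>lborel)"
proof -
  interpret m: sigma_finite_measure m by (rule sigma_finite_m)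
  interpret P: pair_sigma_finite m lborel ..
  note [measurable (raw)] = potential_compose[OF pot]
  have "(\<integral>\<^sup>+x. h x * (\<integral>\<^sup>+s. c s * u s x \<partial>lborel) \<partial>m) = (\<integral>\<^sup>+x. (\<integral>\<^sup>+s. c s * (h x * u s x) \<partial>lborel) \<partial>m)"
    by (intro nn_integral_cong) (simp add: nn_integral_cmult[symmetric] mult.left_commute)
  also have "\<dots> = (\<integral>\<^sup>+s. (\<integral>\<^sup>+x. c s * (h x * u s x) \<partial>m) \<partial>lborel)"
    by (rule P.Fubini'[symmetric]) measurable
  also have "\<dots> = (\<integral>\<^sup>+s. c s * (\<integral>\<^sup>+x. h x * u s x \<partial>m) \<partial>lborel)"
    by (intro nn_integral_cong nn_integral_cmult) measurable
  finally show ?thesis .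
qed

text \<open>The Revuz formula averaged over time with density \<alpha> e^{-\<alpha> s}: after
  exchanging integrals the weight of p_q h is \<integral>_q^\<infinity> \<alpha> e^{-\<alpha> s} ds
  = e^{-\<alpha> q}.\<close>

lemma potential_laplace:
  assumes pot: "potential \<nu> F A u" and \<nu>: "finite_measure \<nu>" and sets_\<nu>[measurable_cong]: "sets \<nu> = sets borel"
    and \<alpha>: "0 < \<alpha>" and h[measurable]: "h \<in> borel_measurable borel"
  shows "(\<integral>\<^sup>+x. h x * (\<integral>\<^sup>+s\<in>{0..}. ennreal (\<alpha> * exp (- \<alpha> * s)) * u s x \<partial>lborel) \<partial>m) =
    (\<integral>\<^sup>+x. (\<integral>\<^sup>+s\<in>{0..}. ennreal (exp (- \<alpha> * s)) * semigroup_nn M (max 0 s) h x \<partial>lborel) \<partial>\<nu>)"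
proof -
  interpret n: finite_measure \<nu> by (rule \<nu>)
  interpret P: pair_sigma_finite lborel \<nu> ..

  let ?c = "\<lambda>s. ennreal (\<alpha> * exp (- \<alpha> * s)) * indicator {0..} s"
  let ?p = "\<lambda>q x. semigroup_nn M (max 0 q) h x"
  have jm: "(\<lambda>z. (\<integral>\<^sup>+q. ?c (fst z) * (?p q (snd z) * indicator {0..fst z} q) \<partial>lborel)) \<in> borel_measurable (borel \<Otimes>\<^sub>M borel)"
  proof (rule lborel.borel_measurable_nn_integral)
    show "(\<lambda>(z, q). ?c (fst z) * (?p q (snd z) * indicator {0..fst z} q)) \<in> borel_measurable ((borel \<Otimes>\<^sub>M borel) \<Otimes>\<^sub>M lborel)"
      unfolding indicator_def of_bool_def atLeastAtMost_iff by measurable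
  qed
  have "(\<integral>\<^sup>+x. h x * (\<integral>\<^sup>+s\<in>{0..}. ennreal (\<alpha> * exp (- \<alpha> * s)) * u s x \<partial>lborel) \<partial>m) =
    (\<integral>\<^sup>+x. h x * (\<integral>\<^sup>+s. ?c s * u s x \<partial>lborel) \<partial>m)"
    by (simp add: mult_ac)
  also have "\<dots> = (\<integral>\<^sup>+s. ?c s * (\<integral>\<^sup>+x. h x * u s x \<partial>m) \<partial>lborel)"
    by (rule potential_swap[OF pot]) measurable
  also have "\<dots> = (\<integral>\<^sup>+s. ?c s * (\<integral>\<^sup>+x. (\<integral>\<^sup>+q\<in>{0..s}. ?p q x \<partial>lborel) \<partial>\<nu>) \<partial>lborel)"
    by (intro nn_integral_cong) (auto simp: potential_revuz[OF pot h] split: split_indicator)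
  also have "\<dots> = (\<integral>\<^sup>+s. (\<integral>\<^sup>+x. (\<integral>\<^sup>+q. ?c s * (?p q x * indicator {0..s} q) \<partial>lborel) \<partial>\<nu>) \<partial>lborel)"
    by (intro nn_integral_cong) (simp add: nn_integral_cmult)
  also have "\<dots> = (\<integral>\<^sup>+x. (\<integral>\<^sup>+s. (\<integral>\<^sup>+q. ?c s * (?p q x * indicator {0..s} q) \<partial>lborel) \<partial>lborel) \<partial>\<nu>)"
    by (rule P.Fubini'[symmetric]) (use jm in \<open>simp add: case_prod_beta cong: measurable_cong_sets\<close>)
  also have "\<dots> = (\<integral>\<^sup>+x. (\<integral>\<^sup>+q. (\<integral>\<^sup>+s. ?c s * (?p q x * indicator {0..s} q) \<partial>lborel) \<partial>lborel) \<partial>\<nu>)"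
  proof (rule nn_integral_cong, rule lborel_pair.Fubini'[symmetric])
    fix x
    show "(\<lambda>(s, q). ?c s * (?p q x * indicator {0..s} q)) \<in> borel_measurable (lborel \<Otimes>\<^sub>M lborel)"
      unfolding indicator_def of_bool_def atLeastAtMost_iff by measurable
  qed
  also have "\<dots> = (\<integral>\<^sup>+x. (\<integral>\<^sup>+q\<in>{0..}. ennreal (exp (- \<alpha> * q)) * ?p q x \<partial>lborel) \<partial>\<nu>)"
  proof (intro nn_integral_cong)
    fix x q
    have "(\<integral>\<^sup>+s. ?c s * (?p q x * indicator {0..s} q) \<partial>lborel) =
      (\<integral>\<^sup>+s. (?p q x * indicator {0..} q) * (ennreal (\<alpha> * exp (- \<alpha> * s)) * indicator {q..} s) \<partial>lborel)"
      by (intro nn_integral_cong) (auto simp: mult_ac split: split_indicator)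
    also have "\<dots> = (?p q x * indicator {0..} q) * ennreal (exp (- \<alpha> * q))"
      by (subst nn_integral_cmult, measurable) (simp only: nn_integral_exp_tail[OF \<alpha>])
    finally show "(\<integral>\<^sup>+s. ?c s * (?p q x * indicator {0..s} q) \<partial>lborel) = ennreal (exp (- \<alpha> * q)) * ?p q x * indicator {0..} q"
      by (simp add: mult_ac)
  qed
  finally show ?thesis .
qed

text \<open>The pointwise step is u1 \<le> u2 + |u1 - u2|, integrated with h \<le> C 1_K. Only one
  direction is stated; exchanging the roles gives the other, and everything stays in
  [0,\<infinity>].\<close>

lemma potential_compare_time:
  assumes p1: "potential \<nu>1 F A1 u1" and p2: "potential \<nu>2 F A2 u2"
    and h[measurable]: "h \<in> borel_measurable borel" and K[measurable]: "K \<in> sets borel"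
    and hC: "AE x in m. h x \<le> C * indicator K x" and s: "0 \<le> s"
  shows "(\<integral>\<^sup>+x. h x * u1 s x \<partial>m) \<le> (\<integral>\<^sup>+x. h x * u2 s x \<partial>m) +
    C * (\<integral>\<^sup>+x\<in>K. ennreal_absdiff (expect M x (restrict_af M F A1 s)) (expect M x (restrict_af M F A2 s)) \<partial>m)"
proof -
  have [measurable]: "u1 s \<in> borel_measurable borel" "u2 s \<in> borel_measurable borel"
    using potential_compose[OF p1, of "\<lambda>_. s" borel "\<lambda>x. x"] potential_compose[OF p2, of "\<lambda>_. s" borel "\<lambda>x. x"] by simp_all
  have "(\<integral>\<^sup>+x. h x * u1 s x \<partial>m) \<le> (\<integral>\<^sup>+x. h x * u2 s x \<partial>m) +
    (\<integral>\<^sup>+x. C * (ennreal_absdiff (u1 s x) (u2 s x) * indicator K x) \<partial>m)"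
  proof (rule nn_integral_le_add_lower)
    show "AE x in m. h x * u1 s x \<le> h x * u2 s x + C * (ennreal_absdiff (u1 s x) (u2 s x) * indicator K x)"
      using hC
    proof eventually_elim
      case (elim x)
      have "h x * u1 s x \<le> h x * (u2 s x + ennreal_absdiff (u1 s x) (u2 s x))"
        by (intro mult_left_mono le_add_ennreal_absdiff) simp
      also have "\<dots> = h x * u2 s x + h x * ennreal_absdiff (u1 s x) (u2 s x)" by (rule distrib_left)
      also have "\<dots> \<le> h x * u2 s x + (C * indicator K x) * ennreal_absdiff (u1 s x) (u2 s x)"
        by (intro add_left_mono mult_right_mono elim) simp
      finally show ?case by (simp add: mult_ac)
    qed
  qed measurable
  also have "(\<integral>\<^sup>+x. C * (ennreal_absdiff (u1 s x) (u2 s x) * indicator K x) \<partial>m) =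
    C * (\<integral>\<^sup>+x\<in>K. ennreal_absdiff (u1 s x) (u2 s x) \<partial>m)"
    by (rule nn_integral_cmult) measurable
  also have "(\<integral>\<^sup>+x\<in>K. ennreal_absdiff (u1 s x) (u2 s x) \<partial>m) =
     (\<integral>\<^sup>+x\<in>K. ennreal_absdiff (expect M x (restrict_af M F A1 s)) (expect M x (restrict_af M F A2 s)) \<partial>m)"
  proof (rule nn_integral_cong_AE)
    show "AE x in m. ennreal_absdiff (u1 s x) (u2 s x) * indicator K x =
        ennreal_absdiff (expect M x (restrict_af M F A1 s)) (expect M x (restrict_af M F A2 s)) * indicator K x"
      using potential_expect[OF p1] potential_expect[OF p2] by eventually_elim (simp add: s)
  qed
  finally show ?thesis .
qed

text \<open>Time is split at T. Before T the difference costs \<epsilon> once, as \<alpha>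
  e^{-\<alpha> s} ds has total mass 1. After T, integration by parts leaves e^{-\<alpha> T} u1 T and
  the tail that occurs in (A2).\<close>

lemma potential_compare:
  assumes p1: "potential \<nu>1 F A1 u1" and p2: "potential \<nu>2 F A2 u2"
    and h[measurable]: "h \<in> borel_measurable borel" and K[measurable]: "K \<in> sets borel"
    and hC: "AE x in m. h x \<le> C * indicator K x" and T: "0 \<le> T" and \<alpha>: "0 < \<alpha>"
    and \<epsilon>: "\<And>s. s \<in> {0..T} \<Longrightarrow> (\<integral>\<^sup>+x\<in>K. ennreal_absdiff (expect M x (restrict_af M F A1 s)) (expect M x (restrict_af M F A2 s)) \<partial>m) \<le> \<epsilon>"
    and \<tau>: "(\<integral>\<^sup>+x\<in>K. expect M x (path_integral (restrict_af M F A1) {T..} (\<lambda>s. ennreal (exp (- \<alpha> * s)))) \<partial>m) \<le> \<tau>"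
    and uT: "(\<integral>\<^sup>+x. indicator K x * u1 T x \<partial>m) \<le> D"
  shows "(\<integral>\<^sup>+x. h x * (\<integral>\<^sup>+s\<in>{0..}. ennreal (\<alpha> * exp (- \<alpha> * s)) * u1 s x \<partial>lborel) \<partial>m) \<le>
     (\<integral>\<^sup>+x. h x * (\<integral>\<^sup>+s\<in>{0..}. ennreal (\<alpha> * exp (- \<alpha> * s)) * u2 s x \<partial>lborel) \<partial>m) +
     C * (\<epsilon> + (ennreal (exp (- \<alpha> * T)) * D + \<tau>))"
proof -
  let ?c = "\<lambda>s. ennreal (\<alpha> * exp (- \<alpha> * s))"
  let ?X = "\<lambda>x. \<integral>\<^sup>+s\<in>{T..}. ?c s * u1 s x \<partial>lborel"
  have um: "u1 s \<in> borel_measurable borel" "u2 s \<in> borel_measurable borel" for s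
    using potential_compose[OF p1, of "\<lambda>_. s" borel "\<lambda>x. x"] potential_compose[OF p2, of "\<lambda>_. s" borel "\<lambda>x. x"] by simp_all
  have uj: "(\<lambda>z. u1 (snd z) (fst z)) \<in> borel_measurable (borel \<Otimes>\<^sub>M lborel)"
    by (rule potential_compose[OF p1]) measurable
  have us[measurable]: "(\<lambda>s. u1 s x) \<in> borel_measurable borel" "(\<lambda>s. u2 s x) \<in> borel_measurable borel" for x
    using potential_compose[OF p1, of "\<lambda>s. s" borel "\<lambda>_. x"] potential_compose[OF p2, of "\<lambda>s. s" borel "\<lambda>_. x"] by simp_all
  have Xm[measurable]: "?X \<in> borel_measurable borel"
    by (rule lborel.borel_measurable_nn_integral) (use uj in \<open>simp add: case_prod_beta\<close>)
  have Gm: "(\<lambda>s. \<integral>\<^sup>+x. h x * u s x \<partial>m) \<in> borel_measurable borel" if "potential \<nu> F A u" for \<nu> A u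
  proof -
    interpret m: sigma_finite_measure m by (rule sigma_finite_m)
    have "(\<lambda>z. u (fst z) (snd z)) \<in> borel_measurable (borel \<Otimes>\<^sub>M m)"
      by (rule potential_compose[OF that]) (auto cong: measurable_cong_sets)
    then show ?thesis by (intro m.borel_measurable_nn_integral) (simp add: case_prod_beta)
  qed
  note [measurable] = Gm[OF p1] Gm[OF p2]
  have split: "(\<integral>\<^sup>+s\<in>{0..}. ?c s * u1 s x \<partial>lborel) = (\<integral>\<^sup>+s. ?c s * indicator {0..<T} s * u1 s x \<partial>lborel) + ?X x" for x
    using T by (subst nn_integral_add[symmetric]) (auto intro!: nn_integral_cong split: split_indicator)
  have hX: "(\<integral>\<^sup>+x. h x * ?X x \<partial>m) \<le> C * (ennreal (exp (- \<alpha> * T)) * D + \<tau>)"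
  proof -
    have "(\<integral>\<^sup>+x. h x * ?X x \<partial>m) \<le> (\<integral>\<^sup>+x. C * (?X x * indicator K x) \<partial>m)"
    proof (rule nn_integral_mono_AE)
      show "AE x in m. h x * ?X x \<le> C * (?X x * indicator K x)"
        using hC
      proof eventually_elim
        case (elim x)
        then have "h x * ?X x \<le> (C * indicator K x) * ?X x" by (rule mult_right_mono) simp
        then show ?case by (simp add: mult_ac)
      qed
    qed
    also have "\<dots> = C * (\<integral>\<^sup>+x. ?X x * indicator K x \<partial>m)" by (rule nn_integral_cmult) measurable
    also have "(\<integral>\<^sup>+x. ?X x * indicator K x \<partial>m) \<le> (\<integral>\<^sup>+x. ennreal (exp (- \<alpha> * T)) * (indicator K x * u1 T x) \<partial>m) +
       (\<integral>\<^sup>+x\<in>K. expect M x (path_integral (restrict_af M F A1) {T..} (\<lambda>s. ennreal (exp (- \<alpha> * s)))) \<partial>m)"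
    proof (rule nn_integral_le_add_lower)
      show "AE x in m. ?X x * indicator K x \<le> ennreal (exp (- \<alpha> * T)) * (indicator K x * u1 T x) +
          expect M x (path_integral (restrict_af M F A1) {T..} (\<lambda>s. ennreal (exp (- \<alpha> * s)))) * indicator K x"
        using potential_tail[OF p1 \<alpha> T] by eventually_elim (auto split: split_indicator)
    qed (use um in measurable)
    also have "(\<integral>\<^sup>+x. ennreal (exp (- \<alpha> * T)) * (indicator K x * u1 T x) \<partial>m) = ennreal (exp (- \<alpha> * T)) * (\<integral>\<^sup>+x. indicator K x * u1 T x \<partial>m)"
      using um by (intro nn_integral_cmult) measurable
    finally show ?thesis
      using uT \<tau> by (meson add_mono mult_left_mono order_trans zero_le)
  qed
  have head: "(\<integral>\<^sup>+x. h x * (\<integral>\<^sup>+s. ?c s * indicator {0..<T} s * u1 s x \<partial>lborel) \<partial>m) \<le>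
     (\<integral>\<^sup>+x. h x * (\<integral>\<^sup>+s\<in>{0..}. ?c s * u2 s x \<partial>lborel) \<partial>m) + C * \<epsilon>"
  proof -
    have "(\<integral>\<^sup>+x. h x * (\<integral>\<^sup>+s. ?c s * indicator {0..<T} s * u1 s x \<partial>lborel) \<partial>m) =
      (\<integral>\<^sup>+s. ?c s * indicator {0..<T} s * (\<integral>\<^sup>+x. h x * u1 s x \<partial>m) \<partial>lborel)"
      by (rule potential_swap[OF p1 h]) measurable
    also have "\<dots> \<le> (\<integral>\<^sup>+s. ?c s * indicator {0..} s * (\<integral>\<^sup>+x. h x * u2 s x \<partial>m) + (C * \<epsilon>) * (?c s * indicator {0..} s) \<partial>lborel)"
    proof (rule nn_integral_mono)
      fix s
      show "?c s * indicator {0..<T} s * (\<integral>\<^sup>+x. h x * u1 s x \<partial>m) \<le>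
        ?c s * indicator {0..} s * (\<integral>\<^sup>+x. h x * u2 s x \<partial>m) + (C * \<epsilon>) * (?c s * indicator {0..} s)"
      proof (cases "s \<in> {0..<T}")
        case True
        then have "(\<integral>\<^sup>+x. h x * u1 s x \<partial>m) \<le> (\<integral>\<^sup>+x. h x * u2 s x \<partial>m) + C * \<epsilon>"
          by (intro order_trans[OF potential_compare_time[OF p1 p2 h K hC]] add_left_mono mult_left_mono \<epsilon>) auto
        then have "?c s * (\<integral>\<^sup>+x. h x * u1 s x \<partial>m) \<le> ?c s * ((\<integral>\<^sup>+x. h x * u2 s x \<partial>m) + C * \<epsilon>)"
          by (rule mult_left_mono) simp
        then show ?thesis using True by (simp add: distrib_left mult_ac)
      qed simp
    qed
    also have "\<dots> = (\<integral>\<^sup>+s. ?c s * indicator {0..} s * (\<integral>\<^sup>+x. h x * u2 s x \<partial>m) \<partial>lborel) + (C * \<epsilon>) * (\<integral>\<^sup>+s\<in>{0..}. ?c s \<partial>lborel)"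
      by (subst nn_integral_add) (auto simp: nn_integral_cmult)
    also have "(\<integral>\<^sup>+s\<in>{0..}. ?c s \<partial>lborel) = 1"
      using nn_integral_exp_tail[OF \<alpha>, of 0] by simp
    also have "(\<integral>\<^sup>+s. ?c s * indicator {0..} s * (\<integral>\<^sup>+x. h x * u2 s x \<partial>m) \<partial>lborel) =
       (\<integral>\<^sup>+x. h x * (\<integral>\<^sup>+s. ?c s * indicator {0..} s * u2 s x \<partial>lborel) \<partial>m)"
      by (rule potential_swap[OF p2 h, symmetric]) measurable
    finally show ?thesis by (simp add: mult_ac)
  qed
  have "(\<integral>\<^sup>+x. h x * (\<integral>\<^sup>+s\<in>{0..}. ?c s * u1 s x \<partial>lborel) \<partial>m) =
    (\<integral>\<^sup>+x. h x * (\<integral>\<^sup>+s. ?c s * indicator {0..<T} s * u1 s x \<partial>lborel) \<partial>m) + (\<integral>\<^sup>+x. h x * ?X x \<partial>m)"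
  proof -
    note [measurable (raw)] = potential_compose[OF p1]
    have "(\<lambda>x. \<integral>\<^sup>+s. ?c s * indicator {0..<T} s * u1 s x \<partial>lborel) \<in> borel_measurable borel"
      by (rule lborel.borel_measurable_nn_integral) measurable
    then have "(\<lambda>x. h x * (\<integral>\<^sup>+s. ?c s * indicator {0..<T} s * u1 s x \<partial>lborel)) \<in> borel_measurable m"
      "(\<lambda>x. h x * ?X x) \<in> borel_measurable m"
      using Xm h by (auto intro!: borel_measurable_times_ennreal cong: measurable_cong_sets)
    then show ?thesis unfolding split distrib_left by (rule nn_integral_add)
  qed
  also have "\<dots> \<le> ((\<integral>\<^sup>+x. h x * (\<integral>\<^sup>+s\<in>{0..}. ?c s * u2 s x \<partial>lborel) \<partial>m) + C * \<epsilon>) + C * (ennreal (exp (- \<alpha> * T)) * D + \<tau>)"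
    by (rule add_mono[OF head hX])
  finally show ?thesis by (simp add: distrib_left add.assoc)
qed

section \<open>Compactly supported test functions and their resolvents\<close>

lemma Bb0_support:
  assumes "f \<in> Bb0 m"
  obtains K where "compact K" "AE x in m. x \<notin> K \<longrightarrow> f x = 0"
proof -
  let ?K = "{x. \<forall>U. open U \<and> x \<in> U \<longrightarrow> (\<integral>\<^sup>+y\<in>U. ennreal \<bar>f y\<bar> \<partial>m) > 0}"
  let ?\<U> = "{U. open U \<and> (\<integral>\<^sup>+y\<in>U. ennreal \<bar>f y\<bar> \<partial>m) = 0}"
  have K: "compact ?K" and [measurable]: "f \<in> borel_measurable borel" using assms by (auto simp: Bb0_def)
  \<comment> \<open>The complement of the support is a union of open sets on which f vanishes almost
    everywhere; countably many of them suffice, so the union of the exceptional sets is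
    null.\<close>
  obtain \<V> where \<V>: "\<V> \<subseteq> ?\<U>" "countable \<V>" "\<Union>\<V> = \<Union>?\<U>"
    using Lindelof[of ?\<U>] by auto
  have "AE x in m. \<forall>V\<in>\<V>. x \<in> V \<longrightarrow> f x = 0"
  proof (subst AE_ball_countable[OF \<V>(2)], rule ballI)
    fix V assume "V \<in> \<V>"
    then have V: "open V" "(\<integral>\<^sup>+y\<in>V. ennreal \<bar>f y\<bar> \<partial>m) = 0" using \<V> by auto
    then have [measurable]: "V \<in> sets borel" by simp
    have "AE y in m. ennreal \<bar>f y\<bar> * indicator V y = 0"
      using V(2) by (subst (asm) nn_integral_0_iff_AE) auto
    then show "AE x in m. x \<in> V \<longrightarrow> f x = 0" by eventually_elim auto
  qed
  moreover have "x \<in> \<Union>\<V>" if "x \<notin> ?K" for x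
    using that by (auto simp: \<V>(3))
  ultimately have "AE x in m. x \<notin> ?K \<longrightarrow> f x = 0"
    by (auto elim!: eventually_mono)
  then show ?thesis using that K by blast
qed


text \<open>The iterated integral becomes one integral over a probability space, so that linearity,
  bounds and positivity follow from a single integrability statement.\<close>

lemma resolvent_pair:
  assumes f: "bdd_fun f" and \<alpha>: "0 < \<alpha>"
  shows "resolvent M \<alpha> f x = (\<integral>z. ext0 f (coord M (max 0 (snd z)) (fst z)) \<partial>(law M (Some x) \<Otimes>\<^sub>M Exp_meas \<alpha>)) / \<alpha>"
    "integrable (law M (Some x) \<Otimes>\<^sub>M Exp_meas \<alpha>) (\<lambda>z. ext0 f (coord M (max 0 (snd z)) (fst z)))"
proof -
  interpret L: prob_space "law M (Some x)" by (rule prob_law)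
  interpret E: prob_space "Exp_meas \<alpha>" using prob_space_exponential_density[OF \<alpha>] by simp
  interpret P: pair_prob_space "law M (Some x)" "Exp_meas \<alpha>" ..
  obtain C where C: "0 \<le> C" "\<And>x. \<bar>f x\<bar> \<le> C" using bdd_funE[OF f] by blast
  note [measurable] = bdd_fun_measurable[OF f]
  have m: "(\<lambda>z. ext0 f (coord M (max 0 (snd z)) (fst z))) \<in> borel_measurable (law M (Some x) \<Otimes>\<^sub>M Exp_meas \<alpha>)"
    by measurable
  show I: "integrable (law M (Some x) \<Otimes>\<^sub>M Exp_meas \<alpha>) (\<lambda>z. ext0 f (coord M (max 0 (snd z)) (fst z)))"
    by (rule P.integrable_const_bound[where B=C, OF _ m]) (auto intro!: ext0_bdd C)
  have "resolvent M \<alpha> f x = (\<integral>\<omega>. (\<integral>s. ext0 f (coord M (max 0 s) \<omega>) \<partial>Exp_meas \<alpha>) / \<alpha> \<partial>law M (Some x))"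
    unfolding resolvent_def
  proof (rule Bochner_Integration.integral_cong[OF refl])
    fix \<omega> assume "\<omega> \<in> space (law M (Some x))"
    then have [measurable]: "(\<lambda>s. coord M (max 0 s) \<omega>) \<in> borel \<rightarrow>\<^sub>M borel_cpt"
      by (intro coord_path_measurable) simp
    have "(\<integral>s. ext0 f (coord M (max 0 s) \<omega>) \<partial>Exp_meas \<alpha>) / \<alpha> =
      (\<integral>s. exponential_density \<alpha> s * ext0 f (coord M (max 0 s) \<omega>) / \<alpha> \<partial>lborel)"
      using \<alpha> by (subst integral_density) (auto simp: exponential_density_nonneg)
    also have "\<dots> = (LINT t:{0..}|lborel. exp (- \<alpha> * t) * ext0 f (coord M t \<omega>))"
      unfolding set_lebesgue_integral_def using \<alpha>
      by (intro Bochner_Integration.integral_cong refl)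
         (auto simp: exponential_density_def max_def mult.commute split: split_indicator)
    finally show "(LINT t:{0..}|lborel. exp (- \<alpha> * t) * ext0 f (coord M t \<omega>)) = (\<integral>s. ext0 f (coord M (max 0 s) \<omega>) \<partial>Exp_meas \<alpha>) / \<alpha>" ..
  qed
  also have "\<dots> = (\<integral>\<omega>. (\<integral>s. ext0 f (coord M (max 0 s) \<omega>) \<partial>Exp_meas \<alpha>) \<partial>law M (Some x)) / \<alpha>"
    by simp
  also have "(\<integral>\<omega>. (\<integral>s. ext0 f (coord M (max 0 s) \<omega>) \<partial>Exp_meas \<alpha>) \<partial>law M (Some x)) =
    (\<integral>z. ext0 f (coord M (max 0 (snd z)) (fst z)) \<partial>(law M (Some x) \<Otimes>\<^sub>M Exp_meas \<alpha>))"
    using P.integral_fst'[OF I] by simp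
  finally show "resolvent M \<alpha> f x = (\<integral>z. ext0 f (coord M (max 0 (snd z)) (fst z)) \<partial>(law M (Some x) \<Otimes>\<^sub>M Exp_meas \<alpha>)) / \<alpha>" .
qed

lemma resolvent_bound:
  assumes f: "bdd_fun f" and C: "\<And>x. \<bar>f x\<bar> \<le> C" and \<alpha>: "0 < \<alpha>"
  shows "\<bar>resolvent M \<alpha> f x\<bar> \<le> C / \<alpha>"
proof -
  interpret L: prob_space "law M (Some x)" by (rule prob_law)
  interpret E: prob_space "Exp_meas \<alpha>" using prob_space_exponential_density[OF \<alpha>] by simp
  interpret P: pair_prob_space "law M (Some x)" "Exp_meas \<alpha>" ..
  let ?g = "\<lambda>z. ext0 f (coord M (max 0 (snd z)) (fst z))"
  have C0: "0 \<le> C" using C[of x] by linarith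
  note I = resolvent_pair(2)[OF f \<alpha>, of x]
  have "\<bar>\<integral>z. ?g z \<partial>(law M (Some x) \<Otimes>\<^sub>M Exp_meas \<alpha>)\<bar> \<le> (\<integral>z. \<bar>?g z\<bar> \<partial>(law M (Some x) \<Otimes>\<^sub>M Exp_meas \<alpha>))"
    using integral_norm_bound[of "law M (Some x) \<Otimes>\<^sub>M Exp_meas \<alpha>" ?g] by simp
  also have "\<dots> \<le> (\<integral>z. C \<partial>(law M (Some x) \<Otimes>\<^sub>M Exp_meas \<alpha>))"
    by (rule integral_mono[OF integrable_abs[OF I]]) (auto intro!: ext0_bdd C C0)
  also have "\<dots> = C" using P.prob_space by simp
  finally show ?thesis using \<alpha> by (simp add: resolvent_pair(1)[OF f \<alpha>] divide_right_mono)
qed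

lemma resolvent_parts:
  assumes f: "bdd_fun f" and \<alpha>: "0 < \<alpha>"
  shows "resolvent M \<alpha> f x = resolvent M \<alpha> (\<lambda>x. max 0 (f x)) x - resolvent M \<alpha> (\<lambda>x. max 0 (- f x)) x"
proof -
  note b = bdd_fun_parts[OF f]
  have "(\<integral>z. ext0 f (coord M (max 0 (snd z)) (fst z)) \<partial>(law M (Some x) \<Otimes>\<^sub>M Exp_meas \<alpha>)) =
    (\<integral>z. ext0 (\<lambda>x. max 0 (f x)) (coord M (max 0 (snd z)) (fst z)) - ext0 (\<lambda>x. max 0 (- f x)) (coord M (max 0 (snd z)) (fst z))
       \<partial>(law M (Some x) \<Otimes>\<^sub>M Exp_meas \<alpha>))"
    by (intro Bochner_Integration.integral_cong) (auto simp: ext0_def split: option.split)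
  also have "\<dots> = (\<integral>z. ext0 (\<lambda>x. max 0 (f x)) (coord M (max 0 (snd z)) (fst z)) \<partial>(law M (Some x) \<Otimes>\<^sub>M Exp_meas \<alpha>)) -
    (\<integral>z. ext0 (\<lambda>x. max 0 (- f x)) (coord M (max 0 (snd z)) (fst z)) \<partial>(law M (Some x) \<Otimes>\<^sub>M Exp_meas \<alpha>))"
    by (rule Bochner_Integration.integral_diff[OF resolvent_pair(2)[OF b(1) \<alpha>] resolvent_pair(2)[OF b(2) \<alpha>]])
  finally show ?thesis by (simp add: resolvent_pair(1) f b \<alpha> diff_divide_distrib)
qed

lemma ennreal_resolvent:
  assumes f: "bdd_fun f" "\<And>x. 0 \<le> f x" and \<alpha>: "0 < \<alpha>"
  shows "ennreal (resolvent M \<alpha> f x) = (\<integral>\<^sup>+s\<in>{0..}. ennreal (exp (- \<alpha> * s)) * semigroup_nn M (max 0 s) (\<lambda>x. ennreal (f x)) x \<partial>lborel)"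
    "0 \<le> resolvent M \<alpha> f x"
proof -
  interpret L: prob_space "law M (Some x)" by (rule prob_law)
  interpret E: prob_space "Exp_meas \<alpha>" using prob_space_exponential_density[OF \<alpha>] by simp
  interpret P: pair_prob_space "law M (Some x)" "Exp_meas \<alpha>" ..
  note [measurable] = bdd_fun_measurable[OF f(1)]
  let ?g = "\<lambda>z. ext0 f (coord M (max 0 (snd z)) (fst z))"
  note I = resolvent_pair(2)[OF f(1) \<alpha>, of x]
  have nn: "0 \<le> ext0 f y" for y using f(2) by (simp add: ext0_def split: option.split)
  have e: "ennreal (ext0 f y) = ext0 (\<lambda>x. ennreal (f x)) y" for y by (simp add: ext0_def split: option.split)
  show "0 \<le> resolvent M \<alpha> f x" using nn \<alpha> by (simp add: resolvent_pair(1)[OF f(1) \<alpha>])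
  have "ennreal (\<integral>z. ?g z \<partial>(law M (Some x) \<Otimes>\<^sub>M Exp_meas \<alpha>)) = (\<integral>\<^sup>+z. ennreal (?g z) \<partial>(law M (Some x) \<Otimes>\<^sub>M Exp_meas \<alpha>))"
    using nn by (intro nn_integral_eq_integral[OF I, symmetric]) simp
  also have "\<dots> = (\<integral>\<^sup>+s. (\<integral>\<^sup>+\<omega>. ennreal (ext0 f (coord M (max 0 s) \<omega>)) \<partial>law M (Some x)) \<partial>Exp_meas \<alpha>)"
    by (subst P.nn_integral_snd[symmetric]) auto
  also have "\<dots> = (\<integral>\<^sup>+s. semigroup_nn M (max 0 s) (\<lambda>x. ennreal (f x)) x \<partial>Exp_meas \<alpha>)"
    unfolding e semigroup_nn_def expect_def ..
  also have "\<dots> = (\<integral>\<^sup>+s. ennreal \<alpha> * (ennreal (exp (- \<alpha> * s)) * semigroup_nn M (max 0 s) (\<lambda>x. ennreal (f x)) x * indicator {0..} s) \<partial>lborel)"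
    using \<alpha> by (subst nn_integral_density)
      (auto intro!: nn_integral_cong simp: exponential_density_def ennreal_mult mult_ac split: split_indicator)
  also have "\<dots> = ennreal \<alpha> * (\<integral>\<^sup>+s\<in>{0..}. ennreal (exp (- \<alpha> * s)) * semigroup_nn M (max 0 s) (\<lambda>x. ennreal (f x)) x \<partial>lborel)"
    by (rule nn_integral_cmult) measurable
  finally have *: "ennreal (\<integral>z. ?g z \<partial>(law M (Some x) \<Otimes>\<^sub>M Exp_meas \<alpha>)) = \<dots>" .
  have "ennreal (resolvent M \<alpha> f x) = ennreal (inverse \<alpha>) * ennreal (\<integral>z. ?g z \<partial>(law M (Some x) \<Otimes>\<^sub>M Exp_meas \<alpha>))"
    using \<alpha> nn by (subst ennreal_mult[symmetric]) (simp_all add: resolvent_pair(1)[OF f(1) \<alpha>] field_simps)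
  also have "\<dots> = (\<integral>\<^sup>+s\<in>{0..}. ennreal (exp (- \<alpha> * s)) * semigroup_nn M (max 0 s) (\<lambda>x. ennreal (f x)) x \<partial>lborel)"
    unfolding * using \<alpha> by (simp add: mult.assoc[symmetric] ennreal_mult[symmetric])
  finally show "ennreal (resolvent M \<alpha> f x) = (\<integral>\<^sup>+s\<in>{0..}. ennreal (exp (- \<alpha> * s)) * semigroup_nn M (max 0 s) (\<lambda>x. ennreal (f x)) x \<partial>lborel)" .
qed

lemma resolvent_measurable [measurable]:
  assumes f: "bdd_fun f" and \<alpha>: "0 < \<alpha>"
  shows "resolvent M \<alpha> f \<in> borel_measurable borel"
proof -
  have pos: "resolvent M \<alpha> f \<in> borel_measurable borel" if f: "bdd_fun f" "\<And>x. 0 \<le> f x" for f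
  proof -
    note [measurable] = bdd_fun_measurable[OF f(1)]
    have "(\<lambda>x. enn2real (\<integral>\<^sup>+s\<in>{0..}. ennreal (exp (- \<alpha> * s)) * semigroup_nn M (max 0 s) (\<lambda>x. ennreal (f x)) x \<partial>lborel)) \<in> borel_measurable borel"
      by measurable
    moreover have "resolvent M \<alpha> f x = enn2real (\<integral>\<^sup>+s\<in>{0..}. ennreal (exp (- \<alpha> * s)) * semigroup_nn M (max 0 s) (\<lambda>x. ennreal (f x)) x \<partial>lborel)" for x
      unfolding ennreal_resolvent(1)[OF f \<alpha>, symmetric] using ennreal_resolvent(2)[OF f \<alpha>] by simp
    ultimately show ?thesis by presburger
  qed
  note [measurable] = pos[OF bdd_fun_parts(1)[OF f]] pos[OF bdd_fun_parts(2)[OF f]]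
  have "(\<lambda>x. resolvent M \<alpha> (\<lambda>x. max 0 (f x)) x - resolvent M \<alpha> (\<lambda>x. max 0 (- f x)) x) \<in> borel_measurable borel"
    by measurable
  then show ?thesis using resolvent_parts[OF f \<alpha>] by presburger
qed

lemma integrable_resolvent:
  assumes f: "bdd_fun f" and \<alpha>: "0 < \<alpha>" and \<nu>: "finite_measure \<nu>" "sets \<nu> = sets borel"
  shows "integrable \<nu> (resolvent M \<alpha> f)"
proof -
  obtain C where C: "0 \<le> C" "\<And>x. \<bar>f x\<bar> \<le> C" using bdd_funE[OF f] by blast
  show ?thesis
    using resolvent_measurable[OF f \<alpha>] \<nu>(2) resolvent_bound[OF f C(2) \<alpha>]
    by (intro finite_measure.integrable_const_bound[OF \<nu>(1), of _ "C / \<alpha>"]) (auto cong: measurable_cong_sets)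
qed

text \<open>The left side is what (A1) and (A2) control, the right side is the quantity whose limit
  is sought.\<close>

lemma resolvent_laplace:
  assumes pot: "potential \<nu> F A u" and \<nu>: "finite_measure \<nu>" "sets \<nu> = sets borel"
    and \<alpha>: "0 < \<alpha>" and f: "bdd_fun f" "\<And>x. 0 \<le> f x"
  shows "(\<integral>\<^sup>+x. ennreal (f x) * (\<integral>\<^sup>+s\<in>{0..}. ennreal (\<alpha> * exp (- \<alpha> * s)) * u s x \<partial>lborel) \<partial>m) =
    ennreal (\<integral>x. resolvent M \<alpha> f x \<partial>\<nu>)"
proof -
  note [measurable] = bdd_fun_measurable[OF f(1)]
  show ?thesis
  proof (subst potential_laplace[OF pot \<nu> \<alpha>])
    show "(\<integral>\<^sup>+x. (\<integral>\<^sup>+s\<in>{0..}. ennreal (exp (- \<alpha> * s)) * semigroup_nn M (max 0 s) (\<lambda>x. ennreal (f x)) x \<partial>lborel) \<partial>\<nu>) =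
      ennreal (\<integral>x. resolvent M \<alpha> f x \<partial>\<nu>)"
      unfolding ennreal_resolvent(1)[OF f \<alpha>, symmetric]
      using ennreal_resolvent(2)[OF f \<alpha>] by (intro nn_integral_eq_integral integrable_resolvent f(1) \<alpha> \<nu>) simp
  qed simp
qed

text \<open>T is chosen before n, from (A2) and the decay of e^{-\<alpha> T} T; then (A1) on [0,T]
  tells how large n has to be.\<close>

lemma resolvent_convergence_nonneg:
  fixes As :: "nat \<Rightarrow> real \<Rightarrow> 'w \<Rightarrow> ennreal"
  assumes pots: "\<And>n. potential (\<nu>s n) F (As n) (us n)" and pot: "potential \<nu> F A u"
    and \<nu>s: "\<And>n. finite_measure (\<nu>s n)" "\<And>n. sets (\<nu>s n) = sets borel"
    and \<nu>: "finite_measure \<nu>" "sets \<nu> = sets borel"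
    and A1: "\<And>t. t > 0 \<Longrightarrow>
          (\<lambda>n. SUP s\<in>{0..t}. \<integral>\<^sup>+x\<in>K. ennreal_absdiff
                 (expect M x (restrict_af M F (As n) s)) (expect M x (restrict_af M F A s)) \<partial>m) \<longlonglongrightarrow> 0"
    and A2: "((\<lambda>t. SUP n. \<integral>\<^sup>+x\<in>K. max
                 (expect M x (path_integral (restrict_af M F (As n)) {t..} (\<lambda>s. ennreal (exp (- \<alpha> * s)))))
                 (expect M x (path_integral (restrict_af M F A) {t..} (\<lambda>s. ennreal (exp (- \<alpha> * s))))) \<partial>m)
            \<longlongrightarrow> 0) at_top"
    and \<alpha>: "0 < \<alpha>" and f: "bdd_fun f" "\<And>x. 0 \<le> f x" and K: "compact K" "AE x in m. x \<notin> K \<longrightarrow> f x = 0"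
  shows "(\<lambda>n. \<integral>x. resolvent M \<alpha> f x \<partial>\<nu>s n) \<longlonglongrightarrow> (\<integral>x. resolvent M \<alpha> f x \<partial>\<nu>)"
proof -
  obtain C where C: "0 \<le> C" "\<And>x. \<bar>f x\<bar> \<le> C" using bdd_funE[OF f(1)] by blast
  note [measurable] = bdd_fun_measurable[OF f(1)]
  have [measurable]: "K \<in> sets borel" using K(1) by (simp add: borel_closed compact_imp_closed)
  let ?L = "\<lambda>u. \<integral>\<^sup>+x. ennreal (f x) * (\<integral>\<^sup>+s\<in>{0..}. ennreal (\<alpha> * exp (- \<alpha> * s)) * u s x \<partial>lborel) \<partial>m"
  have hC: "AE x in m. ennreal (f x) \<le> ennreal C * indicator K x"
    using K(2) by eventually_elim (use C f(2) in \<open>auto intro!: ennreal_leI split: split_indicator simp: abs_of_nonneg\<close>)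
  have Ls: "?L (us n) = ennreal (\<integral>x. resolvent M \<alpha> f x \<partial>\<nu>s n)" for n
    by (rule resolvent_laplace[OF pots \<nu>s \<alpha> f])
  have L: "?L u = ennreal (\<integral>x. resolvent M \<alpha> f x \<partial>\<nu>)"
    by (rule resolvent_laplace[OF pot \<nu> \<alpha> f])
  define V where "V = measure \<nu> (space \<nu>)"
  have V: "emeasure \<nu> (space \<nu>) = ennreal V" "0 \<le> V"
    unfolding V_def by (simp_all add: finite_measure.emeasure_eq_measure[OF \<nu>(1)])
  let ?eps = "\<lambda>n T. SUP s\<in>{0..T}. \<integral>\<^sup>+x\<in>K. ennreal_absdiff
                 (expect M x (restrict_af M F (As n) s)) (expect M x (restrict_af M F A s)) \<partial>m"
  let ?tau = "\<lambda>t. SUP n. \<integral>\<^sup>+x\<in>K. max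
                 (expect M x (path_integral (restrict_af M F (As n)) {t..} (\<lambda>s. ennreal (exp (- \<alpha> * s)))))
                 (expect M x (path_integral (restrict_af M F A) {t..} (\<lambda>s. ennreal (exp (- \<alpha> * s))))) \<partial>m"
  have decay: "((\<lambda>T. exp (- \<alpha> * T) * (T * V)) \<longlongrightarrow> 0) at_top"
  proof -
    have "filterlim (\<lambda>T. \<alpha> * T) at_top at_top"
      using \<alpha> by (auto intro!: filterlim_tendsto_pos_mult_at_top filterlim_ident)
    from filterlim_compose[OF tendsto_power_div_exp_0[of 1] this]
    have "((\<lambda>T. V / \<alpha> * ((\<alpha> * T) ^ 1 / exp (\<alpha> * T))) \<longlongrightarrow> V / \<alpha> * 0) at_top"
      by (rule tendsto_mult_left)
    then show ?thesis using \<alpha> by (simp add: exp_minus field_simps)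
  qed
  have ev: "\<forall>\<^sub>F n in sequentially. ?L (us n) \<le> ?L u + ennreal \<eta> \<and> ?L u \<le> ?L (us n) + ennreal \<eta>" if \<eta>: "\<eta> > 0" for \<eta>
  proof -
    \<comment> \<open>Four error terms of size at most \<delta> occur: one from (A1), one from (A2),
      and the two summands of e^{-\<alpha> T} (T V + \<delta>). The 1 guards against C = 0.\<close>
    define \<delta> where "\<delta> = \<eta> / (4 * (C + 1))"
    have \<delta>: "0 < \<delta>" "C * (4 * \<delta>) \<le> \<eta>" using \<eta> C(1) by (simp_all add: \<delta>_def field_simps)
    have "\<forall>\<^sub>F T in at_top. ?tau T < ennreal \<delta>"
      using order_tendstoD(2)[OF A2, of "ennreal \<delta>"] \<delta> by simp
    moreover have "\<forall>\<^sub>F T in at_top. exp (- \<alpha> * T) * (T * V) < \<delta>"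
      using order_tendstoD(2)[OF decay \<delta>(1)] .
    moreover have "\<forall>\<^sub>F T in at_top. 0 < (T::real)" by (rule eventually_gt_at_top)
    ultimately have "\<forall>\<^sub>F T in at_top. ?tau T < ennreal \<delta> \<and> exp (- \<alpha> * T) * (T * V) < \<delta> \<and> 0 < T"
      by eventually_elim simp
    then obtain T where T: "?tau T < ennreal \<delta>" "exp (- \<alpha> * T) * (T * V) < \<delta>" "0 < T"
      using eventually_happens'[OF trivial_limit_at_top_linorder] by blast
    have T0: "0 \<le> T" using T by simp
    have \<tau>: "(\<integral>\<^sup>+x\<in>K. expect M x (path_integral (restrict_af M F (As n)) {T..} (\<lambda>s. ennreal (exp (- \<alpha> * s)))) \<partial>m) \<le> ennreal \<delta>"
      "(\<integral>\<^sup>+x\<in>K. expect M x (path_integral (restrict_af M F A) {T..} (\<lambda>s. ennreal (exp (- \<alpha> * s)))) \<partial>m) \<le> ennreal \<delta>" for n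
    proof -
      have "(\<integral>\<^sup>+x\<in>K. max
                 (expect M x (path_integral (restrict_af M F (As n)) {T..} (\<lambda>s. ennreal (exp (- \<alpha> * s)))))
                 (expect M x (path_integral (restrict_af M F A) {T..} (\<lambda>s. ennreal (exp (- \<alpha> * s))))) \<partial>m) \<le> ?tau T"
        by (rule SUP_upper) simp
      then have le: "(\<integral>\<^sup>+x\<in>K. max
                 (expect M x (path_integral (restrict_af M F (As n)) {T..} (\<lambda>s. ennreal (exp (- \<alpha> * s)))))
                 (expect M x (path_integral (restrict_af M F A) {T..} (\<lambda>s. ennreal (exp (- \<alpha> * s))))) \<partial>m) \<le> ennreal \<delta>"
        using T(1) by simp
      show "(\<integral>\<^sup>+x\<in>K. expect M x (path_integral (restrict_af M F (As n)) {T..} (\<lambda>s. ennreal (exp (- \<alpha> * s)))) \<partial>m) \<le> ennreal \<delta>"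
        by (rule order_trans[OF nn_integral_mono le]) (simp add: mult_right_mono)
      show "(\<integral>\<^sup>+x\<in>K. expect M x (path_integral (restrict_af M F A) {T..} (\<lambda>s. ennreal (exp (- \<alpha> * s)))) \<partial>m) \<le> ennreal \<delta>"
        by (rule order_trans[OF nn_integral_mono le]) (simp add: mult_right_mono)
    qed
    \<comment> \<open>Here the mass of \<nu> is used. For \<open>us n\<close> the same estimate
      would involve the masses of the \<nu>s, which are not known to be bounded; below it is derived
      from uT through (A1) instead.\<close>
    have uT: "(\<integral>\<^sup>+x. indicator K x * u T x \<partial>m) \<le> ennreal (T * V)"
      using potential_revuz_le[OF pot, of "indicator K" 1 T] T0 V
      by (simp add: ennreal_mult indicator_def)
    have "\<forall>\<^sub>F n in sequentially. ?eps n T < ennreal \<delta>"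
      using order_tendstoD(2)[OF A1[OF T(3)], of "ennreal \<delta>"] \<delta> by simp
    then show ?thesis
    proof eventually_elim
      case (elim n)
      have \<epsilon>: "(\<integral>\<^sup>+x\<in>K. ennreal_absdiff (expect M x (restrict_af M F (As n) s)) (expect M x (restrict_af M F A s)) \<partial>m) \<le> ennreal \<delta>"
        if "s \<in> {0..T}" for s
        using elim that by (meson SUP_upper order_trans less_imp_le)
      have \<epsilon>': "(\<integral>\<^sup>+x\<in>K. ennreal_absdiff (expect M x (restrict_af M F A s)) (expect M x (restrict_af M F (As n) s)) \<partial>m) \<le> ennreal \<delta>"
        if "s \<in> {0..T}" for s
        using \<epsilon>[OF that] by (simp add: ennreal_absdiff_commute)
      have "(\<integral>\<^sup>+x. indicator K x * us n T x \<partial>m) \<le> (\<integral>\<^sup>+x. indicator K x * u T x \<partial>m) +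
        1 * (\<integral>\<^sup>+x\<in>K. ennreal_absdiff (expect M x (restrict_af M F (As n) T)) (expect M x (restrict_af M F A T)) \<partial>m)"
        by (rule potential_compare_time[OF pots pot _ _ _ T0]) auto
      also have "\<dots> \<le> ennreal (T * V) + 1 * ennreal \<delta>"
        using \<epsilon>[of T] T0 uT by (intro add_mono) auto
      finally have unT: "(\<integral>\<^sup>+x. indicator K x * us n T x \<partial>m) \<le> ennreal (T * V + \<delta>)"
        using T0 V \<delta> by (simp add: ennreal_plus)
      have uT': "(\<integral>\<^sup>+x. indicator K x * u T x \<partial>m) \<le> ennreal (T * V + \<delta>)"
        using \<delta>(1) by (intro order_trans[OF uT] ennreal_leI) simp
      have fin: "ennreal C * (ennreal \<delta> + (ennreal (exp (- \<alpha> * T)) * ennreal (T * V + \<delta>) + ennreal \<delta>)) \<le> ennreal \<eta>"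
      proof -
        have "exp (- \<alpha> * T) * \<delta> \<le> 1 * \<delta>" using \<alpha> T0 \<delta> by (intro mult_right_mono) auto
        then have "\<delta> + (exp (- \<alpha> * T) * (T * V + \<delta>) + \<delta>) \<le> 4 * \<delta>"
          using T(2) by (simp add: distrib_left)
        then have "C * (\<delta> + (exp (- \<alpha> * T) * (T * V + \<delta>) + \<delta>)) \<le> \<eta>"
          using \<delta>(2) C(1) by (meson mult_left_mono order_trans)
        then show ?thesis
          using C(1) \<delta>(1) T0 V(2) by (simp add: ennreal_mult[symmetric] ennreal_plus[symmetric] ennreal_leI del: ennreal_plus)
      qed
      show ?case
        using potential_compare[OF pots pot _ _ hC T0 \<alpha> \<epsilon> \<tau>(1) unT] potential_compare[OF pot pots _ _ hC T0 \<alpha> \<epsilon>' \<tau>(2) uT']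
          add_left_mono[OF fin] by (auto intro: order_trans)
    qed
  qed
  have "(\<lambda>n. enn2real (?L (us n))) \<longlonglongrightarrow> enn2real (?L u)"
    by (rule tendsto_enn2real_squeeze[OF _ ev]) (simp only: L ennreal_less_top infinity_ennreal_def)
  moreover have "0 \<le> (\<integral>x. resolvent M \<alpha> f x \<partial>\<nu>s n)" "0 \<le> (\<integral>x. resolvent M \<alpha> f x \<partial>\<nu>)" for n
    using ennreal_resolvent(2)[OF f \<alpha>] by simp_all
  ultimately show ?thesis unfolding Ls L by simp
qed

lemma resolvent_convergence:
  fixes As :: "nat \<Rightarrow> real \<Rightarrow> 'w \<Rightarrow> ennreal"
  assumes pots: "\<And>n. potential (\<nu>s n) F (As n) (us n)" and pot: "potential \<nu> F A u"
    and \<nu>s: "\<And>n. finite_measure (\<nu>s n)" "\<And>n. sets (\<nu>s n) = sets borel"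
    and \<nu>: "finite_measure \<nu>" "sets \<nu> = sets borel"
    and A1: "\<And>t K. t > 0 \<Longrightarrow> compact K \<Longrightarrow>
          (\<lambda>n. SUP s\<in>{0..t}. \<integral>\<^sup>+x\<in>K. ennreal_absdiff
                 (expect M x (restrict_af M F (As n) s)) (expect M x (restrict_af M F A s)) \<partial>m) \<longlonglongrightarrow> 0"
    and A2: "\<And>K. compact K \<Longrightarrow> ((\<lambda>t. SUP n. \<integral>\<^sup>+x\<in>K. max
                 (expect M x (path_integral (restrict_af M F (As n)) {t..} (\<lambda>s. ennreal (exp (- \<alpha> * s)))))
                 (expect M x (path_integral (restrict_af M F A) {t..} (\<lambda>s. ennreal (exp (- \<alpha> * s))))) \<partial>m)
            \<longlongrightarrow> 0) at_top"
    and \<alpha>: "0 < \<alpha>" and f: "f \<in> Bb0 m"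
  shows "(\<lambda>n. \<integral>x. resolvent M \<alpha> f x \<partial>\<nu>s n) \<longlonglongrightarrow> (\<integral>x. resolvent M \<alpha> f x \<partial>\<nu>)"
proof -
  obtain K where K: "compact K" "AE x in m. x \<notin> K \<longrightarrow> f x = 0" using Bb0_support[OF f] .
  have b: "bdd_fun f" using f by (auto simp: Bb0_def bdd_fun_def bounded_iff)
  note bp = bdd_fun_parts[OF b]
  have Kp: "AE x in m. x \<notin> K \<longrightarrow> max 0 (f x) = 0" and Kn: "AE x in m. x \<notin> K \<longrightarrow> max 0 (- f x) = 0"
    using K(2) by (auto elim!: eventually_mono)
  have split: "(\<integral>x. resolvent M \<alpha> f x \<partial>\<nu>) = (\<integral>x. resolvent M \<alpha> (\<lambda>x. max 0 (f x)) x \<partial>\<nu>) - (\<integral>x. resolvent M \<alpha> (\<lambda>x. max 0 (- f x)) x \<partial>\<nu>)"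
    if "finite_measure \<nu>" "sets \<nu> = sets borel" for \<nu>
    using Bochner_Integration.integral_diff[OF integrable_resolvent[OF bp(1) \<alpha> that] integrable_resolvent[OF bp(2) \<alpha> that]]
    by (simp add: resolvent_parts[OF b \<alpha>, symmetric])
  show ?thesis
    unfolding split[OF \<nu>s] split[OF \<nu>]
    by (intro tendsto_diff resolvent_convergence_nonneg[OF pots pot \<nu>s \<nu> A1 A2 \<alpha> bp(1) _ K(1) Kp]
        resolvent_convergence_nonneg[OF pots pot \<nu>s \<nu> A1 A2 \<alpha> bp(2) _ K(1) Kn] K(1)) auto
qed

end

section \<open>The energy inequality\<close>

text \<open>Nonnegativity for all real r forces c \<ge> 0, and b = 0 when c = 0; in the remaining
  case the minimum at r = -b/c is inserted.\<close>

lemma discriminant_le: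
  fixes a b c :: real
  assumes "\<And>r. 0 \<le> a + 2 * r * b + r\<^sup>2 * c"
  shows "b\<^sup>2 \<le> a * c"
proof (cases "c = 0")
  case True
  have "b = 0"
  proof (rule ccontr)
    assume "b \<noteq> 0"
    \<comment> \<open>This r gives the quadratic the value -1.\<close>
    then show False using assms[of "- (a + 1) / (2 * b)"] True by (simp add: field_simps)
  qed
  then show ?thesis using True by simp
next
  case False
  have "0 \<le> c"
  proof (rule ccontr)
    assume "\<not> 0 \<le> c"
    then have c: "c < 0" by simp
    \<comment> \<open>Large enough for r^2 (-c) to exceed |a| + 2 r |b|, which makes the quadratic
      negative.\<close>
    define r where "r = 1 + (\<bar>a\<bar> + 2 * \<bar>b\<bar>) / (- c)"
    have r: "1 \<le> r" using c by (auto simp: r_def intro!: divide_nonneg_neg)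
    have rc: "r * (- c) = (- c) + \<bar>a\<bar> + 2 * \<bar>b\<bar>" using c by (simp add: r_def field_simps)
    have "r\<^sup>2 * (- c) = r * (r * (- c))" by (simp add: power2_eq_square)
    then have "r\<^sup>2 * (- c) = r * ((- c) + \<bar>a\<bar> + 2 * \<bar>b\<bar>)" by (simp only: rc)
    moreover have "r * \<bar>a\<bar> \<ge> \<bar>a\<bar>" "r * (- c) > 0"
      using r c by (simp_all add: mult_right_le_one_le mult_le_cancel_right1 mult_pos_neg)
    moreover have "2 * r * b \<le> 2 * (r * \<bar>b\<bar>)" using r by (simp add: mult_left_mono)
    ultimately show False using assms[of r] by (simp add: algebra_simps)
  qed
  then have "c > 0" using False by simp
  then show ?thesis using assms[of "- b / c"] by (simp add: field_simps power2_eq_square)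
qed

lemma integrable_indicator_Icc [simp]: "integrable lborel (indicator {a..b} :: real \<Rightarrow> real)"
  by (rule integrable_real_indicator) (auto simp: emeasure_lborel_Icc_eq)

context symmetric_hunt begin

abbreviation avg1 :: "('a \<Rightarrow> real) \<Rightarrow> 'a \<Rightarrow> real" where
  "avg1 \<equiv> avg (\<lambda>_. 1)"

text \<open>The mutual 1-energy of the charges f m and g m, that is, the E_1-inner product of their
  1-potentials.\<close>

definition energy :: "('a \<Rightarrow> real) \<Rightarrow> ('a \<Rightarrow> real) \<Rightarrow> real" where
  "energy f g = (\<integral>x. avg1 f x * g x \<partial>m)"

lemma bdd_const: "bdd_fun (\<lambda>_::'b::topological_space. c::real)"
  by (rule bdd_funI[where C="\<bar>c\<bar>"]) auto

lemma L1b_bdd: "L1b f \<Longrightarrow> bdd_fun f"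
  by (simp add: L1b_def)

text \<open>p_s is the square of the symmetric operator p_{s/2}, so the integral is that of (p_{s/2}
  f)^2.\<close>

lemma transition_inner_nonneg:
  assumes f: "L1b f" and s: "0 \<le> s"
  shows "0 \<le> (\<integral>x. transition M s f x * f x \<partial>m)"
proof -
  have s2: "0 \<le> s / 2" using s by simp
  have "transition M s f x = transition M (s / 2) (transition M (s / 2) f) x" for x
    using transition_add[OF s2 s2 L1b_bdd[OF f], of x] by simp
  then have "(\<integral>x. transition M s f x * f x \<partial>m) = (\<integral>x. transition M (s / 2) f x * transition M (s / 2) f x \<partial>m)"
    using transition_sym[OF L1b_transition[OF f s2] f s2] by simp
  then show ?thesis by simp
qed

lemma energy_eq:
  assumes f: "L1b f" and g: "L1b g"
  shows "energy f g = (\<integral>s. (\<integral>x. transition M (max 0 s) f x * g x \<partial>m) \<partial>Exp_meas 1)"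
  unfolding energy_def using avg_inner(1)[OF f L1b_bdd[OF g] bdd_const[of 1]] by simp

lemma energy_nonneg: "L1b f \<Longrightarrow> 0 \<le> energy f f"
  by (simp add: energy_eq transition_inner_nonneg)

lemma energy_sym: "L1b f \<Longrightarrow> L1b g \<Longrightarrow> energy f g = energy g f"
proof -
  assume f: "L1b f" and g: "L1b g"
  have "(\<integral>x. transition M (max 0 s) f x * g x \<partial>m) = (\<integral>x. transition M (max 0 s) g x * f x \<partial>m)" for s
    using transition_sym[OF f g, of "max 0 s"] by (simp add: mult.commute[of "f _"])
  then show ?thesis by (simp add: energy_eq f g)
qed

lemma energy_lincomb_right:
  assumes f: "L1b f" and g: "L1b g" and h: "L1b h"
  shows "energy f (\<lambda>x. a * g x + b * h x) = a * energy f g + b * energy f h"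
proof -
  have i: "integrable m (\<lambda>x. avg1 f x * g x)" "integrable m (\<lambda>x. avg1 f x * h x)"
    using L1b_mult[OF L1b_avg[OF f bdd_const]] g h by (auto simp: L1b_def)
  have "energy f (\<lambda>x. a * g x + b * h x) = (\<integral>x. a * (avg1 f x * g x) + b * (avg1 f x * h x) \<partial>m)"
    unfolding energy_def by (intro Bochner_Integration.integral_cong) (auto simp: algebra_simps)
  also have "\<dots> = a * energy f g + b * energy f h"
    using i by (simp add: energy_def)
  finally show ?thesis .
qed

lemma energy_square:
  assumes f: "L1b f" and g: "L1b g"
  shows "energy (\<lambda>x. a * f x + b * g x) (\<lambda>x. a * f x + b * g x) = a\<^sup>2 * energy f f + 2 * a * b * energy f g + b\<^sup>2 * energy g g"
proof -
  let ?k = "\<lambda>x. a * f x + b * g x"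
  have k: "L1b ?k" by (rule L1b_lincomb[OF f g])
  have "energy ?k ?k = a * energy ?k f + b * energy ?k g" by (rule energy_lincomb_right[OF k f g])
  also have "energy ?k f = a * energy f f + b * energy f g"
    using energy_lincomb_right[OF f f g] energy_sym[OF k f] by simp
  also have "energy ?k g = a * energy f g + b * energy g g"
    using energy_lincomb_right[OF g f g] energy_sym[OF k g] energy_sym[OF g f] by simp
  finally show ?thesis by (simp add: algebra_simps power2_eq_square)
qed

lemma energy_Cauchy_Schwarz:
  assumes f: "L1b f" and g: "L1b g"
  shows "(energy f g)\<^sup>2 \<le> energy f f * energy g g"
proof (rule discriminant_le)
  fix r
  show "0 \<le> energy f f + 2 * r * energy f g + r\<^sup>2 * energy g g"
    using energy_square[OF f g, of 1 r] energy_nonneg[OF L1b_lincomb[OF f g, of 1 r]] by simp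
qed

section \<open>From the Revuz formula to the energy of a finite measure\<close>

lemma potential_measurable_time:
  "potential \<nu> F A u \<Longrightarrow> u t \<in> borel_measurable borel"
  using potential_compose[of \<nu> F A u "\<lambda>_. t" borel "\<lambda>x. x"] by simp

lemma potential_integrable:
  assumes pot: "potential \<nu> F A u" and \<nu>: "finite_measure \<nu>" and t: "0 \<le> t"
  shows "(\<integral>\<^sup>+x. u t x \<partial>m) < \<infinity>" "AE x in m. u t x < \<infinity>" "integrable m (\<lambda>x. enn2real (u t x))"
proof -
  note [measurable] = potential_measurable_time[OF pot]
  interpret n: finite_measure \<nu> by (rule \<nu>)
  have "(\<integral>\<^sup>+x. 1 * u t x \<partial>m) \<le> ennreal t * 1 * emeasure \<nu> (space \<nu>)"
    by (rule potential_revuz_le[OF pot _ _ t]) auto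
  also have "\<dots> < \<infinity>" by (simp add: ennreal_mult_less_top n.emeasure_eq_measure)
  finally show fin: "(\<integral>\<^sup>+x. u t x \<partial>m) < \<infinity>" by simp
  show ae: "AE x in m. u t x < \<infinity>"
    using nn_integral_noteq_infinite[of "u t" m] fin by (auto simp: less_top)
  have "(\<integral>\<^sup>+x. ennreal (norm (enn2real (u t x))) \<partial>m) = (\<integral>\<^sup>+x. u t x \<partial>m)"
    using ae by (intro nn_integral_cong_AE) (auto elim!: eventually_mono)
  then show "integrable m (\<lambda>x. enn2real (u t x))"
    using fin by (simp add: integrable_iff_bounded)
qed

lemma transition_time_integrable:
  assumes h: "bdd_fun h"
  shows "integrable lborel (\<lambda>s. indicator {0..t} s * transition M (max 0 s) h x)"
proof -
  obtain C where C: "0 \<le> C" "\<And>x. \<bar>h x\<bar> \<le> C" using bdd_funE[OF h] by blast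
  note [measurable] = bdd_fun_measurable[OF h]
  show ?thesis
  proof (rule Bochner_Integration.integrable_bound)
    show "integrable lborel (\<lambda>s. C * indicator {0..t} s :: real)" by simp
    show "AE s in lborel. norm (indicator {0..t} s * transition M (max 0 s) h x) \<le> norm (C * indicator {0..t} s)"
      using C transition_bound[OF h C(2)] by (auto simp: abs_mult split: split_indicator)
  qed measurable
qed

text \<open>Finite mass makes u_t integrable, so the Revuz formula can be applied to the positive
  and negative parts of h and subtracted.\<close>

lemma potential_revuz_real:
  assumes pot: "potential \<nu> F A u" and \<nu>: "finite_measure \<nu>" and sets_\<nu>[measurable_cong]: "sets \<nu> = sets borel"
    and h: "bdd_fun h" and t: "0 \<le> t"
  shows "(\<integral>x. h x * enn2real (u t x) \<partial>m) = (\<integral>x. (\<integral>s. indicator {0..t} s * transition M (max 0 s) h x \<partial>lborel) \<partial>\<nu>)"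
    "integrable \<nu> (\<lambda>x. \<integral>s. indicator {0..t} s * transition M (max 0 s) h x \<partial>lborel)"
    "integrable m (\<lambda>x. h x * enn2real (u t x))"
proof -
  interpret n: finite_measure \<nu> by (rule \<nu>)
  note [measurable] = potential_measurable_time[OF pot, of t]
  let ?S = "\<lambda>h x. \<integral>s. indicator {0..t} s * transition M (max 0 s) h x \<partial>lborel"
  have i: "integrable m (\<lambda>x. h x * enn2real (u t x))" if h: "bdd_fun h" for h
  proof -
    obtain C where C: "0 \<le> C" "\<And>x. \<bar>h x\<bar> \<le> C" using bdd_funE[OF h] by blast
    note [measurable] = bdd_fun_measurable[OF h]
    show ?thesis
      by (rule Bochner_Integration.integrable_bound[of m "\<lambda>x. C * enn2real (u t x)"])
         (use potential_integrable(3)[OF pot \<nu> t] C in \<open>auto simp: abs_mult intro!: mult_right_mono\<close>)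
  qed
  have Sm: "?S h \<in> borel_measurable borel" if h: "bdd_fun h" for h
  proof -
    note [measurable] = bdd_fun_measurable[OF h]
    show ?thesis by (rule lborel.borel_measurable_lebesgue_integral) measurable
  qed
  have Sb: "\<bar>?S h x\<bar> \<le> t * C" if h: "bdd_fun h" and C: "\<And>x. \<bar>h x\<bar> \<le> C" for h C x
  proof -
    have C0: "0 \<le> C" using C[of x] by linarith
    have "\<bar>?S h x\<bar> \<le> (\<integral>s. \<bar>indicator {0..t} s * transition M (max 0 s) h x\<bar> \<partial>lborel)"
      using integral_norm_bound[of lborel "\<lambda>s. indicator {0..t} s * transition M (max 0 s) h x"] by simp
    also have "\<dots> \<le> (\<integral>s. C * indicator {0..t} s \<partial>lborel)"
      by (rule integral_mono[OF integrable_abs[OF transition_time_integrable[OF h]]])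
         (use transition_bound[OF h C] C0 in \<open>auto simp: abs_mult split: split_indicator\<close>)
    also have "\<dots> = t * C" using t by simp
    finally show ?thesis .
  qed
  have Si: "integrable \<nu> (?S h)" if h: "bdd_fun h" for h
  proof -
    obtain C where C: "0 \<le> C" "\<And>x. \<bar>h x\<bar> \<le> C" using bdd_funE[OF h] by blast
    show ?thesis using Sm[OF h] Sb[OF h C(2)]
      by (intro n.integrable_const_bound[where B="t * C"]) (auto cong: measurable_cong_sets)
  qed
  show "integrable \<nu> (?S h)" "integrable m (\<lambda>x. h x * enn2real (u t x))" using Si i h by auto
  have pos: "(\<integral>x. h x * enn2real (u t x) \<partial>m) = (\<integral>x. ?S h x \<partial>\<nu>)" if h: "bdd_fun h" "\<And>x. 0 \<le> h x" for h
  proof -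
    note [measurable] = bdd_fun_measurable[OF h(1)]
    have S0: "0 \<le> ?S h x" for x
      using ennreal_transition(2)[OF h] by (intro Bochner_Integration.integral_nonneg) simp
    have "ennreal (\<integral>x. h x * enn2real (u t x) \<partial>m) = (\<integral>\<^sup>+x. ennreal (h x * enn2real (u t x)) \<partial>m)"
      using i[OF h(1)] h(2) by (intro nn_integral_eq_integral[symmetric]) auto
    also have "\<dots> = (\<integral>\<^sup>+x. ennreal (h x) * u t x \<partial>m)"
      using potential_integrable(2)[OF pot \<nu> t]
      by (intro nn_integral_cong_AE) (auto elim!: eventually_mono simp: ennreal_mult h(2))
    also have "\<dots> = (\<integral>\<^sup>+x. (\<integral>\<^sup>+s\<in>{0..t}. semigroup_nn M (max 0 s) (\<lambda>x. ennreal (h x)) x \<partial>lborel) \<partial>\<nu>)"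
      by (rule potential_revuz[OF pot _ t]) measurable
    also have "\<dots> = (\<integral>\<^sup>+x. ennreal (?S h x) \<partial>\<nu>)"
    proof (rule nn_integral_cong)
      fix x
      have "ennreal (?S h x) = (\<integral>\<^sup>+s. ennreal (indicator {0..t} s * transition M (max 0 s) h x) \<partial>lborel)"
        using transition_time_integrable[OF h(1)] ennreal_transition(2)[OF h]
        by (intro nn_integral_eq_integral[symmetric]) auto
      also have "\<dots> = (\<integral>\<^sup>+s\<in>{0..t}. semigroup_nn M (max 0 s) (\<lambda>x. ennreal (h x)) x \<partial>lborel)"
        by (intro nn_integral_cong) (auto simp: ennreal_transition[OF h] split: split_indicator)
      finally show "(\<integral>\<^sup>+s\<in>{0..t}. semigroup_nn M (max 0 s) (\<lambda>x. ennreal (h x)) x \<partial>lborel) = ennreal (?S h x)" ..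
    qed
    also have "\<dots> = ennreal (\<integral>x. ?S h x \<partial>\<nu>)"
      using Si[OF h(1)] S0 by (intro nn_integral_eq_integral) auto
    finally show ?thesis
      using h(2) S0 by (subst (asm) ennreal_inj) auto
  qed
  note b = bdd_fun_parts[OF h]
  have "(\<integral>x. h x * enn2real (u t x) \<partial>m) = (\<integral>x. max 0 (h x) * enn2real (u t x) - max 0 (- h x) * enn2real (u t x) \<partial>m)"
    by (intro Bochner_Integration.integral_cong) (auto simp: max_def)
  also have "\<dots> = (\<integral>x. ?S (\<lambda>x. max 0 (h x)) x \<partial>\<nu>) - (\<integral>x. ?S (\<lambda>x. max 0 (- h x)) x \<partial>\<nu>)"
    using i[OF b(1)] i[OF b(2)] by (simp add: pos b)
  also have "\<dots> = (\<integral>x. ?S (\<lambda>x. max 0 (h x)) x - ?S (\<lambda>x. max 0 (- h x)) x \<partial>\<nu>)"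
    using Si[OF b(1)] Si[OF b(2)] by simp
  also have "\<dots> = (\<integral>x. ?S h x \<partial>\<nu>)"
  proof (rule Bochner_Integration.integral_cong[OF refl])
    fix x
    have "?S (\<lambda>x. max 0 (h x)) x - ?S (\<lambda>x. max 0 (- h x)) x =
      (\<integral>s. indicator {0..t} s * transition M (max 0 s) (\<lambda>x. max 0 (h x)) x - indicator {0..t} s * transition M (max 0 s) (\<lambda>x. max 0 (- h x)) x \<partial>lborel)"
      by (rule Bochner_Integration.integral_diff[symmetric, OF transition_time_integrable[OF b(1)] transition_time_integrable[OF b(2)]])
    also have "\<dots> = ?S h x"
      by (intro Bochner_Integration.integral_cong refl) (simp add: transition_parts[OF h, symmetric] right_diff_distrib[symmetric])
    finally show "?S (\<lambda>x. max 0 (h x)) x - ?S (\<lambda>x. max 0 (- h x)) x = ?S h x" .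
  qed
  finally show "(\<integral>x. h x * enn2real (u t x) \<partial>m) = (\<integral>x. ?S h x \<partial>\<nu>)" .
qed

text \<open>By the Revuz formula the first integral is the \<nu>-integral of \<integral>_0^t p_s h
  ds. So u_t dm / t approximates \<nu> on functions that the semigroup hardly moves in a short
  time.\<close>

lemma potential_revuz_close:
  assumes pot: "potential \<nu> F A u" and \<nu>: "finite_measure \<nu>" and sets_\<nu>: "sets \<nu> = sets borel"
    and h: "bdd_fun h" and k: "bdd_fun k" and t: "0 < t"
    and close: "\<And>s x. 0 \<le> s \<Longrightarrow> s \<le> t \<Longrightarrow> \<bar>transition M s h x - k x\<bar> \<le> \<delta>"
  shows "\<bar>(\<integral>x. h x * enn2real (u t x) \<partial>m) - t * (\<integral>x. k x \<partial>\<nu>)\<bar> \<le> t * \<delta> * measure \<nu> (space \<nu>)"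
proof -
  interpret n: finite_measure \<nu> by (rule \<nu>)
  have t0: "0 \<le> t" using t by simp
  let ?S = "\<lambda>x. \<integral>s. indicator {0..t} s * transition M (max 0 s) h x \<partial>lborel"
  obtain C where C: "0 \<le> C" "\<And>x. \<bar>k x\<bar> \<le> C" using bdd_funE[OF k] by blast
  have ki: "integrable \<nu> k"
    using C(2) bdd_fun_measurable[OF k] sets_\<nu>
    by (intro n.integrable_const_bound[where B=C]) (auto cong: measurable_cong_sets)
  note Si = potential_revuz_real(2)[OF pot \<nu> sets_\<nu> h t0]
  have S: "\<bar>?S x - t * k x\<bar> \<le> t * \<delta>" for x
  proof -
    have ki: "integrable lborel (\<lambda>s. indicator {0..t} s * k x)" by simp
    have "?S x - t * k x = (\<integral>s. indicator {0..t} s * transition M (max 0 s) h x \<partial>lborel) - (\<integral>s. indicator {0..t} s * k x \<partial>lborel)"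
      using t by simp
    also have "\<dots> = (\<integral>s. indicator {0..t} s * transition M (max 0 s) h x - indicator {0..t} s * k x \<partial>lborel)"
      by (rule Bochner_Integration.integral_diff[symmetric, OF transition_time_integrable[OF h] ki])
    finally have eq: "?S x - t * k x = (\<integral>s. indicator {0..t} s * transition M (max 0 s) h x - indicator {0..t} s * k x \<partial>lborel)" .
    have "\<bar>?S x - t * k x\<bar> \<le> (\<integral>s. \<bar>indicator {0..t} s * transition M (max 0 s) h x - indicator {0..t} s * k x\<bar> \<partial>lborel)"
      unfolding eq using integral_norm_bound[of lborel "\<lambda>s. indicator {0..t} s * transition M (max 0 s) h x - indicator {0..t} s * k x"] by simp
    also have "\<dots> \<le> (\<integral>s. \<delta> * indicator {0..t} s \<partial>lborel)"
      by (rule integral_mono[OF integrable_abs[OF Bochner_Integration.integrable_diff[OF transition_time_integrable[OF h] ki]]])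
         (use close in \<open>auto split: split_indicator\<close>)
    also have "\<dots> = t * \<delta>" using t by simp
    finally show ?thesis .
  qed
  have "(\<integral>x. h x * enn2real (u t x) \<partial>m) - t * (\<integral>x. k x \<partial>\<nu>) = (\<integral>x. ?S x - t * k x \<partial>\<nu>)"
    using Si ki by (simp add: potential_revuz_real(1)[OF pot \<nu> sets_\<nu> h t0])
  also have "\<bar>\<dots>\<bar> \<le> (\<integral>x. \<bar>?S x - t * k x\<bar> \<partial>\<nu>)"
    using integral_norm_bound[of \<nu> "\<lambda>x. ?S x - t * k x"] by simp
  also have "\<dots> \<le> (\<integral>x. t * \<delta> \<partial>\<nu>)"
    by (rule integral_mono) (use Si ki S in auto)
  finally show ?thesis by (simp add: mult_ac)
qed

text \<open>The Revuz formula is used twice. Since R_1 u_t is 1-excessive, integrating p_s R_1 u_t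
  over [0,t] costs at most the factor t e^t. Then \<integral> R_1 u_t d\<nu> is the
  \<open>m\<close>-integral of u_t times the 1-potential of \<nu>, and the Revuz formula with that
  potential as h meets the hypothesis. Dividing u_t by t removes the factor t^2.\<close>

lemma potential_self_energy:
  assumes pot: "potential \<nu> F A u" and \<nu>: "finite_measure \<nu>" and sets_\<nu>: "sets \<nu> = sets borel"
    and K: "\<And>t. 0 \<le> t \<Longrightarrow> AE x in \<nu>. AE r in lborel. r \<in> {0<..t} \<longrightarrow>
      semigroup_nn M r (\<lambda>y. \<integral>\<^sup>+s. u (max 0 s) y \<partial>Exp_meas 1) x \<le> ennreal (exp r) * K"
    and t: "0 < t"
  shows "(\<integral>\<^sup>+x. resolvent_nn (u t) x * u t x \<partial>m) \<le> ennreal (t * exp t) * (ennreal (t * exp t) * (K * emeasure \<nu> (space \<nu>)))"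
proof -
  have t0: "0 \<le> t" using t by simp
  note [measurable] = potential_measurable_time[OF pot, of t]
  note [measurable (raw)] = potential_compose[OF pot]
  interpret E: sigma_finite_measure "Exp_meas 1" by (rule sigma_finite_Exp)
  let ?W = "\<lambda>y. \<integral>\<^sup>+s. u (max 0 s) y \<partial>Exp_meas 1"
  have Wm: "?W \<in> borel_measurable borel" by measurable
  have "(\<integral>\<^sup>+x. resolvent_nn (u t) x * u t x \<partial>m) =
    (\<integral>\<^sup>+x. (\<integral>\<^sup>+s\<in>{0..t}. semigroup_nn M (max 0 s) (resolvent_nn (u t)) x \<partial>lborel) \<partial>\<nu>)"
    by (rule potential_revuz[OF pot _ t0]) measurable
  also have "\<dots> \<le> (\<integral>\<^sup>+x. ennreal (t * exp t) * resolvent_nn (u t) x \<partial>\<nu>)"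
  proof (rule nn_integral_mono)
    fix x
    have "(\<integral>\<^sup>+s\<in>{0..t}. semigroup_nn M (max 0 s) (resolvent_nn (u t)) x \<partial>lborel) \<le>
      (\<integral>\<^sup>+s. (ennreal (exp t) * resolvent_nn (u t) x) * indicator {0..t} s \<partial>lborel)"
    proof (rule nn_integral_mono)
      fix s
      show "semigroup_nn M (max 0 s) (resolvent_nn (u t)) x * indicator {0..t} s \<le> (ennreal (exp t) * resolvent_nn (u t) x) * indicator {0..t} s"
      proof (cases "s \<in> {0..t}")
        case True
        then have "semigroup_nn M (max 0 s) (resolvent_nn (u t)) x \<le> ennreal (exp (max 0 s)) * resolvent_nn (u t) x"
          by (intro semigroup_resolvent_nn_le) auto
        also have "\<dots> \<le> ennreal (exp t) * resolvent_nn (u t) x"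
          using True by (intro mult_right_mono ennreal_leI) auto
        finally show ?thesis using True by simp
      qed simp
    qed
    also have "\<dots> = (ennreal (exp t) * resolvent_nn (u t) x) * ennreal t"
      using t by (subst nn_integral_cmult_indicator) auto
    finally show "(\<integral>\<^sup>+s\<in>{0..t}. semigroup_nn M (max 0 s) (resolvent_nn (u t)) x \<partial>lborel) \<le> ennreal (t * exp t) * resolvent_nn (u t) x"
      using t by (simp add: ennreal_mult mult_ac)
  qed
  also have "\<dots> = ennreal (t * exp t) * (\<integral>\<^sup>+x. resolvent_nn (u t) x \<partial>\<nu>)"
    using sets_\<nu> by (intro nn_integral_cmult) (simp cong: measurable_cong_sets)
  also have "(\<integral>\<^sup>+x. resolvent_nn (u t) x \<partial>\<nu>) = (\<integral>\<^sup>+x. u t x * ?W x \<partial>m)"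
  proof -
    have "(\<integral>\<^sup>+x. resolvent_nn (u t) x \<partial>\<nu>) =
      (\<integral>\<^sup>+x. (\<integral>\<^sup>+s\<in>{0..}. ennreal (exp (- 1 * s)) * semigroup_nn M (max 0 s) (u t) x \<partial>lborel) \<partial>\<nu>)"
      unfolding resolvent_nn_def by (subst nn_integral_Exp) simp_all
    also have "\<dots> = (\<integral>\<^sup>+x. u t x * (\<integral>\<^sup>+s\<in>{0..}. ennreal (1 * exp (- 1 * s)) * u s x \<partial>lborel) \<partial>m)"
      by (rule potential_laplace[OF pot \<nu> sets_\<nu>, symmetric]) auto
    also have "\<dots> = (\<integral>\<^sup>+x. u t x * ?W x \<partial>m)"
    proof (rule nn_integral_cong, rule arg_cong2[where f="(*)", OF refl])
      fix x
      show "(\<integral>\<^sup>+s\<in>{0..}. ennreal (1 * exp (- 1 * s)) * u s x \<partial>lborel) = ?W x"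
        by (subst nn_integral_Exp) (auto intro!: nn_integral_cong simp: max_def split: split_indicator)
    qed
    finally show ?thesis .
  qed
  also have "(\<integral>\<^sup>+x. u t x * ?W x \<partial>m) = (\<integral>\<^sup>+x. (\<integral>\<^sup>+s\<in>{0..t}. semigroup_nn M (max 0 s) ?W x \<partial>lborel) \<partial>\<nu>)"
    using potential_revuz[OF pot Wm t0] by (simp add: mult.commute)
  also have "\<dots> \<le> (\<integral>\<^sup>+x. ennreal (t * exp t) * K \<partial>\<nu>)"
  proof (rule nn_integral_mono_AE)
    show "AE x in \<nu>. (\<integral>\<^sup>+s\<in>{0..t}. semigroup_nn M (max 0 s) ?W x \<partial>lborel) \<le> ennreal (t * exp t) * K"
      using K[OF t0]
    proof eventually_elim
      case (elim x)
      have "(\<integral>\<^sup>+s\<in>{0..t}. semigroup_nn M (max 0 s) ?W x \<partial>lborel) \<le> (\<integral>\<^sup>+s. (ennreal (exp t) * K) * indicator {0..t} s \<partial>lborel)"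
      proof (rule nn_integral_mono_AE)
        show "AE s in lborel. semigroup_nn M (max 0 s) ?W x * indicator {0..t} s \<le> (ennreal (exp t) * K) * indicator {0..t} s"
          \<comment> \<open>The hypothesis is silent at r = 0, which is a single time.\<close>
          using elim AE_lborel_singleton[of "0::real"]
        proof eventually_elim
          case (elim s)
          show ?case
          proof (cases "s \<in> {0..t}")
            case True
            then have "semigroup_nn M (max 0 s) ?W x \<le> ennreal (exp s) * K" using elim by auto
            also have "\<dots> \<le> ennreal (exp t) * K" using True by (intro mult_right_mono ennreal_leI) auto
            finally show ?thesis using True by simp
          qed simp
        qed
      qed
      also have "\<dots> = (ennreal (exp t) * K) * ennreal t"
        using t by (subst nn_integral_cmult_indicator) auto
      finally show ?case using t by (simp add: ennreal_mult mult_ac)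
    qed
  qed
  also have "\<dots> = ennreal (t * exp t) * (K * emeasure \<nu> (space \<nu>))" by (simp add: mult.assoc)
  finally show ?thesis by (simp add: mult_left_mono)
qed

text \<open>\<nu> may have no density, so Cauchy-Schwarz is applied to u_t / t in its place, whose
  energy is at most e^{2t} K \<nu>(E); the exponential disappears as t tends to 0.\<close>

lemma energy_inequality:
  assumes pot: "potential \<nu> F A u" and \<nu>: "finite_measure \<nu>" and sets_\<nu>: "sets \<nu> = sets borel"
    and K: "\<And>t. 0 \<le> t \<Longrightarrow> AE x in \<nu>. AE r in lborel. r \<in> {0<..t} \<longrightarrow>
      semigroup_nn M r (\<lambda>y. \<integral>\<^sup>+s. u (max 0 s) y \<partial>Exp_meas 1) x \<le> ennreal (exp r) * ennreal K"
    and K0: "0 \<le> K" and f: "L1b f"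
  shows "(\<integral>x. avg1 f x \<partial>\<nu>)\<^sup>2 \<le> K * measure \<nu> (space \<nu>) * energy f f"
proof -
  interpret n: finite_measure \<nu> by (rule \<nu>)
  define V where "V = measure \<nu> (space \<nu>)"
  have V0: "0 \<le> V" by (simp add: V_def)
  obtain C where C: "0 \<le> C" "\<And>x. \<bar>f x\<bar> \<le> C" using bdd_funE[OF L1b_bdd[OF f]] by blast
  have bU: "bdd_fun (avg1 f)" by (rule bdd_fun_avg[OF L1b_bdd[OF f] bdd_const])
  have UC: "\<bar>avg1 f x\<bar> \<le> C" for x
    using avg_bound[OF L1b_bdd[OF f] bdd_const C(2), of "1" 1 x] by simp
  have step: "(1 / t * (\<integral>x. avg1 f x * enn2real (u t x) \<partial>m))\<^sup>2 \<le> (exp t)\<^sup>2 * (K * V) * energy f f" if t: "0 < t" for t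
  proof -
    have t0: "0 \<le> t" using t by simp
    note [measurable] = potential_measurable_time[OF pot, of t] bdd_fun_measurable[OF bU]
    note ui = potential_integrable[OF pot \<nu> t0]
    \<comment> \<open>The density of u_t dm / t, cut off at n to become bounded.\<close>
    define k where "k n x = min (enn2real (u t x) / t) (real n)" for n x
    have kL: "L1b (k n)" for n
    proof -
      have "bdd_fun (k n)"
        by (rule bdd_funI[where C="real n"]) (use t in \<open>auto simp: k_def[abs_def] min_def\<close>)
      moreover have "integrable m (k n)"
        by (rule Bochner_Integration.integrable_bound[of m "\<lambda>x. enn2real (u t x) / t"])
           (use ui(3) t in \<open>auto simp: k_def[abs_def] min_def\<close>)
      ultimately show ?thesis by (simp add: L1b_def)
    qed
    have k0: "0 \<le> k n x" for n x using t by (simp add: k_def)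
    have kk: "energy (k n) (k n) \<le> (exp t)\<^sup>2 * (K * V)" for n
    proof -
      note bk = L1b_bdd[OF kL[of n]]
      note [measurable] = bdd_fun_measurable[OF bk]
      have ku: "ennreal (k n x) \<le> ennreal (1 / t) * u t x" for x
      proof -
        have "ennreal (k n x) \<le> ennreal (1 / t * enn2real (u t x))" by (intro ennreal_leI) (simp add: k_def)
        also have "\<dots> = ennreal (1 / t) * ennreal (enn2real (u t x))" using t by (intro ennreal_mult) auto
        also have "\<dots> \<le> ennreal (1 / t) * u t x" by (intro mult_left_mono) (simp_all add: ennreal_enn2real_if)
        finally show ?thesis .
      qed
      have Rk: "ennreal (avg1 (k n) x) \<le> ennreal (1 / t) * resolvent_nn (u t) x" "0 \<le> avg1 (k n) x" for x
      proof -
        have T0: "0 \<le> transition M (max 0 s) (k n) x" for s by (rule ennreal_transition(2)[OF bk k0]) simp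
        then show "0 \<le> avg1 (k n) x" by (simp add: avg_def)
        have "ennreal (avg1 (k n) x) = (\<integral>\<^sup>+s. ennreal (transition M (max 0 s) (k n) x) \<partial>Exp_meas 1)"
          using integrable_avg[OF bk bdd_const[of 1], of x] T0
          by (simp add: avg_def nn_integral_eq_integral)
        also have "\<dots> = (\<integral>\<^sup>+s. semigroup_nn M (max 0 s) (\<lambda>x. ennreal (k n x)) x \<partial>Exp_meas 1)"
          by (simp add: ennreal_transition[OF bk k0])
        also have "\<dots> \<le> (\<integral>\<^sup>+s. ennreal (1 / t) * semigroup_nn M (max 0 s) (u t) x \<partial>Exp_meas 1)"
        proof (rule nn_integral_mono)
          fix s
          have [measurable]: "(\<lambda>\<omega>. ext0 (u t) (coord M (max 0 s) \<omega>)) \<in> borel_measurable (law M (Some x))" by measurable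
          have "semigroup_nn M (max 0 s) (\<lambda>x. ennreal (k n x)) x \<le> (\<integral>\<^sup>+\<omega>. ennreal (1 / t) * ext0 (u t) (coord M (max 0 s) \<omega>) \<partial>law M (Some x))"
            unfolding semigroup_nn_def expect_def using ku by (intro nn_integral_mono) (simp add: ext0_def split: option.split)
          also have "\<dots> = ennreal (1 / t) * semigroup_nn M (max 0 s) (u t) x"
            unfolding semigroup_nn_def expect_def by (rule nn_integral_cmult) simp
          finally show "semigroup_nn M (max 0 s) (\<lambda>x. ennreal (k n x)) x \<le> ennreal (1 / t) * semigroup_nn M (max 0 s) (u t) x" .
        qed
        also have "\<dots> = ennreal (1 / t) * resolvent_nn (u t) x"
          unfolding resolvent_nn_def by (rule nn_integral_cmult) measurable
        finally show "ennreal (avg1 (k n) x) \<le> ennreal (1 / t) * resolvent_nn (u t) x" .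
      qed
      have "ennreal (energy (k n) (k n)) = (\<integral>\<^sup>+x. ennreal (avg1 (k n) x * k n x) \<partial>m)"
        unfolding energy_def using L1b_mult[OF L1b_avg[OF kL bdd_const[of 1]] bk] Rk(2) k0
        by (intro nn_integral_eq_integral[symmetric]) auto
      also have "\<dots> \<le> (\<integral>\<^sup>+x. (ennreal (1 / t) * ennreal (1 / t)) * (resolvent_nn (u t) x * u t x) \<partial>m)"
      proof (rule nn_integral_mono)
        fix x
        have "ennreal (avg1 (k n) x * k n x) = ennreal (avg1 (k n) x) * ennreal (k n x)" using Rk(2) k0 by (intro ennreal_mult) auto
        also have "\<dots> \<le> (ennreal (1 / t) * resolvent_nn (u t) x) * (ennreal (1 / t) * u t x)"
          by (intro mult_mono Rk ku) auto
        finally show "ennreal (avg1 (k n) x * k n x) \<le> (ennreal (1 / t) * ennreal (1 / t)) * (resolvent_nn (u t) x * u t x)"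
          by (simp add: mult_ac)
      qed
      also have "\<dots> = (ennreal (1 / t) * ennreal (1 / t)) * (\<integral>\<^sup>+x. resolvent_nn (u t) x * u t x \<partial>m)"
        by (rule nn_integral_cmult) measurable
      also have "\<dots> \<le> (ennreal (1 / t) * ennreal (1 / t)) * (ennreal (t * exp t) * (ennreal (t * exp t) * (ennreal K * emeasure \<nu> (space \<nu>))))"
        by (intro mult_left_mono potential_self_energy[OF pot \<nu> sets_\<nu> K t]) auto
      also have "\<dots> = ennreal ((1 / t * (1 / t)) * (t * exp t * (t * exp t * (K * V))))"
      proof -
        have e: "emeasure \<nu> (space \<nu>) = ennreal V" by (simp add: V_def n.emeasure_eq_measure)
        show ?thesis unfolding e using t K0 V0 by (simp add: ennreal_mult[symmetric])
      qed
      also have "(1 / t * (1 / t)) * (t * exp t * (t * exp t * (K * V))) = (exp t)\<^sup>2 * (K * V)"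
        using t by (simp add: field_simps power2_eq_square)
      finally show ?thesis using K0 V0 by (subst (asm) ennreal_le_iff) auto
    qed
    have lim: "(\<lambda>n. energy f (k n)) \<longlonglongrightarrow> (\<integral>x. avg1 f x * (enn2real (u t x) / t) \<partial>m)"
      unfolding energy_def
    proof (rule integral_dominated_convergence[where w="\<lambda>x. C * (enn2real (u t x) / t)"])
      show "integrable m (\<lambda>x. C * (enn2real (u t x) / t))" using ui(3) by simp
      show "AE x in m. (\<lambda>n. avg1 f x * k n x) \<longlonglongrightarrow> avg1 f x * (enn2real (u t x) / t)"
      proof (rule AE_I2, rule tendsto_mult_left, rule tendsto_eventually)
        fix x
        obtain N where "enn2real (u t x) / t \<le> real N" using real_arch_simple by blast
        then show "\<forall>\<^sub>F n in sequentially. k n x = enn2real (u t x) / t"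
          by (auto simp: k_def eventually_sequentially min_def intro!: exI[of _ N])
      qed
      show "AE x in m. norm (avg1 f x * k n x) \<le> C * (enn2real (u t x) / t)" for n
      proof (rule AE_I2)
        fix x
        have "\<bar>avg1 f x\<bar> * k n x \<le> C * (enn2real (u t x) / t)"
          by (rule mult_mono[OF UC _ C(1) k0]) (simp add: k_def)
        then show "norm (avg1 f x * k n x) \<le> C * (enn2real (u t x) / t)"
          using k0[of n x] by (simp add: abs_mult)
      qed
      show "(\<lambda>x. avg1 f x * k n x) \<in> borel_measurable m" for n
        using bdd_fun_measurable[OF L1b_bdd[OF kL[of n]]] by measurable
    qed measurable
    have "(energy f (k n))\<^sup>2 \<le> (exp t)\<^sup>2 * (K * V) * energy f f" for n
    proof -
      have "(energy f (k n))\<^sup>2 \<le> energy f f * energy (k n) (k n)" by (rule energy_Cauchy_Schwarz[OF f kL])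
      also have "\<dots> \<le> energy f f * ((exp t)\<^sup>2 * (K * V))" by (intro mult_left_mono kk energy_nonneg f)
      finally show ?thesis by (simp add: mult.commute)
    qed
    then have "(\<integral>x. avg1 f x * (enn2real (u t x) / t) \<partial>m)\<^sup>2 \<le> (exp t)\<^sup>2 * (K * V) * energy f f"
      by (intro LIMSEQ_le_const2[OF tendsto_power[OF lim]]) auto
    then show ?thesis by simp
  qed
  let ?t = "\<lambda>n. inverse (real (Suc n))"
  have t_lim: "?t \<longlonglongrightarrow> 0" by (rule LIMSEQ_inverse_real_of_nat)
  \<comment> \<open>The semigroup moves R_1 f by at most 2 C s in time s, so the integrals of R_1 f
    against u_t dm / t approach the \<nu>-integral with error at most 2 C t V.\<close>
  have "(\<lambda>n. 1 / ?t n * (\<integral>x. avg1 f x * enn2real (u (?t n) x) \<partial>m)) \<longlonglongrightarrow> (\<integral>x. avg1 f x \<partial>\<nu>)"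
  proof (rule LIMSEQ_I)
    fix e :: real assume e: "0 < e"
    have "(\<lambda>n. 2 * C * ?t n * V) \<longlonglongrightarrow> 2 * C * 0 * V" by (intro tendsto_intros t_lim)
    then have "\<forall>\<^sub>F n in sequentially. 2 * C * ?t n * V < e" using e by (intro order_tendstoD(2)) auto
    then have "\<forall>\<^sub>F n in sequentially. norm (1 / ?t n * (\<integral>x. avg1 f x * enn2real (u (?t n) x) \<partial>m) - (\<integral>x. avg1 f x \<partial>\<nu>)) < e"
    proof eventually_elim
      case (elim n)
      have t: "0 < ?t n" by simp
      have "\<bar>(\<integral>x. avg1 f x * enn2real (u (?t n) x) \<partial>m) - ?t n * (\<integral>x. avg1 f x \<partial>\<nu>)\<bar> \<le> ?t n * (2 * C * ?t n) * V"
        unfolding V_def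
      proof (rule potential_revuz_close[OF pot \<nu> sets_\<nu> bU bU t])
        fix s x assume s: "0 \<le> s" "s \<le> ?t n"
        have "\<bar>transition M s (avg1 f) x - avg1 f x\<bar> \<le> 2 * C * s"
          by (rule transition_avg1_close[OF L1b_bdd[OF f] C(2) s(1)])
        also have "\<dots> \<le> 2 * C * ?t n" using s C(1) by (intro mult_left_mono) auto
        finally show "\<bar>transition M s (avg1 f) x - avg1 f x\<bar> \<le> 2 * C * ?t n" .
      qed
      then have "1 / ?t n * \<bar>(\<integral>x. avg1 f x * enn2real (u (?t n) x) \<partial>m) - ?t n * (\<integral>x. avg1 f x \<partial>\<nu>)\<bar> \<le> 1 / ?t n * (?t n * (2 * C * ?t n) * V)"
        using t by (intro mult_left_mono) auto
      also have "\<dots> = 2 * C * ?t n * V" by simp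
      also have "1 / ?t n * \<bar>(\<integral>x. avg1 f x * enn2real (u (?t n) x) \<partial>m) - ?t n * (\<integral>x. avg1 f x \<partial>\<nu>)\<bar> =
         \<bar>1 / ?t n * ((\<integral>x. avg1 f x * enn2real (u (?t n) x) \<partial>m) - ?t n * (\<integral>x. avg1 f x \<partial>\<nu>))\<bar>"
        using t by (simp add: abs_mult)
      also have "1 / ?t n * ((\<integral>x. avg1 f x * enn2real (u (?t n) x) \<partial>m) - ?t n * (\<integral>x. avg1 f x \<partial>\<nu>)) =
         1 / ?t n * (\<integral>x. avg1 f x * enn2real (u (?t n) x) \<partial>m) - (\<integral>x. avg1 f x \<partial>\<nu>)"
        using t by (simp add: right_diff_distrib)
      finally show ?case using elim by simp
    qed
    then show "\<exists>N. \<forall>n\<ge>N. norm (1 / ?t n * (\<integral>x. avg1 f x * enn2real (u (?t n) x) \<partial>m) - (\<integral>x. avg1 f x \<partial>\<nu>)) < e"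
      by (simp only: eventually_sequentially)
  qed
  then have l1: "(\<lambda>n. (1 / ?t n * (\<integral>x. avg1 f x * enn2real (u (?t n) x) \<partial>m))\<^sup>2) \<longlonglongrightarrow> (\<integral>x. avg1 f x \<partial>\<nu>)\<^sup>2"
    by (rule tendsto_power)
  have l2: "(\<lambda>n. (exp (?t n))\<^sup>2 * (K * V) * energy f f) \<longlonglongrightarrow> (exp 0)\<^sup>2 * (K * V) * energy f f"
    by (intro tendsto_intros t_lim)
  have "(\<integral>x. avg1 f x \<partial>\<nu>)\<^sup>2 \<le> (exp 0)\<^sup>2 * (K * V) * energy f f"
    by (rule LIMSEQ_le[OF l1 l2]) (use step in auto)
  then show ?thesis by (simp add: V_def)
qed

end

section \<open>Approximation by time averages\<close>

text \<open>A rise of f from a to a + r would at least double with each doubling of the distance,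
  which boundedness forbids. Midpoint convexity suffices for this; no continuity enters.\<close>

lemma midpoint_convex_bounded_antimono:
  fixes f :: "real \<Rightarrow> real"
  assumes mid: "\<And>a b. 0 \<le> a \<Longrightarrow> 0 \<le> b \<Longrightarrow> 2 * f ((a + b) / 2) \<le> f a + f b"
    and bd: "\<And>a. 0 \<le> a \<Longrightarrow> \<bar>f a\<bar> \<le> B" and a: "0 \<le> a" and r: "0 \<le> r"
  shows "f (a + r) \<le> f a"
proof (rule ccontr)
  assume "\<not> f (a + r) \<le> f a"
  then have e: "0 < f (a + r) - f a" by simp
  have grow: "2 ^ n * (f (a + r) - f a) \<le> f (a + 2 ^ n * r) - f a" for n
  proof (induction n)
    case (Suc n)
    have e: "(a + (a + 2 ^ Suc n * r)) / 2 = a + 2 ^ n * r" by (simp add: field_simps)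
    have "2 * f ((a + (a + 2 ^ Suc n * r)) / 2) \<le> f a + f (a + 2 ^ Suc n * r)"
      using a r by (intro mid) auto
    then have "2 * (f (a + 2 ^ n * r) - f a) \<le> f (a + 2 ^ Suc n * r) - f a" unfolding e by (simp del: power_Suc)
    with mult_left_mono[OF Suc, of 2] have "2 * (2 ^ n * (f (a + r) - f a)) \<le> f (a + 2 ^ Suc n * r) - f a"
      by (simp del: power_Suc)
    then show ?case by (simp only: power_Suc mult.assoc)
  qed simp
  obtain n where n: "2 * B / (f (a + r) - f a) < 2 ^ n"
    using real_arch_pow[of 2 "2 * B / (f (a + r) - f a)"] by auto
  then have "2 * B < 2 ^ n * (f (a + r) - f a)" using e by (simp add: pos_divide_less_eq)
  also have "\<dots> \<le> f (a + 2 ^ n * r) - f a" by (rule grow)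
  also have "\<dots> \<le> 2 * B" using bd[of "a + 2 ^ n * r"] bd[of a] a r by (simp add: abs_le_iff)
  finally show False by simp
qed

text \<open>The density e^{-s} is put together with G, so the integral is the plain average of
  e^{-s} G(s) over [0,u).\<close>

lemma integral_Exp_average_bounds:
  fixes G :: "real \<Rightarrow> real"
  assumes I: "integrable (Exp_meas 1) (\<lambda>s. indicator {..<u} s / u * G s)" and Gm[measurable]: "G \<in> borel_measurable borel"
    and u: "0 < u" and b: "\<And>s. 0 \<le> s \<Longrightarrow> s < u \<Longrightarrow> a \<le> exp (- s) * G s \<and> exp (- s) * G s \<le> b"
  shows "a \<le> (\<integral>s. indicator {..<u} s / u * G s \<partial>Exp_meas 1)" "(\<integral>s. indicator {..<u} s / u * G s \<partial>Exp_meas 1) \<le> b"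
proof -
  let ?F = "\<lambda>s. exponential_density 1 s * (indicator {..<u} s / u * G s)"
  have Fi: "integrable lborel ?F"
    using I by (subst (asm) integrable_density) (auto simp: exponential_density_nonneg)
  have eq: "(\<integral>s. indicator {..<u} s / u * G s \<partial>Exp_meas 1) = (\<integral>s. ?F s \<partial>lborel)"
    by (subst integral_density) (auto simp: exponential_density_nonneg)
  have ci: "integrable lborel (\<lambda>s. c / u * indicator {0..u} s :: real)" for c by simp
  have cv: "(\<integral>s. c / u * indicator {0..u} s \<partial>lborel) = c" for c :: real using u by simp
  have F: "?F s = indicator {0..<u} s * (exp (- s) * G s) / u" for s
    by (simp add: exponential_density_def split: split_indicator)
  have "(\<integral>s. a / u * indicator {0..u} s \<partial>lborel) \<le> (\<integral>s. ?F s \<partial>lborel)"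
  proof (rule integral_mono_AE[OF ci Fi])
    show "AE s in lborel. a / u * indicator {0..u} s \<le> ?F s" unfolding F
      using AE_lborel_singleton[of u]
      by eventually_elim (use u b in \<open>auto simp: F divide_right_mono split: split_indicator\<close>)
  qed
  then show "a \<le> (\<integral>s. indicator {..<u} s / u * G s \<partial>Exp_meas 1)" unfolding eq cv .
  have "(\<integral>s. ?F s \<partial>lborel) \<le> (\<integral>s. b / u * indicator {0..u} s \<partial>lborel)"
  proof (rule integral_mono_AE[OF Fi ci])
    show "AE s in lborel. ?F s \<le> b / u * indicator {0..u} s" unfolding F
      using AE_lborel_singleton[of u]
      by eventually_elim (use u b in \<open>auto simp: F divide_right_mono split: split_indicator\<close>)
  qed
  then show "(\<integral>s. indicator {..<u} s / u * G s \<partial>Exp_meas 1) \<le> b" unfolding eq cv .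
qed

section \<open>Decay of e^{-s} (p_s g, g) and energies of difference quotients\<close>

context symmetric_hunt begin

lemma transition_0: "bdd_fun f \<Longrightarrow> transition M 0 f x = f x"
proof -
  assume f: "bdd_fun f"
  interpret L: prob_space "law M (Some x)" by (rule prob_law)
  have "(\<integral>\<omega>. ext0 f (coord M 0 \<omega>) \<partial>law M (Some x)) = (\<integral>\<omega>. f x \<partial>law M (Some x))"
  proof (rule integral_cong_AE)
    show "(\<lambda>\<omega>. ext0 f (coord M 0 \<omega>)) \<in> borel_measurable (law M (Some x))"
      using integrable_law[OF f, of 0 "Some x"] by auto
    show "AE \<omega> in law M (Some x). ext0 f (coord M 0 \<omega>) = f x"
      using start[of "Some x"] by eventually_elim simp
  qed simp
  then show ?thesis using L.prob_space by (simp add: transition_def)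
qed

text \<open>In spectral terms the Laplace transform of a positive measure; the convexity that this
  would give is proved below by hand. For g in the form domain, minus its slope at 0 is
  E_1(g,g).\<close>

definition psi :: "('a \<Rightarrow> real) \<Rightarrow> real \<Rightarrow> real" where
  "psi g s = exp (- s) * (\<integral>x. transition M s g x * g x \<partial>m)"

lemma transition_inner_add:
  assumes g: "L1b g" and p: "0 \<le> p" and q: "0 \<le> q"
  shows "(\<integral>x. transition M p g x * transition M q g x \<partial>m) = (\<integral>x. transition M (p + q) g x * g x \<partial>m)"
proof -
  have "(\<integral>x. transition M (q + p) g x * g x \<partial>m) = (\<integral>x. transition M q (transition M p g) x * g x \<partial>m)"
    by (simp add: transition_add[OF q p L1b_bdd[OF g]])
  also have "\<dots> = (\<integral>x. transition M p g x * transition M q g x \<partial>m)"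
    by (rule transition_sym[OF L1b_transition[OF g p] g q])
  finally show ?thesis by (simp add: add.commute)
qed

lemma transition_inner_le:
  assumes v: "L1b v" and t: "0 \<le> t"
  shows "exp (- t) * (\<integral>x. transition M t v x * v x \<partial>m) \<le> (\<integral>x. v x * v x \<partial>m)"
    "(\<integral>x. transition M t v x * v x \<partial>m) \<le> (\<integral>x. v x * v x \<partial>m)"
proof -
  have i: "integrable m (\<lambda>x. v x * v x)" "integrable m (\<lambda>x. transition M t v x * v x)"
    using L1b_mult[OF v L1b_bdd[OF v]] L1b_mult[OF L1b_transition[OF v t] L1b_bdd[OF v]] by auto
  show le: "(\<integral>x. transition M t v x * v x \<partial>m) \<le> (\<integral>x. v x * v x \<partial>m)"
  proof (cases "t = 0")
    case False
    then have t': "0 < t" using t by simp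
    have "0 \<le> approx_form M m t v v"
      using i(1) by (intro approx_form_nonneg t' bdd_fun_measurable L1b_bdd v) (simp add: power2_eq_square)
    then have "0 \<le> (\<integral>x. v x * v x - transition M t v x * v x \<partial>m)"
      using t' by (simp add: approx_form_def zero_le_divide_iff left_diff_distrib)
    then show ?thesis using i by simp
  qed (simp add: transition_0 L1b_bdd[OF v])
  have "exp (- t) * (\<integral>x. transition M t v x * v x \<partial>m) \<le> 1 * (\<integral>x. transition M t v x * v x \<partial>m)"
    using t transition_inner_nonneg[OF v t] by (intro mult_right_mono) auto
  then show "exp (- t) * (\<integral>x. transition M t v x * v x \<partial>m) \<le> (\<integral>x. v x * v x \<partial>m)" using le by simp
qed

lemma psi_bounds:
  assumes g: "L1b g" and s: "0 \<le> s" shows "0 \<le> psi g s" "psi g s \<le> (\<integral>x. g x * g x \<partial>m)"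
  unfolding psi_def using transition_inner_nonneg[OF g s] transition_inner_le(1)[OF g s] by simp_all

text \<open>The increment of \<^term>\<open>psi g\<close> is midpoint convex because \<open>1 - e\<^bsup>-t\<^esup> p\<^sub>t\<close> is a nonnegative
  operator commuting with the semigroup; being bounded it decreases.\<close>

lemma psi_increment_antimono:
  assumes g: "L1b g" and t: "0 \<le> t" and a: "0 \<le> a" and r: "0 \<le> r"
  shows "psi g (a + r) - psi g (a + r + t) \<le> psi g a - psi g (a + t)"
proof -
  let ?D = "\<lambda>s. psi g s - psi g (s + t)"
  let ?\<phi> = "\<lambda>s. \<integral>x. transition M s g x * g x \<partial>m"
  note bg = L1b_bdd[OF g]
  have "?D (a + r) \<le> ?D a"
  proof (rule midpoint_convex_bounded_antimono[where f="?D", OF _ _ a r])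
    show "\<bar>?D s\<bar> \<le> (\<integral>x. g x * g x \<partial>m)" if "0 \<le> s" for s
      using psi_bounds[OF g that] psi_bounds[OF g, of "s + t"] that t by (simp add: abs_le_iff)
    fix a b :: real assume ab: "0 \<le> a" "0 \<le> b"
    \<comment> \<open>With a = 2p and b = 2q, symmetry turns the values at a, at b and at their
      midpoint into inner products of two functions. The inequality e^{-t} (p_t v, v) \<le> (v, v)
      for their difference v is the midpoint convexity.\<close>
    define p q where "p = a / 2" and "q = b / 2"
    have pq: "0 \<le> p" "0 \<le> q" "a = p + p" "b = q + q" "(a + b) / 2 = p + q" using ab by (auto simp: p_def q_def field_simps)
    define v where "v x = exp (- p) * transition M p g x + (- exp (- q)) * transition M q g x" for x
    note Lp = L1b_transition[OF g pq(1)] and Lq = L1b_transition[OF g pq(2)]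
    have v: "L1b v" unfolding v_def[abs_def] by (rule L1b_lincomb[OF Lp Lq])
    have Tv: "transition M t v x = exp (- p) * transition M (t + p) g x + (- exp (- q)) * transition M (t + q) g x" if "0 \<le> t" for t x
    proof -
      have "transition M t v x = exp (- p) * transition M t (transition M p g) x + (- exp (- q)) * transition M t (transition M q g) x"
        unfolding v_def[abs_def] by (rule transition_lincomb[OF L1b_bdd[OF Lp] L1b_bdd[OF Lq] that])
      then show ?thesis by (simp only: transition_add[OF that pq(1) bg] transition_add[OF that pq(2) bg])
    qed
    have form: "(\<integral>x. transition M t v x * v x \<partial>m) =
      (exp (- p) * exp (- p) * ?\<phi> (t + p + p) - 2 * (exp (- p) * exp (- q) * ?\<phi> (t + p + q))) + exp (- q) * exp (- q) * ?\<phi> (t + q + q)"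
      if t: "0 \<le> t" for t
    proof -
      have Lt: "L1b (transition M (t + p) g)" "L1b (transition M (t + q) g)" using pq t by (auto intro!: L1b_transition g)
      have i: "integrable m (\<lambda>x. transition M (t + p) g x * transition M p g x)" "integrable m (\<lambda>x. transition M (t + p) g x * transition M q g x)"
        "integrable m (\<lambda>x. transition M (t + q) g x * transition M p g x)" "integrable m (\<lambda>x. transition M (t + q) g x * transition M q g x)"
        using L1b_mult[OF Lt(1) L1b_bdd[OF Lp]] L1b_mult[OF Lt(1) L1b_bdd[OF Lq]] L1b_mult[OF Lt(2) L1b_bdd[OF Lp]] L1b_mult[OF Lt(2) L1b_bdd[OF Lq]] by auto
      have "(\<integral>x. transition M t v x * v x \<partial>m) =
        (\<integral>x. (exp (- p) * exp (- p) * (transition M (t + p) g x * transition M p g x) - exp (- p) * exp (- q) * (transition M (t + p) g x * transition M q g x)) +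
          (exp (- q) * exp (- q) * (transition M (t + q) g x * transition M q g x) - exp (- p) * exp (- q) * (transition M (t + q) g x * transition M p g x)) \<partial>m)"
        by (intro Bochner_Integration.integral_cong refl) (simp add: Tv[OF t] v_def algebra_simps)
      also have "\<dots> = (exp (- p) * exp (- p) * ?\<phi> (t + p + p) - exp (- p) * exp (- q) * ?\<phi> (t + p + q)) +
         (exp (- q) * exp (- q) * ?\<phi> (t + q + q) - exp (- p) * exp (- q) * ?\<phi> (t + q + p))"
        using i pq t by (simp add: transition_inner_add[OF g])
      finally show ?thesis by (simp add: add_ac)
    qed
    have "exp (- t) * (\<integral>x. transition M t v x * v x \<partial>m) \<le> (\<integral>x. transition M 0 v x * v x \<partial>m)"
      using transition_inner_le(1)[OF v t] by (simp add: transition_0 L1b_bdd[OF v])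
    then have main: "exp (- t) * ((exp (- p) * exp (- p) * ?\<phi> (t + p + p) - 2 * (exp (- p) * exp (- q) * ?\<phi> (t + p + q))) + exp (- q) * exp (- q) * ?\<phi> (t + q + q)) \<le>
       (exp (- p) * exp (- p) * ?\<phi> (p + p) - 2 * (exp (- p) * exp (- q) * ?\<phi> (p + q))) + exp (- q) * exp (- q) * ?\<phi> (q + q)"
      unfolding form[OF t] form[OF order_refl] by simp
    then have "psi g (p + p + t) - 2 * psi g (p + q + t) + psi g (q + q + t) \<le> psi g (p + p) - 2 * psi g (p + q) + psi g (q + q)"
    proof -
      have P: "psi g (r + s + t) = exp (- t) * (exp (- r) * exp (- s) * ?\<phi> (t + r + s))"
        "psi g (r + s) = exp (- r) * exp (- s) * ?\<phi> (r + s)" for r s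
        by (simp_all add: psi_def exp_add[symmetric] ac_simps mult.assoc[symmetric] del: exp_add)
      show ?thesis
        using main unfolding P(1) unfolding P(2) by (simp add: algebra_simps)
    qed
    then show "2 * ?D ((a + b) / 2) \<le> ?D a + ?D b"
      unfolding pq(5) unfolding pq(3,4) by simp
  qed
  then show ?thesis .
qed

text \<open>Since increments decrease, the slope over [0,t] is at most the slope over each
  [0, t/2^n], whose limit is c; an increment that starts at s is at most the one that starts at
  0.\<close>

lemma psi_increment_le:
  assumes g: "L1b g" and lim: "((\<lambda>t. (psi g 0 - psi g t) / t) \<longlongrightarrow> c) (at_right 0)"
    and s: "0 \<le> s" and t: "0 \<le> t"
  shows "psi g s - psi g (s + t) \<le> c * t"
proof -
  have base: "psi g 0 - psi g t \<le> c * t"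
  proof (cases "t = 0")
    case False
    then have t': "0 < t" using t by simp
    have half: "(psi g 0 - psi g t) / t \<le> (psi g 0 - psi g (t / 2 ^ n)) / (t / 2 ^ n)" for n
    proof (induction n)
      case (Suc n)

      define r where "r = t / 2 ^ Suc n"
      have r: "0 < r" "t / 2 ^ n = r + r" using t' by (auto simp: r_def)
      have "psi g (0 + r) - psi g (0 + r + r) \<le> psi g 0 - psi g (0 + r)"
        using r by (intro psi_increment_antimono g) auto
      then have "psi g 0 - psi g (r + r) \<le> 2 * (psi g 0 - psi g r)" by simp
      then have "(psi g 0 - psi g (r + r)) / (r + r) \<le> 2 * (psi g 0 - psi g r) / (r + r)"
        using r(1) by (intro divide_right_mono) auto
      also have "\<dots> = (psi g 0 - psi g r) / r"
        using r(1) nonzero_mult_divide_mult_cancel_left[of 2 "psi g 0 - psi g r" r] by simp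
      finally show ?case using Suc unfolding r(2) r_def[symmetric] by (rule order_trans[rotated])
    qed simp
    have "(\<lambda>n. t * (1 / 2) ^ n) \<longlonglongrightarrow> t * 0"
      by (intro tendsto_mult_left LIMSEQ_realpow_zero) auto
    then have "(\<lambda>n. t / 2 ^ n) \<longlonglongrightarrow> 0" by (simp add: power_divide)
    then have "filterlim (\<lambda>n. t / 2 ^ n) (at_right 0) sequentially"
      using t' by (auto simp: filterlim_at)
    from filterlim_compose[OF lim this]
    have "(psi g 0 - psi g t) / t \<le> c"
      by (rule LIMSEQ_le_const) (use half in auto)
    then show ?thesis using t' by (simp add: pos_divide_le_eq)
  qed simp
  have "psi g (0 + s) - psi g (0 + s + t) \<le> psi g 0 - psi g (0 + t)"
    using s t by (intro psi_increment_antimono g) auto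
  then show ?thesis using base by simp
qed

text \<open>The chord from 0 to \<tau> has a slope above c - e. Removing the piece up to s, over
  which \<open>psi\<close> falls by at most c s, leaves N steps of length t, none larger than the
  first. The total error e (s + N t) is at most 2 e N t because s \<le> N t.\<close>

lemma psi_increment_ge:
  assumes g: "L1b g" and lim: "((\<lambda>t. (psi g 0 - psi g t) / t) \<longlongrightarrow> c) (at_right 0)" and e: "0 < e"
  obtains \<eta> where "0 < \<eta>" "\<And>s t. 0 \<le> s \<Longrightarrow> s < \<eta> \<Longrightarrow> 0 < t \<Longrightarrow> t < \<eta> \<Longrightarrow> (c - 2 * e) * t \<le> psi g s - psi g (s + t)"
proof -
  have "\<forall>\<^sub>F t in at_right 0. c - e < (psi g 0 - psi g t) / t"
    using order_tendstoD(1)[OF lim, of "c - e"] e by simp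
  then obtain b where b: "0 < b" "\<And>t. 0 < t \<Longrightarrow> t < b \<Longrightarrow> c - e < (psi g 0 - psi g t) / t"
    unfolding eventually_at_right_field by auto
  show ?thesis
  \<comment> \<open>A quarter of b keeps \<tau>, which is at most 2 s + 2 t, below b.\<close>
  proof (rule that[of "b / 4"])
    fix s t assume st: "0 \<le> s" "s < b / 4" "0 < t" "t < b / 4"
    \<comment> \<open>The extra 1 keeps N positive at s = 0 and costs one more step, whence N t
      \<le> s + 2 t.\<close>
    define N where "N = nat \<lceil>s / t\<rceil> + 1"
    have "s / t \<le> real_of_int \<lceil>s / t\<rceil>" "real_of_int \<lceil>s / t\<rceil> < s / t + 1" by linarith+
    moreover have "real N = real_of_int \<lceil>s / t\<rceil> + 1" using st unfolding N_def by (simp add: of_nat_nat)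
    moreover have "0 \<le> s / t" using st by simp
    ultimately have "s / t \<le> real N" "real N \<le> s / t + 2" "1 \<le> real N" by linarith+
    then have N: "s \<le> real N * t" "real N * t \<le> s + 2 * t" "0 < real N"
      using st by (simp_all add: pos_divide_le_eq) (simp add: field_simps)
    have sum: "psi g s - psi g (s + real k * t) \<le> real k * (psi g s - psi g (s + t))" for k
    proof (induction k)
      case (Suc k)
      have "psi g (s + real k * t) - psi g (s + real k * t + t) \<le> psi g s - psi g (s + t)"
        using st by (intro psi_increment_antimono g) auto
      moreover have "s + real (Suc k) * t = s + real k * t + t" by (simp add: algebra_simps)
      ultimately show ?case using Suc by (simp add: algebra_simps)
    qed simp
    define \<tau> where "\<tau> = s + real N * t"
    have \<tau>: "0 < \<tau>" "\<tau> < b" using st N by (auto simp: \<tau>_def intro: add_nonneg_pos)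
    have "(c - e) * \<tau> < psi g 0 - psi g \<tau>"
      using b(2)[OF \<tau>] \<tau>(1) by (simp add: pos_less_divide_eq)
    moreover have "psi g 0 - psi g (0 + s) \<le> c * s"
      by (rule psi_increment_le[OF g lim]) (use st in auto)
    ultimately have "(c - e) * \<tau> - c * s \<le> psi g s - psi g \<tau>" by simp
    also have "\<dots> \<le> real N * (psi g s - psi g (s + t))" unfolding \<tau>_def by (rule sum)
    finally have 1: "(c - e) * \<tau> - c * s \<le> real N * (psi g s - psi g (s + t))" .
    have "e * s \<le> e * (real N * t)" using N e by (intro mult_left_mono) auto
    then have "real N * ((c - 2 * e) * t) \<le> (c - e) * \<tau> - c * s"
      by (simp add: \<tau>_def algebra_simps)
    then have "real N * ((c - 2 * e) * t) \<le> real N * (psi g s - psi g (s + t))" using 1 by linarith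
    then show "(c - 2 * e) * t \<le> psi g s - psi g (s + t)" using N(3) by simp
  qed (use b in auto)
qed

definition dquot :: "('a \<Rightarrow> real) \<Rightarrow> real \<Rightarrow> 'a \<Rightarrow> real" where
  "dquot g t x = (g x - exp (- t) * transition M t g x) / t"

definition tavg :: "('a \<Rightarrow> real) \<Rightarrow> real \<Rightarrow> 'a \<Rightarrow> real" where
  "tavg g t = avg (\<lambda>s. indicator {..<t} s / t) g"

lemma bdd_weight: "bdd_fun (\<lambda>s::real. indicator {..<t} s / t :: real)"
  by (rule bdd_funI[where C="\<bar>1 / t\<bar>"]) (auto split: split_indicator)

lemma L1b_dquot: "L1b g \<Longrightarrow> 0 < t \<Longrightarrow> L1b (dquot g t)"
  using L1b_lincomb[of g "transition M t g" "1 / t" "- exp (- t) / t"] L1b_transition[of g t]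
  by (simp add: dquot_def[abs_def] diff_divide_distrib)

lemma avg1_dquot: "bdd_fun g \<Longrightarrow> 0 < t \<Longrightarrow> avg1 (dquot g t) x = tavg g t x"
  unfolding dquot_def[abs_def] tavg_def by (rule avg1_difference_quotient)

text \<open>The 1-potential of the first quotient is a time average, so the energy is the average
  over s in [0,u) of the slopes (psi g s - psi g (s + t)) / t, and bounds on the slopes pass to
  it.\<close>

lemma energy_dquot:
  assumes g: "L1b g" and u: "0 < u" and t: "0 < t"
    and b: "\<And>s. 0 \<le> s \<Longrightarrow> s < u \<Longrightarrow> a * t \<le> psi g s - psi g (s + t) \<and> psi g s - psi g (s + t) \<le> b * t"
  shows "a \<le> energy (dquot g u) (dquot g t)" "energy (dquot g u) (dquot g t) \<le> b"
proof -
  interpret m: sigma_finite_measure m by (rule sigma_finite_m)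
  note bg = L1b_bdd[OF g] and Lt = L1b_dquot[OF g t]
  note [measurable] = bdd_fun_measurable[OF bg] bdd_fun_measurable[OF L1b_bdd[OF Lt]]
  let ?G = "\<lambda>s. \<integral>x. transition M (max 0 s) g x * dquot g t x \<partial>m"
  have Gm: "?G \<in> borel_measurable borel"
    by (rule m.borel_measurable_lebesgue_integral) measurable
  have eq: "energy (dquot g u) (dquot g t) = (\<integral>s. indicator {..<u} s / u * ?G s \<partial>Exp_meas 1)"
    unfolding energy_def avg1_dquot[OF bg u] tavg_def by (rule avg_inner(1)[OF g L1b_bdd[OF Lt] bdd_weight])
  have I: "integrable (Exp_meas 1) (\<lambda>s. indicator {..<u} s / u * ?G s)"
    by (rule avg_inner(2)[OF g L1b_bdd[OF Lt] bdd_weight])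
  have G: "exp (- s) * ?G s = (psi g s - psi g (s + t)) / t" if s: "0 \<le> s" for s
  proof -
    note Ls = L1b_transition[OF g s]
    have i: "integrable m (\<lambda>x. transition M s g x * g x)" "integrable m (\<lambda>x. transition M s g x * transition M t g x)"
      using L1b_mult[OF Ls bg] L1b_mult[OF Ls L1b_bdd[OF L1b_transition[OF g less_imp_le[OF t]]]] by auto
    have "?G s = (\<integral>x. (1 / t) * (transition M s g x * g x) - (exp (- t) / t) * (transition M s g x * transition M t g x) \<partial>m)"
      using s by (intro Bochner_Integration.integral_cong) (auto simp: dquot_def max_def diff_divide_distrib right_diff_distrib)
    also have "\<dots> = (1 / t) * (\<integral>x. transition M s g x * g x \<partial>m) - (exp (- t) / t) * (\<integral>x. transition M (s + t) g x * g x \<partial>m)"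
      using i s t by (simp add: transition_inner_add[OF g])
    finally show ?thesis
      by (simp add: psi_def right_diff_distrib diff_divide_distrib exp_add[symmetric] mult.assoc[symmetric] del: exp_add)
  qed
  have bb: "a \<le> exp (- s) * ?G s \<and> exp (- s) * ?G s \<le> b" if "0 \<le> s" "s < u" for s
    using b[OF that] t unfolding G[OF that(1)] by (simp add: pos_le_divide_eq pos_divide_le_eq)
  show "a \<le> energy (dquot g u) (dquot g t)" "energy (dquot g u) (dquot g t) \<le> b"
    unfolding eq using integral_Exp_average_bounds[OF I Gm u bb] by auto
qed

text \<open>Paths are right continuous at 0 and g is continuous, so p_s g tends to g as s tends to
  0, at every point. Convergence everywhere, not just \<open>m\<close>-almost everywhere, is what
  allows integration against \<nu>.\<close>

lemma tavg_tendsto: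
  assumes g: "bdd_fun g" and cont: "continuous_on UNIV g"
  shows "(\<lambda>n. tavg g (inverse (real (Suc n))) x) \<longlonglongrightarrow> g x"
proof (rule LIMSEQ_I)
  interpret L: prob_space "law M (Some x)" by (rule prob_law)
  fix r :: real assume r: "0 < r"
  obtain C where C: "0 \<le> C" "\<And>x. \<bar>g x\<bar> \<le> C" using bdd_funE[OF g] by blast
  note [measurable] = bdd_fun_measurable[OF g]
  have lim: "((\<lambda>s. exp (- s) * transition M s g x) \<longlongrightarrow> exp (- 0) * g x) (at_right 0)"
  proof (intro tendsto_mult tendsto_exp tendsto_minus tendsto_ident_at)
    show "((\<lambda>s. transition M s g x) \<longlongrightarrow> g x) (at_right 0)"
    proof (rule tendsto_at_right_sequentially[of _ 1])
      fix S assume S: "\<And>n. (0::real) < S n" "S \<longlonglongrightarrow> 0"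
      have "(\<lambda>n. transition M (S n) g x) \<longlonglongrightarrow> (\<integral>\<omega>. g x \<partial>law M (Some x))"
        unfolding transition_def
      proof (rule integral_dominated_convergence[where w="\<lambda>_. C"])
        show "(\<lambda>\<omega>. ext0 g (coord M (S n) \<omega>)) \<in> borel_measurable (law M (Some x))" for n
          using integrable_law[OF g less_imp_le[OF S(1)]] by auto
        show "AE \<omega> in law M (Some x). (\<lambda>n. ext0 g (coord M (S n) \<omega>)) \<longlonglongrightarrow> g x"
          using start[of "Some x"] AE_space
        proof eventually_elim
          case (elim \<omega>)
          have "filterlim S (at_right 0) sequentially" using S by (simp add: filterlim_at less_imp_neq[THEN not_sym])
          then have l: "limitin cpt_top (\<lambda>n. coord M (S n) \<omega>) (Some x) sequentially"
            using right_cont[of \<omega> 0] elim by (auto simp: limitin_def intro: eventually_compose_filterlim)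
          show ?case
          proof (rule tendstoI)
            fix e :: real assume e: "0 < e"
            let ?U = "{y. dist (g y) (g x) < e}"
            have "open ?U" by (intro open_Collect_less continuous_intros cont)
            then have "\<forall>\<^sub>F n in sequentially. coord M (S n) \<omega> \<in> Some ` ?U"
              using l e openin_cpt_top_Some[of ?U] unfolding limitin_def by auto
            then show "\<forall>\<^sub>F n in sequentially. dist (ext0 g (coord M (S n) \<omega>)) (g x) < e"
              by eventually_elim auto
          qed
        qed
        show "AE \<omega> in law M (Some x). norm (ext0 g (coord M (S n) \<omega>)) \<le> C" for n
          by (intro AE_I2) (simp add: ext0_bdd[of g, OF C(2,1)])
      qed auto
      then show "(\<lambda>n. transition M (S n) g x) \<longlonglongrightarrow> g x" using L.prob_space by simp
    qed simp
  qed
  have "\<forall>\<^sub>F s in at_right 0. \<bar>exp (- s) * transition M s g x - g x\<bar> < r / 2"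
    using tendstoD[OF lim, of "r / 2"] r by (simp add: dist_real_def)
  then obtain b where b: "0 < b" "\<And>s. 0 < s \<Longrightarrow> s < b \<Longrightarrow> \<bar>exp (- s) * transition M s g x - g x\<bar> < r / 2"
    unfolding eventually_at_right_field by auto
  have close: "\<bar>tavg g u x - g x\<bar> < r" if u: "0 < u" "u < b" for u
  proof -
    have Tm: "(\<lambda>s. transition M (max 0 s) g x) \<in> borel_measurable borel" by measurable
    have bb: "g x - r / 2 \<le> exp (- s) * transition M (max 0 s) g x \<and> exp (- s) * transition M (max 0 s) g x \<le> g x + r / 2"
      if "0 \<le> s" "s < u" for s
    proof (cases "s = 0")
      case False
      then have "\<bar>exp (- s) * transition M s g x - g x\<bar> < r / 2" using b(2)[of s] that u by simp
      then show ?thesis using that unfolding abs_less_iff by simp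
    qed (use r in \<open>simp add: transition_0[OF g]\<close>)
    show ?thesis
      using integral_Exp_average_bounds[OF integrable_avg[OF g bdd_weight] Tm u(1) bb] r
      by (simp add: tavg_def avg_def abs_less_iff)
  qed
  have "\<forall>\<^sub>F n in sequentially. inverse (real (Suc n)) < b"
    using order_tendstoD(2)[OF LIMSEQ_inverse_real_of_nat b(1)] .
  then have "\<forall>\<^sub>F n in sequentially. norm (tavg g (inverse (real (Suc n))) x - g x) < r"
    by eventually_elim (use close in auto)
  then show "\<exists>N. \<forall>n\<ge>N. norm (tavg g (inverse (real (Suc n))) x - g x) < r"
    by (simp only: eventually_sequentially)
qed

lemma tavg_bound:
  assumes g: "bdd_fun g" and C: "\<And>x. \<bar>g x\<bar> \<le> C" and t: "0 < t"
  shows "\<bar>tavg g t x\<bar> \<le> C"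
proof -
  note [measurable] = bdd_fun_measurable[OF g]
  have C0: "0 \<le> C" using C[of x] by linarith
  have Tm: "(\<lambda>s. transition M (max 0 s) g x) \<in> borel_measurable borel" by measurable
  have bb: "- C \<le> exp (- s) * transition M (max 0 s) g x \<and> exp (- s) * transition M (max 0 s) g x \<le> C"
    if "0 \<le> s" "s < t" for s
  proof -
    have "\<bar>exp (- s) * transition M (max 0 s) g x\<bar> \<le> 1 * C"
      unfolding abs_mult using that C0 by (intro mult_mono transition_bound g C) auto
    then show ?thesis by (simp add: abs_le_iff)
  qed
  show ?thesis
    using integral_Exp_average_bounds[OF integrable_avg[OF g bdd_weight] Tm t bb]
    by (simp add: tavg_def avg_def abs_le_iff)
qed

lemma integral_tavg_tendsto:
  assumes g: "bdd_fun g" and cont: "continuous_on UNIV g" and \<nu>: "finite_measure \<nu>" and sets_\<nu>: "sets \<nu> = sets borel"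
  shows "(\<lambda>n. \<integral>x. tavg g (inverse (real (Suc n))) x \<partial>\<nu>) \<longlonglongrightarrow> (\<integral>x. g x \<partial>\<nu>)"
proof -
  interpret n: finite_measure \<nu> by (rule \<nu>)
  obtain C where C: "0 \<le> C" "\<And>x. \<bar>g x\<bar> \<le> C" using bdd_funE[OF g] by blast
  have m: "h \<in> borel_measurable \<nu>" if "bdd_fun h" for h
    using bdd_fun_measurable[OF that] sets_\<nu> by (simp cong: measurable_cong_sets)
  show ?thesis
    by (rule integral_dominated_convergence[where w="\<lambda>_. C"])
       (use tavg_tendsto[OF g cont] tavg_bound[OF g C(2)] in \<open>auto intro!: m g bdd_fun_avg bdd_weight simp: tavg_def\<close>)
qed

end

section \<open>Weak convergence\<close>

context symmetric_hunt begin

lemma C0_vanishing: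
  assumes "g \<in> C0" obtains K where "compact K" "\<And>x. x \<notin> K \<Longrightarrow> g x = (0::real)"
  using assms closure_subset[of "{x. g x \<noteq> 0}"] by (auto simp: C0_def)

lemma C0_L1b: "g \<in> C0 \<Longrightarrow> L1b g"
proof -
  assume g: "g \<in> C0"
  obtain K where K: "compact K" "\<And>x. x \<notin> K \<Longrightarrow> g x = 0" using C0_vanishing[OF g] by blast
  have cont: "continuous_on UNIV g" using g by (simp add: C0_def)
  have "bounded (g ` K)"
    using K(1) cont by (intro compact_imp_bounded compact_continuous_image) (auto intro: continuous_on_subset)
  then obtain C where C: "\<And>x. x \<in> K \<Longrightarrow> \<bar>g x\<bar> \<le> C" by (auto simp: bounded_iff)
  have C': "\<bar>g x\<bar> \<le> max C 0" for x using C[of x] K(2)[of x] by (cases "x \<in> K") auto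
  have b: "bdd_fun g" using cont C' by (intro bdd_funI borel_measurable_continuous_onI)
  note [measurable] = bdd_fun_measurable[OF b]
  have [measurable]: "K \<in> sets borel" using K(1) by (simp add: borel_closed compact_imp_closed)
  have "integrable m (\<lambda>x. max C 0 * indicator K x :: real)"
    using radon K(1) by (intro integrable_mult_right integrable_real_indicator) (auto simp: radon_measure_def)
  then have "integrable m g"
  proof (rule Bochner_Integration.integrable_bound)
    show "AE x in m. norm (g x) \<le> norm (max C 0 * indicator K x :: real)"
      using C' K(2) by (intro AE_I2) (auto split: split_indicator)
  qed simp
  then show ?thesis using b by (simp add: L1b_def)
qed

text \<open>Tietze's theorem on the closed set F \<union> -U, where U is a relatively compact
  neighbourhood of F; prescribing the value 0 off U keeps the support compact.\<close>

lemma C0_extension: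
  fixes F :: "'a set"
  assumes F: "compact F" and f: "continuous_on F f"
  obtains h where "h \<in> C0" "\<And>x. x \<in> F \<Longrightarrow> h x = (f x :: real)"
proof -
  have "\<forall>x. \<exists>e>0. compact (cball x e :: 'a set)" using compact_nbhd[OF open_UNIV] by (metis UNIV_I)
  then obtain e where e: "\<And>x. 0 < e x" "\<And>x. compact (cball x (e x) :: 'a set)" by metis
  have "F \<subseteq> (\<Union>x\<in>F. ball x (e x))" using e(1) by auto
  then obtain T where T: "T \<subseteq> F" "finite T" "F \<subseteq> (\<Union>x\<in>T. ball x (e x))"
    using compactE_image[OF F, of F "\<lambda>x. ball x (e x)"] by auto
  define U where "U = (\<Union>x\<in>T. ball x (e x))"
  define K where "K = (\<Union>x\<in>T. cball x (e x))"
  have U: "open U" "F \<subseteq> U" "U \<subseteq> K" using T by (auto simp: U_def K_def)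
  have K: "compact K" using T e by (auto simp: K_def)
  let ?S = "F \<union> - U"
  let ?f = "\<lambda>x. if x \<in> F then f x else 0"
  have cont: "continuous_on ?S ?f"
    using U F f by (intro continuous_on_cases) (auto simp: compact_imp_closed)
  have n: "normal_space (euclidean :: 'a topology)"
    by (rule metrizable_imp_normal_space[OF metrizable_space_euclidean])
  have cl: "closedin euclidean ?S" using F U by (auto simp: compact_imp_closed)
  obtain h where h: "continuous_map euclidean euclideanreal h" "\<And>x. x \<in> ?S \<Longrightarrow> h x = ?f x"
    using Tietze_extension_realinterval[OF n cl is_interval_univ UNIV_not_empty, of ?f] cont by auto
  have "{x. h x \<noteq> 0} \<subseteq> K"
  proof
    fix x assume "x \<in> {x. h x \<noteq> 0}"
    then have "x \<in> U" using h(2)[of x] U(2) by (cases "x \<in> F") auto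
    then show "x \<in> K" using U(3) by auto
  qed
  then have "closure {x. h x \<noteq> 0} \<subseteq> K" by (intro closure_minimal compact_imp_closed K)
  then have "compact (closure {x. h x \<noteq> 0})"
    using compact_Int_closed[OF K closed_closure[of "{x. h x \<noteq> 0}"]] by (simp add: Int_absorb1)
  then have "h \<in> C0" using h(1) by (simp add: C0_def)
  then show thesis by (rule that) (simp add: h(2))
qed

text \<open>The quotient is e^{-t} times the approximating form plus (1 - e^{-t})/t times
  \<integral> g^2 dm; the second term produces the 1 in E_1.\<close>

lemma psi_limit:
  assumes g: "L1b g" and dom: "g \<in> form_domain M m"
  shows "((\<lambda>t. (psi g 0 - psi g t) / t) \<longlongrightarrow> dirichlet_form_alpha M m 1 g g) (at_right 0)"
proof -
  let ?I = "\<integral>x. g x * g x \<partial>m"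
  have "((\<lambda>t::real. exp (- t)) has_field_derivative - exp (- 0)) (at 0)"
    by (auto intro!: derivative_eq_intros)
  then have "((\<lambda>t::real. (exp (- t) - exp (- 0)) / (t - 0)) \<longlongrightarrow> - exp (- 0)) (at 0)"
    unfolding has_field_derivative_iff .
  then have "((\<lambda>t::real. (exp (- t) - 1) / t) \<longlongrightarrow> - 1) (at 0)" by simp
  then have "((\<lambda>t::real. (exp (- t) - 1) / t) \<longlongrightarrow> - 1) (at_right 0)"
    by (rule tendsto_within_subset) simp
  then have q: "((\<lambda>t::real. - ((exp (- t) - 1) / t)) \<longlongrightarrow> - (- 1)) (at_right 0)" by (rule tendsto_minus)
  have "((\<lambda>t::real. exp (- t)) \<longlongrightarrow> exp (- 0)) (at_right 0)" by (intro tendsto_intros)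
  then have "((\<lambda>t. exp (- t) * approx_form M m t g g + - ((exp (- t) - 1) / t) * ?I) \<longlongrightarrow>
    exp (- 0) * dirichlet_form M m g g + - (- 1) * ?I) (at_right 0)"
    by (rule tendsto_add[OF tendsto_mult[OF _ form_domain_limit(1)[OF dom]] tendsto_mult[OF q tendsto_const]])
  then have lim: "((\<lambda>t. exp (- t) * approx_form M m t g g + - ((exp (- t) - 1) / t) * ?I) \<longlongrightarrow>
    dirichlet_form_alpha M m 1 g g) (at_right 0)"
    by (simp add: dirichlet_form_alpha_def)
  have "exp (- t) * approx_form M m t g g + - ((exp (- t) - 1) / t) * ?I = (psi g 0 - psi g t) / t" if t: "0 < t" for t
  proof -
    have i: "integrable m (\<lambda>x. g x * g x)" "integrable m (\<lambda>x. transition M t g x * g x)"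
      using L1b_mult[OF g L1b_bdd[OF g]] L1b_mult[OF L1b_transition[OF g] L1b_bdd[OF g]] t by auto
    have "(\<integral>x. (g x - transition M t g x) * g x \<partial>m) = ?I - (\<integral>x. transition M t g x * g x \<partial>m)"
      using i by (simp add: left_diff_distrib)
    then have "approx_form M m t g g = (?I - (\<integral>x. transition M t g x * g x \<partial>m)) / t"
      by (simp only: approx_form_def)
    then have "?I = t * approx_form M m t g g + (\<integral>x. transition M t g x * g x \<partial>m)" using t by simp
    then show ?thesis
      using t by (simp add: psi_def transition_0 L1b_bdd[OF g] field_simps)
  qed
  then show ?thesis
    by (intro Lim_transform_eventually[OF lim] eventually_mono[OF eventually_at_right_less[of "0::real"]])
qed

lemma energy_dquot_le:
  assumes g: "L1b g" and lim: "((\<lambda>t. (psi g 0 - psi g t) / t) \<longlongrightarrow> c) (at_right 0)" and t: "0 < t"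
  shows "energy (dquot g t) (dquot g t) \<le> c"
proof (rule energy_dquot(2)[OF g t t])
  fix s :: real assume s: "0 \<le> s"
  \<comment> \<open>Only the upper bound is wanted, but \<open>energy_dquot\<close> takes bounds on
    both sides; a crude lower one comes from 0 \<le> psi \<le> \<integral> g^2 dm.\<close>
  have "- ((\<integral>x. g x * g x \<partial>m) / t) * t \<le> psi g s - psi g (s + t)"
    using psi_bounds(1)[OF g s] psi_bounds(2)[OF g, of "s + t"] s t by simp
  then show "- ((\<integral>x. g x * g x \<partial>m) / t) * t \<le> psi g s - psi g (s + t) \<and> psi g s - psi g (s + t) \<le> c * t"
    using psi_increment_le[OF g lim s] t by simp
qed

text \<open>Expanding the square gives at most c + c - 2 (c - 2 e) = 4 e: the quotients form a
  Cauchy family in energy.\<close>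

lemma energy_dquot_gap:
  assumes g: "L1b g" and lim: "((\<lambda>t. (psi g 0 - psi g t) / t) \<longlongrightarrow> c) (at_right 0)" and e: "0 < e"
  obtains \<eta> where "0 < \<eta>" "\<And>t u. 0 < t \<Longrightarrow> t < \<eta> \<Longrightarrow> 0 < u \<Longrightarrow> u < \<eta> \<Longrightarrow>
    energy (\<lambda>x. 1 * dquot g t x + (- 1) * dquot g u x) (\<lambda>x. 1 * dquot g t x + (- 1) * dquot g u x) \<le> 4 * e"
proof -
  obtain \<eta> where \<eta>: "0 < \<eta>"
    "\<And>s t. 0 \<le> s \<Longrightarrow> s < \<eta> \<Longrightarrow> 0 < t \<Longrightarrow> t < \<eta> \<Longrightarrow> (c - 2 * e) * t \<le> psi g s - psi g (s + t)"
    using psi_increment_ge[OF g lim e] by blast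
  show thesis
  proof (rule that[OF \<eta>(1)])
    fix t u assume t: "0 < t" "t < \<eta>" and u: "0 < u" "u < \<eta>"
    have "c - 2 * e \<le> energy (dquot g t) (dquot g u)"
    proof (rule energy_dquot(1)[OF g t(1) u(1)])
      fix s assume s: "0 \<le> s" "s < t"
      then show "(c - 2 * e) * u \<le> psi g s - psi g (s + u) \<and> psi g s - psi g (s + u) \<le> c * u"
        using \<eta>(2)[of s u] psi_increment_le[OF g lim s(1)] t u by simp
    qed
    then show "energy (\<lambda>x. 1 * dquot g t x + (- 1) * dquot g u x) (\<lambda>x. 1 * dquot g t x + (- 1) * dquot g u x) \<le> 4 * e"
      using energy_dquot_le[OF g lim t(1)] energy_dquot_le[OF g lim u(1)]
      unfolding energy_square[OF L1b_dquot[OF g t(1)] L1b_dquot[OF g u(1)]] by simp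
  qed
qed

text \<open>The last clause of \<open>potential\<close> with the expectation replaced by a constant;
  the factor e^r and the exceptional times come from there.\<close>

definition path_potential_bound :: "'a measure \<Rightarrow> (real \<Rightarrow> 'a \<Rightarrow> ennreal) \<Rightarrow> real \<Rightarrow> bool" where
  "path_potential_bound \<nu> u K \<longleftrightarrow> (\<forall>t\<ge>0. AE x in \<nu>. AE r in lborel. r \<in> {0<..t} \<longrightarrow>
      semigroup_nn M r (\<lambda>y. \<integral>\<^sup>+s. u (max 0 s) y \<partial>Exp_meas 1) x \<le> ennreal (exp r) * ennreal K)"

lemma bdd_tavg: "bdd_fun g \<Longrightarrow> bdd_fun (tavg g t)"
  unfolding tavg_def by (rule bdd_fun_avg[OF _ bdd_weight])

lemma bdd_integrable:
  assumes \<nu>: "finite_measure \<nu>" "sets \<nu> = sets borel" and h: "bdd_fun h"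
  shows "integrable \<nu> h"
proof -
  interpret n: finite_measure \<nu> by (rule \<nu>)
  obtain C where "\<And>x. \<bar>h x\<bar> \<le> C" using bdd_funE[OF h] by blast
  then show ?thesis
    using bdd_fun_measurable[OF h] \<nu>(2) by (intro n.integrable_const_bound[where B=C]) (auto cong: measurable_cong_sets)
qed

section \<open>Estimates that involve the measure only through its mass and K\<close>

context
  fixes \<nu> F A u K
  assumes pot: "potential \<nu> F A u" and \<nu>: "finite_measure \<nu>" "sets \<nu> = sets borel"
    and K: "path_potential_bound \<nu> u K" "0 \<le> K"
begin

lemma energy_bound: "L1b f \<Longrightarrow> (\<integral>x. avg1 f x \<partial>\<nu>)\<^sup>2 \<le> K * measure \<nu> (space \<nu>) * energy f f"
  by (rule energy_inequality[OF pot \<nu> _ K(2)]) (use K(1) in \<open>auto simp: path_potential_bound_def\<close>)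

text \<open>The energy inequality is applied to the difference of two quotients, whose 1-potential
  is a difference of time averages; then u tends to 0 along inverse integers.\<close>

lemma integral_tavg_close:
  assumes g: "L1b g" and cont: "continuous_on UNIV g" and t: "0 < t" "t < \<eta>"
    and gap: "\<And>u. 0 < u \<Longrightarrow> u < \<eta> \<Longrightarrow>
      energy (\<lambda>x. 1 * dquot g t x + (- 1) * dquot g u x) (\<lambda>x. 1 * dquot g t x + (- 1) * dquot g u x) \<le> d"
  shows "((\<integral>x. tavg g t x \<partial>\<nu>) - (\<integral>x. g x \<partial>\<nu>))\<^sup>2 \<le> K * measure \<nu> (space \<nu>) * d"
proof -
  note bg = L1b_bdd[OF g]
  have "(\<lambda>n. ((\<integral>x. tavg g t x \<partial>\<nu>) - (\<integral>x. tavg g (inverse (real (Suc n))) x \<partial>\<nu>))\<^sup>2) \<longlonglongrightarrow> ((\<integral>x. tavg g t x \<partial>\<nu>) - (\<integral>x. g x \<partial>\<nu>))\<^sup>2"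
    by (intro tendsto_intros integral_tavg_tendsto bg cont \<nu>)
  moreover have "\<forall>\<^sub>F n in sequentially. inverse (real (Suc n)) < \<eta>"
    using order_tendstoD(2)[OF LIMSEQ_inverse_real_of_nat, of \<eta>] t by simp
  then have "\<forall>\<^sub>F n in sequentially. ((\<integral>x. tavg g t x \<partial>\<nu>) - (\<integral>x. tavg g (inverse (real (Suc n))) x \<partial>\<nu>))\<^sup>2 \<le> K * measure \<nu> (space \<nu>) * d"
  proof eventually_elim
    case (elim n)
    define u where "u = inverse (real (Suc n))"
    have u: "0 < u" "u < \<eta>" using elim by (simp_all add: u_def)
    let ?f = "\<lambda>x. 1 * dquot g t x + (- 1) * dquot g u x"
    note Lt = L1b_dquot[OF g t(1)] and Lu = L1b_dquot[OF g u(1)]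
    have "avg1 ?f x = tavg g t x - tavg g u x" for x
      using avg_lincomb[OF L1b_bdd[OF Lt] L1b_bdd[OF Lu] bdd_const, of 1 1 "- 1" x] t u by (simp add: avg1_dquot bg)
    then have "(\<integral>x. avg1 ?f x \<partial>\<nu>) = (\<integral>x. tavg g t x \<partial>\<nu>) - (\<integral>x. tavg g u x \<partial>\<nu>)"
      using bdd_integrable[OF \<nu> bdd_tavg[OF bg]] by simp
    then have "((\<integral>x. tavg g t x \<partial>\<nu>) - (\<integral>x. tavg g u x \<partial>\<nu>))\<^sup>2 \<le> K * measure \<nu> (space \<nu>) * energy ?f ?f"
      using energy_bound[OF L1b_lincomb[OF Lt Lu, of 1 "- 1"]] by (simp only:)
    also have "\<dots> \<le> K * measure \<nu> (space \<nu>) * d"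
      by (intro mult_left_mono gap u) (simp add: K(2))
    finally show ?case by (simp only: u_def)
  qed
  ultimately show ?thesis by (rule tendsto_upperbound) simp
qed

text \<open>The energy inequality for the difference quotients, whose energies stay below E_1(g,g)
  and whose 1-potentials tend to g.\<close>

lemma integral_square_le:
  assumes g: "g \<in> form_domain M m \<inter> C0"
  shows "(\<integral>x. g x \<partial>\<nu>)\<^sup>2 \<le> K * measure \<nu> (space \<nu>) * dirichlet_form_alpha M m 1 g g"
proof -
  have L: "L1b g" and cont: "continuous_on UNIV g" using g C0_L1b by (auto simp: C0_def)
  note lim = psi_limit[OF L IntD1[OF g]]
  have "(\<lambda>n. (\<integral>x. tavg g (inverse (real (Suc n))) x \<partial>\<nu>)\<^sup>2) \<longlonglongrightarrow> (\<integral>x. g x \<partial>\<nu>)\<^sup>2"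
    by (intro tendsto_intros integral_tavg_tendsto L1b_bdd L cont \<nu>)
  then show ?thesis
  proof (rule LIMSEQ_le_const2, intro exI allI impI)
    fix n
    define u where "u = inverse (real (Suc n))"
    have u: "0 < u" by (simp add: u_def)
    have "(\<integral>x. avg1 (dquot g u) x \<partial>\<nu>)\<^sup>2 \<le> K * measure \<nu> (space \<nu>) * energy (dquot g u) (dquot g u)"
      by (rule energy_bound[OF L1b_dquot[OF L u]])
    also have "\<dots> \<le> K * measure \<nu> (space \<nu>) * dirichlet_form_alpha M m 1 g g"
      by (intro mult_left_mono energy_dquot_le L lim u) (simp add: K(2))
    finally show "(\<integral>x. tavg g (inverse (real (Suc n))) x \<partial>\<nu>)\<^sup>2 \<le> K * measure \<nu> (space \<nu>) * dirichlet_form_alpha M m 1 g g"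
      unfolding u_def by (simp only: avg1_dquot[OF L1b_bdd[OF L] u, unfolded u_def])
  qed
qed

text \<open>With V the mass, V^2 \<le> (\<integral> v d\<nu>)^2 \<le> K V E_1(v,v), and one factor V
  cancels. Apart from K the bound does not depend on the measure, so it serves a whole
  sequence.\<close>

lemma mass_le:
  assumes v: "v \<in> form_domain M m \<inter> C0" and v1: "AE x in \<nu>. 1 \<le> v x"
  shows "measure \<nu> (space \<nu>) \<le> K * dirichlet_form_alpha M m 1 v v"
proof -
  interpret n: finite_measure \<nu> by (rule \<nu>)
  let ?V = "measure \<nu> (space \<nu>)" and ?c = "dirichlet_form_alpha M m 1 v v"
  have L: "L1b v" using v C0_L1b by auto
  have c: "0 \<le> ?c" using form_domain_limit(2)[OF IntD1[OF v]] by (simp add: dirichlet_form_alpha_def)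
  have "(\<integral>x. 1 \<partial>\<nu>) \<le> (\<integral>x. v x \<partial>\<nu>)"
    by (intro integral_mono_AE v1 bdd_integrable[OF \<nu> L1b_bdd[OF L]]) simp
  then have "?V\<^sup>2 \<le> (\<integral>x. v x \<partial>\<nu>)\<^sup>2" by (intro power_mono) auto
  also have "\<dots> \<le> K * ?V * ?c" by (rule integral_square_le[OF v])
  finally have "?V * ?V \<le> ?V * (K * ?c)" by (simp add: power2_eq_square mult_ac)
  then show ?thesis
    using K(2) c by (cases "?V = 0") (auto simp: mult_le_cancel_left less_le)
qed

text \<open>The two integrals differ by the weight (e^{-s} - 1)/t on [0,t), of absolute value at
  most s/t \<le> 1; integrating over [0,t] gives t C at each point.\<close>

lemma integral_tavg_time_close:
  assumes g: "bdd_fun g" and C: "\<And>x. \<bar>g x\<bar> \<le> C" and t: "0 < t"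
  shows "\<bar>(\<integral>x. tavg g t x \<partial>\<nu>) - (\<integral>x. g x * enn2real (u t x) \<partial>m) / t\<bar> \<le> t * C * measure \<nu> (space \<nu>)"
proof -
  interpret n: finite_measure \<nu> by (rule \<nu>)
  have C0: "0 \<le> C" using C[of undefined] by linarith
  note [measurable] = bdd_fun_measurable[OF g]
  let ?S = "\<lambda>x. \<integral>s. indicator {0..t} s * transition M (max 0 s) g x \<partial>lborel"
  have S: "\<bar>tavg g t x - ?S x / t\<bar> \<le> t * C" for x
  proof -
    let ?T = "\<lambda>s. exponential_density 1 s * (indicator {..<t} s / t * transition M (max 0 s) g x)"
    have Ti: "integrable lborel ?T"
      using integrable_avg[OF g bdd_weight[of t], of x] by (subst (asm) integrable_density) (auto simp: exponential_density_nonneg)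
    have T: "tavg g t x = (\<integral>s. ?T s \<partial>lborel)"
      unfolding tavg_def avg_def by (subst integral_density) (auto simp: exponential_density_nonneg)
    have Si: "integrable lborel (\<lambda>s. indicator {0..t} s * transition M (max 0 s) g x / t)"
      using transition_time_integrable[OF g] by simp
    have ci: "integrable lborel (\<lambda>s. C * indicator {0..t} s :: real)" by simp
    have "tavg g t x - ?S x / t = (\<integral>s. ?T s - indicator {0..t} s * transition M (max 0 s) g x / t \<partial>lborel)"
      unfolding T using Bochner_Integration.integral_diff[OF Ti Si] by simp
    also have "\<bar>\<dots>\<bar> \<le> (\<integral>s. C * indicator {0..t} s \<partial>lborel)"
    proof (rule order_trans[OF integral_abs_bound], rule integral_mono_AE[OF _ ci])
      show "integrable lborel (\<lambda>s. \<bar>?T s - indicator {0..t} s * transition M (max 0 s) g x / t\<bar>)"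
        using Ti Si by (intro integrable_abs Bochner_Integration.integrable_diff)
      show "AE s in lborel. \<bar>?T s - indicator {0..t} s * transition M (max 0 s) g x / t\<bar> \<le> C * indicator {0..t} s"
        using AE_lborel_singleton[of t]
      proof eventually_elim
        case (elim s)
        show ?case
        proof (cases "0 \<le> s \<and> s < t")
          case True
          have e: "\<bar>(exp (- s) - 1) / t\<bar> \<le> 1"
            using exp_ge_add_one_self[of "- s"] True t by (simp add: pos_divide_le_eq)
          have "?T s - indicator {0..t} s * transition M (max 0 s) g x / t = (exp (- s) - 1) / t * transition M (max 0 s) g x"
            using True by (simp add: exponential_density_def left_diff_distrib diff_divide_distrib)
          also have "\<bar>\<dots>\<bar> \<le> 1 * C"
            unfolding abs_mult using True by (intro mult_mono e transition_bound g C) auto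
          finally show ?thesis using True by simp
        next
          case False
          then show ?thesis using elim C0 by (auto simp: exponential_density_def split: split_indicator)
        qed
      qed
    qed
    also have "\<dots> = t * C" using t by simp
    finally show ?thesis .
  qed
  note R = potential_revuz_real(1,2)[OF pot \<nu> g less_imp_le[OF t]]
  have "(\<integral>x. tavg g t x \<partial>\<nu>) - (\<integral>x. g x * enn2real (u t x) \<partial>m) / t = (\<integral>x. tavg g t x - ?S x / t \<partial>\<nu>)"
    unfolding R(1) using bdd_integrable[OF \<nu> bdd_tavg[OF g]] R(2) by simp
  also have "\<bar>\<dots>\<bar> \<le> (\<integral>x. t * C \<partial>\<nu>)"
    by (rule order_trans[OF integral_abs_bound], rule integral_mono)
       (use bdd_integrable[OF \<nu> bdd_tavg[OF g]] R(2) S in auto)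
  finally show ?thesis by (simp add: mult_ac)
qed

end

section \<open>Passage to the limit along the sequence of measures\<close>

context
  fixes \<nu>s :: "nat \<Rightarrow> 'a measure" and \<nu> F us u and A :: "real \<Rightarrow> 'w \<Rightarrow> ennreal" and As
  assumes pots: "\<And>n. potential (\<nu>s n) F (As n) (us n)" and pot: "potential \<nu> F A u"
    and \<nu>s: "\<And>n. finite_measure (\<nu>s n)" "\<And>n. sets (\<nu>s n) = sets borel"
    and \<nu>: "finite_measure \<nu>" "sets \<nu> = sets borel"
    and A1: "\<And>t K. t > 0 \<Longrightarrow> compact K \<Longrightarrow>
          (\<lambda>n. SUP s\<in>{0..t}. \<integral>\<^sup>+x\<in>K. ennreal_absdiff
                 (expect M x (restrict_af M F (As n) s)) (expect M x (restrict_af M F A s)) \<partial>m) \<longlonglongrightarrow> 0"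
begin

text \<open>(A1) is used at the single time s = t, in both directions and for nonnegative functions;
  the sign is restored by splitting g.\<close>

lemma potential_inner_convergence:
  assumes g: "bdd_fun g" and Q: "compact Q" "\<And>x. x \<notin> Q \<Longrightarrow> g x = 0" and t: "0 < t"
  shows "(\<lambda>n. \<integral>x. g x * enn2real (us n t x) \<partial>m) \<longlonglongrightarrow> (\<integral>x. g x * enn2real (u t x) \<partial>m)"
proof -
  have t0: "0 \<le> t" using t by simp
  have [measurable]: "Q \<in> sets borel" using Q(1) by (simp add: borel_closed compact_imp_closed)
  have pos: "(\<lambda>n. \<integral>x. h x * enn2real (us n t x) \<partial>m) \<longlonglongrightarrow> (\<integral>x. h x * enn2real (u t x) \<partial>m)"
    if h: "bdd_fun h" "\<And>x. 0 \<le> h x" "\<And>x. x \<notin> Q \<Longrightarrow> h x = 0" for h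
  proof -
    obtain C where C: "0 \<le> C" "\<And>x. \<bar>h x\<bar> \<le> C" using bdd_funE[OF h(1)] by blast
    note [measurable] = bdd_fun_measurable[OF h(1)]
    have hC: "AE x in m. ennreal (h x) \<le> ennreal C * indicator Q x"
    proof (rule AE_I2)
      fix x show "ennreal (h x) \<le> ennreal C * indicator Q x"
        using C(2)[of x] h(2,3)[of x] by (cases "x \<in> Q") (auto intro: ennreal_leI)
    qed
    have eq: "(\<integral>\<^sup>+x. ennreal (h x) * w t x \<partial>m) = ennreal (\<integral>x. h x * enn2real (w t x) \<partial>m)"
      if p: "potential \<mu> F B w" "finite_measure \<mu>" "sets \<mu> = sets borel" for \<mu> B w
    proof -
      have "(\<integral>\<^sup>+x. ennreal (h x) * w t x \<partial>m) = (\<integral>\<^sup>+x. ennreal (h x * enn2real (w t x)) \<partial>m)"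
        using potential_integrable(2)[OF p(1,2) t0] h(2)
        by (intro nn_integral_cong_AE) (auto elim!: eventually_mono simp: ennreal_mult)
      also have "\<dots> = ennreal (\<integral>x. h x * enn2real (w t x) \<partial>m)"
        using h(2) by (intro nn_integral_eq_integral potential_revuz_real(3)[OF p h(1) t0]) auto
      finally show ?thesis .
    qed
    note Ls = eq[OF pots \<nu>s] and L = eq[OF pot \<nu>]
    let ?d = "\<lambda>n. \<integral>\<^sup>+x\<in>Q. ennreal_absdiff (expect M x (restrict_af M F (As n) t)) (expect M x (restrict_af M F A t)) \<partial>m"
    have "(\<lambda>n. enn2real (\<integral>\<^sup>+x. ennreal (h x) * us n t x \<partial>m)) \<longlonglongrightarrow> enn2real (\<integral>\<^sup>+x. ennreal (h x) * u t x \<partial>m)"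
    proof (rule tendsto_enn2real_squeeze)
      fix \<eta> :: real assume \<eta>: "0 < \<eta>"
      define \<delta> where "\<delta> = \<eta> / (C + 1)"
      have \<delta>: "0 < \<delta>" "C * \<delta> \<le> \<eta>" using C(1) \<eta> by (auto simp: \<delta>_def field_simps)
      have "\<forall>\<^sub>F n in sequentially. (SUP s\<in>{0..t}. \<integral>\<^sup>+x\<in>Q. ennreal_absdiff
                 (expect M x (restrict_af M F (As n) s)) (expect M x (restrict_af M F A s)) \<partial>m) < ennreal \<delta>"
        using order_tendstoD(2)[OF A1[OF t Q(1)], of "ennreal \<delta>"] \<delta> by simp
      then show "\<forall>\<^sub>F n in sequentially. (\<integral>\<^sup>+x. ennreal (h x) * us n t x \<partial>m) \<le> (\<integral>\<^sup>+x. ennreal (h x) * u t x \<partial>m) + ennreal \<eta> \<and>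
        (\<integral>\<^sup>+x. ennreal (h x) * u t x \<partial>m) \<le> (\<integral>\<^sup>+x. ennreal (h x) * us n t x \<partial>m) + ennreal \<eta>"
      proof eventually_elim
        case (elim n)
        have "?d n \<le> ennreal \<delta>" using elim t0 by (meson SUP_upper order_trans less_imp_le atLeastAtMost_iff order_refl)
        then have "ennreal C * ?d n \<le> ennreal C * ennreal \<delta>" by (rule mult_left_mono) simp
        also have "\<dots> \<le> ennreal \<eta>" using C(1) \<delta> by (simp add: ennreal_mult[symmetric] ennreal_leI)
        finally have d: "ennreal C * ?d n \<le> ennreal \<eta>" .
        show ?case
          using order_trans[OF potential_compare_time[OF pots pot _ _ hC t0] add_left_mono[OF d]]
            order_trans[OF potential_compare_time[OF pot pots _ _ hC t0, of n]
              add_left_mono[OF d[unfolded ennreal_absdiff_commute[of "expect M _ (restrict_af M F (As n) t)"]]]]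
          by simp
      qed
    qed (simp add: L)
    moreover have "0 \<le> (\<integral>x. h x * enn2real (w t x) \<partial>m)" for w
      by (intro Bochner_Integration.integral_nonneg) (simp add: h(2))
    ultimately show ?thesis unfolding Ls L by simp
  qed
  note bp = bdd_fun_parts[OF g]
  have split: "(\<integral>x. g x * enn2real (w t x) \<partial>m) = (\<integral>x. max 0 (g x) * enn2real (w t x) \<partial>m) - (\<integral>x. max 0 (- g x) * enn2real (w t x) \<partial>m)"
    if p: "potential \<mu> F B w" "finite_measure \<mu>" "sets \<mu> = sets borel" for \<mu> B w
  proof -
    have "g x = max 0 (g x) - max 0 (- g x)" for x by simp
    then have "(\<integral>x. g x * enn2real (w t x) \<partial>m) = (\<integral>x. max 0 (g x) * enn2real (w t x) - max 0 (- g x) * enn2real (w t x) \<partial>m)"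
      by (simp only: left_diff_distrib[symmetric])
    also have "\<dots> = (\<integral>x. max 0 (g x) * enn2real (w t x) \<partial>m) - (\<integral>x. max 0 (- g x) * enn2real (w t x) \<partial>m)"
      by (rule Bochner_Integration.integral_diff[OF potential_revuz_real(3)[OF p bp(1) t0] potential_revuz_real(3)[OF p bp(2) t0]])
    finally show ?thesis .
  qed
  show ?thesis
    unfolding split[OF pots \<nu>s] split[OF pot \<nu>]
    by (intro tendsto_diff pos bp) (use Q(2) in auto)
qed

lemma form_domain_convergence:
  assumes Ks: "\<And>n. path_potential_bound (\<nu>s n) (us n) K" and K: "path_potential_bound \<nu> u K" "0 \<le> K"
    and V: "\<And>n. measure (\<nu>s n) (space (\<nu>s n)) \<le> V" "measure \<nu> (space \<nu>) \<le> V"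
    and g: "g \<in> form_domain M m \<inter> C0"
  shows "(\<lambda>n. \<integral>x. g x \<partial>\<nu>s n) \<longlonglongrightarrow> (\<integral>x. g x \<partial>\<nu>)"
proof (rule LIMSEQ_I)
  fix r :: real assume r: "0 < r"
  \<comment> \<open>Two errors of size 2 d, one for each measure, and one of size d for the
    convergence at fixed t.\<close>
  define d where "d = r / 6"
  have d: "0 < d" using r by (simp add: d_def)
  have L: "L1b g" and cont: "continuous_on UNIV g" using g C0_L1b by (auto simp: C0_def)
  obtain C where C: "0 \<le> C" "\<And>x. \<bar>g x\<bar> \<le> C" using bdd_funE[OF L1b_bdd[OF L]] by blast
  obtain Q where Q: "compact Q" "\<And>x. x \<notin> Q \<Longrightarrow> g x = 0" using C0_vanishing[OF IntD2[OF g]] by blast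
  have V0: "0 \<le> V" using V(2) measure_nonneg[of \<nu> "space \<nu>"] by linarith
  \<comment> \<open>The energy gap 4 e of two quotients, multiplied by K V, has to stay below d^2;
    the 1 guards against K V = 0.\<close>
  define e where "e = d\<^sup>2 / (4 * (K * V + 1))"
  have KV: "0 \<le> K * V" using K(2) V0 by simp
  have e: "0 < e" using d KV by (simp add: e_def)
  have "(K * V) * (4 * e) \<le> (K * V + 1) * (4 * e)" using e by (intro mult_right_mono) auto
  also have "\<dots> = d\<^sup>2" using KV by (simp add: e_def field_simps)
  finally have KVe: "K * V * (4 * e) \<le> d\<^sup>2" .
  obtain \<eta> where \<eta>: "0 < \<eta>" "\<And>t u. 0 < t \<Longrightarrow> t < \<eta> \<Longrightarrow> 0 < u \<Longrightarrow> u < \<eta> \<Longrightarrow>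
    energy (\<lambda>x. 1 * dquot g t x + (- 1) * dquot g u x) (\<lambda>x. 1 * dquot g t x + (- 1) * dquot g u x) \<le> 4 * e"
    using energy_dquot_gap[OF L psi_limit[OF L IntD1[OF g]] e] by blast
  \<comment> \<open>Below \<eta> for the sake of the energy gap, and small enough for t C V \<le>
    d.\<close>
  define t where "t = min (\<eta> / 2) (d / (C * V + 1))"
  have CV: "0 \<le> C * V" using C V0 by simp
  have t: "0 < t" "t < \<eta>" using \<eta>(1) d CV by (auto simp: t_def)
  have "t * C * V \<le> d / (C * V + 1) * (C * V)"
    unfolding mult.assoc using CV by (intro mult_right_mono) (simp_all add: t_def)
  also have "\<dots> \<le> d" using CV d by (simp add: field_simps)
  finally have tCV: "t * C * V \<le> d" .
  have close: "\<bar>(\<integral>x. g x \<partial>\<mu>) - (\<integral>x. g x * enn2real (w t x) \<partial>m) / t\<bar> \<le> 2 * d"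
    if p: "potential \<mu> F B w" "finite_measure \<mu>" "sets \<mu> = sets borel" "path_potential_bound \<mu> w K" "measure \<mu> (space \<mu>) \<le> V" for \<mu> B w
  proof -
    have "((\<integral>x. tavg g t x \<partial>\<mu>) - (\<integral>x. g x \<partial>\<mu>))\<^sup>2 \<le> K * measure \<mu> (space \<mu>) * (4 * e)"
      by (rule integral_tavg_close[OF p(1-4) K(2) L cont t \<eta>(2)[OF t]])
    also have "\<dots> \<le> K * V * (4 * e)" using K(2) e p(5) by (intro mult_right_mono mult_left_mono) auto
    also have "\<dots> \<le> d\<^sup>2" by (rule KVe)
    finally have 1: "\<bar>(\<integral>x. tavg g t x \<partial>\<mu>) - (\<integral>x. g x \<partial>\<mu>)\<bar> \<le> d" using d by (simp add: abs_le_square_iff[symmetric])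
    have "\<bar>(\<integral>x. tavg g t x \<partial>\<mu>) - (\<integral>x. g x * enn2real (w t x) \<partial>m) / t\<bar> \<le> t * C * measure \<mu> (space \<mu>)"
      by (rule integral_tavg_time_close[OF p(1-4) K(2) L1b_bdd[OF L] C(2) t(1)])
    also have "\<dots> \<le> t * C * V" using t C p(5) by (intro mult_left_mono) auto
    finally show ?thesis using 1 tCV by linarith
  qed
  have "(\<lambda>n. (\<integral>x. g x * enn2real (us n t x) \<partial>m) / t) \<longlonglongrightarrow> (\<integral>x. g x * enn2real (u t x) \<partial>m) / t"
    by (intro tendsto_divide potential_inner_convergence[OF L1b_bdd[OF L] Q t(1)] tendsto_const) (use t in auto)
  from tendstoD[OF this d]
  have "\<forall>\<^sub>F n in sequentially. norm ((\<integral>x. g x \<partial>\<nu>s n) - (\<integral>x. g x \<partial>\<nu>)) < r"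
  proof eventually_elim
    case (elim n)
    then show ?case
      using close[OF pots \<nu>s Ks V(1), of n] close[OF pot \<nu> K(1) V(2)]
      unfolding dist_real_def real_norm_def d_def by linarith
  qed
  then show "\<exists>N. \<forall>n\<ge>N. norm ((\<integral>x. g x \<partial>\<nu>s n) - (\<integral>x. g x \<partial>\<nu>)) < r"
    by (simp add: eventually_sequentially)
qed

text \<open>A Tietze extension followed by uniform approximation inside the form domain reduces the
  claim to \<open>form_domain_convergence\<close>. The error is \<epsilon> times the mass, so the
  bound on the masses has to be available before \<epsilon> is chosen.\<close>

lemma continuous_convergence:
  fixes f :: "'a \<Rightarrow> real"
  assumes Ks: "\<And>n. path_potential_bound (\<nu>s n) (us n) K" and K: "path_potential_bound \<nu> u K" "0 \<le> K"
    and F: "compact F" and on: "\<And>n. AE x in \<nu>s n. x \<in> F" "AE x in \<nu>. x \<in> F"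
    and reg: "regular_form M m"
    and f: "continuous_on F f" and fm: "f \<in> borel_measurable borel"
  shows "(\<lambda>n. \<integral>x. f x \<partial>\<nu>s n) \<longlonglongrightarrow> (\<integral>x. f x \<partial>\<nu>)"
proof (rule LIMSEQ_I)
  fix r :: real assume r: "0 < r"
  have approx: "\<exists>v \<in> form_domain M m \<inter> C0. \<forall>x\<in>F. \<bar>f x - v x\<bar> < \<epsilon>" if c: "continuous_on F f" and e: "0 < \<epsilon>" for f \<epsilon>
  proof -
    obtain h where h: "h \<in> C0" "\<And>x. x \<in> F \<Longrightarrow> h x = f x" using C0_extension[OF F c] by blast
    then obtain v where "v \<in> form_domain M m \<inter> C0" "\<forall>x. \<bar>h x - v x\<bar> < \<epsilon>"
      using reg e unfolding regular_form_def by blast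
    then show ?thesis using h(2)[symmetric] by (intro bexI[of _ v]) auto
  qed
  \<comment> \<open>A function within distance 1 of the constant 2 on F is at least 1 there, as
    \<open>mass_le\<close> asks.\<close>
  obtain v where v: "v \<in> form_domain M m \<inter> C0" "\<forall>x\<in>F. \<bar>2 - v x\<bar> < 1"
    using approx[of "\<lambda>_. 2" 1] by auto
  define V where "V = K * dirichlet_form_alpha M m 1 v v"
  have v1: "1 \<le> v x" if "x \<in> F" for x using v(2) that by (auto simp: abs_less_iff)
  have V: "measure (\<nu>s n) (space (\<nu>s n)) \<le> V" "measure \<nu> (space \<nu>) \<le> V" for n
    unfolding V_def using on[THEN eventually_mono, OF v1]
    by (simp_all add: mass_le[OF pots \<nu>s Ks K(2) v(1)] mass_le[OF pot \<nu> K v(1)])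
  have V0: "0 \<le> V" using V(2) measure_nonneg[of \<nu> "space \<nu>"] by linarith
  \<comment> \<open>The uniform error times the mass enters twice, once for each measure; the last
    third is left for the integrals of g.\<close>
  define \<epsilon> where "\<epsilon> = r / (3 * (V + 1))"
  have \<epsilon>: "0 < \<epsilon>" using r V0 by (simp add: \<epsilon>_def)
  have "\<epsilon> * V \<le> \<epsilon> * (V + 1)" using \<epsilon> by (intro mult_left_mono) auto
  also have "\<dots> = r / 3" using V0 by (simp add: \<epsilon>_def field_simps)
  finally have \<epsilon>V: "\<epsilon> * V \<le> r / 3" .
  obtain g where g: "g \<in> form_domain M m \<inter> C0" "\<forall>x\<in>F. \<bar>f x - g x\<bar> < \<epsilon>"
    using approx[OF f \<epsilon>] by auto
  have bg: "bdd_fun g" using g(1) C0_L1b L1b_bdd by auto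
  obtain C where C: "\<And>x. x \<in> F \<Longrightarrow> \<bar>f x\<bar> \<le> C"
    using compact_imp_bounded[OF compact_continuous_image[OF f F]] by (auto simp: bounded_iff)
  have close: "\<bar>(\<integral>x. f x \<partial>\<mu>) - (\<integral>x. g x \<partial>\<mu>)\<bar> \<le> r / 3"
    if \<mu>: "finite_measure \<mu>" "sets \<mu> = sets borel" "AE x in \<mu>. x \<in> F" "measure \<mu> (space \<mu>) \<le> V" for \<mu>
  proof -
    interpret n: finite_measure \<mu> by (rule \<mu>)
    have fi: "integrable \<mu> f"
      using \<mu>(3) fm \<mu>(2) C by (intro n.integrable_const_bound[where B=C]) (auto elim!: eventually_mono cong: measurable_cong_sets)
    note gi = bdd_integrable[OF \<mu>(1,2) bg]
    have "(\<integral>x. f x \<partial>\<mu>) - (\<integral>x. g x \<partial>\<mu>) = (\<integral>x. f x - g x \<partial>\<mu>)" using fi gi by simp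
    also have "\<bar>\<dots>\<bar> \<le> (\<integral>x. \<epsilon> \<partial>\<mu>)"
      by (rule order_trans[OF integral_abs_bound], rule integral_mono_AE)
         (use fi gi g(2) \<mu>(3) in \<open>auto elim!: eventually_mono intro: less_imp_le\<close>)
    also have "\<dots> \<le> V * \<epsilon>" using \<mu>(4) \<epsilon> by (simp add: mult_right_mono)
    finally show ?thesis using \<epsilon>V by (simp add: mult.commute)
  qed
  have "0 < r / 3" using r by simp
  from tendstoD[OF form_domain_convergence[OF Ks K V g(1)] this]
  have "\<forall>\<^sub>F n in sequentially. norm ((\<integral>x. f x \<partial>\<nu>s n) - (\<integral>x. f x \<partial>\<nu>)) < r"
  proof eventually_elim
    case (elim n)
    then show ?case
      using close[OF \<nu>s on(1) V(1), of n] close[OF \<nu> on(2) V(2)]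
      unfolding dist_real_def real_norm_def by linarith
  qed
  then show "\<exists>N. \<forall>n\<ge>N. norm ((\<integral>x. f x \<partial>\<nu>s n) - (\<integral>x. f x \<partial>\<nu>)) < r"
    by (simp add: eventually_sequentially)
qed

end

end

section \<open>Restriction to the members of the nest and conclusion\<close>

lemma (in symmetric_hunt) S_nest_restriction:
  fixes \<phi> :: "'a \<Rightarrow> real"
  assumes "\<mu> \<in> S_nest M m F" and "nest M m F"
  shows "finite_measure (density \<mu> (indicator (F l)))" "sets (density \<mu> (indicator (F l))) = sets borel"
    "AE x in density \<mu> (indicator (F l)). x \<in> F l"
    "\<phi> \<in> borel_measurable borel \<Longrightarrow> (LINT x:F l|\<mu>. \<phi> x) = (\<integral>x. \<phi> x \<partial>density \<mu> (indicator (F l)))"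
proof -
  have sets_\<mu>[measurable_cong]: "sets \<mu> = sets borel" using assms(1) by (auto simp: S_nest_def smooth_measure_def)
  have sp: "space \<mu> = UNIV" using sets_eq_imp_space_eq[OF sets_\<mu>] by simp
  have F: "compact (F l)" using assms(2) by (simp add: nest_def)
  have Fm[measurable]: "F l \<in> sets borel" using F by (simp add: borel_closed compact_imp_closed)
  have "density \<mu> (indicator (F l)) \<in> S0_measures M m" using assms(1) by (simp add: S_nest_def)
  \<comment> \<open>Members of S_0 are finite on compact sets, and the restricted measure has no
    mass outside \<open>F l\<close>; together these give a finite measure.\<close>
  then have "emeasure (density \<mu> (indicator (F l))) (F l) < \<infinity>"
    using F by (simp add: S0_measures_def radon_measure_def)
  moreover have "emeasure (density \<mu> (indicator (F l))) UNIV = emeasure (density \<mu> (indicator (F l))) (F l)"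
    by (simp add: emeasure_density indicator_inter_arith[symmetric] sp)
  ultimately show "finite_measure (density \<mu> (indicator (F l)))"
    by (intro finite_measureI) (simp add: sp)
  show "sets (density \<mu> (indicator (F l))) = sets borel" by (simp add: sets_\<mu>)
  show "AE x in density \<mu> (indicator (F l)). x \<in> F l"
    by (subst AE_density) (auto split: split_indicator)
  show "(LINT x:F l|\<mu>. \<phi> x) = (\<integral>x. \<phi> x \<partial>density \<mu> (indicator (F l)))" if [measurable]: "\<phi> \<in> borel_measurable borel" for \<phi> :: "'a \<Rightarrow> real"
    using integral_density[of \<phi> \<mu> "indicator (F l)"] by (simp add: set_lebesgue_integral_def ennreal_indicator)
qed

text \<open>\<nu> is carried by F, so a pointwise bound on F is enough.\<close>

lemma (in symmetric_hunt) path_potential_boundI: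
  assumes pot: "potential \<nu> F A u" and on: "AE x in \<nu>. x \<in> F"
    and le: "\<And>x. x \<in> F \<Longrightarrow> expect M x (path_integral (restrict_af M F A) {0..} (\<lambda>s. ennreal (exp (- s)))) \<le> ennreal K"
  shows "path_potential_bound \<nu> u K"
  unfolding path_potential_bound_def
proof (intro allI impI)
  fix t :: real assume t: "0 \<le> t"
  have "AE x in \<nu>. AE r in lborel. r \<in> {0<..t} \<longrightarrow>
      semigroup_nn M r (\<lambda>y. \<integral>\<^sup>+s. u (max 0 s) y \<partial>Exp_meas 1) x \<le>
      ennreal (exp r) * expect M x (path_integral (restrict_af M F A) {0..} (\<lambda>s. ennreal (exp (- s))))"
    using pot t unfolding potential_def by blast
  then show "AE x in \<nu>. AE r in lborel. r \<in> {0<..t} \<longrightarrow>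
      semigroup_nn M r (\<lambda>y. \<integral>\<^sup>+s. u (max 0 s) y \<partial>Exp_meas 1) x \<le> ennreal (exp r) * ennreal K"
    using on
  proof eventually_elim
    case (elim x)
    have "ennreal (exp r) * expect M x (path_integral (restrict_af M F A) {0..} (\<lambda>s. ennreal (exp (- s)))) \<le> ennreal (exp r) * ennreal K" for r
      by (intro mult_left_mono le elim(2)) simp
    with elim(1) show ?case by (auto elim!: eventually_mono intro: order_trans)
  qed
qed

theorem theorem4p1:
  fixes M :: "('a::{metric_space, second_countable_topology}, 'w) process"
    and m \<mu> :: "'a measure" and \<mu>s :: "nat \<Rightarrow> 'a measure"
    and F :: "nat \<Rightarrow> 'a set"
    and A :: "real \<Rightarrow> 'w \<Rightarrow> ennreal" and As :: "nat \<Rightarrow> real \<Rightarrow> 'w \<Rightarrow> ennreal"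
  assumes "locally_compact_space (euclidean :: 'a topology)"
    and "radon_measure m" and "full_support m"
    and "hunt_process M" and "symmetric_process M m" and "regular_form M m"
    and "nest M m F"
    and "\<And>n. \<mu>s n \<in> S_nest M m F" and "\<mu> \<in> S_nest M m F"
    and "\<And>n. revuz M m (\<mu>s n) (As n)" and "revuz M m \<mu> A"
    and A1: "\<And>l t K. t > 0 \<Longrightarrow> compact K \<Longrightarrow>
          (\<lambda>n. SUP s\<in>{0..t}. \<integral>\<^sup>+x\<in>K. ennreal_absdiff
                 (expect M x (restrict_af M (F l) (As n) s))
                 (expect M x (restrict_af M (F l) A s)) \<partial>m) \<longlonglongrightarrow> 0"
    and A2: "\<And>\<alpha> l K. \<alpha> > 0 \<Longrightarrow> compact K \<Longrightarrow>
          ((\<lambda>t. SUP n. \<integral>\<^sup>+x\<in>K. max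
                 (expect M x (path_integral (restrict_af M (F l) (As n)) {t..} (\<lambda>s. ennreal (exp (- \<alpha> * s)))))
                 (expect M x (path_integral (restrict_af M (F l) A) {t..} (\<lambda>s. ennreal (exp (- \<alpha> * s))))) \<partial>m)
            \<longlongrightarrow> 0) at_top"
  shows "(\<forall>\<alpha>>0. \<forall>l. \<forall>f \<in> Bb0 m.
            (\<lambda>n. LINT x:F l|\<mu>s n. resolvent M \<alpha> f x) \<longlonglongrightarrow> (LINT x:F l|\<mu>. resolvent M \<alpha> f x)) \<and>
         ((\<forall>l. (SUP x\<in>F l. max
                 (SUP n. expect M x (path_integral (restrict_af M (F l) (As n)) {0..} (\<lambda>s. ennreal (exp (- s)))))
                 (expect M x (path_integral (restrict_af M (F l) A) {0..} (\<lambda>s. ennreal (exp (- s)))))) < \<infinity>) \<longrightarrow>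
          converges_weakly_on_nest M m F \<mu>s \<mu>)"
proof (intro conjI allI impI ballI)
  interpret symmetric_hunt M m by unfold_locales (fact assms)+
  have F: "compact (F l)" "F l \<in> sets borel" for l
    using assms(7) by (auto simp: nest_def borel_closed compact_imp_closed)
  note rs = S_nest_restriction[OF assms(8,7)] and r = S_nest_restriction[OF assms(9,7)]
  have "\<forall>n l. \<exists>u. potential (density (\<mu>s n) (indicator (F l))) (F l) (As n) u"
    using potential_exists[OF assms(10) F(2)] by metis
  then obtain us where pots: "\<And>n l. potential (density (\<mu>s n) (indicator (F l))) (F l) (As n) (us n l)" by metis
  have "\<forall>l. \<exists>u. potential (density \<mu> (indicator (F l))) (F l) A u"
    using potential_exists[OF assms(11) F(2)] by metis
  then obtain u where pot: "\<And>l. potential (density \<mu> (indicator (F l))) (F l) A (u l)" by metis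
  {
    fix \<alpha> :: real and l f assume \<alpha>: "0 < \<alpha>" and f: "f \<in> Bb0 m"
    have "bdd_fun f" using f by (auto simp: Bb0_def bdd_fun_def bounded_iff)
    then have m: "(\<lambda>x. resolvent M \<alpha> f x) \<in> borel_measurable borel" using \<alpha> by measurable
    from resolvent_convergence[OF pots pot rs(1,2) r(1,2) A1 A2[OF \<alpha>] \<alpha> f, of l]
    show "(\<lambda>n. LINT x:F l|\<mu>s n. resolvent M \<alpha> f x) \<longlonglongrightarrow> (LINT x:F l|\<mu>. resolvent M \<alpha> f x)"
      unfolding rs(4)[OF m] r(4)[OF m] by simp
  }
  assume bound: "\<forall>l. (SUP x\<in>F l. max
                 (SUP n. expect M x (path_integral (restrict_af M (F l) (As n)) {0..} (\<lambda>s. ennreal (exp (- s)))))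
                 (expect M x (path_integral (restrict_af M (F l) A) {0..} (\<lambda>s. ennreal (exp (- s)))))) < \<infinity>"
  show "converges_weakly_on_nest M m F \<mu>s \<mu>"
    unfolding converges_weakly_on_nest_def
  proof (intro conjI allI ballI assms(8))
    fix l f assume f: "f \<in> C_nest F"
    let ?b = "SUP x\<in>F l. max
                 (SUP n. expect M x (path_integral (restrict_af M (F l) (As n)) {0..} (\<lambda>s. ennreal (exp (- s)))))
                 (expect M x (path_integral (restrict_af M (F l) A) {0..} (\<lambda>s. ennreal (exp (- s)))))"
    define K where "K = enn2real ?b"
    have K: "?b = ennreal K" "0 \<le> K" using bound by (simp_all add: K_def)
    have le: "max (SUP n. expect M x (path_integral (restrict_af M (F l) (As n)) {0..} (\<lambda>s. ennreal (exp (- s)))))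
        (expect M x (path_integral (restrict_af M (F l) A) {0..} (\<lambda>s. ennreal (exp (- s))))) \<le> ennreal K" if "x \<in> F l" for x
      unfolding K(1)[symmetric] using that by (rule SUP_upper)
    have les: "expect M x (path_integral (restrict_af M (F l) (As n)) {0..} (\<lambda>s. ennreal (exp (- s)))) \<le> ennreal K" if "x \<in> F l" for x n
      using le[OF that] by (simp add: SUP_le_iff)
    \<comment> \<open>Off \<open>F l\<close> the function f is unconstrained. Setting it to 0 there
      makes \<phi> Borel on the whole space without changing the integrals.\<close>
    define \<phi> where "\<phi> x = (if x \<in> F l then real_of_ereal (f x) else 0)" for x
    have cont: "continuous_on (F l) (\<lambda>x. real_of_ereal (f x))"
      using f continuous_on_iff_real[of "F l" f] by (auto simp: C_nest_def comp_def)
    then have cont\<phi>: "continuous_on (F l) \<phi>" by (rule continuous_on_eq) (simp add: \<phi>_def)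
    have "\<phi> = (\<lambda>x. indicator (F l) x *\<^sub>R real_of_ereal (f x))" by (auto simp: \<phi>_def fun_eq_iff)
    then have \<phi>m: "\<phi> \<in> borel_measurable borel"
      using borel_measurable_continuous_on_indicator[OF F(2) cont] by simp
    have eq: "(LINT x:F l|\<kappa>. real_of_ereal (f x)) = (LINT x:F l|\<kappa>. \<phi> x)" for \<kappa> :: "'a measure"
      unfolding set_lebesgue_integral_def
      by (intro Bochner_Integration.integral_cong refl) (simp add: \<phi>_def split: split_indicator)
    show "(\<lambda>n. LINT x:F l|\<mu>s n. real_of_ereal (f x)) \<longlonglongrightarrow> (LINT x:F l|\<mu>. real_of_ereal (f x))"
      unfolding eq rs(4)[OF \<phi>m] r(4)[OF \<phi>m]
      by (rule continuous_convergence[OF pots pot rs(1,2) r(1,2) A1 path_potential_boundI[OF pots rs(3) les]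
            path_potential_boundI[OF pot r(3)] K(2) F(1) rs(3) r(3) assms(6) cont\<phi> \<phi>m])
         (use le in auto)
  qed
qed

end
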